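(* Assume that $\mathbf y_n=\mathbf A\mathbf y_{n-1}+\sigma\mathbf x_n$ holds with Gaussian source data $\{\mathbf x_n\}$, and with initial state $\mathbf y_0$ distributed according to the stationary distribution of the process (so that the process $\mathbf y_n$ is stationary). Let $\mathbf A$ be a regular diffusion matrix with parameters $\rho$ and $\kappa$, with the network graph drawn according to an Erdős–Rényi random graph model $\mathscr G(N,p_N)$, where the fraction of observable nodes $|\mathcal S|/N$ converges to $\xi\in(0,1)$. Assume the uniform concentration regime $p_N=\omega_N\frac{\log N}{N}\to p$ with $\omega_N\to\infty$ as $N\to\infty$. Let $\widehat{\mathbf A}_{\mathcal S,n}$ be the regularized sample Granger estimator $\widehat{\mathbf A}^{(\mathrm{reGra})}_{\mathcal S,n}$, or the sample one-lag estimator $[\widehat{\mathbf R}_{1,n}]_{\mathcal S}$, or the sample residual estimator $[\widehat{\mathbf R}_{1,n}]_{\mathcal S}-[\widehat{\mathbf R}_{0,n}]_{\mathcal S}$. Then $$\lim_{N\to\infty}\mathbb P\big[\mathsf{clu}(\widehat{\mathbf A}_{\mathcal S,n(N)})=\mathbf G_{\mathcal S}\big]=1,$$ provided that the number of samples is on the order of $n(N)=\Omega\big((Np_N)^2\log|\mathcal S|\big)$; that is, there is a constant $C>0$ not depending on $N$ such that the conclusion holds whenever $n(N)\ge C\,(Np_N)^2\log|\mathcal S|$ for all sufficiently large $N$. Moreover, in the dense regime where $p>0$, the same result holds for the (non-regularized) sample Granger estimator $\widehat{\mathbf A}^{(\mathrm{Gra})}_{\mathcal S,n}=[\widehat{\mathbf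 R}_{1,n}]_{\mathcal S}([\widehat{\mathbf R}_{0,n}]_{\mathcal S})^{-1}$.
   Context: **Graph.** For each $N$, the node set is $\mathcal N=\{1,\dots,N\}$ and $\mathbf G\sim\mathscr G(N,p_N)$ is the adjacency matrix of an undirected Erdős–Rényi graph: $\mathbf g_{ij}$, $i<j$, are independent Bernoulli variables with success probability $p_N$, and $\mathbf g_{ji}=\mathbf g_{ij}$. Degrees: $\mathbf d_i=1+\sum_{\ell\ne i}\mathbf g_{i\ell}$, $\mathbf d_{\min}=\min_i\mathbf d_i$, $\mathbf d_{\max}=\max_i\mathbf d_i$. **Regular diffusion matrix.** $\mathbf A=\pi(\mathbf G)$ is a deterministic function of $\mathbf G$. It is a regular diffusion matrix with parameters $\rho,\kappa$, $0<\kappa\le\rho<1$ (constants not depending on $N$), if it is symmetric with nonnegative entries, $\sum_{\ell=1}^N\mathbf a_{i\ell}=\rho$ for all $i$, and $\frac{\kappa}{\mathbf d_{\max}}\mathbf g_{ij}\le\mathbf a_{ij}\le\frac{\kappa}{\mathbf d_{\min}}\mathbf g_{ij}$ for all $i\ne j$. **Dynamics.** $\sigma>0$; the input entries $\mathbf x_i(n)$ are i.i.d. in $i$ and $n$, zero mean, unit variance, independent of $\mathbf G$. **Observed nodes.** $\mathcal S=\mathcal S_N\subset\mathcal N$ is the set of observed nodes; $[M]_{\mathcal S}$ is the submatrix with rows and columns in $\mathcal S$. $\mathbf G_{\mathcal S}$ is the support graph of $\mathbf A_{\mathcal S}$: its off-diagonal entries are $1$ if $\mathbf a_{ij}>0$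 and $0$ otherwise, and its diagonal is conventionally $0$. It is a standing assumption that the probability that the pairs of nodes in $\mathcal S$ are all connected, or all disconnected, tends to $0$ as $N\to\infty$. **Sample correlations.** $\widehat{\mathbf R}_{0,n}=\frac1n\sum_{t=1}^n\mathbf y_t\mathbf y_t^\top$ and $\widehat{\mathbf R}_{1,n}=\frac1{n-1}\sum_{t=1}^{n-1}\mathbf y_{t+1}\mathbf y_t^\top$. **Estimators.** The sample Granger estimator is left unspecified (arbitrary) when $[\widehat{\mathbf R}_{0,n}]_{\mathcal S}$ is singular. For $i\in\mathcal S$, the $i$-th row of $\widehat{\mathbf A}^{(\mathrm{reGra})}_{\mathcal S,n}$ is a solution to $$\min_{x\in\mathbb R^{|\mathcal S|}}\big\|x\,[\widehat{\mathbf R}_{0,n}]_{\mathcal S}-r_i\big\|_\infty\quad\text{subject to }\|x\|_1\le1,$$ where $x$ is a row vector, $r_i$ is the $i$-th row of $[\widehat{\mathbf R}_{1,n}]_{\mathcal S}$, and $\|\cdot\|_\infty,\|\cdot\|_1$ are the usual vector norms. **Clustering algorithm $\mathsf{clu}$.** Given a matrix $M$ indexed by $\mathcal S$, arrange the off-diagonal entries $m_{ij}$ ($i,j\in\mathcal S$, $i\ne j$) in ascending order $v_1\le\dots\le v_L$. For $j\in\{1,\dots,L-1\}$ consider the partition $\mathcal C_0(j)=\{v_1,\dots,v_j\}$, $\mathcal C_1(j)=\{v_{j+1},\dots,v_L\}$ with centroids (arithmetic means) $c_0(j),c_1(j)$. An index $j$ is admissible if the midpoint between the centroids separates the two clusters: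 $v_j\le\frac{c_0(j)+c_1(j)}2\le v_{j+1}$. Among admissible indices the algorithm selects $j^\star$ maximizing $c_1(j)-c_0(j)$. The output $\widehat G=\mathsf{clu}(M)$ has zero main diagonal and, for $i\ne j$, $\widehat g_{ij}=1$ if $m_{ij}$ is assigned to $\mathcal C_1(j^\star)$ and $\widehat g_{ij}=0$ otherwise. *)

theory Defs
  imports "HOL-Probability.Probability"
begin

text \<open>
  The network size varies inside limits, so graphs, matrices and vectors over the node set
  are functions on the natural numbers, of which only the values at indices in
  \<open>{1..N}\<close> (or in the observed set) are meaningful.
\<close>

type_synonym graph = "nat \<Rightarrow> nat \<Rightarrow> bool"
type_synonym rmatrix = "nat \<Rightarrow> nat \<Rightarrow> real"

definition nodes :: "nat \<Rightarrow> nat set" where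
  "nodes N = {1..N}"

text \<open>Undirected loop-free graphs; they are \<open>False\<close> outside the node set, so that
  equality of graphs is equality of functions and there are finitely many of them.\<close>

definition graphs :: "nat \<Rightarrow> graph set" where
  "graphs N = {g. \<forall>i j. g i j \<longrightarrow> i \<in> nodes N \<and> j \<in> nodes N \<and> i \<noteq> j \<and> g j i}"

locale erdos_renyi = prob_space M for M :: "'a measure" +
  fixes N :: nat and p :: real and G :: "'a \<Rightarrow> graph"
  assumes p_range: "0 \<le> p" "p \<le> 1"
    and G_measurable: "G \<in> measurable M (count_space (graphs N))"
    and G_bernoulli: "\<And>i j. i \<in> nodes N \<Longrightarrow> j \<in> nodes N \<Longrightarrow> i < j \<Longrightarrow>
          distr M (count_space UNIV) (\<lambda>\<omega>. G \<omega> i j) = measure_pmf (bernoulli_pmf p)"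
    and G_indep: "indep_vars (\<lambda>_. count_space UNIV) (\<lambda>(i, j) \<omega>. G \<omega> i j)
          {(i, j). i \<in> nodes N \<and> j \<in> nodes N \<and> i < j}"

definition degree :: "nat \<Rightarrow> graph \<Rightarrow> nat \<Rightarrow> nat" where
  "degree N g i = 1 + (\<Sum>l\<in>nodes N - {i}. of_bool (g i l))"

definition min_degree :: "nat \<Rightarrow> graph \<Rightarrow> nat" where
  "min_degree N g = Min (degree N g ` nodes N)"

definition max_degree :: "nat \<Rightarrow> graph \<Rightarrow> nat" where
  "max_degree N g = Max (degree N g ` nodes N)"

definition regular_diffusion :: "nat \<Rightarrow> real \<Rightarrow> real \<Rightarrow> graph \<Rightarrow> rmatrix \<Rightarrow> bool" where
  "regular_diffusion N \<rho> \<kappa> g a \<longleftrightarrow>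
     0 < \<kappa> \<and> \<kappa> \<le> \<rho> \<and> \<rho> < 1 \<and>
     (\<forall>i\<in>nodes N. \<forall>j\<in>nodes N. a i j = a j i \<and> 0 \<le> a i j) \<and>
     (\<forall>i\<in>nodes N. (\<Sum>l\<in>nodes N. a i l) = \<rho>) \<and>
     (\<forall>i\<in>nodes N. \<forall>j\<in>nodes N. i \<noteq> j \<longrightarrow>
        \<kappa> / real (max_degree N g) * of_bool (g i j) \<le> a i j \<and>
        a i j \<le> \<kappa> / real (min_degree N g) * of_bool (g i j))"

definition std_gaussian :: "real measure" where
  "std_gaussian = density lborel std_normal_density"

definition vec_space :: "nat \<Rightarrow> (nat \<Rightarrow> real) measure" where
  "vec_space N = Pi\<^sub>M (nodes N) (\<lambda>_. borel)"

definition var_step :: "nat \<Rightarrow> rmatrix \<Rightarrow> real \<Rightarrow> (nat \<Rightarrow> real) \<Rightarrow> (nat \<Rightarrow> real) \<Rightarrow> nat \<Rightarrow> real" where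
  "var_step N a \<sigma> v w i = (\<Sum>l\<in>nodes N. a i l * v l) + \<sigma> * w i"

text \<open>A stationary distribution of the process with matrix \<open>a\<close>: a law on vectors that is
  preserved by one step driven by independent standard Gaussian noise. It is unique
  when \<open>a\<close> is a regular diffusion matrix, whose spectral radius is \<open>\<rho> < 1\<close>.\<close>

definition stationary_law :: "nat \<Rightarrow> rmatrix \<Rightarrow> real \<Rightarrow> (nat \<Rightarrow> real) measure \<Rightarrow> bool" where
  "stationary_law N a \<sigma> \<mu> \<longleftrightarrow>
     prob_space \<mu> \<and> sets \<mu> = sets (vec_space N) \<and>
     distr (\<mu> \<Otimes>\<^sub>M Pi\<^sub>M (nodes N) (\<lambda>_. std_gaussian)) (vec_space N)
       (\<lambda>(v, w). restrict (var_step N a \<sigma> v w) (nodes N)) = \<mu>"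

text \<open>In \<open>x \<omega> t i\<close> and \<open>y \<omega> t i\<close>, \<open>t\<close> is the time and \<open>i\<close> the node. The matrix
  depends on the graph through the deterministic map \<open>\<pi>\<close>, so the
  stationary distribution depends on the graph as well: the initial state is stationary
  conditionally on each graph of positive probability. Joint independence of the sources
  from the pair (graph, initial state) expresses that they are independent of the graph and,
  given the graph, of the initial state.\<close>

locale diffusion_network = erdos_renyi M N p G
  for M :: "'a measure" and N p G +
  fixes \<pi> :: "graph \<Rightarrow> rmatrix" and \<rho> \<kappa> \<sigma> :: real
    and x y :: "'a \<Rightarrow> nat \<Rightarrow> nat \<Rightarrow> real"
  assumes sigma_pos: "\<sigma> > 0"
    and diffusion: "\<And>\<omega>. \<omega> \<in> space M \<Longrightarrow> regular_diffusion N \<rho> \<kappa> (G \<omega>) (\<pi> (G \<omega>))"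
    and x_gaussian: "\<And>t i. 1 \<le> t \<Longrightarrow> i \<in> nodes N \<Longrightarrow>
          distributed M lborel (\<lambda>\<omega>. x \<omega> t i) std_normal_density"
    and x_indep: "indep_vars (\<lambda>_. borel) (\<lambda>(t, i) \<omega>. x \<omega> t i) ({1..} \<times> nodes N)"
    and x_indep_G_y0:
      "indep_set
         (sets (vimage_algebra (space M) (\<lambda>\<omega>. (G \<omega>, restrict (y \<omega> 0) (nodes N)))
            (count_space (graphs N) \<Otimes>\<^sub>M vec_space N)))
         (sets (vimage_algebra (space M) (\<lambda>\<omega>. restrict (\<lambda>(t, i). x \<omega> t i) ({1..} \<times> nodes N))
            (Pi\<^sub>M ({1..} \<times> nodes N) (\<lambda>_. borel))))"
    and y0_stationary: "\<And>g. g \<in> graphs N \<Longrightarrow> prob {\<omega> \<in> space M. G \<omega> = g} > 0 \<Longrightarrow>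
          stationary_law N (\<pi> g) \<sigma>
            (distr (uniform_measure M {\<omega> \<in> space M. G \<omega> = g}) (vec_space N)
              (\<lambda>\<omega>. restrict (y \<omega> 0) (nodes N)))"
    and dynamics: "\<And>\<omega> t i. \<omega> \<in> space M \<Longrightarrow> 1 \<le> t \<Longrightarrow> i \<in> nodes N \<Longrightarrow>
          y \<omega> t i = var_step N (\<pi> (G \<omega>)) \<sigma> (y \<omega> (t - 1)) (x \<omega> t) i"

definition support_graph :: "nat set \<Rightarrow> rmatrix \<Rightarrow> graph" where
  "support_graph S a = (\<lambda>i j. i \<in> S \<and> j \<in> S \<and> i \<noteq> j \<and> a i j > 0)"

definition all_connected :: "nat set \<Rightarrow> graph \<Rightarrow> bool" where
  "all_connected S g \<longleftrightarrow> (\<forall>i\<in>S. \<forall>j\<in>S. i \<noteq> j \<longrightarrow> g i j)"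

definition all_disconnected :: "nat set \<Rightarrow> graph \<Rightarrow> bool" where
  "all_disconnected S g \<longleftrightarrow> (\<forall>i\<in>S. \<forall>j\<in>S. i \<noteq> j \<longrightarrow> \<not> g i j)"

definition corr0 :: "(nat \<Rightarrow> nat \<Rightarrow> real) \<Rightarrow> nat \<Rightarrow> rmatrix" where
  "corr0 y n i j = (\<Sum>t = 1..n. y t i * y t j) / real n"

definition corr1 :: "(nat \<Rightarrow> nat \<Rightarrow> real) \<Rightarrow> nat \<Rightarrow> rmatrix" where
  "corr1 y n i j = (\<Sum>t = 1..n - 1. y (t + 1) i * y t j) / (real n - 1)"

definition mat_mult_on :: "nat set \<Rightarrow> rmatrix \<Rightarrow> rmatrix \<Rightarrow> rmatrix" where
  "mat_mult_on S a b i j = (\<Sum>l\<in>S. a i l * b l j)"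

definition mat_inverse_on :: "nat set \<Rightarrow> rmatrix \<Rightarrow> rmatrix \<Rightarrow> bool" where
  "mat_inverse_on S a b \<longleftrightarrow> (\<forall>i\<in>S. \<forall>j\<in>S.
     mat_mult_on S a b i j = of_bool (i = j) \<and> mat_mult_on S b a i j = of_bool (i = j))"

text \<open>No condition when \<open>r0\<close> restricted to \<open>S\<close> is singular.\<close>

definition granger_matrix :: "nat set \<Rightarrow> rmatrix \<Rightarrow> rmatrix \<Rightarrow> rmatrix \<Rightarrow> bool" where
  "granger_matrix S r0 r1 a \<longleftrightarrow> (\<forall>b. mat_inverse_on S r0 b \<longrightarrow>
     (\<forall>i\<in>S. \<forall>j\<in>S. a i j = mat_mult_on S r1 b i j))"

definition norm1_on :: "nat set \<Rightarrow> (nat \<Rightarrow> real) \<Rightarrow> real" where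
  "norm1_on S v = (\<Sum>j\<in>S. \<bar>v j\<bar>)"

definition norm_max_on :: "nat set \<Rightarrow> (nat \<Rightarrow> real) \<Rightarrow> real" where
  "norm_max_on S v = Max ((\<lambda>j. \<bar>v j\<bar>) ` S)"

definition regra_residual ::
    "nat set \<Rightarrow> rmatrix \<Rightarrow> rmatrix \<Rightarrow> nat \<Rightarrow> (nat \<Rightarrow> real) \<Rightarrow> real" where
  "regra_residual S r0 r1 i v = norm_max_on S (\<lambda>j. (\<Sum>l\<in>S. v l * r0 l j) - r1 i j)"

definition regra_matrix :: "nat set \<Rightarrow> rmatrix \<Rightarrow> rmatrix \<Rightarrow> rmatrix \<Rightarrow> bool" where
  "regra_matrix S r0 r1 a \<longleftrightarrow> (\<forall>i\<in>S. norm1_on S (a i) \<le> 1 \<and>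
     (\<forall>v. norm1_on S v \<le> 1 \<longrightarrow> regra_residual S r0 r1 i (a i) \<le> regra_residual S r0 r1 i v))"

definition off_diag :: "nat set \<Rightarrow> (nat \<times> nat) set" where
  "off_diag S = {(i, j). i \<in> S \<and> j \<in> S \<and> i \<noteq> j}"

definition mean :: "real list \<Rightarrow> real" where
  "mean v = sum_list v / real (length v)"

definition centroid_gap :: "real list \<Rightarrow> nat \<Rightarrow> real" where
  "centroid_gap v k = mean (drop k v) - mean (take k v)"

text \<open>The list \<open>v\<close> is indexed from 0: the lower cluster \<open>take k v\<close> ends
  with \<open>v ! (k - 1)\<close> and the upper cluster \<open>drop k v\<close> starts with \<open>v ! k\<close>.\<close>

definition admissible_split :: "real list \<Rightarrow> nat \<Rightarrow> bool" where
  "admissible_split v k \<longleftrightarrow> 1 \<le> k \<and> k < length v \<and>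
     v ! (k - 1) \<le> (mean (take k v) + mean (drop k v)) / 2 \<and>
     (mean (take k v) + mean (drop k v)) / 2 \<le> v ! k"

definition selected_split :: "real list \<Rightarrow> nat \<Rightarrow> bool" where
  "selected_split v k \<longleftrightarrow> admissible_split v k \<and>
     (\<forall>k'. admissible_split v k' \<longrightarrow> centroid_gap v k' \<le> centroid_gap v k)"

text \<open>The clustering algorithm does not say how to order equal entries or which of several
  maximizing splits to take. \<open>clu S m\<close> is the set of all its possible outputs;
  \<open>clu S m = {g}\<close> says that it returns \<open>g\<close> however ties are resolved.\<close>

definition clu :: "nat set \<Rightarrow> rmatrix \<Rightarrow> graph set" where
  "clu S m = {g. \<exists>e k. distinct e \<and> set e = off_diag S \<and>
     sorted (map (\<lambda>(i, j). m i j) e) \<and> selected_split (map (\<lambda>(i, j). m i j) e) k \<and>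
     g = (\<lambda>i j. (i, j) \<in> set (drop k e))}"

text \<open>A family of estimators \<open>a N n \<omega>\<close>, for network size \<open>N\<close> and sample size \<open>n\<close>, whose
  defining property may leave a choice (a minimizer, the singular case), has
  to be a random matrix for the recovery probability to make sense.\<close>

definition random_estimator ::
    "(nat \<Rightarrow> 'a measure) \<Rightarrow> (nat \<Rightarrow> nat set) \<Rightarrow> (nat \<Rightarrow> nat \<Rightarrow> 'a \<Rightarrow> rmatrix) \<Rightarrow> bool" where
  "random_estimator M S a \<longleftrightarrow>
     (\<forall>N n. \<forall>i\<in>S N. \<forall>j\<in>S N. (\<lambda>\<omega>. a N n \<omega> i j) \<in> borel_measurable (M N))"

definition regra_estimator :: "(nat \<Rightarrow> 'a measure) \<Rightarrow> (nat \<Rightarrow> nat set) \<Rightarrow>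
    (nat \<Rightarrow> 'a \<Rightarrow> nat \<Rightarrow> nat \<Rightarrow> real) \<Rightarrow> (nat \<Rightarrow> nat \<Rightarrow> 'a \<Rightarrow> rmatrix) \<Rightarrow> bool" where
  "regra_estimator M S y a \<longleftrightarrow> random_estimator M S a \<and>
     (\<forall>N n. \<forall>\<omega>\<in>space (M N). regra_matrix (S N) (corr0 (y N \<omega>) n) (corr1 (y N \<omega>) n) (a N n \<omega>))"

definition granger_estimator :: "(nat \<Rightarrow> 'a measure) \<Rightarrow> (nat \<Rightarrow> nat set) \<Rightarrow>
    (nat \<Rightarrow> 'a \<Rightarrow> nat \<Rightarrow> nat \<Rightarrow> real) \<Rightarrow> (nat \<Rightarrow> nat \<Rightarrow> 'a \<Rightarrow> rmatrix) \<Rightarrow> bool" where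
  "granger_estimator M S y a \<longleftrightarrow> random_estimator M S a \<and>
     (\<forall>N n. \<forall>\<omega>\<in>space (M N). granger_matrix (S N) (corr0 (y N \<omega>) n) (corr1 (y N \<omega>) n) (a N n \<omega>))"

definition one_lag_estimator ::
    "(nat \<Rightarrow> 'a \<Rightarrow> nat \<Rightarrow> nat \<Rightarrow> real) \<Rightarrow> nat \<Rightarrow> nat \<Rightarrow> 'a \<Rightarrow> rmatrix" where
  "one_lag_estimator y N n \<omega> = corr1 (y N \<omega>) n"

definition residual_estimator ::
    "(nat \<Rightarrow> 'a \<Rightarrow> nat \<Rightarrow> nat \<Rightarrow> real) \<Rightarrow> nat \<Rightarrow> nat \<Rightarrow> 'a \<Rightarrow> rmatrix" where
  "residual_estimator y N n \<omega> i j = corr1 (y N \<omega>) n i j - corr0 (y N \<omega>) n i j"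

end

theory Submission
  imports Defs
begin

text \<open>
  Degrees and common neighbour counts of the graph concentrate, over all nodes and over the latent
  ones. This makes each limit matrix (the covariances at lags 0 and 1, hence the one-lag and
  residual matrices, and the Granger matrix of the observed block) have, after multiplication
  by \<open>N p\<close>, off-diagonal entries uniformly close to \<open>b g + e\<close> with \<open>b\<close> bounded away
  from 0: the two-level form solves the defining linear equation up to a small error, and the
  equation is a contraction in the maximum norm. The clustering then separates the two levels.

  For the sample correlations, \<open>exp (\<Sum> (\<lambda> y\<^sub>t x\<^sub>t\<^sub>+\<^sub>1 - \<lambda>\<^sup>2 y\<^sub>t\<^sup>2 / 2))\<close> is a martingale, so the
  cross correlations of state and noise are at most \<open>\<delta>\<close> times a constant and a sample variance.
  The sample covariance satisfies the stationarity equation up to these cross terms, and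
  contraction in the maximum norm bounds all errors by a multiple of \<open>\<delta> = \<epsilon> / (N p)\<close>, small
  against the gap \<open>b / (N p)\<close>. The bounds on rows in the 1-norm transfer this to the
  regularized estimator; in the dense regime the observed sample covariance is
  close enough to its limit to be invertible, which gives the Granger estimator.
\<close>

subsection \<open>Clustering of two separated levels\<close>

text \<open>In the sparse regime the gap between the two levels is of order 1 / (N p) and tends to
  0, so errors must be small against 1 / (N p) entry by entry; spectral norm bounds are too coarse
  for this. Row sums \<rho> < 1 give contraction in the maximum norm with constants free of N. The
  martingale bound contains the sample variance of the state, for which nothing is known beforehand;
  with \<sigma> \<delta> \<le> (1 - \<rho>) / 2 it is absorbed by the contraction. The stationary
  law enters only through its invariance in time, never through an explicit Gaussian form. The tail
  exponents are of order \<delta>^2 n. Making them 3 ln N beats the union over N^2 pairs of nodes,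
  and since ln N and ln |S| are comparable this is the origin of (N p)^2 ln |S| samples. An
  entrywise error of order \<delta> perturbs the observed covariance by |S| \<delta> in row norm, so
  invertibility of the sample covariance is guaranteed only if N p is of order N. For the
  regularized estimator the constraint on the 1-norm removes the factor |S|.\<close>

lemma mean_ge:
  assumes "v \<noteq> []" and "\<And>x. x \<in> set v \<Longrightarrow> c \<le> x"
  shows "c \<le> mean v"
proof -
  have "c * real (length v) \<le> sum_list v" using assms(2)
    by (induction v) (auto simp: algebra_simps intro: add_mono)
  then show ?thesis using assms(1) by (simp add: mean_def field_simps)
qed

lemma mean_le:
  assumes "v \<noteq> []" and "\<And>x. x \<in> set v \<Longrightarrow> x \<le> c"
  shows "mean v \<le> c"
proof -
  have "sum_list v \<le> c * real (length v)" using assms(2)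
    by (induction v) (auto simp: algebra_simps intro: add_mono)
  then show ?thesis using assms(1) by (simp add: mean_def field_simps)
qed

text \<open>If a split cuts inside one level, one of its clusters lies in that level and
  admissibility bounds the midpoint by an entry of the same level. This forces the gap to be at most
  4 \<delta>. The split between the levels has gap at least b - 2 \<delta>, and 6 \<delta> < b makes
  it the larger one.\<close>

lemma selected_split_two_levels:
  fixes L U :: "real list"
  assumes "L \<noteq> []" "U \<noteq> []"
    and L: "\<And>x. x \<in> set L \<Longrightarrow> \<bar>x - c\<bar> \<le> \<delta>"
    and U: "\<And>x. x \<in> set U \<Longrightarrow> \<bar>x - (c + b)\<bar> \<le> \<delta>"
    and sep: "6 * \<delta> < b"
  shows "selected_split (L @ U) k \<longleftrightarrow> k = length L"
proof -
  let ?v = "L @ U" and ?l = "length L"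
  have mL: "c - \<delta> \<le> mean L" "mean L \<le> c + \<delta>"
    using L assms(1) by (auto intro!: mean_ge mean_le simp: abs_le_iff) (smt (verit) L)+
  have mU: "c + b - \<delta> \<le> mean U" "mean U \<le> c + b + \<delta>"
    using U assms(2) by (auto intro!: mean_ge mean_le simp: abs_le_iff) (smt (verit) U)+
  have "0 \<le> \<delta>" using L assms(1) by (meson abs_ge_zero hd_in_set order_trans)
  have "?v ! (?l - 1) = L ! (?l - 1)" "L ! (?l - 1) \<in> set L" "?v ! ?l = U ! 0" "U ! 0 \<in> set U"
    using assms(1,2) by (auto simp: nth_append)
  then have adm: "admissible_split ?v ?l"
    using L[of "L ! (?l - 1)"] U[of "U ! 0"] mL mU sep \<open>0 \<le> \<delta>\<close> assms(1,2)
    unfolding admissible_split_def by (auto simp: Suc_le_eq abs_le_iff)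
  have gap: "centroid_gap ?v ?l > 4 * \<delta>"
    using mL mU sep unfolding centroid_gap_def by simp
  have other: "centroid_gap ?v k' \<le> 4 * \<delta>" if k': "admissible_split ?v k'" "k' \<noteq> ?l" for k'
  proof (cases "k' < ?l")
    case True
    have "c - \<delta> \<le> mean (take k' ?v)"
      using True k'(1) L by (intro mean_ge) (auto simp: admissible_split_def abs_le_iff dest!: in_set_takeD, fastforce)
    moreover have "?v ! k' \<le> c + \<delta>"
      using True L[of "L ! k'"] by (simp add: nth_append abs_le_iff)
    ultimately show ?thesis using k'(1) unfolding admissible_split_def centroid_gap_def by simp
  next
    case False
    then have g: "k' > ?l" using k'(2) by simp
    have len: "k' < length ?v" "1 \<le> k'" using k'(1) by (auto simp: admissible_split_def)
    have "mean (drop k' ?v) \<le> c + b + \<delta>"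
    proof (rule mean_le)
      show "drop k' ?v \<noteq> []" using len(1) by (metis drop_eq_Nil not_le)
      fix x assume "x \<in> set (drop k' ?v)"
      then have "x \<in> set U" using g by (auto dest: in_set_dropD)
      then show "x \<le> c + b + \<delta>" using U[of x] by (simp add: abs_le_iff)
    qed
    moreover have "?v ! (k' - 1) = U ! (k' - 1 - ?l)" "U ! (k' - 1 - ?l) \<in> set U"
      using g len by (auto simp: nth_append)
    then have "?v ! (k' - 1) \<ge> c + b - \<delta>" using U[of "U ! (k' - 1 - ?l)"] by (simp add: abs_le_iff)
    ultimately show ?thesis using k'(1) unfolding admissible_split_def centroid_gap_def by simp
  qed
  show ?thesis
  proof
    assume s: "selected_split ?v k"
    show "k = ?l"
    proof (rule ccontr)
      assume "k \<noteq> ?l"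
      then show False using other[of k] s adm gap unfolding selected_split_def by fastforce
    qed
  next
    assume k: "k = ?l"
    show "selected_split ?v k" unfolding selected_split_def k
    proof (intro conjI allI impI adm)
      fix k' assume "admissible_split ?v k'"
      then show "centroid_gap ?v k' \<le> centroid_gap ?v ?l"
        using other[of k'] gap by (cases "k' = ?l") auto
    qed
  qed
qed

lemma finite_off_diag: "finite S \<Longrightarrow> finite (off_diag S)"
  by (rule finite_subset[of _ "S \<times> S"]) (auto simp: off_diag_def)

text \<open>Ties can only occur within a level, so every sorted enumeration lists all non-edges
  before all edges. The cut is then \<open>takeWhile\<close> of the non-edges, and the output does
  not depend on how ties are resolved. A graph of mixed type makes both levels nonempty.\<close>

lemma clu_two_levels:
  assumes "finite S"
    and lev: "\<And>i j. i \<in> S \<Longrightarrow> j \<in> S \<Longrightarrow> i \<noteq> j \<Longrightarrow> \<bar>m i j - (c + b * of_bool (g i j))\<bar> \<le> \<delta>"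
    and sep: "6 * \<delta> < b"
    and mixed: "\<not> all_connected S g" "\<not> all_disconnected S g"
  shows "clu S m = {\<lambda>i j. i \<in> S \<and> j \<in> S \<and> i \<noteq> j \<and> g i j}" (is "_ = {?g}")
proof -
  let ?f = "\<lambda>(i, j). m i j" and ?P = "\<lambda>(i, j). \<not> g i j"
  obtain i1 j1 i2 j2 where ij: "i1 \<in> S" "j1 \<in> S" "i1 \<noteq> j1" "\<not> g i1 j1" "i2 \<in> S" "j2 \<in> S" "i2 \<noteq> j2" "g i2 j2"
    using mixed unfolding all_connected_def all_disconnected_def by blast
  \<comment> \<open>Some pair of nodes is available, so 0 \<le> \<delta>, and the separation makes b
    positive.\<close>
  have b: "0 < b" using lev[of i1 j1] ij sep by (smt (verit) of_bool_eq(1))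
  have key: "selected_split (map ?f e) k \<longleftrightarrow> k = length (takeWhile ?P e)"
    and key2: "set (dropWhile ?P e) = {x \<in> off_diag S. \<not> ?P x}"
    if e: "distinct e" "set e = off_diag S" "sorted (map ?f e)" for e k
  proof -
    let ?l = "takeWhile ?P e" and ?u = "dropWhile ?P e"
    \<comment> \<open>The first edge in the list bounds all later entries from below, so a later
      non-edge would contradict the separation of the levels.\<close>
    have up: "\<not> ?P x" if "x \<in> set ?u" for x
    proof -
      have ne: "?u \<noteq> []"
      proof
        assume e: "?u = []"
        show False using that unfolding e by simp
      qed
      have h: "\<not> ?P (hd ?u)" by (rule hd_dropWhile[OF ne])
      have h2: "hd ?u \<in> off_diag S" using set_dropWhileD[OF hd_in_set[OF ne]] e(2) by simp
      have "sorted (map ?f ?u)" using e(3)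
        by (metis sorted_append map_append takeWhile_dropWhile_id)
      then have "?f (hd ?u) \<le> ?f x" using ne that by (cases ?u) auto
      moreover have "x \<in> off_diag S" using set_dropWhileD[OF that] e(2) by simp
      ultimately show ?thesis using h h2 lev[of "fst (hd ?u)" "snd (hd ?u)"] lev[of "fst x" "snd x"] sep b
        by (cases "g (fst x) (snd x)") (auto simp: off_diag_def case_prod_beta abs_le_iff)
    qed
    have lo: "?P x" if "x \<in> set ?l" for x using set_takeWhileD[OF that] by simp
    have un: "set ?l \<union> set ?u = off_diag S" using e(2) by (metis set_append takeWhile_dropWhile_id)
    have "u = {x \<in> T. \<not> P x}" if "l \<union> u = T" "\<And>x. x \<in> l \<Longrightarrow> P x" "\<And>x. x \<in> u \<Longrightarrow> \<not> P x"
      for l u T :: "(nat \<times> nat) set" and P using that by blast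
    from this[OF un lo up] show s: "set ?u = {x \<in> off_diag S. \<not> ?P x}" .
    have "(i1, j1) \<in> set ?l \<union> set ?u" unfolding un using ij by (simp add: off_diag_def)
    moreover have "(i1, j1) \<notin> set ?u" using up[of "(i1, j1)"] ij(4) by auto
    ultimately have "(i1, j1) \<in> set ?l" by (simp only: Un_iff simp_thms)
    then have l: "?l \<noteq> []" by force
    have "(i2, j2) \<in> set ?u" unfolding s using ij by (simp add: off_diag_def)
    then have u: "?u \<noteq> []" by force
    have "selected_split (map ?f ?l @ map ?f ?u) k \<longleftrightarrow> k = length (map ?f ?l)"
    proof (rule selected_split_two_levels[OF _ _ _ _ sep])
      show "\<bar>x - c\<bar> \<le> \<delta>" if xx: "x \<in> set (map ?f ?l)" for x
      proof -
        obtain z where z: "x = ?f z" "z \<in> set ?l" using xx unfolding set_map by (elim imageE)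
        obtain i j where "z = (i, j)" by (cases z)
        then have ij: "(i, j) \<in> set ?l" "x = m i j" using z by simp_all
        then have "(i, j) \<in> off_diag S" using un by blast
        then show ?thesis using lo[OF ij(1)] lev[of i j] ij(2) by (simp add: off_diag_def)
      qed
      show "\<bar>x - (c + b)\<bar> \<le> \<delta>" if xx: "x \<in> set (map ?f ?u)" for x
      proof -
        obtain z where z: "x = ?f z" "z \<in> set ?u" using xx unfolding set_map by (elim imageE)
        obtain i j where "z = (i, j)" by (cases z)
        then have ij: "(i, j) \<in> set ?u" "x = m i j" using z by simp_all
        then have "(i, j) \<in> off_diag S" using un by blast
        then show ?thesis using up[OF ij(1)] lev[of i j] ij(2) by (simp add: off_diag_def)
      qed
    qed (use l u in auto)
    then show "selected_split (map ?f e) k \<longleftrightarrow> k = length ?l"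
      by (simp flip: map_append)
  qed
  have drop: "set (drop (length (takeWhile ?P e)) e) = {x \<in> off_diag S. \<not> ?P x}"
    if e: "distinct e" "set e = off_diag S" "sorted (map ?f e)" for e
    using key2[OF e] by (simp add: dropWhile_eq_drop)
  have g: "(\<lambda>i j. (i, j) \<in> {x \<in> off_diag S. \<not> ?P x}) = ?g"
    by (auto simp: off_diag_def fun_eq_iff)
  obtain e0 where e0: "distinct e0" "set e0 = off_diag S"
    using finite_distinct_list[OF finite_off_diag[OF assms(1)]] by blast
  have e: "distinct (sort_key ?f e0)" "set (sort_key ?f e0) = off_diag S" "sorted (map ?f (sort_key ?f e0))"
    using e0 by auto
  show ?thesis
  proof (intro set_eqI iffI)
    fix h assume "h \<in> clu S m"
    then show "h \<in> {?g}" unfolding clu_def using key drop g by auto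
  next
    fix h assume "h \<in> {?g}"
    then show "h \<in> clu S m" unfolding clu_def using key[OF e] drop[OF e] g e
      by (intro CollectI exI[of _ "sort_key ?f e0"] exI[of _ "length (takeWhile ?P (sort_key ?f e0))"]) simp
  qed
qed

subsection \<open>Resolvents and covariances of regular networks\<close>

text \<open>A self-referential estimate m \<mapsto> r m + e closes when m is the actual maximum,
  which a finite index set attains. This replaces Neumann series in all the error estimates.\<close>

lemma contraction_bound:
  fixes f :: "'b \<Rightarrow> real"
  assumes "finite I" "0 \<le> r" "r < 1" "0 \<le> e"
    and step: "\<And>m. 0 \<le> m \<Longrightarrow> (\<And>i. i \<in> I \<Longrightarrow> \<bar>f i\<bar> \<le> m) \<Longrightarrow> (\<And>i. i \<in> I \<Longrightarrow> \<bar>f i\<bar> \<le> r * m + e)"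
    and "i \<in> I"
  shows "\<bar>f i\<bar> \<le> e / (1 - r)"
proof -
  let ?m = "Max ((\<lambda>i. \<bar>f i\<bar>) ` I)"
  have le: "\<bar>f i\<bar> \<le> ?m" if "i \<in> I" for i using assms(1) that by simp
  then have "0 \<le> ?m" using \<open>i \<in> I\<close> abs_ge_zero order_trans by blast
  obtain i0 where i0: "i0 \<in> I" "\<bar>f i0\<bar> = ?m"
    using Max_in[of "(\<lambda>i. \<bar>f i\<bar>) ` I"] assms(1) \<open>i \<in> I\<close> by (metis (mono_tags, lifting) empty_iff finite_imageI imageE image_is_empty)
  have "?m \<le> r * ?m + e" using step[OF \<open>0 \<le> ?m\<close> le i0(1)] i0(2) by simp
  then have "?m \<le> e / (1 - r)" using assms(3) by (simp add: field_simps)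
  then show ?thesis using le[OF \<open>i \<in> I\<close>] by simp
qed

text \<open>Gaussian elimination by induction on the index set. Eliminating the unknown at a keeps
  the absolute row sums below r, because the pivot 1 - \<open>B a a\<close> dominates the rest of
  row a.\<close>

lemma linear_system_solvable:
  fixes B :: "'b \<Rightarrow> 'b \<Rightarrow> real"
  assumes "finite I" "r < 1" "\<And>i. i \<in> I \<Longrightarrow> (\<Sum>l\<in>I. \<bar>B i l\<bar>) \<le> r"
  shows "\<exists>f. \<forall>i\<in>I. f i = b i + (\<Sum>l\<in>I. B i l * f l)"
  using assms(1,3)
proof (induction I arbitrary: B b rule: finite_induct)
  case empty
  then show ?case by simp
next
  case (insert a I)
  let ?c = "1 - B a a"
  have row: "\<bar>B i a\<bar> + (\<Sum>l\<in>I. \<bar>B i l\<bar>) \<le> r" if "i \<in> insert a I" for i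
    using insert.prems[OF that] insert.hyps by simp
  have s0: "0 \<le> (\<Sum>l\<in>I. \<bar>B a l\<bar>)" by (simp add: sum_nonneg)
  have ra: "\<bar>B a a\<bar> + (\<Sum>l\<in>I. \<bar>B a l\<bar>) \<le> r" using row[of a] by simp
  have c: "0 < ?c" "(\<Sum>l\<in>I. \<bar>B a l\<bar>) \<le> ?c"
    using ra s0 \<open>r < 1\<close> abs_ge_self[of "B a a"] by linarith+
  define B' where "B' i l = B i l + B i a * B a l / ?c" for i l
  define b' where "b' i = b i + B i a * b a / ?c" for i
  have "(\<Sum>l\<in>I. \<bar>B' i l\<bar>) \<le> r" if "i \<in> I" for i
  proof -
    have "(\<Sum>l\<in>I. \<bar>B' i l\<bar>) \<le> (\<Sum>l\<in>I. \<bar>B i l\<bar> + \<bar>B i a\<bar> * \<bar>B a l\<bar> / ?c)"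
      using c unfolding B'_def
      by (intro sum_mono order_trans[OF abs_triangle_ineq]) (simp add: abs_mult)
    also have "\<dots> = (\<Sum>l\<in>I. \<bar>B i l\<bar>) + \<bar>B i a\<bar> * ((\<Sum>l\<in>I. \<bar>B a l\<bar>) / ?c)"
      by (simp add: sum.distrib sum_distrib_left sum_divide_distrib)
    also have "\<dots> \<le> (\<Sum>l\<in>I. \<bar>B i l\<bar>) + \<bar>B i a\<bar> * 1"
      using c by (intro add_left_mono mult_left_mono) auto
    also have "\<dots> \<le> r" using row[of i] that by simp
    finally show ?thesis .
  qed
  from insert.IH[of B' b', OF this] obtain f where
    f: "\<And>i. i \<in> I \<Longrightarrow> f i = b' i + (\<Sum>l\<in>I. B' i l * f l)" by blast
  define fa where "fa = (b a + (\<Sum>l\<in>I. B a l * f l)) / ?c"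
  have fa: "fa = b a + B a a * fa + (\<Sum>l\<in>I. B a l * f l)"
    unfolding fa_def using c(1) by (simp add: field_simps)
  define h where "h = f(a := fa)"
  have h: "(\<Sum>l\<in>I. B i l * h l) = (\<Sum>l\<in>I. B i l * f l)" for i
    unfolding h_def using insert.hyps by (intro sum.cong) auto
  have "h i = b i + (\<Sum>l\<in>insert a I. B i l * h l)" if "i \<in> insert a I" for i
  proof (cases "i = a")
    case True
    then show ?thesis using fa insert.hyps h by (simp add: h_def)
  next
    case False
    then have "i \<in> I" using that by simp
    have "(\<Sum>l\<in>I. B' i l * f l) = (\<Sum>l\<in>I. B i l * f l) + B i a / ?c * (\<Sum>l\<in>I. B a l * f l)"
      by (simp add: B'_def algebra_simps sum.distrib sum_distrib_left sum_divide_distrib)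
    then have "f i = b i + (\<Sum>l\<in>I. B i l * f l) + B i a * fa"
      using f[OF \<open>i \<in> I\<close>] c(1) by (simp add: b'_def fa_def field_simps)
    then show ?thesis using False insert.hyps h by (simp add: h_def)
  qed
  then show ?case by blast
qed

lemma sum_of_bool_mult:
  fixes f :: "'b \<Rightarrow> real"
  assumes "finite V" "i \<in> V"
  shows "(\<Sum>l\<in>V. of_bool (i = l) * f l) = f i" "(\<Sum>l\<in>V. f l * of_bool (l = i)) = f i"
proof -
  have "(\<Sum>l\<in>V. of_bool (i = l) * f l) = (\<Sum>l\<in>V. if i = l then f l else 0)" by (intro sum.cong) auto
  then show "(\<Sum>l\<in>V. of_bool (i = l) * f l) = f i" using assms by simp
  have "(\<Sum>l\<in>V. f l * of_bool (l = i)) = (\<Sum>l\<in>V. if l = i then f l else 0)" by (intro sum.cong) auto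
  then show "(\<Sum>l\<in>V. f l * of_bool (l = i)) = f i" using assms by simp
qed

lemma sum_split2:
  fixes f :: "'b \<Rightarrow> real"
  assumes "finite T" "i \<in> T" "j \<in> T" "i \<noteq> j"
  shows "(\<Sum>l\<in>T. f l) = f i + f j + (\<Sum>l\<in>T - {i, j}. f l)"
proof -
  have "(\<Sum>l\<in>T. f l) = f i + (\<Sum>l\<in>T - {i}. f l)" using assms by (simp add: sum.remove)
  also have "(\<Sum>l\<in>T - {i}. f l) = f j + (\<Sum>l\<in>T - {i} - {j}. f l)" using assms by (intro sum.remove) auto
  also have "T - {i} - {j} = T - {i, j}" by auto
  finally show ?thesis by simp
qed

lemma abs_sum_mult_le:
  fixes a f :: "'b \<Rightarrow> real"
  assumes "\<And>l. l \<in> T \<Longrightarrow> \<bar>f l\<bar> \<le> m"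
  shows "\<bar>\<Sum>l\<in>T. a l * f l\<bar> \<le> (\<Sum>l\<in>T. \<bar>a l\<bar>) * m"
proof -
  have "\<bar>\<Sum>l\<in>T. a l * f l\<bar> \<le> (\<Sum>l\<in>T. \<bar>a l\<bar> * m)"
    by (rule order_trans[OF sum_abs]) (auto simp: abs_mult intro!: sum_mono mult_left_mono assms)
  then show ?thesis by (simp add: sum_distrib_right)
qed

text \<open>The equation F = I + s a F characterizes the inverse of I - s a.\<close>

definition resolvent :: "nat set \<Rightarrow> rmatrix \<Rightarrow> real \<Rightarrow> rmatrix \<Rightarrow> bool" where
  "resolvent V a s F \<longleftrightarrow> (\<forall>i\<in>V. \<forall>j\<in>V. F i j = of_bool (i = j) + s * (\<Sum>l\<in>V. a i l * F l j))"

locale substochastic =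
  fixes V :: "nat set" and a :: rmatrix and \<rho> :: real
  assumes finV: "finite V"
    and sym: "i \<in> V \<Longrightarrow> j \<in> V \<Longrightarrow> a i j = a j i"
    and nonneg: "i \<in> V \<Longrightarrow> j \<in> V \<Longrightarrow> 0 \<le> a i j"
    and row: "i \<in> V \<Longrightarrow> (\<Sum>l\<in>V. a i l) = \<rho>"
    and rho: "0 < \<rho>" "\<rho> < 1"
begin

lemma row_abs: "i \<in> V \<Longrightarrow> (\<Sum>l\<in>V. \<bar>a i l\<bar>) = \<rho>"
  using row[of i] nonneg[of i] by simp

lemma abs_row_le:
  assumes "i \<in> V" "\<And>l. l \<in> V \<Longrightarrow> \<bar>f l\<bar> \<le> m"
  shows "\<bar>\<Sum>l\<in>V. a i l * f l\<bar> \<le> \<rho> * m"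
  using abs_sum_mult_le[of V f m "a i"] assms row_abs by simp

lemma resolvent_exists:
  assumes "\<bar>s\<bar> = 1" shows "\<exists>F. resolvent V a s F"
proof -
  have "\<forall>j. \<exists>f. \<forall>i\<in>V. f i = of_bool (i = j) + (\<Sum>l\<in>V. s * a i l * f l)"
  proof (intro allI linear_system_solvable[OF finV rho(2)])
    fix i assume "i \<in> V"
    then show "(\<Sum>l\<in>V. \<bar>s * a i l\<bar>) \<le> \<rho>" using assms row_abs by (simp add: abs_mult)
  qed
  then obtain f where "\<And>j i. i \<in> V \<Longrightarrow> f j i = of_bool (i = j) + (\<Sum>l\<in>V. s * a i l * f j l)"
    by metis
  then have "resolvent V a s (\<lambda>i j. f j i)"
    unfolding resolvent_def by (simp add: sum_distrib_left mult.assoc)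
  then show ?thesis by blast
qed

lemma resolvent_bound:
  assumes F: "resolvent V a s F" and s: "\<bar>s\<bar> = 1" and ij: "i \<in> V" "j \<in> V"
  shows "\<bar>F i j\<bar> \<le> 1 / (1 - \<rho>)"
proof (rule contraction_bound[of V \<rho> 1 "\<lambda>i. F i j"])
  fix m i assume m: "\<And>i. i \<in> V \<Longrightarrow> \<bar>F i j\<bar> \<le> m" and i: "i \<in> V"
  have "\<bar>F i j\<bar> \<le> 1 + \<bar>s * (\<Sum>l\<in>V. a i l * F l j)\<bar>"
  proof -
    have "F i j = of_bool (i = j) + s * (\<Sum>l\<in>V. a i l * F l j)"
      using F i ij(2) unfolding resolvent_def by blast
    then show ?thesis by (cases "i = j") auto
  qed
  also have "\<dots> \<le> \<rho> * m + 1" using abs_row_le[OF i m] s by (simp add: abs_mult)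
  finally show "\<bar>F i j\<bar> \<le> \<rho> * m + 1" .
qed (use finV rho ij in auto)

text \<open>The difference Z of the two products solves the homogeneous equation Z = s a Z and
  vanishes by contraction.\<close>

lemma resolvent_commute:
  assumes F: "resolvent V a s F" and s: "\<bar>s\<bar> = 1" and ij: "i \<in> V" "j \<in> V"
  shows "(\<Sum>l\<in>V. F i l * a l j) = (\<Sum>l\<in>V. a i l * F l j)"
proof -
  define Z where "Z i = (\<Sum>l\<in>V. F i l * a l j) - (\<Sum>l\<in>V. a i l * F l j)" for i
  have Z: "Z i = s * (\<Sum>k\<in>V. a i k * Z k)" if i: "i \<in> V" for i
  proof -
    have "(\<Sum>l\<in>V. F i l * a l j) = (\<Sum>l\<in>V. of_bool (i = l) * a l j + s * (\<Sum>k\<in>V. a i k * (F k l * a l j)))"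
      using F i unfolding resolvent_def by (intro sum.cong) (auto simp: algebra_simps sum_distrib_left)
    also have "\<dots> = a i j + s * (\<Sum>l\<in>V. \<Sum>k\<in>V. a i k * (F k l * a l j))"
      using i finV by (simp add: sum.distrib sum_of_bool_mult flip: sum_distrib_left)
    also have "(\<Sum>l\<in>V. \<Sum>k\<in>V. a i k * (F k l * a l j)) = (\<Sum>k\<in>V. a i k * (\<Sum>l\<in>V. F k l * a l j))"
      by (subst sum.swap) (simp add: sum_distrib_left)
    finally have 1: "(\<Sum>l\<in>V. F i l * a l j) = a i j + s * (\<Sum>k\<in>V. a i k * (\<Sum>l\<in>V. F k l * a l j))" .
    have "(\<Sum>l\<in>V. a i l * F l j) = (\<Sum>l\<in>V. a i l * of_bool (l = j) + s * (a i l * (\<Sum>k\<in>V. a l k * F k j)))"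
      using F ij unfolding resolvent_def by (intro sum.cong) (auto simp: algebra_simps)
    also have "\<dots> = a i j + s * (\<Sum>l\<in>V. a i l * (\<Sum>k\<in>V. a l k * F k j))"
      using ij finV by (simp add: sum.distrib sum_of_bool_mult flip: sum_distrib_left)
    finally have 2: "(\<Sum>l\<in>V. a i l * F l j) = a i j + s * (\<Sum>l\<in>V. a i l * (\<Sum>k\<in>V. a l k * F k j))" .
    show ?thesis unfolding Z_def by (subst 1, subst 2) (simp add: algebra_simps sum_subtractf)
  qed
  have "\<bar>Z i\<bar> \<le> 0 / (1 - \<rho>)"
  proof (rule contraction_bound[of V \<rho> 0 Z])
    fix m i assume "\<And>i. i \<in> V \<Longrightarrow> \<bar>Z i\<bar> \<le> m" "i \<in> V"
    then show "\<bar>Z i\<bar> \<le> \<rho> * m + 0" using abs_row_le[of i Z m] s Z[of i] by (simp add: abs_mult)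
  qed (use finV rho ij in auto)
  then show ?thesis by (simp add: Z_def)
qed

end

section \<open>Regular networks: row sums and averages\<close>

lemma abs_diff_chain:
  fixes x y z :: real
  assumes "\<bar>x - y\<bar> \<le> A" "\<bar>y - z\<bar> \<le> B" "A + B = C"
  shows "\<bar>x - z\<bar> \<le> C"
  using assms by linarith

text \<open>The deterministic content of a concentrated graph, with d in the role of N p and one
  tolerance \<eta> for all deviations. The index T also ranges over the latent nodes, because the
  Granger coefficients involve sums over them. The condition 1 \<le> \<eta> d lets single entries,
  of order 1 / d, count as errors; the upper bound on \<eta> leaves room in the contraction.\<close>

locale regular_network = substochastic V a \<rho> for V a \<rho> +
  fixes S :: "nat set" and g :: graph and \<kappa> p d \<eta> :: real
  assumes kappa: "0 < \<kappa>" "\<kappa> \<le> \<rho>"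
    and p: "0 \<le> p" "p \<le> 1"
    and eta: "0 \<le> \<eta>" "1 \<le> \<eta> * d" "\<eta> \<le> (1 - \<rho>)\<^sup>2 / 2"
    and d: "0 < d"
    and SV: "S \<subseteq> V"
    and dev: "i \<in> V \<Longrightarrow> j \<in> V \<Longrightarrow> i \<noteq> j \<Longrightarrow>
      \<bar>d * a i j - \<kappa> * of_bool (g i j)\<bar> \<le> \<eta> * of_bool (g i j)"
    and deg: "T = V \<or> T = V - S \<Longrightarrow> i \<in> V \<Longrightarrow>
      \<bar>(\<Sum>l\<in>T - {i}. of_bool (g i l)) - real (card T) / real (card V) * d\<bar> \<le> \<eta> * d"
    and codeg: "T = V \<or> T = V - S \<Longrightarrow> i \<in> V \<Longrightarrow> j \<in> V \<Longrightarrow> i \<noteq> j \<Longrightarrow>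
      \<bar>(\<Sum>l\<in>T - {i, j}. of_bool (g i l) * of_bool (g l j)) - real (card T) / real (card V) * p * d\<bar> \<le> \<eta> * d"
begin

abbreviation "q \<equiv> \<rho> - \<kappa>"
abbreviation "ratio T \<equiv> real (card T) / real (card V)"
abbreviation "k \<equiv> 1 / (1 - \<rho>)"

lemma eta_le: "\<eta> \<le> 1 / 2"
proof -
  have "(1 - \<rho>)\<^sup>2 \<le> 1\<^sup>2" using rho by (intro power_mono) auto
  then show ?thesis using eta(3) by simp
qed

lemma k_ge: "1 \<le> k" using rho by simp

lemma le_mult_k: "x * (1 - \<rho>) \<le> y \<Longrightarrow> x \<le> y * k"
  using rho by (simp add: field_simps)

lemma inv_d: "1 / d \<le> \<eta>" using eta(2) d by (simp add: field_simps)

lemma frac_bound: "T \<subseteq> V \<Longrightarrow> 0 \<le> ratio T \<and> ratio T \<le> 1"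
  using card_mono[OF finV] by (simp add: divide_le_eq)

lemma entry_le:
  assumes "i \<in> V" "j \<in> V" "i \<noteq> j"
  shows "d * a i j \<le> 2" "a i j \<le> 2 * \<eta>"
proof -
  have "d * a i j \<le> (\<kappa> + \<eta>) * of_bool (g i j)" using dev[OF assms] by (auto simp: abs_le_iff algebra_simps)
  also have "\<dots> \<le> 2" using kappa rho eta_le by (cases "g i j") auto
  finally show *: "d * a i j \<le> 2" .
  have "a i j = (d * a i j) * (1 / d)" using d by simp
  also have "\<dots> \<le> 2 * \<eta>"
    using * inv_d d eta nonneg[of i j] assms by (intro mult_mono) auto
  finally show "a i j \<le> 2 * \<eta>" .
qed

lemma degree_le:
  assumes T: "T = V \<or> T = V - S" and i: "i \<in> V"
  shows "(\<Sum>l\<in>T - {i}. of_bool (g i l)) \<le> 2 * d"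
proof -
  have TV: "T \<subseteq> V" using T by auto
  have "ratio T * d \<le> 1 * d" using frac_bound[OF TV] d by (intro mult_right_mono) auto
  moreover have "\<eta> * d \<le> 1 * d" using eta_le d by (intro mult_right_mono) auto
  ultimately show ?thesis using deg[OF T i] by linarith
qed

lemma sum_off_entries:
  assumes T: "T = V \<or> T = V - S" and i: "i \<in> V"
  shows "\<bar>(\<Sum>l\<in>T - {i}. a i l) - \<kappa> * ratio T\<bar> \<le> 3 * \<eta>"
proof -
  have TV: "T \<subseteq> V" using T by auto
  let ?D = "\<Sum>l\<in>T - {i}. of_bool (g i l) :: real"
  have D: "?D \<le> 2 * d" by (rule degree_le[OF T i])
  have "\<bar>(\<Sum>l\<in>T - {i}. d * a i l) - \<kappa> * ?D\<bar> = \<bar>\<Sum>l\<in>T - {i}. d * a i l - \<kappa> * of_bool (g i l)\<bar>"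
    by (simp only: sum_subtractf sum_distrib_left)
  also have "\<dots> \<le> (\<Sum>l\<in>T - {i}. \<eta> * of_bool (g i l))"
    using TV i by (intro order_trans[OF sum_abs] sum_mono dev) auto
  also have "\<dots> = \<eta> * ?D" by (simp add: sum_distrib_left)
  also have "\<dots> \<le> \<eta> * (2 * d)" using D eta by (intro mult_left_mono)
  finally have 1: "\<bar>d * (\<Sum>l\<in>T - {i}. a i l) - \<kappa> * ?D\<bar> \<le> 2 * \<eta> * d" by (simp add: sum_distrib_left)
  have "\<bar>\<kappa> * ?D - \<kappa> * (ratio T * d)\<bar> = \<kappa> * \<bar>?D - ratio T * d\<bar>"
    unfolding right_diff_distrib[symmetric] abs_mult using kappa by simp
  also have "\<dots> \<le> 1 * (\<eta> * d)" using kappa rho deg[OF T i] by (intro mult_mono) auto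
  finally have "\<bar>d * (\<Sum>l\<in>T - {i}. a i l) - \<kappa> * (ratio T * d)\<bar> \<le> 3 * \<eta> * d"
    by (rule abs_diff_chain[OF 1]) simp
  then have "d * \<bar>(\<Sum>l\<in>T - {i}. a i l) - \<kappa> * ratio T\<bar> \<le> d * (3 * \<eta>)"
    using d by (simp add: algebra_simps abs_mult_pos' flip: right_diff_distrib)
  then show ?thesis using d by simp
qed

text \<open>A row has mass \<rho>, of which the neighbours receive about \<kappa>; the rest q stays
  on the diagonal.\<close>

lemma diag_entry: "i \<in> V \<Longrightarrow> \<bar>a i i - q\<bar> \<le> 3 * \<eta>"
proof -
  assume i: "i \<in> V"
  then have "real (card V) \<noteq> 0" using finV by auto
  then have "\<bar>(\<Sum>l\<in>V - {i}. a i l) - \<kappa>\<bar> \<le> 3 * \<eta>" using sum_off_entries[of V i] i by simp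
  moreover have "a i i + (\<Sum>l\<in>V - {i}. a i l) = \<rho>" using row[OF i] finV i by (simp add: sum.remove[of V i])
  ultimately show ?thesis by linarith
qed

lemma diag_bounds: "i \<in> V \<Longrightarrow> 0 \<le> a i i \<and> a i i \<le> \<rho>"
  using row[of i] nonneg[of i] finV by (simp add: sum.remove[of V i] sum_nonneg) (smt (verit) DiffD1 sum_nonneg nonneg)

lemma sub_row_le:
  assumes "T \<subseteq> V" "i \<in> V" shows "(\<Sum>l\<in>T. a i l) \<le> \<rho>"
  using sum_mono2[OF finV assms(1), of "a i"] row[OF assms(2)] nonneg assms(2) by auto

lemma sum_off_entries2:
  assumes T: "T = V \<or> T = V - S" and ij: "i \<in> V" "j \<in> V" "i \<noteq> j"
  shows "\<bar>(\<Sum>l\<in>T - {i, j}. a i l) - \<kappa> * ratio T\<bar> \<le> 5 * \<eta>"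
proof (cases "j \<in> T")
  case True
  have "finite (T - {i})" using T finV by auto
  then have "(\<Sum>l\<in>T - {i}. a i l) = a i j + (\<Sum>l\<in>T - {i} - {j}. a i l)"
    using True ij by (intro sum.remove) auto
  moreover have "T - {i} - {j} = T - {i, j}" by auto
  ultimately show ?thesis
    using sum_off_entries[OF T ij(1)] entry_le(2)[OF ij] nonneg[OF ij(1,2)] by auto
next
  case False
  then have "T - {i, j} = T - {i}" by auto
  then show ?thesis using sum_off_entries[OF T ij(1)] eta by simp
qed

lemma sum_common_entries:
  assumes T: "T = V \<or> T = V - S" and ij: "i \<in> V" "j \<in> V" "i \<noteq> j"
  shows "\<bar>(\<Sum>l\<in>T - {i, j}. a i l * of_bool (g l j)) - \<kappa> * ratio T * p\<bar> \<le> 3 * \<eta>"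
proof -
  have TV: "T \<subseteq> V" "finite T" using T finV by auto
  let ?D = "\<Sum>l\<in>T - {i}. of_bool (g i l) :: real"
  let ?C = "\<Sum>l\<in>T - {i, j}. of_bool (g i l) * of_bool (g l j) :: real"
  have D: "?D \<le> 2 * d" by (rule degree_le[OF T ij(1)])
  have "\<bar>(\<Sum>l\<in>T - {i, j}. d * a i l * of_bool (g l j)) - \<kappa> * ?C\<bar>
      = \<bar>\<Sum>l\<in>T - {i, j}. (d * a i l - \<kappa> * of_bool (g i l)) * of_bool (g l j)\<bar>"
    by (simp only: sum_subtractf sum_distrib_left left_diff_distrib mult.assoc)
  also have "\<dots> \<le> (\<Sum>l\<in>T - {i, j}. \<eta> * of_bool (g i l) * 1)"
    using TV ij eta by (intro order_trans[OF sum_abs] sum_mono) (auto simp only: abs_mult intro!: mult_mono dev, auto)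
  also have "\<dots> \<le> (\<Sum>l\<in>T - {i}. \<eta> * of_bool (g i l))"
    using TV eta unfolding mult_1_right by (intro sum_mono2) auto
  also have "\<dots> = \<eta> * ?D" by (simp add: sum_distrib_left)
  also have "\<dots> \<le> \<eta> * (2 * d)" using D eta by (intro mult_left_mono)
  finally have 1: "\<bar>d * (\<Sum>l\<in>T - {i, j}. a i l * of_bool (g l j)) - \<kappa> * ?C\<bar> \<le> 2 * \<eta> * d"
    by (simp add: sum_distrib_left mult.assoc)
  have "\<bar>\<kappa> * ?C - \<kappa> * (ratio T * p * d)\<bar> = \<kappa> * \<bar>?C - ratio T * p * d\<bar>"
    unfolding right_diff_distrib[symmetric] abs_mult using kappa by simp
  also have "\<dots> \<le> 1 * (\<eta> * d)" using kappa rho codeg[OF T ij] by (intro mult_mono) auto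
  finally have "\<bar>d * (\<Sum>l\<in>T - {i, j}. a i l * of_bool (g l j)) - \<kappa> * (ratio T * p * d)\<bar> \<le> 3 * \<eta> * d"
    by (rule abs_diff_chain[OF 1]) simp
  then have "d * \<bar>(\<Sum>l\<in>T - {i, j}. a i l * of_bool (g l j)) - \<kappa> * ratio T * p\<bar> \<le> d * (3 * \<eta>)"
    using d by (simp add: algebra_simps abs_mult_pos' flip: right_diff_distrib)
  then show ?thesis using d by simp
qed

text \<open>Among the neighbours of i a fraction of about p is adjacent to j, so averaging over row
  i turns the slope \<beta> into its mean p \<beta> and leaves a constant. The indices i and j,
  where this heuristic fails, are left out and treated by hand in each application.\<close>

lemma mixing:
  assumes T: "T = V \<or> T = V - S" and ij: "i \<in> V" "j \<in> V" "i \<noteq> j"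
    and h: "\<And>l. l \<in> T - {i, j} \<Longrightarrow> \<bar>h l - (\<beta> * of_bool (g l j) + \<gamma>)\<bar> \<le> \<theta>" and \<theta>: "0 \<le> \<theta>"
  shows "\<bar>(\<Sum>l\<in>T - {i, j}. a i l * h l) - \<kappa> * ratio T * (p * \<beta> + \<gamma>)\<bar> \<le> \<rho> * \<theta> + 5 * \<eta> * (\<bar>\<beta>\<bar> + \<bar>\<gamma>\<bar>)"
proof -
  have TV: "T \<subseteq> V" using T by auto
  let ?e = "\<lambda>l. h l - (\<beta> * of_bool (g l j) + \<gamma>)"
  let ?A = "\<Sum>l\<in>T - {i, j}. a i l * of_bool (g l j)" and ?B = "\<Sum>l\<in>T - {i, j}. a i l"
  have "(\<Sum>l\<in>T - {i, j}. a i l * h l) = (\<Sum>l\<in>T - {i, j}. a i l * ?e l + \<beta> * (a i l * of_bool (g l j)) + \<gamma> * a i l)"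
    by (intro sum.cong) (auto simp: algebra_simps)
  then have eq: "(\<Sum>l\<in>T - {i, j}. a i l * h l) = (\<Sum>l\<in>T - {i, j}. a i l * ?e l) + \<beta> * ?A + \<gamma> * ?B"
    by (simp add: sum.distrib sum_distrib_left)
  have "\<bar>\<Sum>l\<in>T - {i, j}. a i l * ?e l\<bar> \<le> (\<Sum>l\<in>T - {i, j}. \<bar>a i l\<bar>) * \<theta>"
    by (rule abs_sum_mult_le[OF h])
  also have "\<dots> = ?B * \<theta>" using nonneg ij(1) TV by (intro arg_cong2[of _ _ _ _ times] sum.cong) auto
  also have "\<dots> \<le> \<rho> * \<theta>" using TV ij \<theta> by (intro mult_right_mono sub_row_le) auto
  finally have 1: "\<bar>\<Sum>l\<in>T - {i, j}. a i l * ?e l\<bar> \<le> \<rho> * \<theta>" .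
  have "\<bar>\<beta> * ?A - \<beta> * (\<kappa> * ratio T * p)\<bar> \<le> \<bar>\<beta>\<bar> * (3 * \<eta>)"
    unfolding right_diff_distrib[symmetric] abs_mult
    by (intro mult_left_mono sum_common_entries[OF T ij]) auto
  also have "\<dots> \<le> \<bar>\<beta>\<bar> * (5 * \<eta>)" using eta by (intro mult_left_mono) auto
  finally have 2: "\<bar>\<beta> * ?A - \<beta> * (\<kappa> * ratio T * p)\<bar> \<le> \<bar>\<beta>\<bar> * (5 * \<eta>)" .
  have 3: "\<bar>\<gamma> * ?B - \<gamma> * (\<kappa> * ratio T)\<bar> \<le> \<bar>\<gamma>\<bar> * (5 * \<eta>)"
    unfolding right_diff_distrib[symmetric] abs_mult
    by (intro mult_left_mono sum_off_entries2[OF T ij]) auto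
  have "(\<Sum>l\<in>T - {i, j}. a i l * h l) - \<kappa> * ratio T * (p * \<beta> + \<gamma>)
    = (\<Sum>l\<in>T - {i, j}. a i l * ?e l) + (\<beta> * ?A - \<beta> * (\<kappa> * ratio T * p)) + (\<gamma> * ?B - \<gamma> * (\<kappa> * ratio T))"
    unfolding eq by (simp add: algebra_simps add_divide_distrib)
  also have "\<bar>\<dots>\<bar> \<le> \<rho> * \<theta> + \<bar>\<beta>\<bar> * (5 * \<eta>) + \<bar>\<gamma>\<bar> * (5 * \<eta>)" using 1 2 3 by linarith
  finally show ?thesis by (simp add: algebra_simps)
qed

end

lemma abs_unit_mult: "\<bar>s\<bar> = 1 \<Longrightarrow> x = s * y \<Longrightarrow> \<bar>x\<bar> = \<bar>y\<bar>" for x y s :: real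
  by (simp add: abs_mult)

lemma abs_sum5_le:
  fixes x :: real
  assumes "\<bar>x\<bar> = \<bar>a + b + c + d + e\<bar>" "\<bar>a\<bar> \<le> A" "\<bar>b\<bar> \<le> B" "\<bar>c\<bar> \<le> C" "\<bar>d\<bar> \<le> D" "\<bar>e\<bar> \<le> E"
  shows "\<bar>x\<bar> \<le> A + B + C + D + E"
  using assms by linarith

text \<open>The defect of the two-level ansatz is split into the contracted error, the deviation of
  the diagonal weight, the deviation of the edge weight, the error of the diagonal entry of the
  resolvent, and the error of the averaged ansatz.\<close>

lemma resolvent_step_identity:
  fixes A x b c f q r M K \<alpha> e s :: real
  shows "s * (A * x + e * f + (r + M)) - s * (q * b + c * \<alpha> + K)
    = s * ((A * (x - b) + r) + (A - q) * b + (e - c) * f + c * (f - \<alpha>) + (M - K))"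
  by (simp add: algebra_simps)

section \<open>Two-level form of the resolvents\<close>

context regular_network
begin

text \<open>Ansatz for the resolvent \<open>(I - s a)\<inverse>\<close>: off the diagonal it is close to
  \<open>(\<beta> g + \<gamma>) / d\<close>. Inserting this in the resolvent equation, with the common neighbour counts
  replaced by their mean \<open>p d\<close>, and comparing coefficients gives the slope \<open>\<beta>\<close> and the
  offset \<open>\<gamma>\<close>.\<close>

definition "res_slope s = s * \<kappa> / (1 - s * q)\<^sup>2"
definition "res_offset s = s * \<kappa> * p * res_slope s / (1 - s * \<rho>)"

text \<open>The three equations compare coefficients on the diagonal, on an edge, and in the
  constant part. Each division by 1 - s q or 1 - s \<rho> costs one factor k, which gives the powers
  in the bounds.\<close>

lemma resolvent_coeffs:
  assumes s: "\<bar>s\<bar> = 1"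
  defines "\<alpha> \<equiv> 1 / (1 - s * q)" and "\<beta> \<equiv> res_slope s" and "\<gamma> \<equiv> res_offset s"
  shows "\<alpha> = 1 + s * q * \<alpha>" "\<beta> = s * (q * \<beta> + \<kappa> * \<alpha>)" "\<gamma> = s * (q * \<gamma> + \<kappa> * (p * \<beta> + \<gamma>))"
    and "\<bar>\<alpha>\<bar> \<le> k" "\<bar>\<beta>\<bar> \<le> k ^ 2" "\<bar>\<gamma>\<bar> \<le> k ^ 3"
proof -
  have s': "s = 1 \<or> s = -1" using s by (auto simp: abs_if split: if_splits)
  then have pos: "1 - \<rho> \<le> 1 - s * q" "1 - \<rho> \<le> 1 - s * \<rho>" using kappa rho by auto
  then have nz: "1 - s * q \<noteq> 0" "1 - s * \<rho> \<noteq> 0" using rho by linarith+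
  show "\<alpha> = 1 + s * q * \<alpha>" using nz by (simp add: \<alpha>_def field_simps)
  have \<beta>: "\<beta> = s * \<kappa> * \<alpha> * \<alpha>" by (simp add: \<beta>_def res_slope_def \<alpha>_def power2_eq_square)
  then have "\<beta> * (1 - s * q) = s * \<kappa> * \<alpha>" using nz by (simp add: \<alpha>_def)
  then show "\<beta> = s * (q * \<beta> + \<kappa> * \<alpha>)" by (simp add: algebra_simps)
  have "\<gamma> * (1 - s * \<rho>) = s * \<kappa> * p * \<beta>" using nz by (simp add: \<gamma>_def res_offset_def \<beta>_def)
  then show "\<gamma> = s * (q * \<gamma> + \<kappa> * (p * \<beta> + \<gamma>))" by (simp add: algebra_simps)
  have "\<bar>\<alpha>\<bar> = 1 / (1 - s * q)" using pos rho by (simp add: \<alpha>_def)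
  then show a: "\<bar>\<alpha>\<bar> \<le> k" using pos rho by (simp add: frac_le)
  have "\<bar>\<beta>\<bar> = \<kappa> * (\<bar>\<alpha>\<bar> * \<bar>\<alpha>\<bar>)" using kappa s by (simp add: \<beta> abs_mult)
  also have "\<dots> \<le> 1 * (k * k)" using a kappa rho k_ge by (intro mult_mono) auto
  finally show b: "\<bar>\<beta>\<bar> \<le> k ^ 2" by (simp add: power2_eq_square)
  have "\<bar>1 - s * \<rho>\<bar> = 1 - s * \<rho>" using pos rho by linarith
  then have "\<bar>\<gamma>\<bar> = (\<kappa> * p) * \<bar>\<beta>\<bar> * (1 / (1 - s * \<rho>))"
    using kappa s p by (simp add: \<gamma>_def res_offset_def \<beta>_def abs_mult)
  also have "\<dots> \<le> 1 * k ^ 2 * k"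
  proof -
    have "1 / (1 - s * \<rho>) \<le> k" by (rule frac_le) (use pos rho in linarith)+
    moreover have "0 \<le> 1 / (1 - s * \<rho>)" using pos rho by (intro divide_nonneg_nonneg) linarith+
    moreover have "\<kappa> * p \<le> 1" using kappa rho p by (intro mult_le_one) auto
    ultimately show ?thesis using b kappa k_ge p by (intro mult_mono) auto
  qed
  finally show "\<bar>\<gamma>\<bar> \<le> k ^ 3" by (simp add: power3_eq_cube power2_eq_square)
qed

lemma k_eta: "k * \<eta> \<le> (1 - \<rho>) / 2"
proof -
  have "k * \<eta> \<le> k * ((1 - \<rho>)\<^sup>2 / 2)" using eta rho by (intro mult_left_mono) auto
  also have "\<dots> = (1 - \<rho>) / 2" using rho by (simp add: power2_eq_square)
  finally show ?thesis .
qed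

text \<open>For a fixed column j the error of the ansatz satisfies the resolvent equation up to
  terms of order \<eta>, and the maximum norm closes the estimate. The constant 22 is 3 + 2 + 16 +
  1, the sum of the coefficients of powers of k that are all at most \<open>k ^ 4\<close>.\<close>

lemma resolvent_asymptotics:
  assumes F: "resolvent V a s F" and s: "\<bar>s\<bar> = 1" and ij: "i \<in> V" "j \<in> V" "i \<noteq> j"
  shows "\<bar>d * F i j - (res_slope s * of_bool (g i j) + res_offset s)\<bar> \<le> 44 * k ^ 5 * \<eta>"
proof -
  define \<alpha> \<beta> \<gamma> where "\<alpha> = 1 / (1 - s * q)" and "\<beta> = res_slope s" and "\<gamma> = res_offset s"
  note co = resolvent_coeffs[OF s, folded \<alpha>_def \<beta>_def \<gamma>_def]
  define B where "B = \<bar>\<beta>\<bar> + \<bar>\<gamma>\<bar>"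
  have kp: "k \<le> k ^ 4" "k ^ 2 \<le> k ^ 4" "k ^ 3 \<le> k ^ 4"
    using power_increasing[of 1 4 k] power_increasing[of 2 4 k] power_increasing[of 3 4 k] k_ge by simp_all
  have B: "0 \<le> B" "B \<le> 2 * k ^ 3"
    using co(5,6) power_increasing[of 2 3 k] k_ge unfolding B_def by auto
  have bg: "\<bar>\<beta> * of_bool b + \<gamma>\<bar> \<le> B" for b unfolding B_def by (cases b) auto
  define w where "w i = d * F i j - (\<beta> * of_bool (g i j) + \<gamma>)" for i
  \<comment> \<open>The diagonal entry is of order 1 and is not scaled by d. Its error is first
    bounded in terms of the off-diagonal errors and then fed back into their estimate.\<close>
  define wj where "wj = F j j - \<alpha>"
  \<comment> \<open>Half of the contraction margin 1 - \<rho> is spent on the feedback k \<eta> m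
    through the diagonal entry, so the factor is (1 + \<rho>) / 2. Dividing by (1 - \<rho>) / 2
    turns 22 into 44 and adds a power of k.\<close>
  have "\<bar>w i\<bar> \<le> 22 * k ^ 4 * \<eta> / (1 - (1 + \<rho>) / 2)"
  proof (rule contraction_bound[of "V - {j}"])
    fix m i assume m: "0 \<le> m" "\<And>i. i \<in> V - {j} \<Longrightarrow> \<bar>w i\<bar> \<le> m" and i: "i \<in> V - {j}"
    have Fl: "\<bar>F l j\<bar> \<le> (m + B) * \<eta>" if "l \<in> V - {j}" for l
    proof -
      have "d * F l j = w l + (\<beta> * of_bool (g l j) + \<gamma>)" by (simp add: w_def)
      then have "\<bar>d * F l j\<bar> \<le> m + B" using m(2)[OF that] bg[of "g l j"] by linarith
      then have "\<bar>F l j\<bar> \<le> (m + B) * (1 / d)" using d by (simp add: abs_mult field_simps)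
      also have "\<dots> \<le> (m + B) * \<eta>" using m B inv_d by (intro mult_left_mono) auto
      finally show ?thesis .
    qed
    have "\<bar>\<Sum>l\<in>V - {j}. a j l * F l j\<bar> \<le> (\<Sum>l\<in>V - {j}. \<bar>a j l\<bar>) * ((m + B) * \<eta>)"
      by (rule abs_sum_mult_le[OF Fl])
    also have "\<dots> \<le> 1 * ((m + B) * \<eta>)"
    proof (intro mult_right_mono)
      have "(\<Sum>l\<in>V - {j}. \<bar>a j l\<bar>) = (\<Sum>l\<in>V - {j}. a j l)" using nonneg ij by (intro sum.cong) auto
      also have "\<dots> \<le> 1" using sub_row_le[of "V - {j}" j] ij rho by auto
      finally show "(\<Sum>l\<in>V - {j}. \<bar>a j l\<bar>) \<le> 1" .
    qed (use m B eta in auto)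
    finally have sj: "\<bar>\<Sum>l\<in>V - {j}. a j l * F l j\<bar> \<le> (m + B) * \<eta>" by simp
    have "F j j = 1 + s * (\<Sum>l\<in>V. a j l * F l j)" using F ij unfolding resolvent_def by force
    then have "F j j = 1 + s * (a j j * F j j + (\<Sum>l\<in>V - {j}. a j l * F l j))"
      using finV ij by (simp add: sum.remove[of V j])
    then have "wj = s * (a j j * wj + (a j j - q) * \<alpha> + (\<Sum>l\<in>V - {j}. a j l * F l j))"
      using co(1) unfolding wj_def by (simp add: algebra_simps)
    then have "\<bar>wj\<bar> = \<bar>a j j * wj + (a j j - q) * \<alpha> + (\<Sum>l\<in>V - {j}. a j l * F l j)\<bar>"
      by (rule abs_unit_mult[OF s])
    moreover have "\<bar>a j j * wj\<bar> \<le> \<rho> * \<bar>wj\<bar>"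
      unfolding abs_mult using diag_bounds[OF ij(2)] by (intro mult_right_mono) auto
    moreover have "\<bar>(a j j - q) * \<alpha>\<bar> \<le> 3 * \<eta> * k"
      unfolding abs_mult using diag_entry[OF ij(2)] co(4) by (intro mult_mono) auto
    ultimately have "\<bar>wj\<bar> * (1 - \<rho>) \<le> \<eta> * (3 * k + m + B)" using sj by (simp add: algebra_simps)
    then have "\<bar>wj\<bar> \<le> \<eta> * (3 * k + m + B) * k" by (rule le_mult_k)
    also have "\<dots> \<le> \<eta> * (3 * k + m + 2 * k ^ 3) * k"
      using B eta k_ge rho by (intro mult_right_mono mult_left_mono) auto
    also have "\<dots> = k * \<eta> * m + \<eta> * (3 * k ^ 2 + 2 * k ^ 4)"
      by (simp add: algebra_simps power2_eq_square power3_eq_cube power4_eq_xxxx)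
    finally have wj: "\<bar>wj\<bar> \<le> k * \<eta> * m + \<eta> * (3 * k ^ 2 + 2 * k ^ 4)" .
    have i': "i \<in> V" "i \<noteq> j" using i by auto
    let ?b = "of_bool (g i j) :: real"
    let ?R = "\<Sum>l\<in>V - {i, j}. a i l * w l" and ?M = "\<Sum>l\<in>V - {i, j}. a i l * (\<beta> * of_bool (g l j) + \<gamma>)"
    have "F i j = s * (\<Sum>l\<in>V. a i l * F l j)" using F ij i' unfolding resolvent_def by force
    also have "\<dots> = s * (a i i * F i j + a i j * F j j + (\<Sum>l\<in>V - {i, j}. a i l * F l j))"
      by (subst sum_split2[OF finV i'(1) ij(2) i'(2)]) simp
    finally have "d * F i j = d * (s * (a i i * F i j + a i j * F j j + (\<Sum>l\<in>V - {i, j}. a i l * F l j)))"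
      by simp
    also have "\<dots> = s * (a i i * (d * F i j) + d * a i j * F j j + (\<Sum>l\<in>V - {i, j}. a i l * (d * F l j)))"
      by (simp add: algebra_simps sum_distrib_left)
    also have "(\<Sum>l\<in>V - {i, j}. a i l * (d * F l j)) = ?R + ?M"
      unfolding w_def by (simp add: sum.distrib[symmetric] algebra_simps)
    finally have Fi: "d * F i j = s * (a i i * (d * F i j) + d * a i j * F j j + (?R + ?M))" .
    have rec: "\<beta> * ?b + \<gamma> = s * (q * (\<beta> * ?b + \<gamma>) + \<kappa> * ?b * \<alpha> + \<kappa> * (p * \<beta> + \<gamma>))"
    proof -
      have "\<beta> * ?b + \<gamma> = s * (q * \<beta> + \<kappa> * \<alpha>) * ?b + s * (q * \<gamma> + \<kappa> * (p * \<beta> + \<gamma>))"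
        using co(2,3) by simp
      then show ?thesis by (simp add: algebra_simps)
    qed
    have "w i = s * (a i i * (d * F i j) + d * a i j * F j j + (?R + ?M))
        - s * (q * (\<beta> * ?b + \<gamma>) + \<kappa> * ?b * \<alpha> + \<kappa> * (p * \<beta> + \<gamma>))"
      using Fi rec unfolding w_def by linarith
    also have "\<dots> = s * ((a i i * w i + ?R) + (a i i - q) * (\<beta> * ?b + \<gamma>) + (d * a i j - \<kappa> * ?b) * F j j
        + \<kappa> * ?b * wj + (?M - \<kappa> * (p * \<beta> + \<gamma>)))"
      unfolding resolvent_step_identity by (simp only: w_def wj_def)
    finally have "\<bar>w i\<bar> = \<bar>(a i i * w i + ?R) + (a i i - q) * (\<beta> * ?b + \<gamma>) + (d * a i j - \<kappa> * ?b) * F j j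
        + \<kappa> * ?b * wj + (?M - \<kappa> * (p * \<beta> + \<gamma>))\<bar>"
      by (rule abs_unit_mult[OF s])
    moreover have "\<bar>a i i * w i + ?R\<bar> \<le> \<rho> * m"
    proof -
      have "a i i * w i + ?R = (\<Sum>l\<in>V - {j}. a i l * w l)"
        using i' finV by (subst sum.remove[of _ i]) (auto intro!: sum.cong)
      also have "\<bar>\<dots>\<bar> \<le> (\<Sum>l\<in>V - {j}. \<bar>a i l\<bar>) * m" by (rule abs_sum_mult_le[OF m(2)])
      also have "(\<Sum>l\<in>V - {j}. \<bar>a i l\<bar>) = (\<Sum>l\<in>V - {j}. a i l)" using nonneg i' by (intro sum.cong) auto
      also have "\<dots> * m \<le> \<rho> * m" using sub_row_le[of "V - {j}" i] i' m by (intro mult_right_mono) auto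
      finally show ?thesis .
    qed
    moreover have "\<bar>(a i i - q) * (\<beta> * ?b + \<gamma>)\<bar> \<le> 3 * \<eta> * B"
      unfolding abs_mult using diag_entry[OF i'(1)] bg eta by (intro mult_mono) auto
    moreover have "\<bar>(d * a i j - \<kappa> * ?b) * F j j\<bar> \<le> \<eta> * k"
    proof -
      have "\<bar>d * a i j - \<kappa> * ?b\<bar> \<le> \<eta>" using dev[OF i'(1) ij(2) i'(2)] eta by (cases "g i j") auto
      then show ?thesis
        unfolding abs_mult using resolvent_bound[OF F s ij(2,2)] eta by (intro mult_mono) auto
    qed
    moreover have "\<bar>\<kappa> * ?b * wj\<bar> \<le> \<bar>wj\<bar>"
    proof -
      have "\<bar>\<kappa> * ?b * wj\<bar> \<le> 1 * \<bar>wj\<bar>" unfolding abs_mult using kappa rho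
        by (intro mult_right_mono) (auto simp: abs_mult)
      then show ?thesis by simp
    qed
    moreover have "\<bar>?M - \<kappa> * (p * \<beta> + \<gamma>)\<bar> \<le> 5 * \<eta> * B"
    proof -
      have "real (card V) \<noteq> 0" using finV i' by auto
      then show ?thesis
        using mixing[of V i j "\<lambda>l. \<beta> * of_bool (g l j) + \<gamma>" \<beta> \<gamma> 0] i' ij unfolding B_def by simp
    qed
    ultimately have "\<bar>w i\<bar> \<le> \<rho> * m + 3 * \<eta> * B + \<eta> * k + \<bar>wj\<bar> + 5 * \<eta> * B" by (rule abs_sum5_le)
    also have "\<dots> = \<rho> * m + \<bar>wj\<bar> + \<eta> * (8 * B + k)" by (simp add: algebra_simps)
    also have "\<dots> \<le> \<rho> * m + (k * \<eta> * m + \<eta> * (3 * k ^ 2 + 2 * k ^ 4)) + \<eta> * (16 * k ^ 3 + k)"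
      using wj B eta rho by (intro add_mono mult_left_mono) auto
    also have "\<dots> = \<rho> * m + k * \<eta> * m + \<eta> * (3 * k ^ 2 + 2 * k ^ 4 + 16 * k ^ 3 + k)" by (simp add: algebra_simps)
    also have "\<dots> \<le> \<rho> * m + (1 - \<rho>) / 2 * m + \<eta> * (22 * k ^ 4)"
      using kp k_eta m eta by (intro add_mono mult_left_mono mult_right_mono) auto
    also have "\<dots> = (1 + \<rho>) / 2 * m + 22 * k ^ 4 * \<eta>" by (simp add: field_simps)
    finally show "\<bar>w i\<bar> \<le> (1 + \<rho>) / 2 * m + 22 * k ^ 4 * \<eta>" .
  qed (use finV rho ij eta k_ge in auto)
  also have "1 - (1 + \<rho>) / 2 = (1 - \<rho>) / 2" by (simp add: field_simps)
  also have "22 * k ^ 4 * \<eta> / ((1 - \<rho>) / 2) = 44 * k ^ 5 * \<eta>"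
    using rho by (simp add: power_def field_simps)
  finally show ?thesis unfolding w_def \<beta>_def \<gamma>_def .
qed

end

section \<open>The squared matrix, the latent block and the Granger coefficients\<close>

definition sq_mat :: "nat set \<Rightarrow> rmatrix \<Rightarrow> rmatrix" where
  "sq_mat V a i j = (\<Sum>l\<in>V. a i l * a l j)"

context substochastic
begin

abbreviation "A2 \<equiv> sq_mat V a"

lemma A2_sym: "i \<in> V \<Longrightarrow> j \<in> V \<Longrightarrow> A2 i j = A2 j i"
  unfolding sq_mat_def by (intro sum.cong) (auto simp: sym)

lemma A2_nonneg: "i \<in> V \<Longrightarrow> j \<in> V \<Longrightarrow> 0 \<le> A2 i j"
  unfolding sq_mat_def by (intro sum_nonneg mult_nonneg_nonneg nonneg)

lemma A2_apply: "(\<Sum>m\<in>T. A2 l m * f m) = (\<Sum>k\<in>V. a l k * (\<Sum>m\<in>T. a k m * f m))"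
  unfolding sq_mat_def by (simp add: sum_distrib_left sum_distrib_right mult.assoc) (rule sum.swap)

lemma A2_row: "i \<in> V \<Longrightarrow> (\<Sum>j\<in>V. A2 i j) = \<rho>\<^sup>2"
  using A2_apply[of i "\<lambda>_. 1" V] by (simp add: row power2_eq_square flip: sum_distrib_right)

lemma rho_sq: "0 \<le> \<rho>\<^sup>2" "\<rho>\<^sup>2 < 1"
  using rho by (auto simp: power_less_one_iff)

lemma A2_abs_row: "i \<in> V \<Longrightarrow> T \<subseteq> V \<Longrightarrow> (\<Sum>j\<in>T. \<bar>A2 i j\<bar>) \<le> \<rho>\<^sup>2"
  using sum_mono2[OF finV, of T "\<lambda>j. \<bar>A2 i j\<bar>"] A2_row[of i] A2_nonneg[of i] by simp

lemma A2_abs_le: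
  assumes "i \<in> V" "T \<subseteq> V" "\<And>l. l \<in> T \<Longrightarrow> \<bar>f l\<bar> \<le> m" "0 \<le> m"
  shows "\<bar>\<Sum>l\<in>T. A2 i l * f l\<bar> \<le> \<rho>\<^sup>2 * m"
  using order_trans[OF abs_sum_mult_le[OF assms(3)] mult_right_mono[OF A2_abs_row[OF assms(1,2)] assms(4)]] .

text \<open>A maximum principle for a kernel of row mass below 1: contraction applied to the
  positive part of f - c. The sign of c enters in \<rho>^2 c \<le> c.\<close>

lemma A2_max_principle:
  assumes TV: "T \<subseteq> V" and "0 \<le> c" and out: "\<And>i. i \<in> V - T \<Longrightarrow> f i \<le> c"
    and sub: "\<And>i. i \<in> T \<Longrightarrow> f i \<le> (\<Sum>l\<in>V. A2 i l * f l)" and "i \<in> V"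
  shows "f i \<le> c"
proof -
  have "\<bar>max (f i - c) 0\<bar> \<le> 0 / (1 - \<rho>\<^sup>2)"
  proof (rule contraction_bound[of V "\<rho>\<^sup>2" 0])
    fix m i assume m: "0 \<le> m" "\<And>i. i \<in> V \<Longrightarrow> \<bar>max (f i - c) 0\<bar> \<le> m" and i: "i \<in> V"
    show "\<bar>max (f i - c) 0\<bar> \<le> \<rho>\<^sup>2 * m + 0"
    proof (cases "i \<in> T")
      case True
      have "f i \<le> (\<Sum>l\<in>V. A2 i l * f l)" by (rule sub[OF True])
      also have "\<dots> \<le> (\<Sum>l\<in>V. A2 i l * (c + m))"
      proof (intro sum_mono mult_left_mono)
        fix l assume l: "l \<in> V"
        show "f l \<le> c + m" using m(2)[OF l] by simp
        show "0 \<le> A2 i l" by (rule A2_nonneg[OF i l])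
      qed
      also have "\<dots> = \<rho>\<^sup>2 * (c + m)" using A2_row[OF i] by (simp flip: sum_distrib_right)
      also have "\<dots> \<le> c + \<rho>\<^sup>2 * m" using rho_sq \<open>0 \<le> c\<close> mult_right_mono[of "\<rho>\<^sup>2" 1 c] by (simp add: algebra_simps)
      finally show ?thesis using m(1) rho_sq by simp
    next
      case False
      then show ?thesis using out i m(1) rho_sq by simp
    qed
  qed (use finV rho_sq \<open>i \<in> V\<close> in auto)
  then show ?thesis by simp
qed

text \<open>The matrix c times the inverse of I - a^2, as a two-sided inverse. The left equation
  serves the identity for the Granger coefficients and the solvability of the observed block, the
  right one the lower bound on that block.\<close>

definition stationary_cov :: "real \<Rightarrow> rmatrix \<Rightarrow> bool" where
  "stationary_cov c R \<longleftrightarrow> (\<forall>i\<in>V. \<forall>j\<in>V. R i j = c * of_bool (i = j) + (\<Sum>l\<in>V. A2 i l * R l j) \<and>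
     R i j = c * of_bool (i = j) + (\<Sum>l\<in>V. R i l * A2 l j))"

text \<open>For the killed chain with kernel \<open>A2\<close> started at a latent node l,
  \<open>U l j\<close> is the probability of entering S first at j.\<close>

definition block_solution :: "nat set \<Rightarrow> rmatrix \<Rightarrow> bool" where
  "block_solution S U \<longleftrightarrow> (\<forall>l\<in>V - S. \<forall>j\<in>S. U l j = A2 l j + (\<Sum>m\<in>V - S. A2 l m * U m j))"

text \<open>By block inversion this is \<open>R1 R0\<inverse>\<close> with both covariances restricted to \<open>S\<close>.\<close>

definition granger_coeff :: "nat set \<Rightarrow> rmatrix \<Rightarrow> rmatrix" where
  "granger_coeff S U i j = a i j + (\<Sum>l\<in>V - S. a i l * U l j)"

lemma sum_V_split: "S \<subseteq> V \<Longrightarrow> (\<Sum>l\<in>V. f l) = (\<Sum>l\<in>S. f l) + (\<Sum>l\<in>V - S. f l)" for f :: "nat \<Rightarrow> real"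
  using sum.subset_diff[OF _ finV, of S f] by simp

lemma block_solution_exists:
  assumes "S \<subseteq> V" shows "\<exists>U. block_solution S U"
proof -
  have "\<forall>j. \<exists>f. \<forall>i\<in>V - S. f i = A2 i j + (\<Sum>l\<in>V - S. A2 i l * f l)"
    using finV A2_abs_row rho_sq(2) by (intro allI linear_system_solvable[of _ "\<rho>\<^sup>2"]) auto
  then obtain f where "\<And>j i. i \<in> V - S \<Longrightarrow> f j i = A2 i j + (\<Sum>l\<in>V - S. A2 i l * f j l)"
    by metis
  then have "block_solution S (\<lambda>i j. f j i)" unfolding block_solution_def by blast
  then show ?thesis by blast
qed

text \<open>The absolute row mass of U, continued by 1 to the observed nodes, is subharmonic for
  \<open>A2\<close> on the latent nodes, so the maximum principle applies with the bound 1.\<close>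

lemma block_solution_row:
  assumes SV: "S \<subseteq> V" and U: "block_solution S U" and l: "l \<in> V - S"
  shows "(\<Sum>j\<in>S. \<bar>U l j\<bar>) \<le> 1"
proof -
  define t where "t l = (if l \<in> S then 1 else \<Sum>j\<in>S. \<bar>U l j\<bar>)" for l
  have "t l \<le> 1"
  proof (rule A2_max_principle[of "V - S"])
    fix i assume i: "i \<in> V - S"
    have "t i = (\<Sum>j\<in>S. \<bar>A2 i j + (\<Sum>m\<in>V - S. A2 i m * U m j)\<bar>)"
    proof -
      have "U i j = A2 i j + (\<Sum>m\<in>V - S. A2 i m * U m j)" if "j \<in> S" for j
        using that i U unfolding block_solution_def by blast
      then have "(\<Sum>j\<in>S. \<bar>U i j\<bar>) = (\<Sum>j\<in>S. \<bar>A2 i j + (\<Sum>m\<in>V - S. A2 i m * U m j)\<bar>)"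
        by (intro sum.cong refl arg_cong[of _ _ abs])
      then show ?thesis using i unfolding t_def by simp
    qed
    also have "\<dots> \<le> (\<Sum>j\<in>S. A2 i j + (\<Sum>m\<in>V - S. A2 i m * \<bar>U m j\<bar>))"
    proof (rule sum_mono)
      fix j assume j: "j \<in> S"
      have "\<bar>\<Sum>m\<in>V - S. A2 i m * U m j\<bar> \<le> (\<Sum>m\<in>V - S. A2 i m * \<bar>U m j\<bar>)"
        using A2_nonneg i by (intro order_trans[OF sum_abs] sum_mono) (auto simp: abs_mult)
      then show "\<bar>A2 i j + (\<Sum>m\<in>V - S. A2 i m * U m j)\<bar> \<le> A2 i j + (\<Sum>m\<in>V - S. A2 i m * \<bar>U m j\<bar>)"
        using A2_nonneg[of i j] i j SV by auto
    qed
    also have "\<dots> = (\<Sum>j\<in>S. A2 i j) + (\<Sum>m\<in>V - S. A2 i m * (\<Sum>j\<in>S. \<bar>U m j\<bar>))"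
      unfolding sum.distrib sum_distrib_left by (subst sum.swap) simp
    also have "\<dots> = (\<Sum>l\<in>V. A2 i l * t l)"
      unfolding sum_V_split[OF SV] by (simp add: t_def)
    finally show "t i \<le> (\<Sum>l\<in>V. A2 i l * t l)" .
  qed (use l in \<open>auto simp: t_def\<close>)
  then show ?thesis using l by (simp add: t_def)
qed

text \<open>This makes the true coefficient rows feasible for the constraint of the regularized
  estimator. It also keeps errors free of the factor |S| when such a row is applied to an entrywise
  perturbation.\<close>

lemma granger_coeff_row:
  assumes SV: "S \<subseteq> V" and U: "block_solution S U" and i: "i \<in> S"
  shows "(\<Sum>j\<in>S. \<bar>granger_coeff S U i j\<bar>) \<le> 1"
proof -
  have a0: "0 \<le> a i l" if "l \<in> V" for l using nonneg i SV that by auto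
  have "(\<Sum>j\<in>S. \<bar>granger_coeff S U i j\<bar>) \<le> (\<Sum>j\<in>S. a i j + (\<Sum>l\<in>V - S. a i l * \<bar>U l j\<bar>))"
  proof (rule sum_mono)
    fix j assume j: "j \<in> S"
    have "\<bar>\<Sum>l\<in>V - S. a i l * U l j\<bar> \<le> (\<Sum>l\<in>V - S. a i l * \<bar>U l j\<bar>)"
      using a0 by (intro order_trans[OF sum_abs] sum_mono) (auto simp: abs_mult)
    then show "\<bar>granger_coeff S U i j\<bar> \<le> a i j + (\<Sum>l\<in>V - S. a i l * \<bar>U l j\<bar>)"
      using a0[of j] j SV unfolding granger_coeff_def by auto
  qed
  also have "\<dots> = (\<Sum>j\<in>S. a i j) + (\<Sum>l\<in>V - S. a i l * (\<Sum>j\<in>S. \<bar>U l j\<bar>))"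
    unfolding sum.distrib sum_distrib_left by (subst sum.swap) simp
  also have "\<dots> \<le> (\<Sum>j\<in>S. a i j) + (\<Sum>l\<in>V - S. a i l * 1)"
    using a0 block_solution_row[OF SV U] by (intro add_left_mono sum_mono mult_left_mono) auto
  also have "\<dots> = \<rho>" using sum_V_split[OF SV, of "a i"] row[of i] i SV by auto
  finally show ?thesis using rho by simp
qed

text \<open>On the latent nodes the defect of R = U R, with R restricted to S on the right, is
  harmonic for \<open>A2\<close>, and it is continued by 0 to S. The maximum principle for both
  signs makes it vanish, so the latent rows of the covariance can be eliminated.\<close>

lemma granger_coeff_eq:
  assumes SV: "S \<subseteq> V" and U: "block_solution S U" and R: "stationary_cov c R" and ij: "i \<in> S" "j \<in> S"
  shows "(\<Sum>m\<in>S. granger_coeff S U i m * R m j) = (\<Sum>l\<in>V. a i l * R l j)"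
proof -
  define Z where "Z l = (if l \<in> S then 0 else R l j - (\<Sum>m\<in>S. U l m * R m j))" for l
  have Z: "Z l = (\<Sum>m\<in>V. A2 l m * Z m)" if l: "l \<in> V - S" for l
  proof -
    have "R l j = (\<Sum>m\<in>V. A2 l m * R m j)" 
    proof -
      have "R l j = c * of_bool (l = j) + (\<Sum>m\<in>V. A2 l m * R m j)"
        using R l ij SV unfolding stationary_cov_def by blast
      moreover have "l \<noteq> j" using l ij by auto
      ultimately show ?thesis by simp
    qed
    also have "\<dots> = (\<Sum>m\<in>S. A2 l m * R m j) + (\<Sum>m\<in>V - S. A2 l m * R m j)" by (rule sum_V_split[OF SV])
    finally have 1: "R l j = (\<Sum>m\<in>S. A2 l m * R m j) + (\<Sum>m\<in>V - S. A2 l m * R m j)" .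
    have "(\<Sum>m\<in>S. U l m * R m j) = (\<Sum>m\<in>S. A2 l m * R m j + (\<Sum>n\<in>V - S. A2 l n * (U n m * R m j)))"
    proof (rule sum.cong[OF refl])
      fix m assume "m \<in> S"
      then have "U l m = A2 l m + (\<Sum>n\<in>V - S. A2 l n * U n m)"
        using U l unfolding block_solution_def by blast
      then have "U l m * R m j = (A2 l m + (\<Sum>n\<in>V - S. A2 l n * U n m)) * R m j" by (rule arg_cong)
      then show "U l m * R m j = A2 l m * R m j + (\<Sum>n\<in>V - S. A2 l n * (U n m * R m j))"
        by (simp only: distrib_right sum_distrib_right mult.assoc)
    qed
    also have "\<dots> = (\<Sum>m\<in>S. A2 l m * R m j) + (\<Sum>n\<in>V - S. A2 l n * (\<Sum>m\<in>S. U n m * R m j))"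
      unfolding sum.distrib sum_distrib_left by (subst sum.swap) simp
    finally have "Z l = (\<Sum>m\<in>V - S. A2 l m * (R m j - (\<Sum>n\<in>S. U m n * R n j)))"
      using 1 l by (simp add: Z_def algebra_simps sum_subtractf)
    also have "\<dots> = (\<Sum>m\<in>V - S. A2 l m * Z m)" by (intro sum.cong) (auto simp: Z_def)
    also have "\<dots> = (\<Sum>m\<in>V. A2 l m * Z m)" unfolding sum_V_split[OF SV] by (simp add: Z_def)
    finally show ?thesis .
  qed
  have "Z l \<le> 0" if "l \<in> V" for l
  proof (rule A2_max_principle[of "V - S" 0 Z])
    show "Z i \<le> (\<Sum>l\<in>V. A2 i l * Z l)" if "i \<in> V - S" for i by (rule eq_refl[OF Z[OF that]])
  qed (use that in \<open>auto simp: Z_def\<close>)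
  moreover have "- Z l \<le> 0" if "l \<in> V" for l
  proof (rule A2_max_principle[of "V - S" 0 "\<lambda>l. - Z l"])
    show "- Z i \<le> (\<Sum>l\<in>V. A2 i l * - Z l)" if "i \<in> V - S" for i
      by (subst Z[OF that]) (simp add: sum_negf)
  qed (use that in \<open>auto simp: Z_def\<close>)
  ultimately have "Z l = 0" if "l \<in> V" for l using that by force
  then have Z0: "(\<Sum>m\<in>S. U l m * R m j) = R l j" if "l \<in> V - S" for l using that by (force simp: Z_def)
  have "(\<Sum>m\<in>S. granger_coeff S U i m * R m j) = (\<Sum>m\<in>S. a i m * R m j + (\<Sum>l\<in>V - S. a i l * (U l m * R m j)))"
    unfolding granger_coeff_def by (simp add: algebra_simps sum_distrib_left)
  also have "\<dots> = (\<Sum>m\<in>S. a i m * R m j) + (\<Sum>l\<in>V - S. a i l * (\<Sum>m\<in>S. U l m * R m j))"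
    unfolding sum.distrib sum_distrib_left by (subst sum.swap) simp
  also have "\<dots> = (\<Sum>m\<in>S. a i m * R m j) + (\<Sum>l\<in>V - S. a i l * R l j)" using Z0 by simp
  also have "\<dots> = (\<Sum>l\<in>V. a i l * R l j)" by (rule sum_V_split[OF SV, symmetric])
  finally show ?thesis .
qed

text \<open>The inverse of the observed covariance block is bounded by 2 / c in the maximum norm,
  whatever the size of S. The vector Z = v R, taken over all nodes, is harmonic for
  \<open>A2\<close> off S, hence bounded by \<zeta> everywhere; on S the stationarity equation
  expresses c v as Z - \<open>A2\<close> Z.\<close>

lemma cov_lower_bound:
  assumes SV: "S \<subseteq> V" and R: "stationary_cov c R" and c: "0 < c"
    and z: "\<And>j. j \<in> S \<Longrightarrow> \<bar>\<Sum>m\<in>S. v m * R m j\<bar> \<le> \<zeta>" and j: "j \<in> S"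
  shows "\<bar>v j\<bar> \<le> 2 * \<zeta> / c"
proof -
  define Z where "Z j = (\<Sum>m\<in>S. v m * R m j)" for j
  have finS: "finite S" using SV finV finite_subset by blast
  have \<zeta>: "0 \<le> \<zeta>" using z[OF j] by linarith
  have Z: "Z j = (if j \<in> S then c * v j else 0) + (\<Sum>l\<in>V. A2 j l * Z l)" if j: "j \<in> V" for j
  proof -
    have "Z j = (\<Sum>m\<in>S. c * (v m * of_bool (m = j)) + (\<Sum>l\<in>V. v m * R m l * A2 l j))"
      unfolding Z_def
    proof (rule sum.cong[OF refl])
      fix m assume "m \<in> S"
      then have "R m j = c * of_bool (m = j) + (\<Sum>l\<in>V. R m l * A2 l j)"
        using R j SV unfolding stationary_cov_def by blast
      then have "v m * R m j = v m * (c * of_bool (m = j) + (\<Sum>l\<in>V. R m l * A2 l j))" by (rule arg_cong)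
      also have "\<dots> = c * (v m * of_bool (m = j)) + (\<Sum>l\<in>V. v m * R m l * A2 l j)"
        by (simp only: distrib_left sum_distrib_left mult.assoc mult.left_commute[of "v m" c])
      finally show "v m * R m j = c * (v m * of_bool (m = j)) + (\<Sum>l\<in>V. v m * R m l * A2 l j)" .
    qed
    also have "\<dots> = (\<Sum>m\<in>S. c * (v m * of_bool (m = j))) + (\<Sum>l\<in>V. Z l * A2 l j)"
      unfolding sum.distrib Z_def sum_distrib_right by (subst sum.swap) simp
    also have "(\<Sum>l\<in>V. Z l * A2 l j) = (\<Sum>l\<in>V. A2 j l * Z l)"
      using A2_sym j by (intro sum.cong) auto
    also have "(\<Sum>m\<in>S. c * (v m * of_bool (m = j))) = (if j \<in> S then c * v j else 0)"
      using finS by (auto simp: sum_of_bool_mult(2) intro!: sum.neutral simp flip: sum_distrib_left)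
    finally show ?thesis .
  qed
  have bnd: "\<bar>Z l\<bar> \<le> \<zeta>" if "l \<in> V" for l
  proof (rule A2_max_principle[of "V - S" \<zeta> "\<lambda>l. \<bar>Z l\<bar>"])
    fix i assume i: "i \<in> V - S"
    then have "\<bar>Z i\<bar> = \<bar>\<Sum>l\<in>V. A2 i l * Z l\<bar>" using Z[of i] by simp
    also have "\<dots> \<le> (\<Sum>l\<in>V. A2 i l * \<bar>Z l\<bar>)"
      using A2_nonneg i by (intro order_trans[OF sum_abs] sum_mono) (auto simp: abs_mult)
    finally show "\<bar>Z i\<bar> \<le> (\<Sum>l\<in>V. A2 i l * \<bar>Z l\<bar>)" .
  qed (use \<zeta> z that in \<open>auto simp: Z_def\<close>)
  have jV: "j \<in> V" using j SV by auto
  have "\<bar>\<Sum>l\<in>V. A2 j l * Z l\<bar> \<le> \<rho>\<^sup>2 * \<zeta>" using bnd \<zeta> by (intro A2_abs_le jV) auto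
  also have "\<dots> \<le> 1 * \<zeta>" using rho_sq \<zeta> by (intro mult_right_mono) auto
  finally have "\<bar>c * v j\<bar> \<le> 2 * \<zeta>" using Z[OF jV] bnd[OF jV] j by simp
  then show ?thesis using c by (simp add: abs_mult field_simps)
qed

text \<open>The solution is explicit: continue z harmonically to the latent nodes as h and put v =
  (h - \<open>A2\<close> h) / c. Harmonicity makes v vanish off S.\<close>

lemma cov_solvable:
  assumes SV: "S \<subseteq> V" and R: "stationary_cov c R" and c: "0 < c"
  shows "\<exists>v. \<forall>j\<in>S. (\<Sum>m\<in>S. v m * R m j) = z j"
proof -
  have "\<exists>f. \<forall>i\<in>V - S. f i = (\<Sum>l\<in>S. A2 i l * z l) + (\<Sum>l\<in>V - S. A2 i l * f l)"
    using finV A2_abs_row rho_sq(2) by (intro linear_system_solvable[of _ "\<rho>\<^sup>2"]) auto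
  then obtain f where f: "\<And>i. i \<in> V - S \<Longrightarrow> f i = (\<Sum>l\<in>S. A2 i l * z l) + (\<Sum>l\<in>V - S. A2 i l * f l)"
    by blast
  define h where "h i = (if i \<in> S then z i else f i)" for i
  define v where "v i = (h i - (\<Sum>l\<in>V. A2 i l * h l)) / c" for i
  have v0: "v i = 0" if i: "i \<in> V - S" for i
  proof -
    have "(\<Sum>l\<in>V. A2 i l * h l) = (\<Sum>l\<in>S. A2 i l * h l) + (\<Sum>l\<in>V - S. A2 i l * h l)" by (rule sum_V_split[OF SV])
    also have "(\<Sum>l\<in>S. A2 i l * h l) = (\<Sum>l\<in>S. A2 i l * z l)" by (simp add: h_def)
    also have "(\<Sum>l\<in>V - S. A2 i l * h l) = (\<Sum>l\<in>V - S. A2 i l * f l)" by (intro sum.cong) (auto simp: h_def)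
    finally show ?thesis using f[OF i] i by (simp add: v_def h_def)
  qed
  have "(\<Sum>m\<in>S. v m * R m j) = z j" if j: "j \<in> S" for j
  proof -
    have jV: "j \<in> V" using j SV by auto
    have R': "R l j - (\<Sum>m\<in>V. A2 l m * R m j) = c * of_bool (l = j)" if "l \<in> V" for l
    proof -
      have "R l j = c * of_bool (l = j) + (\<Sum>m\<in>V. A2 l m * R m j)"
        using R that jV unfolding stationary_cov_def by blast
      then show ?thesis by linarith
    qed
    have "(\<Sum>m\<in>S. v m * R m j) = (\<Sum>m\<in>V. v m * R m j)" unfolding sum_V_split[OF SV] using v0 by simp
    also have "\<dots> = (\<Sum>m\<in>V. (h m * R m j - (\<Sum>l\<in>V. A2 m l * h l * R m j)) / c)"
      by (simp add: v_def left_diff_distrib sum_distrib_right)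
    also have "\<dots> = ((\<Sum>m\<in>V. h m * R m j) - (\<Sum>m\<in>V. \<Sum>l\<in>V. A2 m l * h l * R m j)) / c"
      by (simp add: sum_subtractf flip: sum_divide_distrib)
    also have "(\<Sum>m\<in>V. \<Sum>l\<in>V. A2 m l * h l * R m j) = (\<Sum>l\<in>V. h l * (\<Sum>m\<in>V. A2 l m * R m j))"
      unfolding sum_distrib_left by (subst sum.swap) (intro sum.cong refl, subst A2_sym, simp_all only: mult_ac)
    also have "(\<Sum>m\<in>V. h m * R m j) - \<dots> = (\<Sum>l\<in>V. h l * (R l j - (\<Sum>m\<in>V. A2 l m * R m j)))"
      by (simp only: sum_subtractf right_diff_distrib)
    also have "\<dots> = (\<Sum>l\<in>V. c * (h l * of_bool (l = j)))"
      by (intro sum.cong refl) (simp only: R' mult.left_commute)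
    also have "\<dots> = c * h j" using finV jV by (simp add: sum_of_bool_mult flip: sum_distrib_left)
    finally show ?thesis using c j by (simp add: h_def)
  qed
  then show ?thesis by blast
qed

end

section \<open>Stationary covariances from the two resolvents\<close>

locale resolvent_pair = substochastic +
  fixes c :: real and F1 F2 :: rmatrix
  assumes c: "0 < c"
    and F1: "resolvent V a 1 F1" and F2: "resolvent V a (-1) F2"
begin

text \<open>Partial fractions: these are \<open>c (I - a\<^sup>2)\<inverse>\<close> and \<open>c a (I - a\<^sup>2)\<inverse>\<close>, the stationary
  covariances at lags 0 and 1.\<close>

definition "R0 i j = c / 2 * (F1 i j + F2 i j)"
definition "R1 i j = c / 2 * (F1 i j - F2 i j)"

lemma F_eq:
  assumes "i \<in> V" "j \<in> V"
  shows "F1 i j = of_bool (i = j) + (\<Sum>l\<in>V. a i l * F1 l j)"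
    and "F2 i j = of_bool (i = j) - (\<Sum>l\<in>V. a i l * F2 l j)"
proof -
  show "F1 i j = of_bool (i = j) + (\<Sum>l\<in>V. a i l * F1 l j)"
    using F1 assms unfolding resolvent_def mult_1 by blast
  have "F2 i j = of_bool (i = j) + (-1) * (\<Sum>l\<in>V. a i l * F2 l j)"
    using F2 assms unfolding resolvent_def by blast
  then show "F2 i j = of_bool (i = j) - (\<Sum>l\<in>V. a i l * F2 l j)" by simp
qed

lemma sum_scaled_pair:
  "(\<Sum>l\<in>V. f l * (c / 2 * (u l + v l))) = c / 2 * ((\<Sum>l\<in>V. f l * u l) + (\<Sum>l\<in>V. f l * v l))"
  "(\<Sum>l\<in>V. f l * (c / 2 * (u l - v l))) = c / 2 * ((\<Sum>l\<in>V. f l * u l) - (\<Sum>l\<in>V. f l * v l))"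
  "(\<Sum>l\<in>V. c / 2 * (u l + v l) * f l) = c / 2 * ((\<Sum>l\<in>V. u l * f l) + (\<Sum>l\<in>V. v l * f l))"
  "(\<Sum>l\<in>V. c / 2 * (u l - v l) * f l) = c / 2 * ((\<Sum>l\<in>V. u l * f l) - (\<Sum>l\<in>V. v l * f l))"
  for f u v :: "nat \<Rightarrow> real"
  by (simp_all add: algebra_simps sum.distrib sum_subtractf sum_distrib_left sum_divide_distrib add_divide_distrib diff_divide_distrib)

lemma R1_left:
  assumes "i \<in> V" "j \<in> V" shows "R1 i j = (\<Sum>l\<in>V. a i l * R0 l j)"
proof -
  have "F1 i j - F2 i j = (\<Sum>l\<in>V. a i l * F1 l j) + (\<Sum>l\<in>V. a i l * F2 l j)"
    using F_eq[OF assms] by linarith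
  then show ?thesis unfolding R0_def R1_def sum_scaled_pair by simp
qed

lemma R0_left:
  assumes "i \<in> V" "j \<in> V" shows "R0 i j = c * of_bool (i = j) + (\<Sum>l\<in>V. a i l * R1 l j)"
proof -
  have "F1 i j + F2 i j = 2 * of_bool (i = j) + ((\<Sum>l\<in>V. a i l * F1 l j) - (\<Sum>l\<in>V. a i l * F2 l j))"
    using F_eq[OF assms] by linarith
  then have "c / 2 * (F1 i j + F2 i j)
      = c / 2 * (2 * of_bool (i = j) + ((\<Sum>l\<in>V. a i l * F1 l j) - (\<Sum>l\<in>V. a i l * F2 l j)))"
    by (rule arg_cong)
  then show ?thesis unfolding R0_def R1_def sum_scaled_pair distrib_left[of "c / 2"] by simp
qed

lemma F_commute:
  assumes "i \<in> V" "j \<in> V"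
  shows "(\<Sum>l\<in>V. F1 i l * a l j) = (\<Sum>l\<in>V. a i l * F1 l j)"
    "(\<Sum>l\<in>V. F2 i l * a l j) = (\<Sum>l\<in>V. a i l * F2 l j)"
  using resolvent_commute[OF F1 _ assms] resolvent_commute[OF F2 _ assms] by auto

lemma R1_right:
  assumes "i \<in> V" "j \<in> V" shows "R1 i j = (\<Sum>l\<in>V. R0 i l * a l j)"
  unfolding R1_left[OF assms] R0_def sum_scaled_pair F_commute[OF assms] ..

lemma R0_right:
  assumes "i \<in> V" "j \<in> V" shows "R0 i j = c * of_bool (i = j) + (\<Sum>l\<in>V. R1 i l * a l j)"
  unfolding R0_left[OF assms] R1_def sum_scaled_pair F_commute[OF assms] ..

lemma stationary_cov_R0: "stationary_cov c R0"
  unfolding stationary_cov_def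
proof (intro ballI conjI)
  fix i j assume ij: "i \<in> V" "j \<in> V"
  have "(\<Sum>l\<in>V. A2 i l * R0 l j) = (\<Sum>l\<in>V. a i l * R1 l j)"
    unfolding A2_apply using R1_left ij(2) by (intro sum.cong) auto
  then show "R0 i j = c * of_bool (i = j) + (\<Sum>l\<in>V. A2 i l * R0 l j)" using R0_left[OF ij] by simp
  have "(\<Sum>l\<in>V. R0 i l * A2 l j) = (\<Sum>l\<in>V. \<Sum>k\<in>V. R0 i l * a l k * a k j)"
    unfolding sq_mat_def by (simp add: sum_distrib_left mult.assoc)
  also have "\<dots> = (\<Sum>k\<in>V. (\<Sum>l\<in>V. R0 i l * a l k) * a k j)"
    by (subst sum.swap) (simp add: sum_distrib_right)
  also have "\<dots> = (\<Sum>k\<in>V. R1 i k * a k j)" using R1_right ij(1) by (intro sum.cong) auto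
  finally show "R0 i j = c * of_bool (i = j) + (\<Sum>l\<in>V. R0 i l * A2 l j)" using R0_right[OF ij] by simp
qed

lemma R0_bound:
  assumes "i \<in> V" "j \<in> V" shows "\<bar>R0 i j\<bar> \<le> c / (1 - \<rho>)"
proof -
  have "\<bar>F1 i j\<bar> \<le> 1 / (1 - \<rho>)" "\<bar>F2 i j\<bar> \<le> 1 / (1 - \<rho>)"
    using resolvent_bound[OF F1 _ assms] resolvent_bound[OF F2 _ assms] by auto
  then have "\<bar>F1 i j + F2 i j\<bar> \<le> 2 * (1 / (1 - \<rho>))" by linarith
  then have "c / 2 * \<bar>F1 i j + F2 i j\<bar> \<le> c / 2 * (2 * (1 / (1 - \<rho>)))" using c by (intro mult_left_mono) auto
  then show ?thesis unfolding R0_def abs_mult using c by simp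
qed

end

section \<open>Two-level form of the covariances and of the Granger coefficients\<close>

context regular_network
begin

lemma q_bounds: "0 \<le> q" "q \<le> \<rho>" "(1 - q)\<^sup>2 \<le> 1" "(1 + q)\<^sup>2 \<le> 4" "0 < (1 - q)\<^sup>2" "0 < (1 + q)\<^sup>2"
proof -
  show q: "0 \<le> q" "q \<le> \<rho>" using kappa rho by auto
  show "(1 - q)\<^sup>2 \<le> 1" using power_mono[of "1 - q" 1 2] q rho by simp
  show "(1 + q)\<^sup>2 \<le> 4" using power_mono[of "1 + q" 2 2] q rho by simp
  show "0 < (1 - q)\<^sup>2" "0 < (1 + q)\<^sup>2" using q rho by simp_all
qed

text \<open>The two resolvents have slopes of opposite sign. Hence the lag-one matrix, a multiple of
  F1 - F2, and the residual matrix -c F2 both have a positive slope bounded away from 0.\<close>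

lemma slopes: "\<kappa> \<le> res_slope 1" "res_slope (-1) \<le> - (\<kappa> / 4)"
proof -
  have "\<kappa> / 1 \<le> \<kappa> / (1 - q)\<^sup>2" using kappa q_bounds by (intro divide_left_mono) auto
  then show "\<kappa> \<le> res_slope 1" by (simp add: res_slope_def)
  have "\<kappa> / 4 \<le> \<kappa> / (1 + q)\<^sup>2" using kappa q_bounds by (intro divide_left_mono) auto
  moreover have "res_slope (-1) = - (\<kappa> / (1 + q)\<^sup>2)"
    unfolding res_slope_def by (simp add: algebra_simps)
  ultimately show "res_slope (-1) \<le> - (\<kappa> / 4)" by linarith
qed

lemma covariance_two_levels:
  assumes RP: "resolvent_pair V a \<rho> c F1 F2"
  shows "\<exists>b e. c * \<kappa> / 4 \<le> b \<and> (\<forall>i\<in>V. \<forall>j\<in>V. i \<noteq> j \<longrightarrow>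
      \<bar>d * resolvent_pair.R1 c F1 F2 i j - (b * of_bool (g i j) + e)\<bar> \<le> 44 * c * k ^ 5 * \<eta>)"
    and "\<exists>b e. c * \<kappa> / 4 \<le> b \<and> (\<forall>i\<in>V. \<forall>j\<in>V. i \<noteq> j \<longrightarrow>
      \<bar>d * (resolvent_pair.R1 c F1 F2 i j - resolvent_pair.R0 c F1 F2 i j) - (b * of_bool (g i j) + e)\<bar> \<le> 44 * c * k ^ 5 * \<eta>)"
proof -
  interpret resolvent_pair V a \<rho> c F1 F2 by (rule RP)
  have F: "\<bar>d * F1 i j - (res_slope 1 * of_bool (g i j) + res_offset 1)\<bar> \<le> 44 * k ^ 5 * \<eta>"
    "\<bar>d * F2 i j - (res_slope (-1) * of_bool (g i j) + res_offset (-1))\<bar> \<le> 44 * k ^ 5 * \<eta>"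
    if "i \<in> V" "j \<in> V" "i \<noteq> j" for i j
    using resolvent_asymptotics[OF F1 _ that] resolvent_asymptotics[OF F2 _ that] by auto
  let ?b = "c / 2 * (res_slope 1 - res_slope (-1))" and ?e = "c / 2 * (res_offset 1 - res_offset (-1))"
  have "\<bar>d * R1 i j - (?b * of_bool (g i j) + ?e)\<bar> \<le> 44 * c * k ^ 5 * \<eta>"
    if "i \<in> V" "j \<in> V" "i \<noteq> j" for i j
  proof -
    let ?x = "(d * F1 i j - (res_slope 1 * of_bool (g i j) + res_offset 1))
      - (d * F2 i j - (res_slope (-1) * of_bool (g i j) + res_offset (-1)))"
    have "d * R1 i j - (?b * of_bool (g i j) + ?e) = c / 2 * ?x"
      unfolding R1_def by (simp add: field_simps)
    moreover have "c / 2 * \<bar>?x\<bar> \<le> c / 2 * (2 * (44 * k ^ 5 * \<eta>))"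
      using F[OF that] c by (intro mult_left_mono) linarith+
    ultimately have "\<bar>d * R1 i j - (?b * of_bool (g i j) + ?e)\<bar> \<le> c / 2 * (2 * (44 * k ^ 5 * \<eta>))"
      using c by (simp only: abs_mult abs_divide abs_minus_cancel abs_of_pos abs_numeral)
    moreover have "c / 2 * (2 * (44 * k ^ 5 * \<eta>)) = 44 * c * k ^ 5 * \<eta>" by simp
    ultimately show ?thesis by (simp only:)
  qed
  moreover have "c * \<kappa> / 4 \<le> ?b"
  proof -
    have "c / 2 * (\<kappa> / 2) \<le> ?b" using slopes kappa c by (intro mult_left_mono) auto
    then show ?thesis by simp
  qed
  ultimately show "\<exists>b e. c * \<kappa> / 4 \<le> b \<and> (\<forall>i\<in>V. \<forall>j\<in>V. i \<noteq> j \<longrightarrow>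
      \<bar>d * R1 i j - (b * of_bool (g i j) + e)\<bar> \<le> 44 * c * k ^ 5 * \<eta>)" by blast
  let ?b = "- c * res_slope (-1)" and ?e = "- c * res_offset (-1)"
  have "\<bar>d * (R1 i j - R0 i j) - (?b * of_bool (g i j) + ?e)\<bar> \<le> 44 * c * k ^ 5 * \<eta>"
    if "i \<in> V" "j \<in> V" "i \<noteq> j" for i j
  proof -
    let ?x = "d * F2 i j - (res_slope (-1) * of_bool (g i j) + res_offset (-1))"
    have "R1 i j - R0 i j = - c * F2 i j"
      unfolding R1_def R0_def by (simp add: field_simps)
    then have "d * (R1 i j - R0 i j) = d * (- c * F2 i j)" by (rule arg_cong)
    then have "d * (R1 i j - R0 i j) - (?b * of_bool (g i j) + ?e) = d * (- c * F2 i j) - (?b * of_bool (g i j) + ?e)"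
      by (rule arg_cong)
    also have "\<dots> = - c * ?x" by (simp add: algebra_simps)
    finally have "d * (R1 i j - R0 i j) - (?b * of_bool (g i j) + ?e) = - c * ?x" .
    moreover have "c * \<bar>?x\<bar> \<le> c * (44 * k ^ 5 * \<eta>)"
      using F(2)[OF that] c by (intro mult_left_mono) linarith+
    ultimately have "\<bar>d * (R1 i j - R0 i j) - (?b * of_bool (g i j) + ?e)\<bar> \<le> c * (44 * k ^ 5 * \<eta>)"
      using c by (simp only: abs_mult abs_divide abs_minus_cancel abs_of_pos abs_numeral)
    moreover have "c * (44 * k ^ 5 * \<eta>) = 44 * c * k ^ 5 * \<eta>" by simp
    ultimately show ?thesis by (simp only:)
  qed
  moreover have "c * \<kappa> / 4 \<le> ?b"
  proof -
    have "c * (\<kappa> / 4) \<le> c * (- res_slope (-1))" using slopes c by (intro mult_left_mono) auto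
    then show ?thesis by simp
  qed
  ultimately show "\<exists>b e. c * \<kappa> / 4 \<le> b \<and> (\<forall>i\<in>V. \<forall>j\<in>V. i \<noteq> j \<longrightarrow>
      \<bar>d * (R1 i j - R0 i j) - (b * of_bool (g i j) + e)\<bar> \<le> 44 * c * k ^ 5 * \<eta>)" by blast
qed

text \<open>The same ansatz for the latent block equation \<open>U = A2 + A2 U\<close> of \<open>block_solution\<close>.\<close>

definition "bl_slope = 2 * q * \<kappa> / (1 - q\<^sup>2)"
definition "bl_offset = (\<kappa>\<^sup>2 * p + (2 * q + \<kappa>) * \<kappa> * ratio (V - S) * p * bl_slope)
  / (1 - q\<^sup>2 - \<kappa> * (2 * q + \<kappa>) * ratio (V - S))"
definition "bl_mean = \<kappa> * ratio (V - S) * (p * bl_slope + bl_offset)"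

lemma bl_coeffs:
  shows "bl_slope = 2 * q * \<kappa> + q\<^sup>2 * bl_slope"
    and "bl_offset = \<kappa>\<^sup>2 * p + q\<^sup>2 * bl_offset + (2 * q + \<kappa>) * bl_mean"
    and "\<bar>bl_slope\<bar> + \<bar>bl_offset\<bar> \<le> 7 * k ^ 2" "\<bar>bl_mean\<bar> \<le> \<bar>bl_slope\<bar> + \<bar>bl_offset\<bar>"
proof -
  let ?t = "ratio (V - S)"
  have t: "0 \<le> ?t" "?t \<le> 1" using frac_bound[of "V - S"] by auto
  have qr: "q\<^sup>2 \<le> \<rho>\<^sup>2" using power_mono[of q \<rho> 2] q_bounds by simp
  have r: "\<rho>\<^sup>2 \<le> \<rho>" using rho by (simp add: power2_eq_square mult_left_le)
  have 1: "1 - \<rho> \<le> 1 - q\<^sup>2" using qr r by linarith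
  \<comment> \<open>Since q + \<kappa> = \<rho> and the latent fraction is at most 1, the
    denominator of \<open>bl_offset\<close> is at least 1 - \<rho>^2, uniformly in the
    fraction.\<close>
  have "q\<^sup>2 + \<kappa> * (2 * q + \<kappa>) = \<rho>\<^sup>2" by (simp add: power2_eq_square algebra_simps)
  moreover have "\<kappa> * (2 * q + \<kappa>) * ?t \<le> \<kappa> * (2 * q + \<kappa>) * 1"
    using t kappa q_bounds by (intro mult_left_mono) auto
  ultimately have 2: "1 - \<rho> \<le> 1 - q\<^sup>2 - \<kappa> * (2 * q + \<kappa>) * ?t" using r by linarith
  have nz: "1 - q\<^sup>2 \<noteq> 0" "1 - q\<^sup>2 - \<kappa> * (2 * q + \<kappa>) * ?t \<noteq> 0" using 1 2 rho by linarith+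
  have "bl_slope * (1 - q\<^sup>2) = 2 * q * \<kappa>" using nz by (simp add: bl_slope_def)
  then show "bl_slope = 2 * q * \<kappa> + q\<^sup>2 * bl_slope" by (simp add: algebra_simps)
  have "bl_offset * (1 - q\<^sup>2 - \<kappa> * (2 * q + \<kappa>) * ?t)
      = \<kappa>\<^sup>2 * p + (2 * q + \<kappa>) * \<kappa> * ?t * p * bl_slope" using nz by (simp add: bl_offset_def)
  moreover have "x = e + y * x + u * (\<kappa> * r * (s + x))"
    if "x * (1 - y - \<kappa> * u * r) = e + u * \<kappa> * r * s" for x y u r s e :: real
    using that by (simp add: algebra_simps)
  ultimately show "bl_offset = \<kappa>\<^sup>2 * p + q\<^sup>2 * bl_offset + (2 * q + \<kappa>) * bl_mean"
    unfolding bl_mean_def by (metis mult.assoc)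
  have s: "0 \<le> bl_slope" "bl_slope \<le> 2 * k"
  proof -
    show "0 \<le> bl_slope" unfolding bl_slope_def using q_bounds kappa 1 rho by (intro divide_nonneg_nonneg) auto
    have "q * \<kappa> \<le> 1" using kappa rho q_bounds by (intro mult_le_one) auto
    then have "2 * q * \<kappa> \<le> 2 * 1" by (simp only: mult.assoc)
    then have "bl_slope \<le> 2 / (1 - \<rho>)" unfolding bl_slope_def using 1 rho kappa q_bounds by (intro frac_le) auto
    then show "bl_slope \<le> 2 * k" by simp
  qed
  have o: "0 \<le> bl_offset" "bl_offset \<le> (1 + 4 * k) * k"
  proof -
    have u: "0 \<le> (2 * q + \<kappa>) * (\<kappa> * ?t * p)" "(2 * q + \<kappa>) * (\<kappa> * ?t * p) \<le> 2 * 1"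
    proof -
      have "\<kappa> * ?t * p \<le> 1" "0 \<le> \<kappa> * ?t * p" by (intro mult_le_one mult_nonneg_nonneg; use kappa rho t p in force)+
      moreover have "2 * q + \<kappa> \<le> 2" "0 \<le> 2 * q + \<kappa>" using kappa rho by auto
      ultimately have "0 \<le> (2 * q + \<kappa>) * (\<kappa> * ?t * p)" "(2 * q + \<kappa>) * (\<kappa> * ?t * p) \<le> 2 * 1"
        by - (rule mult_nonneg_nonneg, assumption+, rule mult_mono, auto)
      then show "0 \<le> (2 * q + \<kappa>) * (\<kappa> * ?t * p)" "(2 * q + \<kappa>) * (\<kappa> * ?t * p) \<le> 2 * 1" by -
    qed
    have v: "0 \<le> \<kappa>\<^sup>2 * p" "\<kappa>\<^sup>2 * p \<le> 1"
      using kappa rho p by (auto intro!: mult_le_one power_le_one)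
    have "(2 * q + \<kappa>) * (\<kappa> * ?t * p) * bl_slope \<le> 2 * 1 * (2 * k)"
      by (rule mult_mono[OF u(2) s(2)]) (use s in auto)
    then have le: "\<kappa>\<^sup>2 * p + (2 * q + \<kappa>) * \<kappa> * ?t * p * bl_slope \<le> 1 + 4 * k"
      using v by (simp add: mult.assoc)
    have ge: "0 \<le> \<kappa>\<^sup>2 * p + (2 * q + \<kappa>) * \<kappa> * ?t * p * bl_slope"
      using v mult_nonneg_nonneg[OF u(1) s(1)] by (simp add: mult.assoc)
    show "0 \<le> bl_offset" unfolding bl_offset_def using ge 2 rho by (intro divide_nonneg_nonneg) linarith+
    have "bl_offset \<le> (1 + 4 * k) / (1 - \<rho>)"
      unfolding bl_offset_def by (rule frac_le) (use ge le 2 rho in linarith)+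
    then show "bl_offset \<le> (1 + 4 * k) * k" by simp
  qed
  have "k \<le> k ^ 2" using power_increasing[of 1 2 k] k_ge by simp
  show "\<bar>bl_slope\<bar> + \<bar>bl_offset\<bar> \<le> 7 * k ^ 2"
  proof -
    have "(1 + 4 * k) * k = k + 4 * k ^ 2" by (simp only: distrib_right power2_eq_square mult_1 mult.assoc)
    then show ?thesis using s o \<open>k \<le> k ^ 2\<close> by linarith
  qed
  have "bl_mean = (\<kappa> * ?t) * (p * bl_slope + bl_offset)" by (simp add: bl_mean_def)
  also have "\<bar>\<dots>\<bar> \<le> 1 * (1 * bl_slope + bl_offset)"
  proof -
    have "\<kappa> * ?t \<le> 1" "0 \<le> \<kappa> * ?t" by (intro mult_le_one mult_nonneg_nonneg; use kappa rho t in force)+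
    then have 1: "\<bar>\<kappa> * ?t\<bar> \<le> 1" by (simp only: abs_of_nonneg)
    have "p * bl_slope \<le> 1 * bl_slope" "0 \<le> p * bl_slope" using mult_right_mono[OF p(2) s(1)] mult_nonneg_nonneg[OF p(1) s(1)] by simp_all
    then have 2: "\<bar>p * bl_slope + bl_offset\<bar> \<le> 1 * bl_slope + bl_offset" using o by linarith
    show ?thesis unfolding abs_mult[of "\<kappa> * ?t"] by (rule mult_mono[OF 1 2]) auto
  qed
  finally show "\<bar>bl_mean\<bar> \<le> \<bar>bl_slope\<bar> + \<bar>bl_offset\<bar>" using s o by simp
qed

text \<open>Two-step paths from i to j use the self-weight q at one of the two ends, which gives 2 q
  \<kappa> on an edge, or a third node, which gives \<kappa>^2 p on average. The constant 20 is 7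
  for each end and 6 for the third node.\<close>

lemma A2_asymptotics:
  assumes ij: "i \<in> V" "j \<in> V" "i \<noteq> j"
  shows "\<bar>d * A2 i j - (2 * q * \<kappa> * of_bool (g i j) + \<kappa>\<^sup>2 * p)\<bar> \<le> 20 * \<eta>"
proof -
  let ?b = "of_bool (g i j) :: real" and ?x = "d * a i j"
  let ?M = "\<Sum>l\<in>V - {i, j}. a i l * (d * a l j)"
  have dv: "\<bar>?x - \<kappa> * ?b\<bar> \<le> \<eta>" using dev[OF ij] eta by (cases "g i j") auto
  have x: "\<bar>?x\<bar> \<le> 2" using entry_le(1)[OF ij] nonneg[OF ij(1,2)] d by simp
  have "A2 i j = a i i * a i j + a i j * a j j + (\<Sum>l\<in>V - {i, j}. a i l * a l j)"
    unfolding sq_mat_def by (rule sum_split2[OF finV ij])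
  then have "d * A2 i j = d * (a i i * a i j + a i j * a j j + (\<Sum>l\<in>V - {i, j}. a i l * a l j))" by simp
  also have "\<dots> = a i i * ?x + a j j * ?x + ?M"
    by (simp add: algebra_simps sum_distrib_left)
  finally have eq: "d * A2 i j = a i i * ?x + a j j * ?x + ?M" .
  have diag: "\<bar>a l l * ?x - q * \<kappa> * ?b\<bar> \<le> 7 * \<eta>" if l: "l \<in> V" for l
  proof -
    have "a l l * ?x - q * \<kappa> * ?b = (a l l - q) * ?x + q * (?x - \<kappa> * ?b)" by (simp add: algebra_simps)
    moreover have "\<bar>(a l l - q) * ?x\<bar> \<le> 3 * \<eta> * 2"
      unfolding abs_mult[of "a l l - q"] using diag_entry[OF l] x eta by (intro mult_mono) auto
    moreover have "\<bar>q * (?x - \<kappa> * ?b)\<bar> \<le> 1 * \<eta>"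
      unfolding abs_mult[of q] using dv kappa rho by (intro mult_mono) auto
    ultimately show ?thesis by linarith
  qed
  have cV: "real (card V) \<noteq> 0" using finV ij by auto
  have eqn: "\<kappa> * ratio V * (p * \<kappa>) = \<kappa>\<^sup>2 * p" using cV by (simp add: power2_eq_square)
  have "\<bar>?M - \<kappa> * ratio V * (p * \<kappa> + 0)\<bar> \<le> \<rho> * \<eta> + 5 * \<eta> * (\<bar>\<kappa>\<bar> + \<bar>0\<bar>)"
  proof (rule mixing[OF _ ij])
    fix l assume "l \<in> V - {i, j}"
    then show "\<bar>d * a l j - (\<kappa> * of_bool (g l j) + 0)\<bar> \<le> \<eta>"
      using dev[of l j] ij eta by (cases "g l j") auto
  qed (use eta in auto)
  then have "\<bar>?M - \<kappa>\<^sup>2 * p\<bar> \<le> \<rho> * \<eta> + 5 * \<eta> * \<bar>\<kappa>\<bar>" unfolding eqn abs_zero add_0_right .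
  moreover have "\<rho> * \<eta> \<le> 1 * \<eta>" using rho eta by (intro mult_right_mono) auto
  moreover have "5 * \<eta> * \<bar>\<kappa>\<bar> \<le> 5 * \<eta> * 1" using kappa rho eta by (intro mult_left_mono) auto
  ultimately have "\<bar>?M - \<kappa>\<^sup>2 * p\<bar> \<le> 6 * \<eta>" by linarith
  moreover have "2 * q * \<kappa> * ?b + \<kappa>\<^sup>2 * p = q * \<kappa> * ?b + q * \<kappa> * ?b + \<kappa>\<^sup>2 * p" by simp
  ultimately show ?thesis using diag[OF ij(1)] diag[OF ij(2)] eq by linarith
qed

text \<open>Applying \<open>A2\<close> on the latent block through two factors \<open>a\<close> keeps the entrywise
  errors summable in the sparse regime, where those of \<open>A2\<close> itself are not.\<close>

lemma A2_block_mixing: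
  assumes l: "l \<in> V - S" and j: "j \<in> S"
  shows "\<bar>(\<Sum>m\<in>V - S. A2 l m * (bl_slope * of_bool (g m j) + bl_offset))
      - (q\<^sup>2 * (bl_slope * of_bool (g l j) + bl_offset) + (2 * q + \<kappa>) * bl_mean)\<bar>
    \<le> 34 * \<eta> * (\<bar>bl_slope\<bar> + \<bar>bl_offset\<bar>)"
proof -
  define B where "B = \<bar>bl_slope\<bar> + \<bar>bl_offset\<bar>"
  define h where "h m = bl_slope * of_bool (g m j) + bl_offset" for m
  define \<phi> where "\<phi> n = (\<Sum>m\<in>V - S. a n m * h m)" for n
  have B0: "0 \<le> B" unfolding B_def by simp
  have eB: "0 \<le> \<eta> * B" using eta B0 by simp
  have h: "\<bar>h m\<bar> \<le> B" for m unfolding h_def B_def by (cases "g m j") auto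
  have c1: "\<bar>bl_mean\<bar> \<le> B" unfolding B_def by (rule bl_coeffs)
  have lj: "l \<in> V" "j \<in> V" "l \<noteq> j" using l j SV by auto
  have hl: "\<bar>h m - (bl_slope * of_bool (g m j) + bl_offset)\<bar> \<le> 0" for m unfolding h_def by simp
  \<comment> \<open>One application of a to the latent part of h: the self-weight keeps q
    \<open>h n\<close> only if n is itself latent, and the remaining terms average to
    \<open>bl_mean\<close>.\<close>
  have phi: "\<bar>\<phi> n - ((if n \<in> V - S then q * h n else 0) + bl_mean)\<bar> \<le> 8 * \<eta> * B"
    if n: "n \<in> V" "n \<noteq> j" for n
  proof -
    have mix: "\<bar>(\<Sum>m\<in>V - S - {n, j}. a n m * h m) - bl_mean\<bar> \<le> 5 * \<eta> * B"
      using mixing[of "V - S" n j h bl_slope bl_offset 0] hl n lj unfolding bl_mean_def B_def by simp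
    show ?thesis
    proof (cases "n \<in> V - S")
      case True
      have "\<phi> n = a n n * h n + (\<Sum>m\<in>V - S - {n}. a n m * h m)"
        unfolding \<phi>_def using True finV by (intro sum.remove) auto
      moreover have "V - S - {n} = V - S - {n, j}" using j by auto
      moreover have "\<bar>a n n * h n - q * h n\<bar> \<le> 3 * \<eta> * B"
        unfolding left_diff_distrib[symmetric] abs_mult
        using diag_entry[OF n(1)] h eta by (intro mult_mono) auto
      ultimately show ?thesis using mix True by simp
    next
      case False
      then have "V - S - {n, j} = V - S" using j by auto
      then show ?thesis using mix eB unfolding \<phi>_def if_not_P[OF False] by simp
    qed
  qed
  have "\<bar>\<phi> j\<bar> \<le> (\<Sum>m\<in>V - S. \<bar>a j m\<bar>) * B" unfolding \<phi>_def by (rule abs_sum_mult_le[OF h])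
  also have "(\<Sum>m\<in>V - S. \<bar>a j m\<bar>) = (\<Sum>m\<in>V - S. a j m)" using nonneg lj by (intro sum.cong) auto
  also have "\<dots> * B \<le> 1 * B" using sub_row_le[of "V - S" j] lj rho B0 by (intro mult_right_mono) auto
  finally have phij: "\<bar>\<phi> j\<bar> \<le> B" by simp
  have t1: "\<bar>a l l * \<phi> l - q * (q * h l + bl_mean)\<bar> \<le> 14 * (\<eta> * B)"
  proof -
    have "a l l * \<phi> l - q * (q * h l + bl_mean) = a l l * (\<phi> l - (q * h l + bl_mean)) + (a l l - q) * (q * h l + bl_mean)"
      by (simp add: algebra_simps)
    moreover have "\<bar>a l l * (\<phi> l - (q * h l + bl_mean))\<bar> \<le> 1 * (8 * \<eta> * B)"
      unfolding abs_mult using phi[of l] l lj diag_bounds[of l] rho by (intro mult_mono) auto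
    moreover have "\<bar>(a l l - q) * (q * h l + bl_mean)\<bar> \<le> (3 * \<eta>) * (2 * B)"
    proof -
      have "\<bar>q * h l\<bar> \<le> 1 * B" unfolding abs_mult using h kappa rho by (intro mult_mono) auto
      then have "\<bar>q * h l + bl_mean\<bar> \<le> 2 * B" using c1 by linarith
      then show ?thesis unfolding abs_mult using diag_entry[OF lj(1)] eta by (intro mult_mono) auto
    qed
    ultimately show ?thesis by linarith
  qed
  have t2: "\<bar>a l j * \<phi> j\<bar> \<le> 2 * (\<eta> * B)"
  proof -
    have "\<bar>a l j * \<phi> j\<bar> \<le> (2 * \<eta>) * B"
      unfolding abs_mult using entry_le(2)[OF lj] nonneg[OF lj(1,2)] phij eta by (intro mult_mono) auto
    then show ?thesis by simp
  qed
  let ?V = "V - {l, j}"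
  let ?e = "\<lambda>n. \<phi> n - ((if n \<in> V - S then q * h n else 0) + bl_mean)"
  have "(\<Sum>n\<in>?V. a l n * \<phi> n) = (\<Sum>n\<in>?V. a l n * ?e n) + (\<Sum>n\<in>?V. a l n * bl_mean)
      + (\<Sum>n\<in>?V. a l n * (if n \<in> V - S then q * h n else 0))"
    unfolding sum.distrib[symmetric] by (intro sum.cong refl) (simp only: distrib_left[symmetric], simp)
  also have "(\<Sum>n\<in>?V. a l n * (if n \<in> V - S then q * h n else 0)) = (\<Sum>n\<in>V - S - {l, j}. q * (a l n * h n))"
    using finV by (intro sum.mono_neutral_cong_right) auto
  also have "\<dots> = q * (\<Sum>n\<in>V - S - {l, j}. a l n * h n)" by (simp add: sum_distrib_left)
  finally have split: "(\<Sum>n\<in>?V. a l n * \<phi> n) = (\<Sum>n\<in>?V. a l n * ?e n) + (\<Sum>n\<in>?V. a l n * bl_mean)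
      + q * (\<Sum>n\<in>V - S - {l, j}. a l n * h n)" .
  have s1: "\<bar>\<Sum>n\<in>?V. a l n * ?e n\<bar> \<le> 8 * (\<eta> * B)"
  proof -
    have "\<bar>\<Sum>n\<in>?V. a l n * ?e n\<bar> \<le> (\<Sum>n\<in>?V. \<bar>a l n\<bar>) * (8 * \<eta> * B)"
      by (rule abs_sum_mult_le) (rule phi, auto)
    also have "(\<Sum>n\<in>?V. \<bar>a l n\<bar>) = (\<Sum>n\<in>?V. a l n)" using nonneg lj by (intro sum.cong) auto
    also have "\<dots> * (8 * \<eta> * B) \<le> 1 * (8 * \<eta> * B)"
      using sub_row_le[of ?V l] lj rho eta B0 by (intro mult_right_mono) auto
    finally show ?thesis by simp
  qed
  have s2: "\<bar>(\<Sum>n\<in>?V. a l n * bl_mean) - \<kappa> * bl_mean\<bar> \<le> 5 * (\<eta> * B)"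
  proof -
    have "real (card V) \<noteq> 0" using finV lj by auto
    then have "\<bar>(\<Sum>n\<in>?V. a l n * bl_mean) - \<kappa> * bl_mean\<bar> \<le> 5 * \<eta> * \<bar>bl_mean\<bar>"
      using mixing[of V l j "\<lambda>_. bl_mean" 0 bl_mean 0] lj by simp
    also have "\<dots> \<le> 5 * \<eta> * B" using c1 eta by (intro mult_left_mono) auto
    finally show ?thesis by simp
  qed
  have s3: "\<bar>q * (\<Sum>n\<in>V - S - {l, j}. a l n * h n) - q * bl_mean\<bar> \<le> 5 * (\<eta> * B)"
  proof -
    have "\<bar>(\<Sum>n\<in>V - S - {l, j}. a l n * h n) - bl_mean\<bar> \<le> 5 * \<eta> * B"
      using mixing[of "V - S" l j h bl_slope bl_offset 0] hl lj unfolding bl_mean_def B_def by simp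
    then have "\<bar>q * (\<Sum>n\<in>V - S - {l, j}. a l n * h n) - q * bl_mean\<bar> \<le> 1 * (5 * \<eta> * B)"
      unfolding right_diff_distrib[symmetric] abs_mult using kappa rho by (intro mult_mono) auto
    then show ?thesis by simp
  qed
  have "(\<Sum>m\<in>V - S. A2 l m * h m) = (\<Sum>n\<in>V. a l n * \<phi> n)" unfolding \<phi>_def by (rule A2_apply)
  also have "\<dots> = a l l * \<phi> l + a l j * \<phi> j + (\<Sum>n\<in>?V. a l n * \<phi> n)" by (rule sum_split2[OF finV lj])
  finally have "(\<Sum>m\<in>V - S. A2 l m * h m) = a l l * \<phi> l + a l j * \<phi> j + (\<Sum>n\<in>?V. a l n * \<phi> n)" .
  \<comment> \<open>The three summands correspond to staying at l in the outer step, to averaging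
    the constant \<open>bl_mean\<close> over the neighbours of l, and to averaging q h over its
    latent neighbours.\<close>
  moreover have "q\<^sup>2 * h l + (2 * q + \<kappa>) * bl_mean = q * (q * h l + bl_mean) + \<kappa> * bl_mean + q * bl_mean"
    by (simp add: power2_eq_square algebra_simps)
  ultimately have "\<bar>(\<Sum>m\<in>V - S. A2 l m * h m) - (q\<^sup>2 * h l + (2 * q + \<kappa>) * bl_mean)\<bar> \<le> 34 * (\<eta> * B)"
    using split t1 t2 s1 s2 s3 by linarith
  then show ?thesis unfolding h_def B_def by simp
qed

text \<open>The detour through the latent nodes is averaged once more by row i and so contributes
  only a constant; the slope is the direct weight \<kappa>. Here 258 is 20 + 34 * 7 from the bound
  on \<open>bl_slope\<close> and \<open>bl_offset\<close>, and the total 294 is rounded to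
  300.\<close>

lemma granger_two_levels:
  assumes U: "block_solution S U" and ij: "i \<in> S" "j \<in> S" "i \<noteq> j"
  shows "\<bar>d * granger_coeff S U i j - (\<kappa> * of_bool (g i j) + bl_mean)\<bar> \<le> 300 * k ^ 3 * \<eta>"
proof -
  define B where "B = \<bar>bl_slope\<bar> + \<bar>bl_offset\<bar>"
  define h where "h m = bl_slope * of_bool (g m j) + bl_offset" for m
  define w where "w l = d * U l j - h l" for l
  have B: "0 \<le> B" "B \<le> 7 * k ^ 2" unfolding B_def using bl_coeffs(3) by auto
  have iV: "i \<in> V" "j \<in> V" using ij SV by auto
  define e where "e = 20 * \<eta> + 34 * \<eta> * B"
  have e0: "0 \<le> e" unfolding e_def using eta B by simp
  have w: "\<bar>w l\<bar> \<le> e / (1 - \<rho>\<^sup>2)" if "l \<in> V - S" for l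
  proof (rule contraction_bound[of "V - S" "\<rho>\<^sup>2" e w])
    fix m l assume m: "0 \<le> m" "\<And>l. l \<in> V - S \<Longrightarrow> \<bar>w l\<bar> \<le> m" and l: "l \<in> V - S"
    have lj: "l \<in> V" "l \<noteq> j" using l ij by auto
    have "U l j = A2 l j + (\<Sum>m\<in>V - S. A2 l m * U m j)" using U l ij unfolding block_solution_def by blast
    then have "d * U l j = d * A2 l j + (\<Sum>m\<in>V - S. A2 l m * (d * U m j))"
      by (simp add: distrib_left sum_distrib_left mult.left_commute)
    also have "(\<Sum>m\<in>V - S. A2 l m * (d * U m j)) = (\<Sum>m\<in>V - S. A2 l m * w m) + (\<Sum>m\<in>V - S. A2 l m * h m)"
      unfolding w_def sum.distrib[symmetric] by (intro sum.cong refl) (simp add: algebra_simps)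
    finally have "d * U l j = d * A2 l j + ((\<Sum>m\<in>V - S. A2 l m * w m) + (\<Sum>m\<in>V - S. A2 l m * h m))" .
    moreover have "h l = (2 * q * \<kappa> * of_bool (g l j) + \<kappa>\<^sup>2 * p) + (q\<^sup>2 * h l + (2 * q + \<kappa>) * bl_mean)"
    proof -
      have "h l = bl_slope * of_bool (g l j) + bl_offset" by (simp add: h_def)
      also have "\<dots> = (2 * q * \<kappa> + q\<^sup>2 * bl_slope) * of_bool (g l j)
          + (\<kappa>\<^sup>2 * p + q\<^sup>2 * bl_offset + (2 * q + \<kappa>) * bl_mean)"
        by (rule arg_cong2[where f = "\<lambda>u v. u * of_bool (g l j) + v", OF bl_coeffs(1,2)])
      also have "\<dots> = (2 * q * \<kappa> * of_bool (g l j) + \<kappa>\<^sup>2 * p) + (q\<^sup>2 * h l + (2 * q + \<kappa>) * bl_mean)"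
        unfolding h_def by (simp add: algebra_simps)
      finally show ?thesis .
    qed
    moreover have "\<bar>d * A2 l j - (2 * q * \<kappa> * of_bool (g l j) + \<kappa>\<^sup>2 * p)\<bar> \<le> 20 * \<eta>"
      by (rule A2_asymptotics[OF lj(1) iV(2) lj(2)])
    moreover have "\<bar>(\<Sum>m\<in>V - S. A2 l m * h m) - (q\<^sup>2 * h l + (2 * q + \<kappa>) * bl_mean)\<bar> \<le> 34 * \<eta> * B"
      unfolding h_def B_def by (rule A2_block_mixing[OF l ij(2)])
    moreover have "\<bar>\<Sum>m\<in>V - S. A2 l m * w m\<bar> \<le> \<rho>\<^sup>2 * m" using m by (intro A2_abs_le lj) auto
    ultimately show "\<bar>w l\<bar> \<le> \<rho>\<^sup>2 * m + e" unfolding w_def e_def by linarith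
  qed (use finV rho_sq e0 that in auto)
  have "e / (1 - \<rho>\<^sup>2) \<le> e / (1 - \<rho>)"
  proof (rule divide_left_mono)
    show "1 - \<rho> \<le> 1 - \<rho>\<^sup>2" using rho by (simp add: power2_eq_square mult_left_le)
    show "0 < (1 - \<rho>\<^sup>2) * (1 - \<rho>)" using rho rho_sq by (intro mult_pos_pos) auto
  qed (rule e0)
  also have "\<dots> = e * k" by simp
  also have "\<dots> \<le> (258 * k ^ 2 * \<eta>) * k"
  proof (rule mult_right_mono)
    have "20 * \<eta> \<le> 20 * k ^ 2 * \<eta>" using one_le_power[OF k_ge, of 2] eta(1) by (intro mult_right_mono) auto
    moreover have "34 * \<eta> * B \<le> 34 * \<eta> * (7 * k ^ 2)" using B eta by (intro mult_left_mono) auto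
    moreover have "20 * k ^ 2 * \<eta> + 34 * \<eta> * (7 * k ^ 2) = 258 * k ^ 2 * \<eta>" by (simp add: algebra_simps)
    ultimately show "e \<le> 258 * k ^ 2 * \<eta>" unfolding e_def by linarith
  qed (use rho in auto)
  finally have \<theta>: "e / (1 - \<rho>\<^sup>2) \<le> 258 * k ^ 3 * \<eta>" by (simp add: power2_eq_square power3_eq_cube)
  have "\<bar>(\<Sum>l\<in>V - S - {i, j}. a i l * (d * U l j)) - \<kappa> * ratio (V - S) * (p * bl_slope + bl_offset)\<bar>
      \<le> \<rho> * (258 * k ^ 3 * \<eta>) + 5 * \<eta> * (\<bar>bl_slope\<bar> + \<bar>bl_offset\<bar>)"
  proof (rule mixing[OF _ iV ij(3)])
    fix l assume "l \<in> V - S - {i, j}"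
    then show "\<bar>d * U l j - (bl_slope * of_bool (g l j) + bl_offset)\<bar> \<le> 258 * k ^ 3 * \<eta>"
      using w[of l] \<theta> unfolding w_def h_def by simp
  qed (use eta rho in auto)
  then have m: "\<bar>(\<Sum>l\<in>V - S - {i, j}. a i l * (d * U l j)) - bl_mean\<bar> \<le> \<rho> * (258 * k ^ 3 * \<eta>) + 5 * \<eta> * B"
    unfolding bl_mean_def B_def .
  have "V - S - {i, j} = V - S" using ij by auto
  then have "d * granger_coeff S U i j = d * a i j + (\<Sum>l\<in>V - S - {i, j}. a i l * (d * U l j))"
    unfolding granger_coeff_def by (simp add: distrib_left sum_distrib_left mult.left_commute)
  moreover have "\<bar>d * a i j - \<kappa> * of_bool (g i j)\<bar> \<le> \<eta>" using dev[OF iV ij(3)] eta by (cases "g i j") auto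
  moreover have "\<rho> * (258 * k ^ 3 * \<eta>) \<le> 1 * (258 * k ^ 3 * \<eta>)" using rho eta by (intro mult_right_mono) auto
  moreover have "5 * \<eta> * B \<le> 5 * \<eta> * (7 * k ^ 3)"
  proof (rule mult_left_mono)
    show "B \<le> 7 * k ^ 3" using B(2) power_increasing[of 2 3 k] k_ge by simp
  qed (use eta in auto)
  moreover have "\<eta> \<le> k ^ 3 * \<eta>" using one_le_power[OF k_ge, of 3] mult_right_mono[of 1 "k ^ 3" \<eta>] eta by simp
  ultimately have "\<bar>d * granger_coeff S U i j - (\<kappa> * of_bool (g i j) + bl_mean)\<bar>
      \<le> k ^ 3 * \<eta> + (1 * (258 * k ^ 3 * \<eta>) + 5 * \<eta> * (7 * k ^ 3))"
    using m by linarith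
  also have "\<dots> = 294 * (k ^ 3 * \<eta>)" by (simp add: algebra_simps)
  also have "\<dots> \<le> 300 * (k ^ 3 * \<eta>)" using eta rho by (intro mult_right_mono) auto
  finally show ?thesis by (simp add: mult.assoc)
qed

end

subsection \<open>Martingale tail bounds\<close>

lemma sets_std_gaussian [simp, measurable_cong]: "sets std_gaussian = sets borel"
  by (simp add: std_gaussian_def)

lemma space_std_gaussian [simp]: "space std_gaussian = UNIV"
  by (simp add: std_gaussian_def)

lemma prob_space_std_gaussian: "prob_space std_gaussian"
  unfolding std_gaussian_def by (rule prob_space_normal_density) simp

lemma nn_integral_normal_density: "0 < s \<Longrightarrow> (\<integral>\<^sup>+ x. ennreal (normal_density m s x) \<partial>lborel) = 1"
  using prob_space.emeasure_space_1[OF prob_space_normal_density[of s m]]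
  by (simp add: emeasure_density)

lemma nn_integral_std_gaussian:
  "f \<in> borel_measurable borel \<Longrightarrow>
    (\<integral>\<^sup>+ x. f x \<partial>std_gaussian) = (\<integral>\<^sup>+ x. ennreal (std_normal_density x) * f x \<partial>lborel)"
  unfolding std_gaussian_def by (subst nn_integral_density) auto

lemma gaussian_mgf:
  "(\<integral>\<^sup>+ x. ennreal (exp (u * x)) \<partial>std_gaussian) = ennreal (exp (u\<^sup>2 / 2))"
proof -
  have e: "std_normal_density x * exp (u * x) = exp (u\<^sup>2 / 2) * normal_density u 1 x" for x
  proof -
    have "- x\<^sup>2 / 2 + u * x = u\<^sup>2 / 2 + - (x - u)\<^sup>2 / 2" by (simp add: power2_eq_square field_simps)
    then have "exp (- x\<^sup>2 / 2) * exp (u * x) = exp (u\<^sup>2 / 2) * exp (- (x - u)\<^sup>2 / 2)"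
      by (simp only: exp_add[symmetric])
    then show ?thesis by (simp add: normal_density_def)
  qed
  have "(\<integral>\<^sup>+ x. ennreal (exp (u * x)) \<partial>std_gaussian)
      = (\<integral>\<^sup>+ x. ennreal (exp (u\<^sup>2 / 2)) * ennreal (normal_density u 1 x) \<partial>lborel)"
    by (subst nn_integral_std_gaussian) (simp_all add: e flip: ennreal_mult)
  also have "\<dots> = ennreal (exp (u\<^sup>2 / 2))"
    by (subst nn_integral_cmult) (simp_all add: nn_integral_normal_density)
  finally show ?thesis .
qed

lemma gaussian_square_mgf:
  assumes "l < 1 / 2"
  shows "(\<integral>\<^sup>+ x. ennreal (exp (l * x\<^sup>2)) \<partial>std_gaussian) = ennreal (1 / sqrt (1 - 2 * l))"
proof -
  define s where "s = 1 / sqrt (1 - 2 * l)"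
  have s: "0 < s" "s\<^sup>2 = 1 / (1 - 2 * l)" using assms by (simp_all add: s_def power_divide)
  have e: "std_normal_density x * exp (l * x\<^sup>2) = s * normal_density 0 s x" for x
  proof -
    have "x\<^sup>2 / (2 * s\<^sup>2) = x\<^sup>2 * (1 - 2 * l) / 2" using s assms by simp
    then have "- x\<^sup>2 / 2 + l * x\<^sup>2 = - (x\<^sup>2 / (2 * s\<^sup>2))" by (simp add: algebra_simps)
    then have "exp (- x\<^sup>2 / 2) * exp (l * x\<^sup>2) = exp (- (x\<^sup>2 / (2 * s\<^sup>2)))"
      by (simp only: exp_add[symmetric])
    moreover have "sqrt (2 * pi * s\<^sup>2) = sqrt (2 * pi) * s" using s(1) by (simp add: real_sqrt_mult)
    ultimately show ?thesis using s(1) by (simp add: normal_density_def)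
  qed
  have "(\<integral>\<^sup>+ x. ennreal (exp (l * x\<^sup>2)) \<partial>std_gaussian)
      = (\<integral>\<^sup>+ x. ennreal s * ennreal (normal_density 0 s x) \<partial>lborel)"
    using s(1) by (subst nn_integral_std_gaussian) (simp_all add: e flip: ennreal_mult)
  also have "\<dots> = ennreal s"
    using s(1) by (subst nn_integral_cmult) (simp_all add: nn_integral_normal_density)
  finally show ?thesis by (simp add: s_def)
qed

text \<open>With the closed form of the integral this is -ln (1 - 2 l) / 2 \<le> l + 4 l^2. The two
  signs of l use different lower bounds on ln, and |l| \<le> 1 / 4 keeps 2 l in the range of
  both.\<close>

lemma gaussian_centred_square_mgf:
  assumes "\<bar>l\<bar> \<le> 1 / 4"
  shows "(\<integral>\<^sup>+ x. ennreal (exp (l * (x\<^sup>2 - 1) - 4 * l\<^sup>2)) \<partial>std_gaussian) \<le> 1"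
proof -
  have l: "l < 1 / 2" using assms by auto
  have "ln (1 - 2 * l) \<ge> - 2 * l - 8 * l\<^sup>2"
  proof (cases "0 \<le> l")
    case True
    then have "- (2 * l) - 2 * (2 * l)\<^sup>2 \<le> ln (1 - 2 * l)"
      using assms by (intro ln_one_minus_pos_lower_bound) auto
    then show ?thesis by (simp add: power2_eq_square)
  next
    case False
    then have "- 2 * l - (- 2 * l)\<^sup>2 \<le> ln (1 + - 2 * l)"
      using assms by (intro ln_one_plus_pos_lower_bound) auto
    then show ?thesis by (simp add: power2_eq_square) (smt (verit) zero_le_square)
  qed
  then have "exp (- (ln (1 - 2 * l) / 2)) \<le> exp (l + 4 * l\<^sup>2)" by simp
  moreover have "1 / sqrt (1 - 2 * l) = exp (- (ln (1 - 2 * l) / 2))"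
    using l by (simp add: ln_sqrt[symmetric] exp_minus exp_ln inverse_eq_divide)
  ultimately have le: "1 / sqrt (1 - 2 * l) \<le> exp (l + 4 * l\<^sup>2)" by simp
  have "exp (l * (x\<^sup>2 - 1) - 4 * l\<^sup>2) = exp (- l - 4 * l\<^sup>2) * exp (l * x\<^sup>2)" for x
    by (simp only: exp_add[symmetric]) (simp add: algebra_simps)
  then have "(\<integral>\<^sup>+ x. ennreal (exp (l * (x\<^sup>2 - 1) - 4 * l\<^sup>2)) \<partial>std_gaussian)
      = (\<integral>\<^sup>+ x. ennreal (exp (- l - 4 * l\<^sup>2)) * ennreal (exp (l * x\<^sup>2)) \<partial>std_gaussian)"
    by (simp flip: ennreal_mult)
  also have "\<dots> = ennreal (exp (- l - 4 * l\<^sup>2)) * ennreal (1 / sqrt (1 - 2 * l))"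
    by (subst nn_integral_cmult) (simp_all add: gaussian_square_mgf[OF l])
  also have "\<dots> \<le> ennreal (exp (- l - 4 * l\<^sup>2)) * ennreal (exp (l + 4 * l\<^sup>2))"
    using le by (intro mult_left_mono ennreal_leI) auto
  also have "\<dots> = 1" by (simp flip: ennreal_mult exp_add)
  finally show ?thesis .
qed

section \<open>Independence as a product law, for random elements of different types\<close>

definition (in prob_space) indep_pair ::
    "'b measure \<Rightarrow> ('a \<Rightarrow> 'b) \<Rightarrow> 'c measure \<Rightarrow> ('a \<Rightarrow> 'c) \<Rightarrow> bool" where
  "indep_pair S U T V \<longleftrightarrow> U \<in> measurable M S \<and> V \<in> measurable M T \<and>
     distr M S U \<Otimes>\<^sub>M distr M T V = distr M (S \<Otimes>\<^sub>M T) (\<lambda>\<omega>. (U \<omega>, V \<omega>))"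

context prob_space
begin

lemma indep_pairI:
  assumes [measurable]: "U \<in> measurable M S" "V \<in> measurable M T"
    and "\<And>A B. A \<in> sets S \<Longrightarrow> B \<in> sets T \<Longrightarrow>
      prob ((U -` A \<inter> space M) \<inter> (V -` B \<inter> space M)) = prob (U -` A \<inter> space M) * prob (V -` B \<inter> space M)"
  shows "indep_pair S U T V"
  unfolding indep_pair_def
proof (intro conjI assms(1,2) pair_measure_eqI)
  show "sigma_finite_measure (distr M S U)" "sigma_finite_measure (distr M T V)"
    by (auto intro!: prob_space_imp_sigma_finite prob_space_distr)
  fix A B assume "A \<in> sets (distr M S U)" "B \<in> sets (distr M T V)"
  then have [measurable]: "A \<in> sets S" "B \<in> sets T" by simp_all
  have "(\<lambda>\<omega>. (U \<omega>, V \<omega>)) -` (A \<times> B) \<inter> space M = (U -` A \<inter> space M) \<inter> (V -` B \<inter> space M)" by auto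
  then show "emeasure (distr M S U) A * emeasure (distr M T V) B
      = emeasure (distr M (S \<Otimes>\<^sub>M T) (\<lambda>\<omega>. (U \<omega>, V \<omega>))) (A \<times> B)"
    by (simp add: emeasure_distr emeasure_eq_measure assms(3) flip: ennreal_mult)
qed simp

lemma indep_pairD:
  assumes "indep_pair S U T V" "A \<in> sets S" "B \<in> sets T"
  shows "prob ((U -` A \<inter> space M) \<inter> (V -` B \<inter> space M)) = prob (U -` A \<inter> space M) * prob (V -` B \<inter> space M)"
proof -
  have [measurable]: "U \<in> measurable M S" "V \<in> measurable M T" "A \<in> sets S" "B \<in> sets T"
    using assms by (auto simp: indep_pair_def)
  interpret V: prob_space "distr M T V" by (rule prob_space_distr) simp
  have "emeasure (distr M S U \<Otimes>\<^sub>M distr M T V) (A \<times> B) = emeasure (distr M S U) A * emeasure (distr M T V) B"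
    by (rule V.emeasure_pair_measure_Times) simp_all
  then have "emeasure (distr M (S \<Otimes>\<^sub>M T) (\<lambda>\<omega>. (U \<omega>, V \<omega>))) (A \<times> B) = emeasure (distr M S U) A * emeasure (distr M T V) B"
    using assms(1) by (simp add: indep_pair_def)
  moreover have "(\<lambda>\<omega>. (U \<omega>, V \<omega>)) -` (A \<times> B) \<inter> space M = (U -` A \<inter> space M) \<inter> (V -` B \<inter> space M)" by auto
  ultimately show ?thesis
    by (simp add: emeasure_distr emeasure_eq_measure flip: ennreal_mult)
qed

text \<open>This moves part of V to the other side: the past noise joins the graph and the initial
  state, while the next noise stays separate. On rectangles the two hypotheses factorize the
  probability; rectangles are stable under intersection and generate the product, so the rest is a
  Dynkin system induction.\<close>

lemma indep_pair_shift:
  assumes UV: "indep_pair S U T V" and V: "indep_pair T1 (\<lambda>\<omega>. f (V \<omega>)) T2 (\<lambda>\<omega>. h (V \<omega>))"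
    and [measurable]: "f \<in> measurable T T1" "h \<in> measurable T T2"
  shows "indep_pair (S \<Otimes>\<^sub>M T1) (\<lambda>\<omega>. (U \<omega>, f (V \<omega>))) T2 (\<lambda>\<omega>. h (V \<omega>))"
proof -
  let ?V1 = "\<lambda>\<omega>. f (V \<omega>)" and ?V2 = "\<lambda>\<omega>. h (V \<omega>)"
  have [measurable]: "U \<in> measurable M S" "V \<in> measurable M T"
    using UV by (auto simp: indep_pair_def)
  have pre: "V -` (f -` A \<inter> space T) \<inter> space M = ?V1 -` A \<inter> space M"
    "V -` (h -` B \<inter> space T) \<inter> space M = ?V2 -` B \<inter> space M" for A B
    using measurable_space[of V M T] by auto
  define R where "R = {A \<times> B | A B. A \<in> sets S \<and> B \<in> sets T1}"
  let ?X = "\<lambda>\<omega>. (U \<omega>, ?V1 \<omega>)"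
  have sR: "R \<subseteq> Pow (space S \<times> space T1)" unfolding R_def by (rule pair_measure_closed)
  have iR: "Int_stable R" unfolding R_def by (rule Int_stable_pair_measure_generator)
  show ?thesis
  proof (rule indep_pairI)
    fix C D assume C: "C \<in> sets (S \<Otimes>\<^sub>M T1)" and D [measurable]: "D \<in> sets T2"
    let ?B = "?V2 -` D \<inter> space M"
    have mB: "?B \<in> events" by measurable
    have mX: "?X \<in> measurable M (S \<Otimes>\<^sub>M T1)" by measurable
    have C': "C \<in> sigma_sets (space S \<times> space T1) R" using C unfolding R_def sets_pair_measure .
    show "prob ((?X -` C \<inter> space M) \<inter> ?B) = prob (?X -` C \<inter> space M) * prob ?B"
      using iR sR C'
    proof (induction C rule: sigma_sets_induct_disjoint)
      case (basic C)
      then obtain A B where AB: "C = A \<times> B" and [measurable]: "A \<in> sets S" "B \<in> sets T1" by (auto simp: R_def)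
      have i1: "?X -` C \<inter> space M = (U -` A \<inter> space M) \<inter> (V -` (f -` B \<inter> space T) \<inter> space M)"
        unfolding pre AB by auto
      have e: "(?X -` C \<inter> space M) \<inter> ?B = (U -` A \<inter> space M) \<inter> (V -` ((f -` B \<inter> space T) \<inter> (h -` D \<inter> space T)) \<inter> space M)"
        unfolding i1 pre(2)[symmetric] by auto
      have "prob ((?X -` C \<inter> space M) \<inter> ?B) = prob (U -` A \<inter> space M)
          * prob (V -` ((f -` B \<inter> space T) \<inter> (h -` D \<inter> space T)) \<inter> space M)"
        unfolding e by (rule indep_pairD[OF UV]) measurable
      also have "V -` ((f -` B \<inter> space T) \<inter> (h -` D \<inter> space T)) \<inter> space M = (?V1 -` B \<inter> space M) \<inter> ?B"
        unfolding pre[symmetric] by auto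
      also have "prob \<dots> = prob (?V1 -` B \<inter> space M) * prob ?B" by (rule indep_pairD[OF V]) simp_all
      also have "prob (U -` A \<inter> space M) * \<dots> = prob (?X -` C \<inter> space M) * prob ?B"
      proof -
        have "prob (?X -` C \<inter> space M) = prob (U -` A \<inter> space M) * prob (V -` (f -` B \<inter> space T) \<inter> space M)"
          unfolding i1 by (rule indep_pairD[OF UV]) measurable
        then show ?thesis unfolding pre by (simp only: mult.assoc)
      qed
      finally show ?case .
    next
      case empty
      then show ?case by simp
    next
      case (compl C)
      have C: "C \<in> sets (S \<Otimes>\<^sub>M T1)" using compl(1) unfolding R_def sets_pair_measure .
      have ev: "?X -` C \<inter> space M \<in> events" by (rule measurable_sets[OF mX C])
      have 1: "?X -` (space S \<times> space T1 - C) \<inter> space M = space M - (?X -` C \<inter> space M)"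
        using measurable_space[of U M S] measurable_space[of ?V1 M T1] by auto
      have e: "(space M - (?X -` C \<inter> space M)) \<inter> ?B = ?B - ((?X -` C \<inter> space M) \<inter> ?B)" by auto
      have "prob ((space M - (?X -` C \<inter> space M)) \<inter> ?B) = prob ?B - prob ((?X -` C \<inter> space M) \<inter> ?B)"
        unfolding e by (rule finite_measure_Diff[OF mB sets.Int[OF ev mB] Int_lower2])
      then show ?case unfolding 1 using compl(2) ev by (simp add: prob_compl algebra_simps)
    next
      case (union C)
      let ?P = "\<lambda>i. ?X -` C i \<inter> space M"
      have ev: "?P i \<in> events" for i
        using union(2) unfolding R_def sets_pair_measure[symmetric] by (intro measurable_sets[OF mX]) auto
      have dis: "disjoint_family ?P" "disjoint_family (\<lambda>i. ?P i \<inter> ?B)"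
        using union(1) unfolding disjoint_family_on_def by auto
      have "(\<lambda>i. prob (?P i)) sums prob (\<Union>i. ?P i)"
        using dis ev mB by (intro finite_measure_UNION) auto
      then have "(\<lambda>i. prob (?P i) * prob ?B) sums (prob (\<Union>i. ?P i) * prob ?B)" by (rule sums_mult2)
      moreover have "(\<lambda>i. prob (?P i \<inter> ?B)) sums prob (\<Union>i. ?P i \<inter> ?B)"
        using dis ev mB by (intro finite_measure_UNION) auto
      ultimately have "prob (\<Union>i. ?P i \<inter> ?B) = prob (\<Union>i. ?P i) * prob ?B"
        using union(3) by (simp add: sums_unique2)
      moreover have "?X -` (\<Union>i. C i) \<inter> space M = (\<Union>i. ?P i)" by auto
      moreover have "(\<Union>i. ?P i) \<inter> ?B = (\<Union>i. ?P i \<inter> ?B)" by auto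
      ultimately show ?case by simp
    qed
  qed measurable
qed

end

lemma (in erdos_renyi) graph_space: "\<omega> \<in> space M \<Longrightarrow> G \<omega> \<in> graphs N"
  using measurable_space[OF G_measurable] by simp

section \<open>The filtration of graph, initial state and past noise\<close>

context diffusion_network
begin

abbreviation "V \<equiv> nodes N"
abbreviation "noise \<equiv> Pi\<^sub>M V (\<lambda>_. std_gaussian)"
abbreviation "innov t \<omega> \<equiv> restrict (x \<omega> t) V"
abbreviation "start \<omega> \<equiv> (G \<omega>, restrict (y \<omega> 0) V)"
abbreviation "start_space \<equiv> count_space (graphs N) \<Otimes>\<^sub>M vec_space N"
abbreviation "all_noise \<omega> \<equiv> restrict (\<lambda>(t, i). x \<omega> t i) ({1..} \<times> V)"
abbreviation "noise_space t \<equiv> Pi\<^sub>M ({1..t} \<times> V) (\<lambda>_. borel :: real measure)"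

definition history :: "nat \<Rightarrow> 'a \<Rightarrow> (graph \<times> (nat \<Rightarrow> real)) \<times> (nat \<times> nat \<Rightarrow> real)" where
  "history t \<omega> = (start \<omega>, restrict (\<lambda>(s, i). x \<omega> s i) ({1..t} \<times> V))"

text \<open>The graph is contained in every member of the filtration, so weights that depend on the
  random matrix are known at every time.\<close>

definition past :: "nat \<Rightarrow> 'a measure" where
  "past t = vimage_algebra (space M) (history t) (start_space \<Otimes>\<^sub>M noise_space t)"

lemma finite_V: "finite V" by (simp add: nodes_def)

lemma sets_noise [measurable_cong]: "sets noise = sets (vec_space N)"
  unfolding vec_space_def by (intro sets_PiM_cong) auto

lemma prob_space_noise: "prob_space noise"
  by (intro prob_space_PiM prob_space_std_gaussian)

text \<open>Measurability of the initial state is read off from the independence assumption, whose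
  first family consists of events.\<close>

lemma start_measurable: "start \<in> measurable M start_space"
proof (rule measurableI)
  fix \<omega> assume "\<omega> \<in> space M"
  then show "start \<omega> \<in> space start_space"
    using graph_space by (auto simp: space_pair_measure vec_space_def space_PiM)
next
  fix A assume "A \<in> sets start_space"
  then have "start -` A \<inter> space M \<in> sets (vimage_algebra (space M) start start_space)"
    by (rule in_vimage_algebra)
  then show "start -` A \<inter> space M \<in> events"
    using x_indep_G_y0 by (auto simp: indep_sets2_eq)
qed

lemma x_measurable: "1 \<le> t \<Longrightarrow> i \<in> V \<Longrightarrow> (\<lambda>\<omega>. x \<omega> t i) \<in> borel_measurable M"
  using x_gaussian[of t i] unfolding distributed_def by simp

lemma all_noise_measurable: "all_noise \<in> measurable M (Pi\<^sub>M ({1..} \<times> V) (\<lambda>_. borel))"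
  by (rule measurable_restrict) (auto intro: x_measurable)

lemma indep_start_noise: "indep_pair start_space start (Pi\<^sub>M ({1..} \<times> V) (\<lambda>_. borel)) all_noise"
proof (rule indep_pairI[OF start_measurable all_noise_measurable])
  fix A B assume A: "A \<in> sets start_space" and B: "B \<in> sets (Pi\<^sub>M ({1 :: nat..} \<times> V) (\<lambda>_. borel :: real measure))"
  show "prob ((start -` A \<inter> space M) \<inter> (all_noise -` B \<inter> space M))
      = prob (start -` A \<inter> space M) * prob (all_noise -` B \<inter> space M)"
    using x_indep_G_y0 in_vimage_algebra[OF A, of start "space M"] in_vimage_algebra[OF B, of all_noise "space M"]
    unfolding indep_sets2_eq by blast
qed

lemma indep_noise_blocks:
  "indep_pair (noise_space t) (\<lambda>\<omega>. restrict (all_noise \<omega>) ({1..t} \<times> V))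
     (vec_space N) (\<lambda>\<omega>. restrict (\<lambda>i. all_noise \<omega> (Suc t, i)) V)"
proof -
  let ?A = "{1..t} \<times> V" and ?B = "{Suc t} \<times> V"
  let ?X = "\<lambda>k \<omega>. (case k of (t, i) \<Rightarrow> \<lambda>\<omega>. x \<omega> t i) \<omega>"
  have ind: "indep_var (Pi\<^sub>M ?A (\<lambda>_. borel)) (\<lambda>\<omega>. restrict (\<lambda>k. ?X k \<omega>) ?A) (Pi\<^sub>M ?B (\<lambda>_. borel)) (\<lambda>\<omega>. restrict (\<lambda>k. ?X k \<omega>) ?B)"
    by (rule indep_var_restrict[OF x_indep]) auto
  let ?h = "\<lambda>v :: nat \<times> nat \<Rightarrow> real. restrict (\<lambda>i. v (Suc t, i)) V"
  have h [measurable]: "?h \<in> measurable (Pi\<^sub>M ?B (\<lambda>_. borel)) (vec_space N)"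
    unfolding vec_space_def by (intro measurable_restrict measurable_component_singleton) auto
  have eA: "restrict (all_noise \<omega>) ?A = restrict (\<lambda>k. ?X k \<omega>) ?A" for \<omega>
    by (auto simp: restrict_def fun_eq_iff)
  have eB: "restrict (\<lambda>i. all_noise \<omega> (Suc t, i)) V = ?h (restrict (\<lambda>k. ?X k \<omega>) ?B)" for \<omega>
    by (auto simp: restrict_def fun_eq_iff)
  have m: "(\<lambda>\<omega>. restrict (\<lambda>k. ?X k \<omega>) ?A) \<in> measurable M (Pi\<^sub>M ?A (\<lambda>_. borel))"
    "(\<lambda>\<omega>. restrict (\<lambda>k. ?X k \<omega>) ?B) \<in> measurable M (Pi\<^sub>M ?B (\<lambda>_. borel))"
    using ind by (auto dest: indep_var_rv1 indep_var_rv2)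
  show ?thesis unfolding eA eB
  proof (rule indep_pairI[OF m(1) measurable_compose[OF m(2) h]])
    fix C D assume C: "C \<in> sets (noise_space t)" and D: "D \<in> sets (vec_space N)"
    let ?D = "?h -` D \<inter> space (Pi\<^sub>M ?B (\<lambda>_. borel))"
    let ?XA = "\<lambda>\<omega>. restrict (\<lambda>k. ?X k \<omega>) ?A" and ?XB = "\<lambda>\<omega>. restrict (\<lambda>k. ?X k \<omega>) ?B"
    have "?D \<in> sets (Pi\<^sub>M ?B (\<lambda>_. borel))" by (rule measurable_sets[OF h D])
    from indep_varD[OF ind C this]
    have "prob ((\<lambda>\<omega>. (?XA \<omega>, ?XB \<omega>)) -` (C \<times> ?D) \<inter> space M) = prob (?XA -` C \<inter> space M) * prob (?XB -` ?D \<inter> space M)" .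
    moreover have p: "?XB -` ?D \<inter> space M = (\<lambda>\<omega>. ?h (?XB \<omega>)) -` D \<inter> space M"
      using measurable_space[OF m(2)] by auto
    moreover have "(\<lambda>\<omega>. (?XA \<omega>, ?XB \<omega>)) -` (C \<times> ?D) \<inter> space M
        = (?XA -` C \<inter> space M) \<inter> (?XB -` ?D \<inter> space M)" by auto
    ultimately show "prob ((?XA -` C \<inter> space M) \<inter> ((\<lambda>\<omega>. ?h (?XB \<omega>)) -` D \<inter> space M))
        = prob (?XA -` C \<inter> space M) * prob ((\<lambda>\<omega>. ?h (?XB \<omega>)) -` D \<inter> space M)" by (simp only:)
  qed
qed

lemma all_noise_parts:
  "restrict (\<lambda>(s, i). x \<omega> s i) ({1..t} \<times> V) = restrict (all_noise \<omega>) ({1..t} \<times> V)"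
  "innov (Suc t) \<omega> = restrict (\<lambda>i. all_noise \<omega> (Suc t, i)) V"
  by (auto simp: restrict_def fun_eq_iff)

lemma indep_history_innov:
  "indep_pair (start_space \<Otimes>\<^sub>M noise_space t) (history t) (vec_space N) (innov (Suc t))"
  unfolding history_def all_noise_parts
proof (rule indep_pair_shift[where V = all_noise and f = "\<lambda>v. restrict v ({1..t} \<times> V)"
      and h = "\<lambda>v. restrict (\<lambda>i. v (Suc t, i)) V", OF indep_start_noise indep_noise_blocks])
  show "(\<lambda>v. restrict v ({1..t} \<times> V)) \<in> measurable (Pi\<^sub>M ({1..} \<times> V) (\<lambda>_. borel)) (noise_space t)"
    by (rule measurable_restrict_subset) auto
  show "(\<lambda>v. restrict (\<lambda>i. v (Suc t, i)) V) \<in> measurable (Pi\<^sub>M ({1..} \<times> V) (\<lambda>_. borel)) (vec_space N)"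
    unfolding vec_space_def by (intro measurable_restrict measurable_component_singleton) auto
qed

lemma history_measurable: "history t \<in> measurable M (start_space \<Otimes>\<^sub>M noise_space t)"
  using indep_history_innov unfolding indep_pair_def by blast

lemma space_past [simp]: "space (past t) = space M" by (simp add: past_def)

lemma sets_past: "sets (past t) = {history t -` A \<inter> space M | A. A \<in> sets (start_space \<Otimes>\<^sub>M noise_space t)}"
  unfolding past_def using measurable_space[OF history_measurable]
  by (intro sets_vimage_algebra2) auto

lemma past_ident: "(\<lambda>\<omega>. \<omega>) \<in> measurable M (past t)"
  using measurable_sets[OF history_measurable, of _ t]
  by (intro measurableI) (auto simp: sets_past)

lemma measurable_past: "f \<in> measurable (past t) L \<Longrightarrow> f \<in> measurable M L"
  by (rule measurable_compose[OF past_ident])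

lemma indep_past_innov: "indep_pair (past t) (\<lambda>\<omega>. \<omega>) (vec_space N) (innov (Suc t))"
proof (rule indep_pairI[OF past_ident])
  show "innov (Suc t) \<in> measurable M (vec_space N)"
    using indep_history_innov unfolding indep_pair_def by blast
  fix A B assume A: "A \<in> sets (past t)" and B: "B \<in> sets (vec_space N)"
  from A obtain C where C: "C \<in> sets (start_space \<Otimes>\<^sub>M noise_space t)" "A = history t -` C \<inter> space M"
    unfolding sets_past by blast
  have "(\<lambda>\<omega>. \<omega>) -` A \<inter> space M = history t -` C \<inter> space M" using C by auto
  then show "prob ((\<lambda>\<omega>. \<omega>) -` A \<inter> space M \<inter> (innov (Suc t) -` B \<inter> space M))
      = prob ((\<lambda>\<omega>. \<omega>) -` A \<inter> space M) * prob (innov (Suc t) -` B \<inter> space M)"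
    using indep_pairD[OF indep_history_innov C(1) B] by simp
qed

lemma innov_law:
  assumes "1 \<le> N" shows "distr M (vec_space N) (innov (Suc t)) = noise"
proof -
  let ?X = "\<lambda>k \<omega>. (case k of (t, i) \<Rightarrow> \<lambda>\<omega>. x \<omega> t i) \<omega>"
  have "indep_vars (\<lambda>i. Pi\<^sub>M {(Suc t, i)} (\<lambda>_. borel)) (\<lambda>i \<omega>. restrict (\<lambda>k. ?X k \<omega>) {(Suc t, i)}) V"
    by (rule indep_vars_restrict[OF x_indep]) (auto simp: disjoint_family_on_def)
  then have "indep_vars (\<lambda>_. borel) (\<lambda>i \<omega>. (restrict (\<lambda>k. ?X k \<omega>) {(Suc t, i)}) (Suc t, i)) V"
    by (rule indep_vars_compose2[where Y = "\<lambda>i v. v (Suc t, i)"]) (rule measurable_component_singleton, simp)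
  then have "indep_vars (\<lambda>_. borel) (\<lambda>i \<omega>. x \<omega> (Suc t) i) V" by simp
  moreover have "V \<noteq> {}" using assms by (simp add: nodes_def)
  ultimately have "distr M (Pi\<^sub>M V (\<lambda>_. borel)) (\<lambda>\<omega>. \<lambda>i\<in>V. x \<omega> (Suc t) i) = Pi\<^sub>M V (\<lambda>i. distr M borel (\<lambda>\<omega>. x \<omega> (Suc t) i))"
    using x_measurable[of "Suc t"] by (subst (asm) indep_vars_iff_distr_eq_PiM') auto
  also have "\<dots> = noise"
  proof (rule PiM_cong[OF refl])
    fix i assume "i \<in> V"
    then have "distr M lborel (\<lambda>\<omega>. x \<omega> (Suc t) i) = std_gaussian"
      using x_gaussian[of "Suc t" i] unfolding distributed_def std_gaussian_def by simp
    moreover have "distr M lborel (\<lambda>\<omega>. x \<omega> (Suc t) i) = distr M borel (\<lambda>\<omega>. x \<omega> (Suc t) i)"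
      by (rule distr_cong) auto
    ultimately show "distr M borel (\<lambda>\<omega>. x \<omega> (Suc t) i) = std_gaussian" by simp
  qed
  finally show ?thesis by (simp add: vec_space_def)
qed

text \<open>Fubini for the past and the next noise vector: the noise is integrated out with the past
  frozen. This takes the place of a conditional expectation in all that follows.\<close>

lemma nn_integral_innov:
  assumes N: "1 \<le> N" and f [measurable]: "f \<in> borel_measurable (past t \<Otimes>\<^sub>M vec_space N)"
  shows "(\<integral>\<^sup>+ \<omega>. f (\<omega>, innov (Suc t) \<omega>) \<partial>M) = (\<integral>\<^sup>+ \<omega>. \<integral>\<^sup>+ w. f (\<omega>, w) \<partial>noise \<partial>M)"
proof -
  interpret noise: prob_space noise by (rule prob_space_noise)
  have [measurable]: "innov (Suc t) \<in> measurable M (vec_space N)" "(\<lambda>\<omega>. \<omega>) \<in> measurable M (past t)"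
    and eq: "distr M (past t) (\<lambda>\<omega>. \<omega>) \<Otimes>\<^sub>M noise = distr M (past t \<Otimes>\<^sub>M vec_space N) (\<lambda>\<omega>. (\<omega>, innov (Suc t) \<omega>))"
    using indep_past_innov[of t] innov_law[OF N] unfolding indep_pair_def by auto
  have f' [measurable]: "f \<in> borel_measurable (past t \<Otimes>\<^sub>M noise)"
    using f by (simp cong: measurable_cong_sets add: sets_noise cong: sets_pair_measure_cong)
  have "(\<integral>\<^sup>+ \<omega>. f (\<omega>, innov (Suc t) \<omega>) \<partial>M) = (\<integral>\<^sup>+ z. f z \<partial>(distr M (past t) (\<lambda>\<omega>. \<omega>) \<Otimes>\<^sub>M noise))"
    unfolding eq by (subst nn_integral_distr) measurable
  also have "\<dots> = (\<integral>\<^sup>+ \<omega>. \<integral>\<^sup>+ w. f (\<omega>, w) \<partial>noise \<partial>distr M (past t) (\<lambda>\<omega>. \<omega>))"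
    using f' by (intro noise.nn_integral_fst[symmetric]) (simp cong: measurable_cong_sets)
  also have "\<dots> = (\<integral>\<^sup>+ \<omega>. \<integral>\<^sup>+ w. f (\<omega>, w) \<partial>noise \<partial>M)"
    by (rule nn_integral_distr) measurable
  finally show ?thesis .
qed

end

section \<open>Adapted processes and exponential supermartingales\<close>

context diffusion_network
begin

lemma history_past: "history t \<in> measurable (past t) (start_space \<Otimes>\<^sub>M noise_space t)"
  unfolding past_def using measurable_space[OF history_measurable]
  by (intro measurable_vimage_algebra1) auto

lemma start_past: "start \<in> measurable (past t) start_space"
  using measurable_compose[OF history_past measurable_fst] by (simp add: history_def)

lemma G_past: "G \<in> measurable (past t) (count_space (graphs N))"
  using measurable_compose[OF start_past measurable_fst] by simp

lemma graph_function_past: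
  fixes c :: "graph \<Rightarrow> real" shows "(\<lambda>\<omega>. c (G \<omega>)) \<in> borel_measurable (past t)"
  by (rule measurable_compose[OF G_past]) simp

lemma y0_past: "i \<in> V \<Longrightarrow> (\<lambda>\<omega>. y \<omega> 0 i) \<in> borel_measurable (past t)"
proof -
  assume i: "i \<in> V"
  have "(\<lambda>\<omega>. restrict (y \<omega> 0) V) \<in> measurable (past t) (vec_space N)"
    using measurable_compose[OF start_past measurable_snd] by simp
  then have "(\<lambda>\<omega>. restrict (y \<omega> 0) V i) \<in> borel_measurable (past t)"
    unfolding vec_space_def by (rule measurable_compose) (rule measurable_component_singleton[OF i])
  then show ?thesis using i by simp
qed

lemma x_past: "s \<in> {1..t} \<Longrightarrow> i \<in> V \<Longrightarrow> (\<lambda>\<omega>. x \<omega> s i) \<in> borel_measurable (past t)"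
proof -
  assume s: "s \<in> {1..t}" "i \<in> V"
  have "(\<lambda>\<omega>. snd (history t \<omega>)) \<in> measurable (past t) (noise_space t)"
    by (rule measurable_compose[OF history_past measurable_snd])
  then have "(\<lambda>\<omega>. snd (history t \<omega>) (s, i)) \<in> borel_measurable (past t)"
    by (rule measurable_compose) (rule measurable_component_singleton, use s in auto)
  then show ?thesis using s by (simp add: history_def)
qed

lemma past_mono:
  assumes "t \<le> s" "f \<in> measurable (past t) L" shows "f \<in> measurable (past s) L"
proof -
  have "(\<lambda>\<omega>. restrict (\<lambda>(r, i). x \<omega> r i) ({1..t} \<times> V)) \<in> measurable (past s) (noise_space t)"
    using assms(1) by (intro measurable_restrict) (auto intro: x_past)
  then have "history t \<in> measurable (past s) (start_space \<Otimes>\<^sub>M noise_space t)"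
    unfolding history_def by (intro measurable_Pair start_past)
  then have "(\<lambda>\<omega>. \<omega>) \<in> measurable (past s) (past t)"
    unfolding past_def[of t] by (intro measurable_vimage_algebra2) auto
  then show ?thesis using assms(2) by (rule measurable_compose)
qed

lemma y_past: "i \<in> V \<Longrightarrow> (\<lambda>\<omega>. y \<omega> t i) \<in> borel_measurable (past t)"
proof (induction t arbitrary: i)
  case 0
  then show ?case by (rule y0_past)
next
  case (Suc t)
  have [measurable]: "(\<lambda>\<omega>. y \<omega> t l) \<in> borel_measurable (past (Suc t))" if "l \<in> V" for l
    using Suc.IH[OF that] by (rule past_mono[rotated]) simp
  have [measurable]: "(\<lambda>\<omega>. \<pi> (G \<omega>) i l) \<in> borel_measurable (past (Suc t))" for l
    by (rule graph_function_past)
  have [measurable]: "(\<lambda>\<omega>. x \<omega> (Suc t) i) \<in> borel_measurable (past (Suc t))"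
    using Suc.prems by (intro x_past) auto
  have "(\<lambda>\<omega>. (\<Sum>l\<in>V. \<pi> (G \<omega>) i l * y \<omega> t l) + \<sigma> * x \<omega> (Suc t) i) \<in> borel_measurable (past (Suc t))"
    by measurable
  also have "?this \<longleftrightarrow> ?case"
    using Suc.prems by (intro measurable_cong) (simp add: dynamics var_step_def)
  finally show ?case .
qed

lemma y_measurable: "i \<in> V \<Longrightarrow> (\<lambda>\<omega>. y \<omega> t i) \<in> borel_measurable M"
  by (rule measurable_past[OF y_past])

lemma coord_measurable: "i \<in> V \<Longrightarrow> (\<lambda>w. w i) \<in> borel_measurable (vec_space N)"
  unfolding vec_space_def by (rule measurable_component_singleton)

lemma pair_coord_measurable: "i \<in> V \<Longrightarrow> (\<lambda>z. snd z i) \<in> borel_measurable (L \<Otimes>\<^sub>M vec_space N)"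
  by (rule measurable_compose[OF measurable_snd coord_measurable])

text \<open>The last factor is integrated out first, with the earlier factors frozen because they
  are measurable with respect to its past; each such integration costs a factor of at most
  1.\<close>

lemma supermartingale:
  fixes f :: "nat \<Rightarrow> 'a \<times> (nat \<Rightarrow> real) \<Rightarrow> ennreal"
  assumes N: "1 \<le> N" and f: "\<And>t. f t \<in> borel_measurable (past t \<Otimes>\<^sub>M vec_space N)"
    and le: "\<And>t \<omega>. \<omega> \<in> space M \<Longrightarrow> (\<integral>\<^sup>+ w. f t (\<omega>, w) \<partial>noise) \<le> 1"
  shows "(\<lambda>\<omega>. \<Prod>t<m. f t (\<omega>, innov (Suc t) \<omega>)) \<in> borel_measurable (past m)"
    and "(\<integral>\<^sup>+ \<omega>. (\<Prod>t<m. f t (\<omega>, innov (Suc t) \<omega>)) \<partial>M) \<le> 1"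
proof -
  interpret noise: prob_space noise by (rule prob_space_noise)
  have meas: "(\<lambda>\<omega>. \<Prod>t<m. f t (\<omega>, innov (Suc t) \<omega>)) \<in> borel_measurable (past m)" for m
  proof (rule borel_measurable_prod_ennreal)
    fix t assume t: "t \<in> {..<m}"
    have "innov (Suc t) \<in> measurable (past m) (vec_space N)"
      unfolding vec_space_def using t by (intro measurable_restrict x_past) auto
    moreover have "(\<lambda>\<omega>. \<omega>) \<in> measurable (past m) (past t)"
      by (rule past_mono[OF _ measurable_ident[unfolded id_def]]) (use t in simp)
    ultimately have "(\<lambda>\<omega>. (\<omega>, innov (Suc t) \<omega>)) \<in> measurable (past m) (past t \<Otimes>\<^sub>M vec_space N)"
      by (rule measurable_Pair[rotated])
    then show "(\<lambda>\<omega>. f t (\<omega>, innov (Suc t) \<omega>)) \<in> borel_measurable (past m)" by (rule measurable_compose[OF _ f])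
  qed
  then show "(\<lambda>\<omega>. \<Prod>t<m. f t (\<omega>, innov (Suc t) \<omega>)) \<in> borel_measurable (past m)" .
  show "(\<integral>\<^sup>+ \<omega>. (\<Prod>t<m. f t (\<omega>, innov (Suc t) \<omega>)) \<partial>M) \<le> 1"
  proof (induction m)
    case 0
    then show ?case by (simp add: emeasure_space_1)
  next
    case (Suc m)
    let ?W = "\<lambda>\<omega>. \<Prod>t<m. f t (\<omega>, innov (Suc t) \<omega>)"
    have [measurable]: "?W \<in> borel_measurable (past m)" by (rule meas)
    note f[measurable]
    have "(\<integral>\<^sup>+ \<omega>. (\<Prod>t<Suc m. f t (\<omega>, innov (Suc t) \<omega>)) \<partial>M)
        = (\<integral>\<^sup>+ \<omega>. (\<lambda>z. ?W (fst z) * f m z) (\<omega>, innov (Suc m) \<omega>) \<partial>M)" by simp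
    also have "\<dots> = (\<integral>\<^sup>+ \<omega>. \<integral>\<^sup>+ w. (\<lambda>z. ?W (fst z) * f m z) (\<omega>, w) \<partial>noise \<partial>M)"
      by (rule nn_integral_innov[OF N]) measurable
    also have "\<dots> \<le> (\<integral>\<^sup>+ \<omega>. ?W \<omega> \<partial>M)"
    proof (rule nn_integral_mono)
      fix \<omega> assume \<omega>: "\<omega> \<in> space M"
      have "(\<lambda>w. f m (\<omega>, w)) \<in> borel_measurable (vec_space N)"
        using \<omega> by (intro measurable_compose[OF measurable_Pair1' f]) auto
      then have "(\<lambda>w. f m (\<omega>, w)) \<in> borel_measurable noise" by (simp cong: measurable_cong_sets add: sets_noise)
      then have "(\<integral>\<^sup>+ w. (\<lambda>z. ?W (fst z) * f m z) (\<omega>, w) \<partial>noise) = ?W \<omega> * (\<integral>\<^sup>+ w. f m (\<omega>, w) \<partial>noise)"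
        by (simp add: nn_integral_cmult)
      also have "\<dots> \<le> ?W \<omega> * 1" by (intro mult_left_mono le \<omega>) auto
      finally show "(\<integral>\<^sup>+ w. (\<lambda>z. ?W (fst z) * f m z) (\<omega>, w) \<partial>noise) \<le> ?W \<omega>" by simp
    qed
    also have "\<dots> \<le> 1" by (rule Suc.IH)
    finally show ?case .
  qed
qed

text \<open>Markov's inequality for the exponential supermartingale. Since the compensator is part
  of h, the tail is free of any bound on the state.\<close>

lemma exponential_tail:
  fixes h :: "nat \<Rightarrow> 'a \<times> (nat \<Rightarrow> real) \<Rightarrow> real"
  assumes N: "1 \<le> N" and h: "\<And>t. h t \<in> borel_measurable (past t \<Otimes>\<^sub>M vec_space N)"
    and le: "\<And>t \<omega>. \<omega> \<in> space M \<Longrightarrow> (\<integral>\<^sup>+ w. ennreal (exp (h t (\<omega>, w))) \<partial>noise) \<le> 1"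
  shows "(\<lambda>\<omega>. \<Sum>t\<in>{k..<m}. h t (\<omega>, innov (Suc t) \<omega>)) \<in> borel_measurable M"
    and "prob {\<omega> \<in> space M. s \<le> (\<Sum>t\<in>{k..<m}. h t (\<omega>, innov (Suc t) \<omega>))} \<le> exp (- s)"
proof -
  interpret noise: prob_space noise by (rule prob_space_noise)
  \<comment> \<open>Factors before time k are set to 1, so that a sum starting at k comes from a
    product starting at 0. Sample sums use k = 1 and the unrolled state uses k = 0.\<close>
  define f where "f t z = (if t < k then 1 else ennreal (exp (h t z)))" for t z
  have f: "f t \<in> borel_measurable (past t \<Otimes>\<^sub>M vec_space N)" for t
    unfolding f_def using h[of t] by (cases "t < k") auto
  have f_le: "(\<integral>\<^sup>+ w. f t (\<omega>, w) \<partial>noise) \<le> 1" if "\<omega> \<in> space M" for t \<omega>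
    unfolding f_def using le[OF that] by (cases "t < k") (auto simp: noise.emeasure_space_1)
  show m [measurable]: "(\<lambda>\<omega>. \<Sum>t\<in>{k..<m}. h t (\<omega>, innov (Suc t) \<omega>)) \<in> borel_measurable M"
  proof (rule borel_measurable_sum)
    fix t
    have "(\<lambda>\<omega>. (\<omega>, innov (Suc t) \<omega>)) \<in> measurable M (past t \<Otimes>\<^sub>M vec_space N)"
      using indep_past_innov[of t] unfolding indep_pair_def by (intro measurable_Pair) auto
    then show "(\<lambda>\<omega>. h t (\<omega>, innov (Suc t) \<omega>)) \<in> borel_measurable M" by (rule measurable_compose[OF _ h])
  qed
  let ?S = "\<lambda>\<omega>. \<Sum>t\<in>{k..<m}. h t (\<omega>, innov (Suc t) \<omega>)"
  have eq: "(\<Prod>t<m. f t (\<omega>, innov (Suc t) \<omega>)) = ennreal (exp (?S \<omega>))" for \<omega>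
  proof -
    have "(\<Prod>t<m. f t (\<omega>, innov (Suc t) \<omega>)) = (\<Prod>t\<in>{k..<m}. f t (\<omega>, innov (Suc t) \<omega>))"
      by (intro prod.mono_neutral_right) (auto simp: f_def)
    also have "\<dots> = (\<Prod>t\<in>{k..<m}. ennreal (exp (h t (\<omega>, innov (Suc t) \<omega>))))"
      by (intro prod.cong) (auto simp: f_def)
    also have "\<dots> = ennreal (exp (?S \<omega>))" by (simp add: prod_ennreal exp_sum)
    finally show ?thesis .
  qed
  have "emeasure M {\<omega> \<in> space M. s \<le> ?S \<omega>} = emeasure M {\<omega> \<in> space M. 1 \<le> ennreal (exp (- s)) * ennreal (exp (?S \<omega>))}"
    by (intro arg_cong[of _ _ "emeasure M"] Collect_cong conj_cong refl)
       (simp flip: ennreal_mult exp_add add: ennreal_1[symmetric] del: ennreal_1)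
  also have "\<dots> \<le> ennreal (exp (- s)) * (\<integral>\<^sup>+ \<omega>. ennreal (exp (?S \<omega>)) \<partial>M)"
  proof -
    have "{\<omega> \<in> space M. 1 \<le> ennreal (exp (- s)) * ennreal (exp (?S \<omega>))} = {\<omega> \<in> space M. 1 \<le> ennreal (exp (- s)) * ennreal (exp (?S \<omega>))} \<inter> space M"
      by auto
    have "(\<integral>\<^sup>+ \<omega>. ennreal (exp (?S \<omega>)) \<partial>M) = (\<integral>\<^sup>+ \<omega>. ennreal (exp (?S \<omega>)) * indicator (space M) \<omega> \<partial>M)"
      by (intro nn_integral_cong) simp
    then show ?thesis
      using nn_integral_Markov_inequality[of "\<lambda>\<omega>. ennreal (exp (?S \<omega>))" "space M" M "ennreal (exp (- s))"] by simp
  qed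
  also have "\<dots> \<le> ennreal (exp (- s)) * 1"
    using supermartingale(2)[where f = f and m = m, OF N f f_le] unfolding eq by (intro mult_left_mono) auto
  finally show "prob {\<omega> \<in> space M. s \<le> ?S \<omega>} \<le> exp (- s)"
    by (simp add: emeasure_eq_measure)
qed

text \<open>Coordinate j is integrated first with all others frozen, so a one-dimensional Gaussian
  integral suffices.\<close>

lemma noise_coord_integral:
  assumes j: "j \<in> V" and f: "f \<in> borel_measurable (vec_space N)"
    and le: "\<And>w. (\<integral>\<^sup>+ \<xi>. f (w(j := \<xi>)) \<partial>std_gaussian) \<le> 1"
  shows "(\<integral>\<^sup>+ w. f w \<partial>noise) \<le> 1"
proof -
  interpret P: product_prob_space "\<lambda>_. std_gaussian" V
    by (intro product_prob_spaceI prob_space_std_gaussian)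
  interpret R: prob_space "Pi\<^sub>M (V - {j}) (\<lambda>_. std_gaussian)" by (intro prob_space_PiM prob_space_std_gaussian)
  have ins: "insert j (V - {j}) = V" using j by auto
  have "f \<in> borel_measurable noise" using f by (simp cong: measurable_cong_sets add: sets_noise)
  then have "(\<integral>\<^sup>+ w. f w \<partial>noise) = (\<integral>\<^sup>+ w. \<integral>\<^sup>+ \<xi>. f (w(j := \<xi>)) \<partial>std_gaussian \<partial>Pi\<^sub>M (V - {j}) (\<lambda>_. std_gaussian))"
    using P.product_nn_integral_insert[of "V - {j}" j f] finite_V ins by simp
  also have "\<dots> \<le> (\<integral>\<^sup>+ w. 1 \<partial>Pi\<^sub>M (V - {j}) (\<lambda>_. std_gaussian))" by (intro nn_integral_mono le)
  finally show ?thesis by (simp add: R.emeasure_space_1)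
qed

lemma gaussian_linear_mgf: "(\<integral>\<^sup>+ \<xi>. ennreal (exp (u * \<xi> - u\<^sup>2 / 2)) \<partial>std_gaussian) = 1"
proof -
  have "(\<integral>\<^sup>+ \<xi>. ennreal (exp (u * \<xi> - u\<^sup>2 / 2)) \<partial>std_gaussian)
      = (\<integral>\<^sup>+ \<xi>. ennreal (exp (- (u\<^sup>2 / 2))) * ennreal (exp (u * \<xi>)) \<partial>std_gaussian)"
    by (simp flip: ennreal_mult exp_add)
  also have "\<dots> = ennreal (exp (- (u\<^sup>2 / 2))) * ennreal (exp (u\<^sup>2 / 2))"
    by (subst nn_integral_cmult) (simp_all add: gaussian_mgf)
  also have "\<dots> = 1" by (simp flip: ennreal_mult exp_add)
  finally show ?thesis .
qed

lemma noise_linear_mgf: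
  "(\<integral>\<^sup>+ w. ennreal (exp ((\<Sum>l\<in>V. u l * w l) - (\<Sum>l\<in>V. (u l)\<^sup>2) / 2)) \<partial>noise) \<le> 1"
proof -
  interpret P: product_prob_space "\<lambda>_. std_gaussian" V
    by (intro product_prob_spaceI prob_space_std_gaussian)
  have "(\<Sum>l\<in>V. u l * w l) - (\<Sum>l\<in>V. (u l)\<^sup>2) / 2 = (\<Sum>l\<in>V. u l * w l - (u l)\<^sup>2 / 2)" for w
    by (simp add: sum_subtractf sum_divide_distrib)
  then have "ennreal (exp ((\<Sum>l\<in>V. u l * w l) - (\<Sum>l\<in>V. (u l)\<^sup>2) / 2)) = (\<Prod>l\<in>V. ennreal (exp (u l * w l - (u l)\<^sup>2 / 2)))" for w
    by (simp add: exp_sum finite_V prod_ennreal)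
  then have "(\<integral>\<^sup>+ w. ennreal (exp ((\<Sum>l\<in>V. u l * w l) - (\<Sum>l\<in>V. (u l)\<^sup>2) / 2)) \<partial>noise)
      = (\<Prod>l\<in>V. \<integral>\<^sup>+ \<xi>. ennreal (exp (u l * \<xi> - (u l)\<^sup>2 / 2)) \<partial>std_gaussian)"
    using P.product_nn_integral_prod[of V "\<lambda>l \<xi>. ennreal (exp (u l * \<xi> - (u l)\<^sup>2 / 2))"] finite_V by simp
  then show ?thesis by (simp add: gaussian_linear_mgf)
qed

lemma cross_tail:
  assumes N: "1 \<le> N" and ij: "i \<in> V" "j \<in> V"
  shows "prob {\<omega> \<in> space M. s \<le> (\<Sum>t\<in>{1..<Suc m}. l * (y \<omega> t i * x \<omega> (Suc t) j) - l\<^sup>2 / 2 * (y \<omega> t i)\<^sup>2)} \<le> exp (- s)"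
proof -
  let ?h = "\<lambda>t z. l * (y (fst z) t i * snd z j) - l\<^sup>2 / 2 * (y (fst z) t i)\<^sup>2"
  note [measurable] = pair_coord_measurable[OF ij(2)] y_past[OF ij(1)]
  have "prob {\<omega> \<in> space M. s \<le> (\<Sum>t\<in>{1..<Suc m}. ?h t (\<omega>, innov (Suc t) \<omega>))} \<le> exp (- s)"
  proof (rule exponential_tail[OF N])
    fix t \<omega> assume "\<omega> \<in> space M"
    note [measurable] = coord_measurable[OF ij(2)]
    show "(\<integral>\<^sup>+ w. ennreal (exp (?h t (\<omega>, w))) \<partial>noise) \<le> 1"
      unfolding fst_conv snd_conv
    proof (rule noise_coord_integral[OF ij(2)])
      show "(\<integral>\<^sup>+ \<xi>. ennreal (exp (l * (y \<omega> t i * (w(j := \<xi>)) j) - l\<^sup>2 / 2 * (y \<omega> t i)\<^sup>2)) \<partial>std_gaussian) \<le> 1" for w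
        using gaussian_linear_mgf[of "l * y \<omega> t i"] by (simp add: power_mult_distrib mult.assoc)
    qed measurable
  qed measurable
  then show ?thesis using ij by simp
qed

lemma noise_cross_tail:
  assumes N: "1 \<le> N" and ij: "i \<in> V" "j \<in> V" "i \<noteq> j"
  shows "prob {\<omega> \<in> space M. s \<le> (\<Sum>t\<in>{1..<Suc m}. l * (x \<omega> (Suc t) i * x \<omega> (Suc t) j) - l\<^sup>2 / 2 * (x \<omega> (Suc t) i)\<^sup>2)} \<le> exp (- s)"
proof -
  let ?h = "\<lambda>t z. l * (snd z i * snd z j) - l\<^sup>2 / 2 * (snd z i)\<^sup>2"
  note [measurable] = pair_coord_measurable[OF ij(2)] pair_coord_measurable[OF ij(1)]
  have "prob {\<omega> \<in> space M. s \<le> (\<Sum>t\<in>{1..<Suc m}. ?h t (\<omega>, innov (Suc t) \<omega>))} \<le> exp (- s)"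
  proof (rule exponential_tail[OF N])
    fix t \<omega> assume "\<omega> \<in> space M"
    note [measurable] = coord_measurable[OF ij(2)] coord_measurable[OF ij(1)]
    show "(\<integral>\<^sup>+ w. ennreal (exp (?h t (\<omega>, w))) \<partial>noise) \<le> 1"
      unfolding fst_conv snd_conv
    proof (rule noise_coord_integral[OF ij(2)])
      show "(\<integral>\<^sup>+ \<xi>. ennreal (exp (l * ((w(j := \<xi>)) i * (w(j := \<xi>)) j) - l\<^sup>2 / 2 * ((w(j := \<xi>)) i)\<^sup>2)) \<partial>std_gaussian) \<le> 1" for w
        using gaussian_linear_mgf[of "l * w i"] ij(3) by (simp add: power_mult_distrib mult.assoc)
    qed measurable
  qed measurable
  then show ?thesis using ij by simp
qed

lemma noise_square_tail:
  assumes N: "1 \<le> N" and i: "i \<in> V" and l: "\<bar>l\<bar> \<le> 1 / 4"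
  shows "prob {\<omega> \<in> space M. s \<le> (\<Sum>t\<in>{1..<Suc m}. l * ((x \<omega> (Suc t) i)\<^sup>2 - 1) - 4 * l\<^sup>2)} \<le> exp (- s)"
proof -
  let ?h = "\<lambda>t z. l * ((snd z i)\<^sup>2 - 1) - 4 * l\<^sup>2"
  note [measurable] = pair_coord_measurable[OF i]
  have "prob {\<omega> \<in> space M. s \<le> (\<Sum>t\<in>{1..<Suc m}. ?h t (\<omega>, innov (Suc t) \<omega>))} \<le> exp (- s)"
  proof (rule exponential_tail[OF N])
    fix t \<omega> assume "\<omega> \<in> space M"
    note [measurable] = coord_measurable[OF i]
    show "(\<integral>\<^sup>+ w. ennreal (exp (?h t (\<omega>, w))) \<partial>noise) \<le> 1"
      unfolding fst_conv snd_conv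
    proof (rule noise_coord_integral[OF i])
      show "(\<integral>\<^sup>+ \<xi>. ennreal (exp (l * (((w(i := \<xi>)) i)\<^sup>2 - 1) - 4 * l\<^sup>2)) \<partial>std_gaussian) \<le> 1" for w
        using gaussian_centred_square_mgf[OF l] by simp
    qed measurable
  qed measurable
  then show ?thesis using i by simp
qed

end

subsection \<open>Concentration of degrees and common neighbours\<close>

lemma finite_graphs: "finite (graphs N)"
proof -
  have "graphs N \<subseteq> (\<lambda>E i j. (i, j) \<in> E) ` Pow (nodes N \<times> nodes N)"
  proof
    fix g assume g: "g \<in> graphs N"
    then have "g = (\<lambda>i j. (i, j) \<in> {(i, j). g i j})" "{(i, j). g i j} \<in> Pow (nodes N \<times> nodes N)"
      by (auto simp: graphs_def)
    then show "g \<in> (\<lambda>E i j. (i, j) \<in> E) ` Pow (nodes N \<times> nodes N)" by blast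
  qed
  then show ?thesis by (rule finite_subset) (simp add: nodes_def)
qed

text \<open>The left side is the moment generating function at l of a Bernoulli variable of mean r.
  The quadratic bound on exp is obtained for negative l from exp l \<le> 1 / (1 - l).\<close>

lemma centred_exp_le:
  fixes r l :: real
  assumes "0 \<le> r" "\<bar>l\<bar> \<le> 1"
  shows "1 + (exp l - 1) * r \<le> exp (r * l + r * l\<^sup>2)"
proof -
  have "exp l \<le> 1 + l + l\<^sup>2"
  proof (cases "0 \<le> l")
    case True
    then show ?thesis using exp_bound[of l] assms by simp
  next
    case False
    have "exp (- (- l)) \<le> 1 + l + l\<^sup>2"
    proof -
      have "1 / (1 + (- l)) \<le> 1 + l + l\<^sup>2"
      proof -
        have "1 \<le> (1 + l + l\<^sup>2) * (1 - l)"
          using False by (simp add: algebra_simps power2_eq_square power3_eq_cube mult_nonneg_nonpos2 mult_nonpos_nonneg)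
        then show ?thesis using False by (simp add: divide_le_eq)
      qed
      moreover have "exp l \<le> 1 / (1 + (- l))"
      proof -
        have "1 + (- l) \<le> exp (- l)" by (rule exp_ge_add_one_self)
        then have "1 / exp (- l) \<le> 1 / (1 + (- l))" using False by (intro divide_left_mono) auto
        then show ?thesis by (simp add: exp_minus inverse_eq_divide)
      qed
      ultimately show ?thesis by simp
    qed
    then show ?thesis by simp
  qed
  then have "(exp l - 1) * r \<le> (l + l\<^sup>2) * r" using assms(1) by (intro mult_right_mono) auto
  then have "1 + (exp l - 1) * r \<le> 1 + (r * l + r * l\<^sup>2)" by (simp add: algebra_simps)
  also have "\<dots> \<le> exp (r * l + r * l\<^sup>2)" by (rule exp_ge_add_one_self)
  finally show ?thesis .
qed

lemma deviation_cases:
  fixes e D S m :: real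
  assumes "0 < e" "e * D < \<bar>S - m\<bar>"
  shows "1 * e / 2 * m + e\<^sup>2 / 2 * D \<le> 1 * e / 2 * S \<or> -1 * e / 2 * m + e\<^sup>2 / 2 * D \<le> -1 * e / 2 * S"
proof (cases "m \<le> S")
  case True
  then have "e / 2 * (e * D) \<le> e / 2 * (S - m)" using assms by (intro mult_left_mono) auto
  then show ?thesis by (simp add: power2_eq_square algebra_simps)
next
  case False
  then have "e / 2 * (e * D) \<le> e / 2 * (m - S)" using assms by (intro mult_left_mono) auto
  then show ?thesis by (simp add: power2_eq_square algebra_simps)
qed

context erdos_renyi
begin

abbreviation "edges \<equiv> {(i, j). i \<in> nodes N \<and> j \<in> nodes N \<and> i < j}"

lemma graph_fun_measurable: "(\<lambda>\<omega>. f (G \<omega>)) \<in> measurable M (count_space UNIV)"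
  by (rule measurable_compose[OF G_measurable]) simp

lemma graph_event: "{\<omega> \<in> space M. P (G \<omega>)} \<in> events"
proof -
  have "{\<omega> \<in> space M. P (G \<omega>)} = G -` {g \<in> graphs N. P g} \<inter> space M" using graph_space by auto
  also have "\<dots> \<in> events" by (rule measurable_sets[OF G_measurable]) auto
  finally show ?thesis .
qed

lemma prob_edge:
  assumes "(i, j) \<in> edges" shows "prob {\<omega> \<in> space M. G \<omega> i j} = p"
proof -
  have "measure (distr M (count_space UNIV) (\<lambda>\<omega>. G \<omega> i j)) {True} = p"
    using G_bernoulli[of i j] assms p_range by (simp add: measure_pmf_single)
  moreover have "measure (distr M (count_space UNIV) (\<lambda>\<omega>. G \<omega> i j)) {True} = prob ((\<lambda>\<omega>. G \<omega> i j) -` {True} \<inter> space M)"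
    using graph_fun_measurable[of "\<lambda>g. g i j"] by (intro measure_distr) auto
  moreover have "(\<lambda>\<omega>. G \<omega> i j) -` {True} \<inter> space M = {\<omega> \<in> space M. G \<omega> i j}" by auto
  ultimately show ?thesis by simp
qed

lemma prob_all_edges:
  assumes "E \<subseteq> edges"
  shows "prob {\<omega> \<in> space M. \<forall>(i, j)\<in>E. G \<omega> i j} = p ^ card E"
proof (cases "E = {}")
  case True
  then show ?thesis by (simp add: prob_space)
next
  case False
  have fin: "finite E" using assms by (rule finite_subset) (rule finite_subset[of _ "nodes N \<times> nodes N"], auto simp: nodes_def)
  have "prob (\<Inter>e\<in>E. (\<lambda>(i, j) \<omega>. G \<omega> i j) e -` {True} \<inter> space M) = (\<Prod>e\<in>E. prob ((\<lambda>(i, j) \<omega>. G \<omega> i j) e -` {True} \<inter> space M))"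
    using indep_varsD[OF G_indep False fin assms, of "\<lambda>_. {True}"] by simp
  also have "\<dots> = (\<Prod>e\<in>E. p)"
  proof (rule prod.cong[OF refl])
    fix e assume e: "e \<in> E"
    obtain i j where ij: "e = (i, j)" by (cases e)
    have "(\<lambda>(i, j) \<omega>. G \<omega> i j) e -` {True} \<inter> space M = {\<omega> \<in> space M. G \<omega> i j}" unfolding ij by auto
    then show "prob ((\<lambda>(i, j) \<omega>. G \<omega> i j) e -` {True} \<inter> space M) = p"
      using prob_edge[of i j] e assms ij by auto
  qed
  also have "(\<Inter>e\<in>E. (\<lambda>(i, j) \<omega>. G \<omega> i j) e -` {True} \<inter> space M) = {\<omega> \<in> space M. \<forall>(i, j)\<in>E. G \<omega> i j}"
    using False by auto
  finally show ?thesis by simp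
qed

text \<open>The exponential of a sum of indicators expands over subsets into probabilities of joint edge sets.\<close>

lemma edge_block_mgf:
  fixes T :: "nat set" and B :: "nat \<Rightarrow> (nat \<times> nat) set"
  assumes T: "finite T" and B: "\<And>l. l \<in> T \<Longrightarrow> B l \<subseteq> edges" "\<And>l. l \<in> T \<Longrightarrow> card (B l) = k"
    and dis: "disjoint_family_on B T" and k: "0 < k"
  shows "expectation (\<lambda>\<omega>. exp (c * (\<Sum>l\<in>T. of_bool (\<forall>(i, j)\<in>B l. G \<omega> i j)))) = (1 + (exp c - 1) * p ^ k) ^ card T"
proof -
  let ?I = "\<lambda>l \<omega>. of_bool (\<forall>(i, j)\<in>B l. G \<omega> i j) :: real"
  have finB: "finite (B l)" if "l \<in> T" for l using B(2)[OF that] k by (metis card_ge_0_finite)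
  have pr: "(\<Prod>l\<in>X. ?I l \<omega>) = of_bool (\<forall>(i, j)\<in>(\<Union>l\<in>X. B l). G \<omega> i j)" if "finite X" for X \<omega>
    using that by (induction X rule: finite_induct) (auto simp: of_bool_conj[symmetric] ball_Un)
  have "exp (c * (\<Sum>l\<in>T. ?I l \<omega>)) = (\<Prod>l\<in>T. (exp c - 1) * ?I l \<omega> + 1)" for \<omega>
  proof -
    have "exp (c * (\<Sum>l\<in>T. ?I l \<omega>)) = (\<Prod>l\<in>T. exp (c * ?I l \<omega>))"
      unfolding sum_distrib_left by (rule exp_sum[OF T])
    also have "\<dots> = (\<Prod>l\<in>T. (exp c - 1) * ?I l \<omega> + 1)" by (intro prod.cong) auto
    finally show ?thesis .
  qed
  also have "(\<Prod>l\<in>T. (exp c - 1) * ?I l \<omega> + 1) = (\<Sum>X\<in>Pow T. (exp c - 1) ^ card X * of_bool (\<forall>(i, j)\<in>(\<Union>l\<in>X. B l). G \<omega> i j))" for \<omega>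
    unfolding prod_add[OF T]
  proof (rule sum.cong[OF refl])
    fix X assume "X \<in> Pow T"
    then have "finite X" using T finite_subset by blast
    then show "(\<Prod>l\<in>X. (exp c - 1) * ?I l \<omega>) * (\<Prod>l\<in>T - X. 1)
        = (exp c - 1) ^ card X * of_bool (\<forall>(i, j)\<in>(\<Union>l\<in>X. B l). G \<omega> i j)"
      by (simp only: prod.distrib prod_constant pr prod.neutral_const mult_1_right power_one)
  qed
  finally have ex: "exp (c * (\<Sum>l\<in>T. ?I l \<omega>)) = (\<Sum>X\<in>Pow T. (exp c - 1) ^ card X * of_bool (\<forall>(i, j)\<in>(\<Union>l\<in>X. B l). G \<omega> i j))" for \<omega> .
  have single: "expectation (\<lambda>\<omega>. (exp c - 1) ^ card X * of_bool (\<forall>(i, j)\<in>(\<Union>l\<in>X. B l). G \<omega> i j)) = (exp c - 1) ^ card X * (p ^ k) ^ card X"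
    and int: "integrable M (\<lambda>\<omega>. (exp c - 1) ^ card X * of_bool (\<forall>(i, j)\<in>(\<Union>l\<in>X. B l). G \<omega> i j))"
    if X: "X \<in> Pow T" for X
  proof -
    let ?E = "\<Union>l\<in>X. B l"
    let ?A = "{\<omega> \<in> space M. \<forall>(i, j)\<in>?E. G \<omega> i j}"
    have finX: "finite X" using X T finite_subset by auto
    \<comment> \<open>Disjoint blocks of equal size give the joint event the probability
      \<open>(p ^ k) ^ card X\<close>, so that the subset expansion folds back into a
      product.\<close>
    have "card ?E = (\<Sum>l\<in>X. card (B l))"
      by (rule card_UN_disjoint'[OF disjoint_family_on_mono[OF _ dis] _ finX]) (use X finB in auto)
    also have "\<dots> = (\<Sum>l\<in>X. k)" using X B(2) by (intro sum.cong) auto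
    finally have card: "card ?E = card X * k" by simp
    have A: "?A \<in> events" by (rule graph_event)
    have ind: "of_bool (\<forall>(i, j)\<in>?E. G \<omega> i j) = (indicator ?A \<omega> :: real)" if "\<omega> \<in> space M" for \<omega>
      using that by (auto simp: indicator_def)
    have "expectation (\<lambda>\<omega>. (exp c - 1) ^ card X * of_bool (\<forall>(i, j)\<in>?E. G \<omega> i j)) = expectation (\<lambda>\<omega>. (exp c - 1) ^ card X * indicator ?A \<omega>)"
      by (intro Bochner_Integration.integral_cong refl) (simp only: ind)
    also have "\<dots> = (exp c - 1) ^ card X * prob ?A" using A by simp
    also have "prob ?A = (p ^ k) ^ card X"
      using prob_all_edges[of ?E] X B(1) card by (force simp: power_mult[symmetric] mult.commute)
    finally show "expectation (\<lambda>\<omega>. (exp c - 1) ^ card X * of_bool (\<forall>(i, j)\<in>?E. G \<omega> i j)) = (exp c - 1) ^ card X * (p ^ k) ^ card X" .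
    have "integrable M (indicator ?A :: 'a \<Rightarrow> real)"
      by (rule integrable_real_indicator[OF A]) (simp add: less_top[symmetric])
    then have "integrable M (\<lambda>\<omega>. (exp c - 1) ^ card X * indicator ?A \<omega> :: real)"
      by (rule integrable_mult_right)
    also have "?this \<longleftrightarrow> integrable M (\<lambda>\<omega>. (exp c - 1) ^ card X * of_bool (\<forall>(i, j)\<in>?E. G \<omega> i j))"
      by (intro Bochner_Integration.integrable_cong refl) (simp only: ind)
    finally show "integrable M (\<lambda>\<omega>. (exp c - 1) ^ card X * of_bool (\<forall>(i, j)\<in>?E. G \<omega> i j))" .
  qed
  have "expectation (\<lambda>\<omega>. exp (c * (\<Sum>l\<in>T. ?I l \<omega>))) = (\<Sum>X\<in>Pow T. expectation (\<lambda>\<omega>. (exp c - 1) ^ card X * of_bool (\<forall>(i, j)\<in>(\<Union>l\<in>X. B l). G \<omega> i j)))"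
    unfolding ex by (rule Bochner_Integration.integral_sum) (rule int)
  also have "\<dots> = (\<Sum>X\<in>Pow T. (\<Prod>l\<in>X. (exp c - 1) * p ^ k) * (\<Prod>l\<in>T - X. 1))"
    by (intro sum.cong refl) (simp only: single prod_constant power_mult_distrib prod.neutral_const mult_1_right power_one)
  also have "\<dots> = (\<Prod>l\<in>T. (exp c - 1) * p ^ k + 1)" by (rule prod_add[OF T, symmetric])
  finally show ?thesis by (simp add: add.commute)
qed

text \<open>Blocks are single edges for degrees and pairs of edges for common neighbours. D is only
  an upper bound on the mean, so both are controlled on the same scale N p although the mean number
  of common neighbours is smaller. The rate e / 2 balances the linear gain e^2 D / 2 against the
  quadratic cost e^2 D / 4, and e \<le> 2 keeps the rate at most 1.\<close>

lemma edge_block_chernoff: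
  fixes T :: "nat set" and B :: "nat \<Rightarrow> (nat \<times> nat) set"
  assumes T: "finite T" and B: "\<And>l. l \<in> T \<Longrightarrow> B l \<subseteq> edges" "\<And>l. l \<in> T \<Longrightarrow> card (B l) = k"
    and dis: "disjoint_family_on B T" and k: "0 < k"
    and D: "real (card T) * p ^ k \<le> D" and e: "0 < e" "e \<le> 2"
  shows "prob {\<omega> \<in> space M. e * D < \<bar>(\<Sum>l\<in>T. of_bool (\<forall>(i, j)\<in>B l. G \<omega> i j)) - real (card T) * p ^ k\<bar>}
    \<le> 2 * exp (- (e\<^sup>2 / 4 * D))"
proof -
  let ?S = "\<lambda>\<omega>. \<Sum>l\<in>T. of_bool (\<forall>(i, j)\<in>B l. G \<omega> i j) :: real" and ?m = "real (card T) * p ^ k"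
  have pk: "0 \<le> p ^ k" using p_range by simp
  have m0: "0 \<le> ?m" using pk by simp
  have one: "prob {\<omega> \<in> space M. \<epsilon> * e / 2 * ?m + e\<^sup>2 / 2 * D \<le> \<epsilon> * e / 2 * ?S \<omega>} \<le> exp (- (e\<^sup>2 / 4 * D))"
    if \<epsilon>: "\<epsilon> = 1 \<or> \<epsilon> = -1" for \<epsilon> :: real
  proof -
    let ?c = "\<epsilon> * e / 2"
    have c: "\<bar>?c\<bar> \<le> 1" "?c\<^sup>2 = e\<^sup>2 / 4" using \<epsilon> e by (auto simp: power_divide)
    have meas: "(\<lambda>\<omega>. exp (?c * ?S \<omega>)) \<in> borel_measurable M"
      by (rule measurable_compose[OF G_measurable]) simp
    have int: "integrable M (\<lambda>\<omega>. exp (?c * ?S \<omega>))"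
    proof (rule integrable_const_bound[where B = "exp (1 * real (card T))"])
      have "?S \<omega> \<le> real (card T)" for \<omega>
      proof -
        have "?S \<omega> \<le> (\<Sum>l\<in>T. 1)" by (rule sum_mono) simp
        also have "\<dots> = real (card T)" by simp
        finally show ?thesis .
      qed
      moreover have "0 \<le> ?S \<omega>" for \<omega> by (intro sum_nonneg) auto
      ultimately have "?c * ?S \<omega> \<le> 1 * real (card T)" for \<omega>
        using c(1) mult_mono[of "\<bar>?c\<bar>" 1 "?S \<omega>" "real (card T)"] mult_right_mono[OF abs_ge_self[of ?c], of "?S \<omega>"] by force
      then show "AE \<omega> in M. norm (exp (?c * ?S \<omega>)) \<le> exp (1 * real (card T))" by simp
    qed (rule meas)
    let ?a = "exp (?c * ?m + e\<^sup>2 / 2 * D)"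
    have "prob {\<omega> \<in> space M. ?a \<le> exp (?c * ?S \<omega>)} \<le> expectation (\<lambda>\<omega>. exp (?c * ?S \<omega>)) / ?a"
      by (rule integral_Markov_inequality_measure[OF int sets.empty_sets]) auto
    also have "\<dots> \<le> exp (?c * ?m + e\<^sup>2 / 4 * D) / ?a"
    proof (rule divide_right_mono)
      have "expectation (\<lambda>\<omega>. exp (?c * ?S \<omega>)) = (1 + (exp ?c - 1) * p ^ k) ^ card T"
        by (rule edge_block_mgf[OF T B dis k])
      also have "\<dots> \<le> exp (p ^ k * ?c + p ^ k * ?c\<^sup>2) ^ card T"
      proof (rule power_mono[OF centred_exp_le[OF pk c(1)]])
        have "- 1 * p ^ k \<le> (exp ?c - 1) * p ^ k" using pk by (intro mult_right_mono) auto
        moreover have "p ^ k \<le> 1" using p_range by (simp add: power_le_one)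
        ultimately show "0 \<le> 1 + (exp ?c - 1) * p ^ k" by linarith
      qed
      also have "\<dots> = exp (?c * ?m + e\<^sup>2 / 4 * ?m)"
        unfolding c(2) by (simp add: exp_of_nat_mult[symmetric] algebra_simps)
      also have "\<dots> \<le> exp (?c * ?m + e\<^sup>2 / 4 * D)"
        using D by (auto intro!: mult_left_mono)
      finally show "expectation (\<lambda>\<omega>. exp (?c * ?S \<omega>)) \<le> exp (?c * ?m + e\<^sup>2 / 4 * D)" .
    qed simp
    also have "\<dots> = exp (- (e\<^sup>2 / 4 * D))" by (simp add: exp_diff[symmetric])
    finally have "prob {\<omega> \<in> space M. ?a \<le> exp (?c * ?S \<omega>)} \<le> exp (- (e\<^sup>2 / 4 * D))" .
    then show ?thesis by (simp only: exp_le_cancel_iff)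
  qed
  have ev: "{\<omega> \<in> space M. \<epsilon> * e / 2 * ?m + e\<^sup>2 / 2 * D \<le> \<epsilon> * e / 2 * ?S \<omega>} \<in> events" for \<epsilon> :: real
    by (rule graph_event[of "\<lambda>g. \<epsilon> * e / 2 * ?m + e\<^sup>2 / 2 * D \<le> \<epsilon> * e / 2 * (\<Sum>l\<in>T. of_bool (\<forall>(i, j)\<in>B l. g i j))"])
  have "prob {\<omega> \<in> space M. e * D < \<bar>?S \<omega> - ?m\<bar>}
    \<le> prob ({\<omega> \<in> space M. 1 * e / 2 * ?m + e\<^sup>2 / 2 * D \<le> 1 * e / 2 * ?S \<omega>}
        \<union> {\<omega> \<in> space M. -1 * e / 2 * ?m + e\<^sup>2 / 2 * D \<le> -1 * e / 2 * ?S \<omega>})"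
  proof (rule finite_measure_mono)
    show "{\<omega> \<in> space M. e * D < \<bar>?S \<omega> - ?m\<bar>} \<subseteq> {\<omega> \<in> space M. 1 * e / 2 * ?m + e\<^sup>2 / 2 * D \<le> 1 * e / 2 * ?S \<omega>}
        \<union> {\<omega> \<in> space M. -1 * e / 2 * ?m + e\<^sup>2 / 2 * D \<le> -1 * e / 2 * ?S \<omega>}"
    proof
      fix \<omega> assume w: "\<omega> \<in> {\<omega> \<in> space M. e * D < \<bar>?S \<omega> - ?m\<bar>}"
      then have "1 * e / 2 * ?m + e\<^sup>2 / 2 * D \<le> 1 * e / 2 * ?S \<omega> \<or> -1 * e / 2 * ?m + e\<^sup>2 / 2 * D \<le> -1 * e / 2 * ?S \<omega>"
        using deviation_cases[OF e(1), of D "?S \<omega>" ?m] by blast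
      then show "\<omega> \<in> {\<omega> \<in> space M. 1 * e / 2 * ?m + e\<^sup>2 / 2 * D \<le> 1 * e / 2 * ?S \<omega>}
        \<union> {\<omega> \<in> space M. -1 * e / 2 * ?m + e\<^sup>2 / 2 * D \<le> -1 * e / 2 * ?S \<omega>}"
        using w by blast
    qed
  qed (rule sets.Un[OF ev[of 1] ev[of "-1"]])
  also have "\<dots> \<le> prob {\<omega> \<in> space M. 1 * e / 2 * ?m + e\<^sup>2 / 2 * D \<le> 1 * e / 2 * ?S \<omega>}
      + prob {\<omega> \<in> space M. -1 * e / 2 * ?m + e\<^sup>2 / 2 * D \<le> -1 * e / 2 * ?S \<omega>}"
    using ev[of 1] ev[of "-1"] by (rule measure_Un_le)
  also have "\<dots> \<le> exp (- (e\<^sup>2 / 4 * D)) + exp (- (e\<^sup>2 / 4 * D))"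
    by (rule add_mono[OF one one]) auto
  finally show ?thesis by simp
qed

end

subsection \<open>Stationarity and tails of the state\<close>

context diffusion_network
begin

lemma var_step_measurable:
  "(\<lambda>(v, w). restrict (var_step N a \<sigma> v w) V) \<in> measurable (vec_space N \<Otimes>\<^sub>M vec_space N) (vec_space N)"
  unfolding vec_space_def split_beta'
proof (rule measurable_restrict)
  fix i assume i: "i \<in> V"
  have [measurable]: "(\<lambda>z. fst z l) \<in> borel_measurable (Pi\<^sub>M V (\<lambda>_. borel) \<Otimes>\<^sub>M Pi\<^sub>M V (\<lambda>_. borel))" if "l \<in> V" for l
    by (rule measurable_compose[OF measurable_fst measurable_component_singleton[OF that]])
  have [measurable]: "(\<lambda>z. snd z i) \<in> borel_measurable (Pi\<^sub>M V (\<lambda>_. borel) \<Otimes>\<^sub>M Pi\<^sub>M V (\<lambda>_. borel))"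
    by (rule measurable_compose[OF measurable_snd measurable_component_singleton[OF i]])
  show "(\<lambda>z. var_step N a \<sigma> (fst z) (snd z) i) \<in> borel_measurable (Pi\<^sub>M V (\<lambda>_. borel) \<Otimes>\<^sub>M Pi\<^sub>M V (\<lambda>_. borel))"
    unfolding var_step_def by measurable
qed

lemma y_vec_past: "(\<lambda>\<omega>. restrict (y \<omega> t) V) \<in> measurable (past t) (vec_space N)"
  unfolding vec_space_def by (intro measurable_restrict y_past)

lemma graph_past: "{\<omega> \<in> space M. G \<omega> = g} \<in> sets (past t)"
proof -
  have "{\<omega> \<in> space M. G \<omega> = g} = G -` ({g} \<inter> graphs N) \<inter> space (past t)"
    using graph_space by auto
  also have "\<dots> \<in> sets (past t)" by (rule measurable_sets[OF G_past]) auto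
  finally show ?thesis .
qed

text \<open>The event that the graph equals g belongs to the past, so conditioning on it leaves the
  next noise independent of the current state, and one step preserves the stationary law of
  \<open>\<pi> g\<close>.\<close>

lemma conditional_law:
  assumes N: "1 \<le> N" and g: "g \<in> graphs N" "prob {\<omega> \<in> space M. G \<omega> = g} > 0"
  defines "U \<equiv> uniform_measure M {\<omega> \<in> space M. G \<omega> = g}"
  shows "distr U (vec_space N) (\<lambda>\<omega>. restrict (y \<omega> t) V) = distr U (vec_space N) (\<lambda>\<omega>. restrict (y \<omega> 0) V)"
    (is "?D t = ?D 0")
proof (induction t)
  case (Suc t)
  interpret noise: prob_space noise by (rule prob_space_noise)
  let ?A = "{\<omega> \<in> space M. G \<omega> = g}"
  let ?Y = "\<lambda>t \<omega>. restrict (y \<omega> t) V"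
  let ?st = "\<lambda>(v, w). restrict (var_step N (\<pi> g) \<sigma> v w) V"
  have A: "?A \<in> events" by (rule graph_event[of "\<lambda>h. h = g"])
  have Ap [measurable]: "?A \<in> sets (past t)" by (rule graph_past)
  have st [measurable]: "?st \<in> measurable (vec_space N \<Otimes>\<^sub>M vec_space N) (vec_space N)" by (rule var_step_measurable)
  have Yp [measurable]: "?Y t \<in> measurable (past t) (vec_space N)" by (rule y_vec_past)
  have YM: "?Y t \<in> measurable M (vec_space N)" for t by (rule measurable_past[OF y_vec_past])
  have YU: "?Y t \<in> measurable U (vec_space N)" for t using YM unfolding U_def by simp
  have stat: "distr (?D 0 \<Otimes>\<^sub>M noise) (vec_space N) ?st = ?D 0"
    using y0_stationary[OF g] unfolding stationary_law_def U_def by blast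
  show ?case
  proof (rule measure_eqI)
    fix C assume "C \<in> sets (?D (Suc t))"
    then have C [measurable]: "C \<in> sets (vec_space N)" by simp
    \<comment> \<open>On this event the random matrix is the fixed \<open>\<pi> g\<close>, so the
      next state is a fixed function of the current state and the next noise.\<close>
    have step: "indicator C (?Y (Suc t) \<omega>) * indicator ?A \<omega>
        = (indicator C (?st (?Y t \<omega>, innov (Suc t) \<omega>)) * indicator ?A \<omega> :: ennreal)" if \<omega>: "\<omega> \<in> space M" for \<omega>
    proof (cases "G \<omega> = g")
      case True
      have "?Y (Suc t) \<omega> = ?st (?Y t \<omega>, innov (Suc t) \<omega>)"
        using dynamics[OF \<omega>, of "Suc t"] True by (auto simp: restrict_def fun_eq_iff var_step_def)
      then show ?thesis by simp
    qed (use \<omega> in simp)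
    have m2: "(\<lambda>z. indicator C (?st (?Y t (fst z), snd z)) * indicator ?A (fst z) :: ennreal) \<in> borel_measurable (past t \<Otimes>\<^sub>M vec_space N)"
      by measurable
    have m3: "(\<lambda>v. \<integral>\<^sup>+ w. indicator C (?st (v, w)) \<partial>noise) \<in> borel_measurable (vec_space N)"
    proof -
      have "(\<lambda>z. indicator C (?st z) :: ennreal) \<in> borel_measurable (vec_space N \<Otimes>\<^sub>M noise)"
        by (subst measurable_cong_sets[OF sets_pair_measure_cong[OF refl sets_noise] refl]) measurable
      from noise.borel_measurable_nn_integral_fst[OF this] show ?thesis .
    qed
    have "emeasure (?D (Suc t)) C = (\<integral>\<^sup>+ v. indicator C v \<partial>?D (Suc t))" by simp
    also have "\<dots> = (\<integral>\<^sup>+ \<omega>. indicator C (?Y (Suc t) \<omega>) \<partial>U)"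
      by (rule nn_integral_distr[OF YU]) simp
    also have "\<dots> = (\<integral>\<^sup>+ \<omega>. indicator C (?Y (Suc t) \<omega>) * indicator ?A \<omega> \<partial>M) / emeasure M ?A"
      unfolding U_def using YM A by (intro nn_integral_uniform_measure) auto
    also have "(\<integral>\<^sup>+ \<omega>. indicator C (?Y (Suc t) \<omega>) * indicator ?A \<omega> \<partial>M)
        = (\<integral>\<^sup>+ \<omega>. (\<lambda>z. indicator C (?st (?Y t (fst z), snd z)) * indicator ?A (fst z)) (\<omega>, innov (Suc t) \<omega>) \<partial>M)"
      by (intro nn_integral_cong) (simp only: step fst_conv snd_conv)
    also have "\<dots> = (\<integral>\<^sup>+ \<omega>. \<integral>\<^sup>+ w. (\<lambda>z. indicator C (?st (?Y t (fst z), snd z)) * indicator ?A (fst z)) (\<omega>, w) \<partial>noise \<partial>M)"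
      by (rule nn_integral_innov[OF N m2])
    also have "\<dots> = (\<integral>\<^sup>+ \<omega>. (\<integral>\<^sup>+ w. indicator C (?st (?Y t \<omega>, w)) \<partial>noise) * indicator ?A \<omega> \<partial>M)"
    proof (rule nn_integral_cong)
      fix \<omega> assume "\<omega> \<in> space M"
      then have v: "?Y t \<omega> \<in> space (vec_space N)" using measurable_space[OF YM] by blast
      have "(\<lambda>w. indicator C (?st (?Y t \<omega>, w)) :: ennreal) \<in> borel_measurable (vec_space N)"
        using measurable_compose[OF measurable_Pair1'[OF v] st] by (intro measurable_compose[OF _ borel_measurable_indicator[OF C]])
      then have "(\<lambda>w. indicator C (?st (?Y t \<omega>, w)) :: ennreal) \<in> borel_measurable noise"
        by (simp cong: measurable_cong_sets add: sets_noise)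
      then show "(\<integral>\<^sup>+ w. (\<lambda>z. indicator C (?st (?Y t (fst z), snd z)) * indicator ?A (fst z)) (\<omega>, w) \<partial>noise)
          = (\<integral>\<^sup>+ w. indicator C (?st (?Y t \<omega>, w)) \<partial>noise) * indicator ?A \<omega>"
        by (simp only: fst_conv snd_conv nn_integral_multc)
    qed
    also have "\<dots> / emeasure M ?A = (\<integral>\<^sup>+ \<omega>. (\<integral>\<^sup>+ w. indicator C (?st (?Y t \<omega>, w)) \<partial>noise) \<partial>U)"
      unfolding U_def using YM A m3 by (intro nn_integral_uniform_measure[symmetric]) (auto intro: measurable_compose)
    also have "\<dots> = (\<integral>\<^sup>+ v. (\<integral>\<^sup>+ w. indicator C (?st (v, w)) \<partial>noise) \<partial>?D t)"
      by (rule nn_integral_distr[OF YU, symmetric]) (use m3 in simp)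
    also have "\<dots> = (\<integral>\<^sup>+ z. indicator C (?st z) \<partial>(?D 0 \<Otimes>\<^sub>M noise))"
    proof -
      have "(\<lambda>z. indicator C (?st z) :: ennreal) \<in> borel_measurable (?D 0 \<Otimes>\<^sub>M noise)"
        by (subst measurable_cong_sets[OF sets_pair_measure_cong[OF sets_distr sets_noise] refl]) measurable
      then show ?thesis unfolding Suc.IH by (rule noise.nn_integral_fst)
    qed
    also have "\<dots> = emeasure (distr (?D 0 \<Otimes>\<^sub>M noise) (vec_space N) ?st) C"
    proof -
      have m: "?st \<in> measurable (?D 0 \<Otimes>\<^sub>M noise) (vec_space N)"
        by (subst measurable_cong_sets[OF sets_pair_measure_cong[OF sets_distr sets_noise] refl]) (rule st)
      have "emeasure (distr (?D 0 \<Otimes>\<^sub>M noise) (vec_space N) ?st) C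
          = (\<integral>\<^sup>+ v. indicator C v \<partial>distr (?D 0 \<Otimes>\<^sub>M noise) (vec_space N) ?st)" by simp
      also have "\<dots> = (\<integral>\<^sup>+ z. indicator C (?st z) \<partial>(?D 0 \<Otimes>\<^sub>M noise))"
        by (rule nn_integral_distr[OF m]) simp
      finally show ?thesis ..
    qed
    finally show "emeasure (?D (Suc t)) C = emeasure (?D 0) C" unfolding stat .
  qed simp
qed simp

text \<open>The conditional laws are added up over the finitely many graphs; graphs of probability 0
  contribute nothing on either side.\<close>

lemma stationary:
  assumes N: "1 \<le> N" and C: "C \<in> sets (vec_space N)"
  shows "prob {\<omega> \<in> space M. restrict (y \<omega> t) V \<in> C} = prob {\<omega> \<in> space M. restrict (y \<omega> 0) V \<in> C}"
proof -
  let ?Y = "\<lambda>t \<omega>. restrict (y \<omega> t) V"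
  let ?E = "\<lambda>t g. {\<omega> \<in> space M. G \<omega> = g} \<inter> (?Y t -` C \<inter> space M)"
  have YM: "?Y t \<in> measurable M (vec_space N)" for t by (rule measurable_past[OF y_vec_past])
  have Y: "?Y t -` C \<inter> space M \<in> events" for t by (rule measurable_sets[OF YM C])
  have A: "{\<omega> \<in> space M. G \<omega> = g} \<in> events" for g by (rule graph_event[of "\<lambda>h. h = g"])
  have each: "prob (?E t g) = prob (?E 0 g)" if g: "g \<in> graphs N" for g
  proof (cases "prob {\<omega> \<in> space M. G \<omega> = g} > 0")
    case True
    let ?A = "{\<omega> \<in> space M. G \<omega> = g}"
    have em: "emeasure (distr (uniform_measure M ?A) (vec_space N) (?Y t)) C = emeasure M (?E t g) / emeasure M ?A" for t
    proof -
      have "emeasure (distr (uniform_measure M ?A) (vec_space N) (?Y t)) C = emeasure (uniform_measure M ?A) (?Y t -` C \<inter> space M)"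
        using YM C by (subst emeasure_distr) auto
      also have "\<dots> = emeasure M (?E t g) / emeasure M ?A" by (rule emeasure_uniform_measure[OF A Y])
      finally show ?thesis .
    qed
    have "emeasure M (?E t g) / emeasure M ?A = emeasure M (?E 0 g) / emeasure M ?A"
      using conditional_law[OF N g True, of t] em by metis
    then have "prob (?E t g) / prob ?A = prob (?E 0 g) / prob ?A"
      using True by (simp add: emeasure_eq_measure divide_ennreal)
    then show ?thesis using True by simp
  next
    case False
    have le: "prob (?E s g) \<le> prob {\<omega> \<in> space M. G \<omega> = g}" for s
      by (rule finite_measure_mono[OF Int_lower1 A])
    have "prob (?E s g) = 0" for s
      by (rule order_antisym[OF order_trans[OF le] measure_nonneg]) (use False in linarith)
    then show ?thesis by (simp only:)
  qed
  have "prob (?Y t -` C \<inter> space M) = (\<Sum>g\<in>graphs N. prob (?E t g))" for t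
  proof -
    have "?Y t -` C \<inter> space M = (\<Union>g\<in>graphs N. ?E t g)" using graph_space by auto
    moreover have "prob (\<Union>g\<in>graphs N. ?E t g) = (\<Sum>g\<in>graphs N. prob (?E t g))"
      by (rule finite_measure_finite_Union) (use A Y finite_graphs in \<open>auto simp: disjoint_family_on_def\<close>)
    ultimately show ?thesis by simp
  qed
  then have "prob (?Y t -` C \<inter> space M) = prob (?Y 0 -` C \<inter> space M)" by (simp add: each cong: sum.cong)
  moreover have "{\<omega> \<in> space M. ?Y t \<omega> \<in> C} = ?Y t -` C \<inter> space M" for t by auto
  ultimately show ?thesis by simp
qed

end

lemma compensated_le:
  fixes a b h s v w :: real
  assumes "a = b" "h = b - v / 2" "w / 2 + s \<le> a" "v \<le> w"
  shows "s \<le> h"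
  using assms by linarith

section \<open>Unrolling the recursion and the tail of the state\<close>

context diffusion_network
begin

text \<open>Row i of the n-th power of the matrix \<open>\<pi> g\<close>, built by multiplication on
  the right, which is the order in which unrolling goes back in time.\<close>

definition flow :: "graph \<Rightarrow> nat \<Rightarrow> nat \<Rightarrow> nat \<Rightarrow> real" where
  "flow g i = rec_nat (\<lambda>l. of_bool (l = i)) (\<lambda>_ u l. \<Sum>n\<in>V. u n * \<pi> g n l)"

lemma flow_simps:
  "flow g i 0 l = of_bool (l = i)" "flow g i (Suc n) l = (\<Sum>k\<in>V. flow g i n k * \<pi> g k l)"
  by (simp_all add: flow_def)

lemma diffusion_at: "\<omega> \<in> space M \<Longrightarrow> i \<in> V \<Longrightarrow> l \<in> V \<Longrightarrow> 0 \<le> \<pi> (G \<omega>) i l"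
  "\<omega> \<in> space M \<Longrightarrow> i \<in> V \<Longrightarrow> (\<Sum>l\<in>V. \<pi> (G \<omega>) i l) = \<rho>"
  "\<omega> \<in> space M \<Longrightarrow> 0 < \<rho> \<and> \<rho> < 1"
  using diffusion[of \<omega>] unfolding regular_diffusion_def by (blast, blast, linarith)

lemma rho_range: "0 < \<rho>" "\<rho> < 1"
  using diffusion_at(3) not_empty by blast+

lemma flow_nonneg:
  assumes \<omega>: "\<omega> \<in> space M" and i: "i \<in> V"
  shows "l \<in> V \<Longrightarrow> 0 \<le> flow (G \<omega>) i n l" "(\<Sum>l\<in>V. flow (G \<omega>) i n l) = \<rho> ^ n"
proof -
  have "(\<forall>l\<in>V. 0 \<le> flow (G \<omega>) i n l) \<and> (\<Sum>l\<in>V. flow (G \<omega>) i n l) = \<rho> ^ n"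
  proof (induction n)
    case 0
    then show ?case using i finite_V sum_of_bool_mult(2)[OF finite_V i, of "\<lambda>_. 1"] by (simp add: flow_simps)
  next
    case (Suc n)
    have "(\<Sum>l\<in>V. flow (G \<omega>) i (Suc n) l) = (\<Sum>k\<in>V. flow (G \<omega>) i n k * (\<Sum>l\<in>V. \<pi> (G \<omega>) k l))"
      unfolding flow_simps sum_distrib_left by (rule sum.swap)
    also have "\<dots> = (\<Sum>k\<in>V. flow (G \<omega>) i n k * \<rho>)"
      by (intro sum.cong refl) (simp only: diffusion_at(2)[OF \<omega>])
    also have "\<dots> = \<rho> ^ Suc n" using Suc.IH by (simp flip: sum_distrib_right)
    finally have "(\<Sum>l\<in>V. flow (G \<omega>) i (Suc n) l) = \<rho> ^ Suc n" .
    moreover have "0 \<le> flow (G \<omega>) i (Suc n) l" if "l \<in> V" for l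
      unfolding flow_simps using Suc.IH diffusion_at(1)[OF \<omega>] that by (intro sum_nonneg mult_nonneg_nonneg) auto
    ultimately show ?case by blast
  qed
  then show "l \<in> V \<Longrightarrow> 0 \<le> flow (G \<omega>) i n l" "(\<Sum>l\<in>V. flow (G \<omega>) i n l) = \<rho> ^ n" by blast+
qed

lemma flow_square_sum:
  assumes "\<omega> \<in> space M" "i \<in> V" shows "(\<Sum>l\<in>V. (flow (G \<omega>) i n l)\<^sup>2) \<le> (\<rho>\<^sup>2) ^ n"
proof -
  have "(\<Sum>l\<in>V. (flow (G \<omega>) i n l)\<^sup>2) \<le> (\<Sum>l\<in>V. flow (G \<omega>) i n l * \<rho> ^ n)"
    unfolding power2_eq_square
  proof (intro sum_mono mult_left_mono)
    fix l assume l: "l \<in> V"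
    have "flow (G \<omega>) i n l \<le> (\<Sum>l\<in>V. flow (G \<omega>) i n l)"
      by (rule member_le_sum[OF l]) (use flow_nonneg(1)[OF assms] finite_V in auto)
    then show "flow (G \<omega>) i n l \<le> \<rho> ^ n" using flow_nonneg(2)[OF assms] by simp
  qed (rule flow_nonneg(1)[OF assms])
  also have "\<dots> = (\<rho>\<^sup>2) ^ n"
    using flow_nonneg(2)[OF assms, of n] by (simp add: sum_distrib_right[symmetric] power_mult_distrib[symmetric] power2_eq_square)
  finally show ?thesis .
qed

lemma y_unroll:
  assumes \<omega>: "\<omega> \<in> space M" and i: "i \<in> V"
  shows "k \<le> T \<Longrightarrow> y \<omega> T i = (\<Sum>l\<in>V. flow (G \<omega>) i k l * y \<omega> (T - k) l)
    + (\<Sum>t\<in>{T - k..<T}. \<sigma> * (\<Sum>l\<in>V. flow (G \<omega>) i (T - Suc t) l * x \<omega> (Suc t) l))"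
proof (induction k)
  case 0
  then show ?case using sum_of_bool_mult(2)[OF finite_V i, of "\<lambda>l. y \<omega> T l"] by (simp add: flow_simps mult.commute)
next
  case (Suc k)
  define s where "s = T - Suc k"
  have s: "T - k = Suc s" "T - Suc s = k" "T - Suc k = s" using Suc.prems by (auto simp: s_def)
  have "(\<Sum>l\<in>V. flow (G \<omega>) i k l * y \<omega> (Suc s) l)
      = (\<Sum>l\<in>V. (\<Sum>n\<in>V. flow (G \<omega>) i k l * \<pi> (G \<omega>) l n * y \<omega> s n) + \<sigma> * (flow (G \<omega>) i k l * x \<omega> (Suc s) l))"
    by (intro sum.cong refl) (simp add: dynamics[OF \<omega>] var_step_def algebra_simps sum_distrib_left)
  also have "\<dots> = (\<Sum>n\<in>V. flow (G \<omega>) i (Suc k) n * y \<omega> s n) + \<sigma> * (\<Sum>l\<in>V. flow (G \<omega>) i k l * x \<omega> (Suc s) l)"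
    unfolding sum.distrib flow_simps sum_distrib_left[symmetric] sum_distrib_right by (subst sum.swap) simp
  finally have *: "(\<Sum>l\<in>V. flow (G \<omega>) i k l * y \<omega> (T - k) l)
      = (\<Sum>n\<in>V. flow (G \<omega>) i (Suc k) n * y \<omega> s n) + \<sigma> * (\<Sum>l\<in>V. flow (G \<omega>) i (T - Suc s) l * x \<omega> (Suc s) l)"
    unfolding s .
  have "{s..<T} = insert s {T - k..<T}" using s Suc.prems by auto
  then have "(\<Sum>t\<in>{s..<T}. \<sigma> * (\<Sum>l\<in>V. flow (G \<omega>) i (T - Suc t) l * x \<omega> (Suc t) l))
      = \<sigma> * (\<Sum>l\<in>V. flow (G \<omega>) i (T - Suc s) l * x \<omega> (Suc s) l)
        + (\<Sum>t\<in>{T - k..<T}. \<sigma> * (\<Sum>l\<in>V. flow (G \<omega>) i (T - Suc t) l * x \<omega> (Suc t) l))"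
    using s by simp
  then show ?case using Suc * unfolding s(3) by simp
qed

lemma y_eq_forced:
  assumes "\<omega> \<in> space M" "i \<in> V"
  shows "y \<omega> T i = (\<Sum>l\<in>V. flow (G \<omega>) i T l * y \<omega> 0 l)
    + (\<Sum>t\<in>{0..<T}. \<sigma> * (\<Sum>l\<in>V. flow (G \<omega>) i (T - Suc t) l * x \<omega> (Suc t) l))"
  using y_unroll[OF assms, of T T] by simp

abbreviation "kap \<equiv> 1 / (1 - \<rho>)"

text \<open>The noise weights depend on the graph alone and are known at time 0. The compensator is
  at most half of \<sigma>^2 times a geometric series in \<rho>^2, so the threshold does not depend
  on T. The rate e = 1 or -1 gives an exponential tail, which is enough for a union over N
  nodes.\<close>

lemma forced_tail:
  assumes N: "1 \<le> N" and i: "i \<in> V" and e: "e = 1 \<or> e = -1"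
  shows "prob {\<omega> \<in> space M. \<sigma>\<^sup>2 * kap / 2 + s \<le> e * (\<Sum>t\<in>{0..<T}. \<sigma> * (\<Sum>l\<in>V. flow (G \<omega>) i (T - Suc t) l * x \<omega> (Suc t) l))} \<le> exp (- s)"
proof -
  let ?u = "\<lambda>t \<omega> l. e * \<sigma> * flow (G \<omega>) i (T - Suc t) l"
  let ?h = "\<lambda>t z. (\<Sum>l\<in>V. ?u t (fst z) l * snd z l) - (\<Sum>l\<in>V. (?u t (fst z) l)\<^sup>2) / 2"
  have e2: "e\<^sup>2 = 1" using e by auto
  have hm: "?h t \<in> borel_measurable (past t \<Otimes>\<^sub>M vec_space N)" for t
  proof -
    have [measurable]: "(\<lambda>z. ?u t (fst z) l) \<in> borel_measurable (past t \<Otimes>\<^sub>M vec_space N)" for l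
      by (rule measurable_compose[OF measurable_fst graph_function_past])
    note [measurable] = pair_coord_measurable
    show ?thesis by measurable
  qed
  have hl: "(\<integral>\<^sup>+ w. ennreal (exp (?h t (\<omega>, w))) \<partial>noise) \<le> 1" for t \<omega>
    unfolding fst_conv snd_conv by (rule noise_linear_mgf)
  note tail_meas = exponential_tail(1)[where h = ?h and k = 0 and m = T, OF N hm hl]
    and tail = exponential_tail(2)[where h = ?h and k = 0 and m = T and s = s, OF N hm hl]
  have "prob {\<omega> \<in> space M. \<sigma>\<^sup>2 * kap / 2 + s \<le> e * (\<Sum>t\<in>{0..<T}. \<sigma> * (\<Sum>l\<in>V. flow (G \<omega>) i (T - Suc t) l * x \<omega> (Suc t) l))}
      \<le> prob {\<omega> \<in> space M. s \<le> (\<Sum>t\<in>{0..<T}. ?h t (\<omega>, innov (Suc t) \<omega>))}"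
  proof (rule finite_measure_mono)
    show "{\<omega> \<in> space M. s \<le> (\<Sum>t\<in>{0..<T}. ?h t (\<omega>, innov (Suc t) \<omega>))} \<in> events"
      using tail_meas by measurable
    show "{\<omega> \<in> space M. \<sigma>\<^sup>2 * kap / 2 + s \<le> e * (\<Sum>t\<in>{0..<T}. \<sigma> * (\<Sum>l\<in>V. flow (G \<omega>) i (T - Suc t) l * x \<omega> (Suc t) l))}
        \<subseteq> {\<omega> \<in> space M. s \<le> (\<Sum>t\<in>{0..<T}. ?h t (\<omega>, innov (Suc t) \<omega>))}"
    proof
      fix \<omega> assume w: "\<omega> \<in> {\<omega> \<in> space M. \<sigma>\<^sup>2 * kap / 2 + s \<le> e * (\<Sum>t\<in>{0..<T}. \<sigma> * (\<Sum>l\<in>V. flow (G \<omega>) i (T - Suc t) l * x \<omega> (Suc t) l))}"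
      then have \<omega>: "\<omega> \<in> space M" by simp
      have sq: "(\<Sum>l\<in>V. (?u t \<omega> l)\<^sup>2) \<le> \<sigma>\<^sup>2 * (\<rho>\<^sup>2) ^ (T - Suc t)" for t
      proof -
        have "(\<Sum>l\<in>V. (?u t \<omega> l)\<^sup>2) = \<sigma>\<^sup>2 * (\<Sum>l\<in>V. (flow (G \<omega>) i (T - Suc t) l)\<^sup>2)"
          by (simp add: power_mult_distrib e2 sum_distrib_left)
        then show ?thesis using flow_square_sum[OF \<omega> i] by (simp add: mult_left_mono)
      qed
      have "(\<Sum>t\<in>{0..<T}. (\<rho>\<^sup>2) ^ (T - Suc t)) = (\<Sum>n<T. (\<rho>\<^sup>2) ^ n)"
        using sum.nat_diff_reindex[of "\<lambda>n. (\<rho>\<^sup>2) ^ n" T] by (simp add: lessThan_atLeast0)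
      also have "\<dots> \<le> 1 / (1 - \<rho>\<^sup>2)"
        using sum_le_suminf[OF summable_geometric[of "\<rho>\<^sup>2"], of "{..<T}"] rho_range suminf_geometric[of "\<rho>\<^sup>2"]
        by (simp add: power_less_one_iff)
      also have "\<dots> \<le> kap"
      proof -
        have "\<rho>\<^sup>2 \<le> \<rho>" "\<rho>\<^sup>2 < 1" using rho_range by (simp_all add: power2_eq_square mult_left_le power_less_one_iff[of \<rho> 2, unfolded power2_eq_square])
        then show ?thesis using rho_range by (intro divide_left_mono) auto
      qed
      finally have geo: "(\<Sum>t\<in>{0..<T}. (\<rho>\<^sup>2) ^ (T - Suc t)) \<le> kap" .
      have "(\<Sum>t\<in>{0..<T}. \<Sum>l\<in>V. (?u t \<omega> l)\<^sup>2) \<le> (\<Sum>t\<in>{0..<T}. \<sigma>\<^sup>2 * (\<rho>\<^sup>2) ^ (T - Suc t))" by (intro sum_mono sq)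
      also have "\<dots> \<le> \<sigma>\<^sup>2 * kap" unfolding sum_distrib_left[symmetric] using geo by (intro mult_left_mono) auto
      finally have *: "(\<Sum>t\<in>{0..<T}. \<Sum>l\<in>V. (?u t \<omega> l)\<^sup>2) \<le> \<sigma>\<^sup>2 * kap" .
      have "e * (\<Sum>t\<in>{0..<T}. \<sigma> * (\<Sum>l\<in>V. flow (G \<omega>) i (T - Suc t) l * x \<omega> (Suc t) l))
          = (\<Sum>t\<in>{0..<T}. \<Sum>l\<in>V. ?u t \<omega> l * x \<omega> (Suc t) l)"
        by (simp add: sum_distrib_left mult.assoc)
      moreover have "(\<Sum>t\<in>{0..<T}. ?h t (\<omega>, innov (Suc t) \<omega>))
          = (\<Sum>t\<in>{0..<T}. \<Sum>l\<in>V. ?u t \<omega> l * x \<omega> (Suc t) l) - (\<Sum>t\<in>{0..<T}. \<Sum>l\<in>V. (?u t \<omega> l)\<^sup>2) / 2"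
        by (simp add: sum_subtractf sum_divide_distrib)
      moreover have "\<sigma>\<^sup>2 * kap / 2 + s \<le> e * (\<Sum>t\<in>{0..<T}. \<sigma> * (\<Sum>l\<in>V. flow (G \<omega>) i (T - Suc t) l * x \<omega> (Suc t) l))"
        using w by blast
      ultimately have "s \<le> (\<Sum>t\<in>{0..<T}. ?h t (\<omega>, innov (Suc t) \<omega>))"
        by (rule compensated_le[OF _ _ _ *])
      then show "\<omega> \<in> {\<omega> \<in> space M. s \<le> (\<Sum>t\<in>{0..<T}. ?h t (\<omega>, innov (Suc t) \<omega>))}"
        using \<omega> by blast
    qed
  qed
  then show ?thesis using tail by linarith
qed

text \<open>No moments of the initial state are used: the events decrease in T, and their
  intersection is empty because the initial state is finite.\<close>

lemma initial_influence_vanishes: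
  "(\<lambda>T. prob {\<omega> \<in> space M. 1 \<le> \<rho> ^ T * (\<Sum>l\<in>V. \<bar>y \<omega> 0 l\<bar>)}) \<longlonglongrightarrow> 0"
proof -
  let ?Y = "\<lambda>\<omega>. \<Sum>l\<in>V. \<bar>y \<omega> 0 l\<bar>"
  let ?A = "\<lambda>T. {\<omega> \<in> space M. 1 \<le> \<rho> ^ T * ?Y \<omega>}"
  note [measurable] = y_measurable
  have "(\<lambda>T. prob (?A T)) \<longlonglongrightarrow> prob (\<Inter>T. ?A T)"
  proof (rule finite_Lim_measure_decseq)
    show "range ?A \<subseteq> events" by auto
    show "decseq ?A"
    proof (rule decseq_SucI, rule subsetI)
      fix n \<omega> assume w: "\<omega> \<in> ?A (Suc n)"
      have "\<rho> ^ Suc n * ?Y \<omega> \<le> \<rho> ^ n * ?Y \<omega>"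
        using rho_range by (intro mult_right_mono power_decreasing) (auto intro: sum_nonneg)
      then show "\<omega> \<in> ?A n" using w by auto
    qed
  qed
  moreover have "(\<Inter>T. ?A T) = {}"
  proof (rule ccontr)
    assume "(\<Inter>T. ?A T) \<noteq> {}"
    then obtain \<omega> where w: "\<And>T. 1 \<le> \<rho> ^ T * ?Y \<omega>" by blast
    have "(\<lambda>T. \<rho> ^ T * ?Y \<omega>) \<longlonglongrightarrow> 0 * ?Y \<omega>"
      using rho_range by (intro tendsto_mult tendsto_const LIMSEQ_power_zero) auto
    then have "1 \<le> 0 * ?Y \<omega>" by (rule LIMSEQ_le_const) (use w in blast)
    then show False by simp
  qed
  ultimately show ?thesis by simp
qed

text \<open>Stationarity moves the question to an arbitrarily late time T, where the influence of
  the initial state is at most 1 up to a vanishing probability and only the forced part remains.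
  Letting T grow removes that probability, without identifying the stationary law.\<close>

lemma y_tail:
  assumes N: "1 \<le> N" and i: "i \<in> V"
  shows "prob {\<omega> \<in> space M. \<sigma>\<^sup>2 * kap / 2 + s + 1 \<le> \<bar>y \<omega> t i\<bar>} \<le> 2 * exp (- s)"
proof -
  let ?b = "\<sigma>\<^sup>2 * kap / 2 + s"
  let ?Z = "\<lambda>T \<omega>. \<Sum>t\<in>{0..<T}. \<sigma> * (\<Sum>l\<in>V. flow (G \<omega>) i (T - Suc t) l * x \<omega> (Suc t) l)"
  let ?A = "\<lambda>T. {\<omega> \<in> space M. 1 \<le> \<rho> ^ T * (\<Sum>l\<in>V. \<bar>y \<omega> 0 l\<bar>)}"
  let ?E = "\<lambda>T e. {\<omega> \<in> space M. ?b \<le> e * ?Z T \<omega>}"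
  note [measurable] = y_measurable
  let ?C = "{v \<in> space (vec_space N). ?b + 1 \<le> \<bar>v i\<bar>}"
  have C: "?C \<in> sets (vec_space N)" using coord_measurable[OF i] by measurable
  have eqC: "{\<omega> \<in> space M. restrict (y \<omega> T) V \<in> ?C} = {\<omega> \<in> space M. ?b + 1 \<le> \<bar>y \<omega> T i\<bar>}" for T
    using i by (auto simp: vec_space_def space_PiM)
  have shift: "prob {\<omega> \<in> space M. ?b + 1 \<le> \<bar>y \<omega> t i\<bar>} = prob {\<omega> \<in> space M. ?b + 1 \<le> \<bar>y \<omega> T i\<bar>}" for T
    using stationary[OF N C, of t] stationary[OF N C, of T] unfolding eqC by simp
  have evA: "?A T \<in> events" for T by measurable
  have evE: "?E T e \<in> events" for T e
  proof -
    have [measurable]: "(\<lambda>\<omega>. flow (G \<omega>) i n l) \<in> borel_measurable M" for n l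
      by (rule measurable_past[OF graph_function_past])
    have [measurable]: "(\<lambda>\<omega>. x \<omega> (Suc s) l) \<in> borel_measurable M" if "l \<in> V" for s l
      by (rule x_measurable) (use that in auto)
    show ?thesis by measurable
  qed
  have bound: "prob {\<omega> \<in> space M. ?b + 1 \<le> \<bar>y \<omega> t i\<bar>} \<le> prob (?A T) + 2 * exp (- s)" for T
  proof -
    have "{\<omega> \<in> space M. ?b + 1 \<le> \<bar>y \<omega> T i\<bar>} \<subseteq> ?A T \<union> (?E T 1 \<union> ?E T (-1))"
    proof
      fix \<omega> assume w: "\<omega> \<in> {\<omega> \<in> space M. ?b + 1 \<le> \<bar>y \<omega> T i\<bar>}"
      then have \<omega>: "\<omega> \<in> space M" by simp
      have fl: "\<bar>flow (G \<omega>) i T l\<bar> \<le> \<rho> ^ T" if l: "l \<in> V" for l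
      proof -
        have "flow (G \<omega>) i T l \<le> (\<Sum>l\<in>V. flow (G \<omega>) i T l)"
          by (rule member_le_sum[OF l]) (use flow_nonneg(1)[OF \<omega> i] finite_V in auto)
        then show ?thesis using flow_nonneg[OF \<omega> i] l by simp
      qed
      have "\<bar>\<Sum>l\<in>V. flow (G \<omega>) i T l * y \<omega> 0 l\<bar> \<le> (\<Sum>l\<in>V. \<rho> ^ T * \<bar>y \<omega> 0 l\<bar>)"
        by (rule order_trans[OF sum_abs]) (auto simp: abs_mult intro!: sum_mono mult_right_mono fl)
      also have "\<dots> = \<rho> ^ T * (\<Sum>l\<in>V. \<bar>y \<omega> 0 l\<bar>)" by (simp add: sum_distrib_left)
      finally have "\<bar>y \<omega> T i\<bar> \<le> \<rho> ^ T * (\<Sum>l\<in>V. \<bar>y \<omega> 0 l\<bar>) + \<bar>?Z T \<omega>\<bar>"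
        unfolding y_eq_forced[OF \<omega> i, of T] by linarith
      moreover have "?b + 1 \<le> \<bar>y \<omega> T i\<bar>" using w by simp
      ultimately have "1 \<le> \<rho> ^ T * (\<Sum>l\<in>V. \<bar>y \<omega> 0 l\<bar>) \<or> ?b \<le> 1 * ?Z T \<omega> \<or> ?b \<le> -1 * ?Z T \<omega>"
        by linarith
      then show "\<omega> \<in> ?A T \<union> (?E T 1 \<union> ?E T (-1))" using \<omega> by blast
    qed
    then have "prob {\<omega> \<in> space M. ?b + 1 \<le> \<bar>y \<omega> T i\<bar>} \<le> prob (?A T \<union> (?E T 1 \<union> ?E T (-1)))"
      by (rule finite_measure_mono[OF _ sets.Un[OF evA sets.Un[OF evE evE]]])
    also have "\<dots> \<le> prob (?A T) + (prob (?E T 1) + prob (?E T (-1)))"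
      by (rule order_trans[OF measure_Un_le[OF evA sets.Un[OF evE evE]] add_left_mono[OF measure_Un_le[OF evE evE]]])
    also have "\<dots> \<le> prob (?A T) + (exp (- s) + exp (- s))"
      by (intro add_left_mono add_mono forced_tail[OF N i]) auto
    finally show ?thesis unfolding shift[of T] by simp
  qed
  have "(\<lambda>T. prob (?A T) + 2 * exp (- s)) \<longlonglongrightarrow> 0 + 2 * exp (- s)"
    by (intro tendsto_add initial_influence_vanishes tendsto_const)
  then show ?thesis using bound by (auto intro: LIMSEQ_le_const)
qed

end

subsection \<open>Concentrated graphs give regular networks\<close>

text \<open>Both deviations are measured on the scale N p, since the weights are divided by N p. The
  centres use the full \<open>card T\<close>; the one or two omitted nodes are absorbed by the
  tolerance.\<close>

definition concentrated :: "nat \<Rightarrow> nat set \<Rightarrow> real \<Rightarrow> real \<Rightarrow> graph \<Rightarrow> bool" where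
  "concentrated N S p \<eta> g \<longleftrightarrow> (\<forall>T\<in>{nodes N, nodes N - S}. \<forall>i\<in>nodes N.
     \<bar>(\<Sum>l\<in>T - {i}. of_bool (g i l)) - real (card T) * p\<bar> \<le> \<eta> * (real N * p) \<and>
     (\<forall>j\<in>nodes N. i \<noteq> j \<longrightarrow>
       \<bar>(\<Sum>l\<in>T - {i, j}. of_bool (g i l) * of_bool (g l j)) - real (card T) * p\<^sup>2\<bar> \<le> \<eta> * (real N * p)))"

context erdos_renyi
begin

text \<open>The independent edge variables are indexed by increasing pairs.\<close>

definition sorted_edge :: "nat \<Rightarrow> nat \<Rightarrow> nat \<times> nat" where "sorted_edge i l = (min i l, max i l)"

lemma sorted_edge_edges: "i \<in> nodes N \<Longrightarrow> l \<in> nodes N \<Longrightarrow> i \<noteq> l \<Longrightarrow> sorted_edge i l \<in> edges"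
  by (auto simp: sorted_edge_def min_def max_def)

lemma graph_sorted_edge:
  assumes "\<omega> \<in> space M" "sorted_edge i l = (a, b)" shows "G \<omega> a b = G \<omega> i l" "G \<omega> a b = G \<omega> l i"
proof -
  have "G \<omega> i l = G \<omega> l i" using graph_space[OF assms(1)] by (auto simp: graphs_def)
  then show "G \<omega> a b = G \<omega> i l" "G \<omega> a b = G \<omega> l i" using assms(2) by (auto simp: sorted_edge_def min_def max_def split: if_splits)
qed

lemma degree_deviation:
  assumes T: "T \<subseteq> nodes N" and i: "i \<in> nodes N" and e: "0 < e" "e \<le> 2"
  shows "prob {\<omega> \<in> space M. e * (real N * p) < \<bar>(\<Sum>l\<in>T - {i}. of_bool (G \<omega> i l)) - real (card (T - {i})) * p\<bar>}
    \<le> 2 * exp (- (e\<^sup>2 / 4 * (real N * p)))"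
proof -
  have fin: "finite (T - {i})" using T finite_subset by (auto simp: nodes_def)
  have card: "real (card (T - {i})) * p ^ 1 \<le> real N * p"
  proof -
    have "card (T - {i}) \<le> card (nodes N)" by (rule card_mono) (use T in \<open>auto simp: nodes_def\<close>)
    then show ?thesis using p_range by (auto simp: nodes_def intro!: mult_right_mono)
  qed
  have "prob {\<omega> \<in> space M. e * (real N * p) < \<bar>(\<Sum>l\<in>T - {i}. of_bool (\<forall>(a, b)\<in>{sorted_edge i l}. G \<omega> a b)) - real (card (T - {i})) * p ^ 1\<bar>}
    \<le> 2 * exp (- (e\<^sup>2 / 4 * (real N * p)))"
  proof (rule edge_block_chernoff[OF fin _ _ _ _ card e])
    show "{sorted_edge i l} \<subseteq> edges" if "l \<in> T - {i}" for l using sorted_edge_edges[of i l] that T i by auto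
    show "disjoint_family_on (\<lambda>l. {sorted_edge i l}) (T - {i})"
      by (auto simp: disjoint_family_on_def sorted_edge_def min_def max_def split: if_splits)
  qed auto
  moreover have "(\<Sum>l\<in>T - {i}. of_bool (\<forall>(a, b)\<in>{sorted_edge i l}. G \<omega> a b)) = (\<Sum>l\<in>T - {i}. of_bool (G \<omega> i l) :: real)"
    if "\<omega> \<in> space M" for \<omega>
  proof (rule sum.cong[OF refl])
    fix l
    have "(\<forall>(a, b)\<in>{sorted_edge i l}. G \<omega> a b) = G \<omega> i l"
      using graph_sorted_edge(1)[OF that, of i l] by (cases "sorted_edge i l") auto
    then show "of_bool (\<forall>(a, b)\<in>{sorted_edge i l}. G \<omega> a b) = (of_bool (G \<omega> i l) :: real)" by (simp only:)
  qed
  ultimately show ?thesis by (simp cong: conj_cong)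
qed

text \<open>For distinct l outside {i, j} the two-edge paths from i to j through l share no edge, so
  their indicators are independent with probability p^2.\<close>

lemma codegree_deviation:
  assumes T: "T \<subseteq> nodes N" and ij: "i \<in> nodes N" "j \<in> nodes N" "i \<noteq> j" and e: "0 < e" "e \<le> 2"
  shows "prob {\<omega> \<in> space M. e * (real N * p) <
      \<bar>(\<Sum>l\<in>T - {i, j}. of_bool (G \<omega> i l) * of_bool (G \<omega> l j)) - real (card (T - {i, j})) * p\<^sup>2\<bar>}
    \<le> 2 * exp (- (e\<^sup>2 / 4 * (real N * p)))"
proof -
  let ?B = "\<lambda>l. {sorted_edge i l, sorted_edge j l}"
  have fin: "finite (T - {i, j})" using T finite_subset by (auto simp: nodes_def)
  have "real (card (T - {i, j})) * p\<^sup>2 \<le> real N * p\<^sup>2"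
  proof -
    have "card (T - {i, j}) \<le> card (nodes N)" by (rule card_mono) (use T in \<open>auto simp: nodes_def\<close>)
    then show ?thesis by (auto simp: nodes_def intro!: mult_right_mono)
  qed
  also have "\<dots> \<le> real N * p" using p_range by (intro mult_left_mono) (auto simp: power2_eq_square mult_left_le)
  finally have card: "real (card (T - {i, j})) * p\<^sup>2 \<le> real N * p" .
  have "prob {\<omega> \<in> space M. e * (real N * p) < \<bar>(\<Sum>l\<in>T - {i, j}. of_bool (\<forall>(a, b)\<in>?B l. G \<omega> a b)) - real (card (T - {i, j})) * p ^ 2\<bar>}
    \<le> 2 * exp (- (e\<^sup>2 / 4 * (real N * p)))"
  proof (rule edge_block_chernoff[OF fin _ _ _ _ card e])
    show "?B l \<subseteq> edges" if "l \<in> T - {i, j}" for l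
      using sorted_edge_edges[of i l] sorted_edge_edges[of j l] that T ij by auto
    show "card (?B l) = 2" if "l \<in> T - {i, j}" for l
    proof -
      have "sorted_edge i l \<noteq> sorted_edge j l" using that ij(3) by (auto simp: sorted_edge_def min_def max_def split: if_splits)
      then show ?thesis by simp
    qed
    show "disjoint_family_on ?B (T - {i, j})"
      using ij(3) by (auto simp: disjoint_family_on_def sorted_edge_def min_def max_def split: if_splits)
  qed auto
  moreover have "(\<Sum>l\<in>T - {i, j}. of_bool (\<forall>(a, b)\<in>?B l. G \<omega> a b)) = (\<Sum>l\<in>T - {i, j}. of_bool (G \<omega> i l) * of_bool (G \<omega> l j) :: real)"
    if "\<omega> \<in> space M" for \<omega>
  proof (rule sum.cong[OF refl])
    fix l
    have "(\<forall>(a, b)\<in>?B l. G \<omega> a b) = (G \<omega> i l \<and> G \<omega> l j)"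
      using graph_sorted_edge(1)[OF that, of i l] graph_sorted_edge(2)[OF that, of j l]
      by (cases "sorted_edge i l", cases "sorted_edge j l") auto
    then show "of_bool (\<forall>(a, b)\<in>?B l. G \<omega> a b) = (of_bool (G \<omega> i l) * of_bool (G \<omega> l j) :: real)"
      by (simp only: of_bool_conj)
  qed
  ultimately show ?thesis by (simp cong: conj_cong)
qed

text \<open>Half of \<eta> is spent on the random deviation, the other half, at least 2 after
  scaling by N p, on the omitted nodes in the centre. The factor 8 counts two sets T, degrees and
  common neighbours, and two tails.\<close>

lemma concentrated_prob:
  assumes \<eta>: "0 < \<eta>" "\<eta> \<le> 2" and d: "4 \<le> \<eta> * (real N * p)"
  shows "prob {\<omega> \<in> space M. \<not> concentrated N S p \<eta> (G \<omega>)} \<le> 8 * (real N)\<^sup>2 * exp (- (\<eta>\<^sup>2 / 16 * (real N * p)))"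
proof -
  let ?V = "nodes N" and ?D = "real N * p" and ?e = "\<eta> / 2"
  let ?d = "\<lambda>T i g. ?e * ?D < \<bar>(\<Sum>l\<in>T - {i}. of_bool (g i l)) - real (card (T - {i})) * p\<bar>"
  let ?c = "\<lambda>T i j g. i \<noteq> j \<and> ?e * ?D < \<bar>(\<Sum>l\<in>T - {i, j}. of_bool (g i l) * of_bool (g l j)) - real (card (T - {i, j})) * p\<^sup>2\<bar>"
  let ?x = "2 * exp (- (\<eta>\<^sup>2 / 16 * ?D))"
  have e: "0 < ?e" "?e \<le> 2" "?e\<^sup>2 / 4 = \<eta>\<^sup>2 / 16" using \<eta> by (auto simp: power_divide)
  have cardV: "card ?V = N" "finite ?V" by (simp_all add: nodes_def)
  have Pd: "prob {\<omega> \<in> space M. ?d T i (G \<omega>)} \<le> ?x" if "T \<subseteq> ?V" "i \<in> ?V" for T i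
    using degree_deviation[OF that e(1,2)] unfolding e(3) .
  have Pc: "prob {\<omega> \<in> space M. ?c T i j (G \<omega>)} \<le> ?x" if "T \<subseteq> ?V" "i \<in> ?V" "j \<in> ?V" for T i j
  proof (cases "i = j")
    case False
    then show ?thesis using codegree_deviation[OF that False e(1,2)] unfolding e(3) by simp
  qed simp
  have one: "prob {\<omega> \<in> space M. (\<exists>i\<in>?V. ?d T i (G \<omega>)) \<or> (\<exists>i\<in>?V. \<exists>j\<in>?V. ?c T i j (G \<omega>))} \<le> 2 * (real N)\<^sup>2 * ?x"
    if T: "T \<subseteq> ?V" for T
  proof -
    let ?A = "\<Union>i\<in>?V. {\<omega> \<in> space M. ?d T i (G \<omega>)}"
    let ?B = "\<Union>k\<in>?V \<times> ?V. {\<omega> \<in> space M. ?c T (fst k) (snd k) (G \<omega>)}"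
    have evd: "{\<omega> \<in> space M. ?d T i (G \<omega>)} \<in> events" for i by (rule graph_event)
    have evc: "{\<omega> \<in> space M. ?c T i j (G \<omega>)} \<in> events" for i j by (rule graph_event)
    have evA: "?A \<in> events" by (rule sets.finite_UN[OF cardV(2) evd])
    have evB: "?B \<in> events" by (rule sets.finite_UN[OF finite_cartesian_product[OF cardV(2) cardV(2)] evc])
    have "prob ?A \<le> (\<Sum>i\<in>?V. prob {\<omega> \<in> space M. ?d T i (G \<omega>)})"
      by (rule measure_UNION_le[OF cardV(2) evd])
    also have "\<dots> \<le> (\<Sum>i\<in>?V. ?x)" by (intro sum_mono Pd T)
    also have "\<dots> = real N * ?x" using cardV by simp
    also have "\<dots> \<le> (real N)\<^sup>2 * ?x"
    proof (rule mult_right_mono)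
      have "real N \<le> real (N * N)" by (simp only: of_nat_le_iff le_square)
      then show "real N \<le> (real N)\<^sup>2" by (simp add: power2_eq_square)
    qed simp
    finally have A: "prob ?A \<le> (real N)\<^sup>2 * ?x" .
    have "prob ?B \<le> (\<Sum>k\<in>?V \<times> ?V. prob {\<omega> \<in> space M. ?c T (fst k) (snd k) (G \<omega>)})"
      by (rule measure_UNION_le[OF finite_cartesian_product[OF cardV(2) cardV(2)] evc])
    also have "\<dots> \<le> (\<Sum>k\<in>?V \<times> ?V. ?x)" by (intro sum_mono Pc T) auto
    also have "\<dots> = (real N)\<^sup>2 * ?x" using cardV by (simp add: power2_eq_square card_cartesian_product)
    finally have B: "prob ?B \<le> (real N)\<^sup>2 * ?x" .
    have eq: "{\<omega> \<in> space M. (\<exists>i\<in>?V. ?d T i (G \<omega>)) \<or> (\<exists>i\<in>?V. \<exists>j\<in>?V. ?c T i j (G \<omega>))} = ?A \<union> ?B"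
      by fastforce
    have "prob (?A \<union> ?B) \<le> (real N)\<^sup>2 * ?x + (real N)\<^sup>2 * ?x"
      by (rule order_trans[OF measure_Un_le[OF evA evB] add_mono[OF A B]])
    then show ?thesis unfolding eq by simp
  qed
  let ?E = "\<lambda>T. {\<omega> \<in> space M. (\<exists>i\<in>?V. ?d T i (G \<omega>)) \<or> (\<exists>i\<in>?V. \<exists>j\<in>?V. ?c T i j (G \<omega>))}"
  have evE: "?E T \<in> events" for T by (rule graph_event)
  have "prob {\<omega> \<in> space M. \<not> concentrated N S p \<eta> (G \<omega>)} \<le> prob (?E ?V \<union> ?E (?V - S))"
  proof (rule finite_measure_mono)
    show "{\<omega> \<in> space M. \<not> concentrated N S p \<eta> (G \<omega>)} \<subseteq> ?E ?V \<union> ?E (?V - S)"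
    proof (rule subsetI, rule ccontr)
      fix \<omega> assume w: "\<omega> \<in> {\<omega> \<in> space M. \<not> concentrated N S p \<eta> (G \<omega>)}" and n: "\<omega> \<notin> ?E ?V \<union> ?E (?V - S)"
      have tol: "2 * 1 \<le> \<eta> / 2 * ?D" using d by simp
      have good: "\<bar>(\<Sum>l\<in>T - {i}. of_bool (G \<omega> i l)) - real (card T) * p\<bar> \<le> \<eta> * ?D \<and>
        (\<forall>j\<in>?V. i \<noteq> j \<longrightarrow> \<bar>(\<Sum>l\<in>T - {i, j}. of_bool (G \<omega> i l) * of_bool (G \<omega> l j)) - real (card T) * p\<^sup>2\<bar> \<le> \<eta> * ?D)"
        if T: "T \<subseteq> ?V" "\<omega> \<notin> ?E T" and i: "i \<in> ?V" for T i
      proof -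
        have close: "\<bar>real (card (T - X)) * r - real (card T) * r\<bar> \<le> \<eta> / 2 * ?D"
          if X: "finite X" "card X \<le> 2" and r: "0 \<le> r" "r \<le> 1" for X and r :: real
        proof -
          have "finite T" using T(1) cardV finite_subset by blast
          then have "card T \<le> card (T - X) + card X" "card (T - X) \<le> card T"
            using diff_card_le_card_Diff[OF X(1), of T] card_mono[OF _ Diff_subset, of T X] by linarith+
          then have "\<bar>real (card (T - X)) - real (card T)\<bar> \<le> 2" using X(2) by linarith
          then have "\<bar>real (card (T - X)) - real (card T)\<bar> * r \<le> 2 * 1" using r by (intro mult_mono) auto
          then show ?thesis using tol r by (simp add: left_diff_distrib[symmetric] abs_mult)
        qed
        have nd: "\<not> ?d T i (G \<omega>)" using T(2) w i by blast
        have nc: "\<not> ?c T i j (G \<omega>)" if "j \<in> ?V" for j using T(2) w i that by blast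
        have "\<bar>(\<Sum>l\<in>T - {i}. of_bool (G \<omega> i l)) - real (card T) * p\<bar> \<le> \<eta> * ?D"
          by (rule abs_diff_chain[OF nd[unfolded not_less] close[of "{i}" p]]) (use p_range in simp_all)
        moreover have "\<bar>(\<Sum>l\<in>T - {i, j}. of_bool (G \<omega> i l) * of_bool (G \<omega> l j)) - real (card T) * p\<^sup>2\<bar> \<le> \<eta> * ?D"
          if "j \<in> ?V" "i \<noteq> j" for j
        proof -
          have p2: "p\<^sup>2 \<le> 1" using p_range by (simp add: power_le_one)
          have dv: "\<bar>(\<Sum>l\<in>T - {i, j}. of_bool (G \<omega> i l) * of_bool (G \<omega> l j)) - real (card (T - {i, j})) * p\<^sup>2\<bar> \<le> ?e * ?D"
            using nc[OF that(1)] that(2) by (simp only: not_less simp_thms)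
          show ?thesis
            by (rule abs_diff_chain[OF dv close[of "{i, j}" "p\<^sup>2"]]) (use p2 in \<open>simp_all add: card_insert_if\<close>)
        qed
        ultimately show ?thesis by blast
      qed
      have "concentrated N S p \<eta> (G \<omega>)"
        unfolding concentrated_def using good[of ?V] good[of "?V - S"] n by auto
      then show False using w by simp
    qed
  qed (rule sets.Un[OF evE evE])
  also have "\<dots> \<le> prob (?E ?V) + prob (?E (?V - S))" by (rule measure_Un_le[OF evE evE])
  also have "\<dots> \<le> 2 * (real N)\<^sup>2 * ?x + 2 * (real N)\<^sup>2 * ?x"
    by (rule add_mono[OF one one]) auto
  finally show ?thesis by simp
qed

end

lemma degree_window:
  fixes D d X L U :: real
  assumes "\<bar>D - 1 - d\<bar> \<le> X" "L = d - X" "U = d + (X + X)" "1 \<le> X"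
  shows "L \<le> D \<and> D \<le> U"
  using assms by linarith

text \<open>The bounds on the weights are \<kappa> divided by an extremal degree, so concentration
  of the degrees fixes the scaled weights. The graph is assumed concentrated to \<eta> / 2, because
  the 1 in the definition of the degree uses another \<eta> / 2 and inverting the degrees must still
  cost no more than \<eta>.\<close>

lemma concentrated_regular_network:
  assumes rd: "regular_diffusion N \<rho> \<kappa> g a" and con: "concentrated N S p (\<eta> / 2) g"
    and S: "S \<subseteq> nodes N" and p: "0 < p" "p \<le> 1" and N: "1 \<le> N"
    and \<eta>: "0 < \<eta>" "\<eta> \<le> (1 - \<rho>)\<^sup>2 / 2" and d: "1 \<le> \<eta> / 2 * (real N * p)"
  shows "regular_network (nodes N) a \<rho> S g \<kappa> p (real N * p) \<eta>"
proof -
  let ?V = "nodes N" and ?d = "real N * p"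
  have kr: "0 < \<kappa>" "\<kappa> \<le> \<rho>" "\<rho> < 1"
    and sym: "\<And>i j. i \<in> ?V \<Longrightarrow> j \<in> ?V \<Longrightarrow> a i j = a j i \<and> 0 \<le> a i j"
    and row: "\<And>i. i \<in> ?V \<Longrightarrow> (\<Sum>l\<in>?V. a i l) = \<rho>"
    and ent: "\<And>i j. i \<in> ?V \<Longrightarrow> j \<in> ?V \<Longrightarrow> i \<noteq> j \<Longrightarrow>
        \<kappa> / real (max_degree N g) * of_bool (g i j) \<le> a i j \<and> a i j \<le> \<kappa> / real (min_degree N g) * of_bool (g i j)"
    using rd unfolding regular_diffusion_def by blast+
  have d0: "0 < ?d" using p N by simp
  have cardV: "card ?V = N" "finite ?V" "?V \<noteq> {}" using N by (auto simp: nodes_def)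
  have "(1 - \<rho>)\<^sup>2 \<le> 1\<^sup>2" using kr by (intro power_mono) auto
  then have \<eta>2: "\<eta> \<le> 1 / 2" using \<eta> by simp
  have con': "T = ?V \<or> T = ?V - S \<Longrightarrow> i \<in> ?V \<Longrightarrow> \<bar>(\<Sum>l\<in>T - {i}. of_bool (g i l)) - real (card T) * p\<bar> \<le> \<eta> / 2 * ?d"
    "T = ?V \<or> T = ?V - S \<Longrightarrow> i \<in> ?V \<Longrightarrow> j \<in> ?V \<Longrightarrow> i \<noteq> j \<Longrightarrow>
       \<bar>(\<Sum>l\<in>T - {i, j}. of_bool (g i l) * of_bool (g l j)) - real (card T) * p\<^sup>2\<bar> \<le> \<eta> / 2 * ?d" for T i j
    using con unfolding concentrated_def by blast+
  have half: "\<eta> / 2 * ?d \<le> \<eta> * ?d" using \<eta> d0 by (intro mult_right_mono) auto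
  have degree: "?d * (1 - \<eta> / 2) \<le> real (degree N g i)" "real (degree N g i) \<le> ?d * (1 + \<eta>)" if i: "i \<in> ?V" for i
  proof -
    have "real (degree N g i) = 1 + (\<Sum>l\<in>?V - {i}. of_bool (g i l))" by (simp add: degree_def)
    moreover have "\<bar>(\<Sum>l\<in>?V - {i}. of_bool (g i l)) - ?d\<bar> \<le> \<eta> / 2 * ?d" using con'(1)[of ?V i] i cardV by simp
    ultimately have "\<bar>real (degree N g i) - 1 - ?d\<bar> \<le> \<eta> / 2 * ?d" by simp
    moreover have "?d * (1 - \<eta> / 2) = ?d - \<eta> / 2 * ?d" "?d * (1 + \<eta>) = ?d + (\<eta> / 2 * ?d + \<eta> / 2 * ?d)"
      by (simp_all add: algebra_simps)
    ultimately have "?d * (1 - \<eta> / 2) \<le> real (degree N g i) \<and> real (degree N g i) \<le> ?d * (1 + \<eta>)"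
      using d by (intro degree_window)
    then show "?d * (1 - \<eta> / 2) \<le> real (degree N g i)" "real (degree N g i) \<le> ?d * (1 + \<eta>)" by blast+
  qed
  have cancel: "D * (\<kappa> / (D * z)) = \<kappa> / z" if "D \<noteq> 0" for D z using that by simp
  have "Min (degree N g ` ?V) \<in> degree N g ` ?V" by (rule Min_in) (use cardV in simp_all)
  then obtain i0 where i0: "i0 \<in> ?V" "min_degree N g = degree N g i0"
    unfolding min_degree_def by (elim imageE)
  have "Max (degree N g ` ?V) \<in> degree N g ` ?V" by (rule Max_in) (use cardV in simp_all)
  then obtain i1 where i1: "i1 \<in> ?V" "max_degree N g = degree N g i1"
    unfolding max_degree_def by (elim imageE)
  have dev: "\<bar>?d * a i j - \<kappa> * of_bool (g i j)\<bar> \<le> \<eta> * of_bool (g i j)" if ij: "i \<in> ?V" "j \<in> ?V" "i \<noteq> j" for i j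
  proof (cases "g i j")
    case True
    have pos: "0 < ?d * (1 - \<eta> / 2)" by (rule mult_pos_pos[OF d0]) (use \<eta>2 in simp)
    have dm: "0 < real (degree N g i1)" using degree(1)[OF i1(1)] pos by linarith
    have "?d * a i j \<le> ?d * (\<kappa> / real (degree N g i0))"
      using ent[OF ij] True i0 d0 by (intro mult_left_mono) auto
    also have "\<dots> \<le> ?d * (\<kappa> / (?d * (1 - \<eta> / 2)))"
      by (rule mult_left_mono[OF frac_le[OF _ order_refl pos degree(1)[OF i0(1)]]]) (use kr d0 in linarith)+
    also have "\<dots> = \<kappa> / (1 - \<eta> / 2)" by (rule cancel[OF less_imp_neq[OF d0, symmetric]])
    also have "\<dots> \<le> \<kappa> * (1 + \<eta>)"
    proof -
      have "1 \<le> (1 + \<eta>) * (1 - \<eta> / 2)"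
        using \<eta>(1) \<eta>2 mult_right_mono[OF \<eta>2, of \<eta>] by (simp add: algebra_simps)
      then have "\<kappa> * 1 \<le> \<kappa> * ((1 + \<eta>) * (1 - \<eta> / 2))" using kr by (intro mult_left_mono) auto
      then show ?thesis using \<eta>2 by (simp add: divide_le_eq mult.assoc)
    qed
    also have "\<dots> \<le> \<kappa> + \<eta>" using kr \<eta> mult_right_mono[of \<kappa> 1 \<eta>] by (simp add: algebra_simps)
    finally have up: "?d * a i j \<le> \<kappa> + \<eta>" .
    have "\<kappa> - \<eta> \<le> \<kappa> * (1 - \<eta>)" using kr \<eta> mult_right_mono[of \<kappa> 1 \<eta>] by (simp add: algebra_simps)
    also have "\<dots> \<le> \<kappa> / (1 + \<eta>)"
    proof -
      have "\<kappa> * ((1 - \<eta>) * (1 + \<eta>)) \<le> \<kappa> * 1" using kr \<eta> by (intro mult_left_mono) (auto simp: algebra_simps)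
      then show ?thesis using \<eta> by (simp add: le_divide_eq mult.assoc)
    qed
    also have "\<dots> = ?d * (\<kappa> / (?d * (1 + \<eta>)))" by (rule cancel[OF less_imp_neq[OF d0, symmetric], symmetric])
    also have "\<dots> \<le> ?d * (\<kappa> / real (degree N g i1))"
      by (rule mult_left_mono[OF frac_le[OF _ order_refl dm degree(2)[OF i1(1)]]]) (use kr d0 in linarith)+
    also have "\<dots> \<le> ?d * a i j"
      using ent[OF ij] True i1 d0 by (intro mult_left_mono) auto
    finally show ?thesis using up True by (simp add: abs_le_iff)
  next
    case False
    then show ?thesis using ent[OF ij] by simp
  qed
  show ?thesis
  proof
    show "\<bar>(\<Sum>l\<in>T - {i}. of_bool (g i l)) - real (card T) / real (card ?V) * ?d\<bar> \<le> \<eta> * ?d"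
      if "T = ?V \<or> T = ?V - S" "i \<in> ?V" for T i
    proof -
      have "real (card T) / real (card ?V) * ?d = real (card T) * p" using cardV N by simp
      then show ?thesis using con'(1)[OF that] half by linarith
    qed
    show "\<bar>(\<Sum>l\<in>T - {i, j}. of_bool (g i l) * of_bool (g l j)) - real (card T) / real (card ?V) * p * ?d\<bar> \<le> \<eta> * ?d"
      if "T = ?V \<or> T = ?V - S" "i \<in> ?V" "j \<in> ?V" "i \<noteq> j" for T i j
    proof -
      have "real (card T) / real (card ?V) * p * ?d = real (card T) * p\<^sup>2" using cardV N by (simp add: power2_eq_square)
      then show ?thesis using con'(2)[OF that] half by linarith
    qed
    show "finite ?V" "0 < \<rho>" "\<rho> < 1" "0 < \<kappa>" "\<kappa> \<le> \<rho>" "0 \<le> p" "p \<le> 1" "0 \<le> \<eta>"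
      "\<eta> \<le> (1 - \<rho>)\<^sup>2 / 2" "0 < ?d" "S \<subseteq> ?V"
      by (rule cardV kr p \<eta> d0 S | use kr p \<eta> in linarith)+
    show "1 \<le> \<eta> * ?d" using d half by linarith
    show "a i j = a j i" "0 \<le> a i j" if "i \<in> ?V" "j \<in> ?V" for i j using sym[OF that] by blast+
    show "(\<Sum>l\<in>?V. a i l) = \<rho>" if "i \<in> ?V" for i by (rule row[OF that])
    show "\<bar>?d * a i j - \<kappa> * of_bool (g i j)\<bar> \<le> \<eta> * of_bool (g i j)" if "i \<in> ?V" "j \<in> ?V" "i \<noteq> j" for i j
      by (rule dev[OF that])
  qed
qed

subsection \<open>Sample correlation errors\<close>

context substochastic
begin

lemma two_sided_le:
  assumes i: "i \<in> V" "j \<in> V" and f: "\<And>l n. l \<in> V \<Longrightarrow> n \<in> V \<Longrightarrow> \<bar>f l n\<bar> \<le> m" and m: "0 \<le> m"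
  shows "\<bar>\<Sum>l\<in>V. \<Sum>n\<in>V. a i l * f l n * a n j\<bar> \<le> \<rho>\<^sup>2 * m"
proof -
  have "\<bar>\<Sum>n\<in>V. a j n * f l n\<bar> \<le> \<rho> * m" if l: "l \<in> V" for l by (rule abs_row_le[OF i(2) f[OF l]])
  then have "\<bar>\<Sum>l\<in>V. a i l * (\<Sum>n\<in>V. a j n * f l n)\<bar> \<le> \<rho> * (\<rho> * m)" by (rule abs_row_le[OF i(1)])
  moreover have "(\<Sum>l\<in>V. a i l * (\<Sum>n\<in>V. a j n * f l n)) = (\<Sum>l\<in>V. \<Sum>n\<in>V. a i l * f l n * a n j)"
    using sym[OF _ i(2)] by (intro sum.cong refl) (simp add: sum_distrib_left mult_ac)
  ultimately show ?thesis by (simp add: power2_eq_square mult.assoc)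
qed

end

lemma sum_mult_divide:
  fixes f g :: "'b \<Rightarrow> real"
  shows "(\<Sum>l\<in>T. f l * (g l / r)) = (\<Sum>l\<in>T. f l * g l) / r" "(\<Sum>l\<in>T. g l / r * f l) = (\<Sum>l\<in>T. g l * f l) / r"
  by (simp_all add: sum_divide_distrib)

lemma abs_eq_diff_le:
  fixes x u v :: real
  assumes "x = u - v" "\<bar>u\<bar> \<le> A" "\<bar>v\<bar> \<le> B"
  shows "\<bar>x\<bar> \<le> A + B"
  using assms by linarith

text \<open>What is needed of a single sample path with m = n - 1 transitions. The bound on the
  cross terms contains the unknown sample variance, just as the compensated martingale delivers it.
  In 5 \<delta> for the noise covariance, 4 \<delta> is the compensator of the centred square and
  \<delta> the tail level.\<close>

locale var_sample = resolvent_pair +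
  fixes \<sigma> \<delta> :: real and x y :: "nat \<Rightarrow> nat \<Rightarrow> real" and m :: nat
  assumes sigma: "0 < \<sigma>" "c = \<sigma>\<^sup>2"
    and m: "1 \<le> m"
    and delta: "0 < \<delta>" "\<delta> \<le> 1" "\<sigma> * \<delta> \<le> (1 - \<rho>) / 2" "1 \<le> \<delta> * real m"
    and dyn: "1 \<le> t \<Longrightarrow> i \<in> V \<Longrightarrow> y (Suc t) i = (\<Sum>l\<in>V. a i l * y t l) + \<sigma> * x (Suc t) i"
    and noise_cov: "i \<in> V \<Longrightarrow> j \<in> V \<Longrightarrow>
      \<bar>(\<Sum>t = 1..m. x (Suc t) i * x (Suc t) j) / real m - of_bool (i = j)\<bar> \<le> 5 * \<delta>"
    and cross_cov: "i \<in> V \<Longrightarrow> j \<in> V \<Longrightarrow>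
      \<bar>(\<Sum>t = 1..m. y t i * x (Suc t) j) / real m\<bar> \<le> \<delta> / 2 * ((\<Sum>t = 1..m. y t i * y t i) / real m) + \<delta>"
    and boundary: "i \<in> V \<Longrightarrow> (y 1 i)\<^sup>2 \<le> \<delta> * real m" "i \<in> V \<Longrightarrow> (y (Suc m) i)\<^sup>2 \<le> \<delta> * real m"
begin

lemma R0_bound': "i \<in> V \<Longrightarrow> j \<in> V \<Longrightarrow> \<bar>R0 i j\<bar> \<le> \<sigma>\<^sup>2 / (1 - \<rho>)"
  using R0_bound[of i j] arg_cong[OF sigma(2), of "\<lambda>z. z / (1 - \<rho>)"] by linarith

definition "T0 i j = (\<Sum>t = 1..m. y t i * y t j) / real m"
definition "CC i j = (\<Sum>t = 1..m. y t i * x (Suc t) j) / real m"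
definition "XX i j = (\<Sum>t = 1..m. x (Suc t) i * x (Suc t) j) / real m"

text \<open>The bracket collects the errors of the sample stationarity equation: the two cross
  terms, the noise covariance and the boundary. The factor 2 / (1 - \<rho>) comes from a contraction
  with factor (1 + \<rho>) / 2.\<close>

definition "err1 = 2 / (1 - \<rho>) * (\<sigma> ^ 3 / (1 - \<rho>) + 2 * \<sigma> + 5 * \<sigma>\<^sup>2 + 2)"
definition "err = (1 + \<sigma>) * (err1 + 1 + \<sigma>\<^sup>2 / (1 - \<rho>))"

lemma m_pos: "0 < real m" using m by simp

lemma boundary_product:
  assumes "i \<in> V" "j \<in> V"
  shows "\<bar>y 1 i * y 1 j / real m\<bar> \<le> \<delta>" "\<bar>y (Suc m) i * y (Suc m) j / real m\<bar> \<le> \<delta>"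
proof -
  have *: "\<bar>u * v / real m\<bar> \<le> \<delta>" if "u\<^sup>2 \<le> \<delta> * real m" "v\<^sup>2 \<le> \<delta> * real m" for u v :: real
  proof -
    have "2 * \<bar>u * v\<bar> \<le> u\<^sup>2 + v\<^sup>2"
      using zero_le_power2[of "\<bar>u\<bar> - \<bar>v\<bar>"] by (simp add: power2_eq_square abs_mult algebra_simps)
    then have "\<bar>u * v\<bar> \<le> \<delta> * real m" using that by linarith
    then show ?thesis using m_pos by (simp add: abs_divide divide_le_eq)
  qed
  show "\<bar>y 1 i * y 1 j / real m\<bar> \<le> \<delta>" by (rule *[OF boundary(1)[OF assms(1)] boundary(1)[OF assms(2)]])
  show "\<bar>y (Suc m) i * y (Suc m) j / real m\<bar> \<le> \<delta>" by (rule *[OF boundary(2)[OF assms(1)] boundary(2)[OF assms(2)]])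
qed

lemma lag_recursion:
  assumes "i \<in> V" "j \<in> V"
  shows "(\<Sum>t = 1..m. y (Suc t) i * y t j) / real m = (\<Sum>l\<in>V. a i l * T0 l j) + \<sigma> * CC j i"
proof -
  have "(\<Sum>t = 1..m. y (Suc t) i * y t j) = (\<Sum>t = 1..m. (\<Sum>l\<in>V. a i l * (y t l * y t j)) + \<sigma> * (y t j * x (Suc t) i))"
    using dyn assms by (intro sum.cong refl) (simp add: algebra_simps sum_distrib_left)
  also have "\<dots> = (\<Sum>l\<in>V. a i l * (\<Sum>t = 1..m. y t l * y t j)) + \<sigma> * (\<Sum>t = 1..m. y t j * x (Suc t) i)"
    unfolding sum.distrib sum_distrib_left by (subst sum.swap) simp
  finally show ?thesis
    unfolding T0_def CC_def unfolding sum_mult_divide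
    unfolding times_divide_eq_right add_divide_distrib[symmetric] by (rule arg_cong)
qed

text \<open>The sample form of R = a R a + c I. Shifting the time window by one step leaves the
  first and the last product as boundary terms.\<close>

lemma cov_recursion:
  assumes ij: "i \<in> V" "j \<in> V"
  shows "T0 i j + (y (Suc m) i * y (Suc m) j - y 1 i * y 1 j) / real m
    = (\<Sum>l\<in>V. \<Sum>n\<in>V. a i l * T0 l n * a n j) + \<sigma> * (\<Sum>l\<in>V. a i l * CC l j) + \<sigma> * (\<Sum>l\<in>V. a j l * CC l i) + \<sigma>\<^sup>2 * XX i j"
proof -
  have shift: "(\<Sum>t = 1..m. y t i * y t j) + (y (Suc m) i * y (Suc m) j - y 1 i * y 1 j) = (\<Sum>t = 1..m. y (Suc t) i * y (Suc t) j)"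
  proof (induction m)
    case (Suc n)
    then show ?case by simp
  qed simp
  have "(\<Sum>t = 1..m. y (Suc t) i * y (Suc t) j)
      = (\<Sum>t = 1..m. (\<Sum>n\<in>V. (y (Suc t) i * y t n) * a n j) + \<sigma> * (y (Suc t) i * x (Suc t) j))"
    using dyn[OF _ ij(2)] sym[OF ij(2)] by (intro sum.cong refl) (simp add: algebra_simps sum_distrib_left)
  also have "\<dots> = (\<Sum>n\<in>V. (\<Sum>t = 1..m. y (Suc t) i * y t n) * a n j) + \<sigma> * (\<Sum>t = 1..m. y (Suc t) i * x (Suc t) j)"
    unfolding sum.distrib sum_distrib_left sum_distrib_right by (subst sum.swap) simp
  also have "(\<Sum>t = 1..m. y (Suc t) i * x (Suc t) j)
      = (\<Sum>t = 1..m. (\<Sum>l\<in>V. a i l * (y t l * x (Suc t) j)) + \<sigma> * (x (Suc t) i * x (Suc t) j))"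
    using dyn[OF _ ij(1)] by (intro sum.cong refl) (simp add: algebra_simps sum_distrib_left)
  also have "\<dots> = (\<Sum>l\<in>V. a i l * (\<Sum>t = 1..m. y t l * x (Suc t) j)) + \<sigma> * (\<Sum>t = 1..m. x (Suc t) i * x (Suc t) j)"
    unfolding sum.distrib sum_distrib_left by (subst sum.swap) simp
  finally have "(\<Sum>t = 1..m. y (Suc t) i * y (Suc t) j) / real m
      = (\<Sum>n\<in>V. ((\<Sum>t = 1..m. y (Suc t) i * y t n) / real m) * a n j)
        + \<sigma> * ((\<Sum>l\<in>V. a i l * CC l j) + \<sigma> * XX i j)"
    unfolding CC_def XX_def unfolding sum_mult_divide
    unfolding times_divide_eq_right add_divide_distrib[symmetric] by (rule arg_cong)
  also have "(\<Sum>n\<in>V. ((\<Sum>t = 1..m. y (Suc t) i * y t n) / real m) * a n j)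
      = (\<Sum>n\<in>V. ((\<Sum>l\<in>V. a i l * T0 l n) + \<sigma> * CC n i) * a n j)"
    using lag_recursion[OF ij(1)] by (intro sum.cong refl) (simp only:)
  also have "\<dots> = (\<Sum>n\<in>V. \<Sum>l\<in>V. a i l * T0 l n * a n j) + \<sigma> * (\<Sum>l\<in>V. CC l i * a l j)"
    by (simp add: distrib_right sum.distrib sum_distrib_right sum_distrib_left mult.assoc)
  also have "(\<Sum>n\<in>V. \<Sum>l\<in>V. a i l * T0 l n * a n j) = (\<Sum>l\<in>V. \<Sum>n\<in>V. a i l * T0 l n * a n j)" by (rule sum.swap)
  also have "(\<Sum>l\<in>V. CC l i * a l j) = (\<Sum>l\<in>V. a j l * CC l i)"
    using sym[OF _ ij(2)] by (intro sum.cong refl) simp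
  finally have "(\<Sum>t = 1..m. y (Suc t) i * y (Suc t) j) / real m
    = (\<Sum>l\<in>V. \<Sum>n\<in>V. a i l * T0 l n * a n j) + \<sigma> * (\<Sum>l\<in>V. a j l * CC l i) + \<sigma> * ((\<Sum>l\<in>V. a i l * CC l j) + \<sigma> * XX i j)" .
  then show ?thesis unfolding T0_def add_divide_distrib[symmetric] shift by (simp add: power2_eq_square algebra_simps)
qed

lemma R0_two_sided:
  assumes ij: "i \<in> V" "j \<in> V"
  shows "R0 i j = c * of_bool (i = j) + (\<Sum>l\<in>V. \<Sum>n\<in>V. a i l * R0 l n * a n j)"
proof -
  have "(\<Sum>l\<in>V. a i l * R1 l j) = (\<Sum>l\<in>V. a i l * (\<Sum>n\<in>V. R0 l n * a n j))"
    using R1_right ij(2) by (intro sum.cong refl) simp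
  then show ?thesis unfolding R0_left[OF ij] by (simp add: sum_distrib_left mult.assoc)
qed

text \<open>The sample variance in the cross terms is at most its limit plus the maximal error M, so
  it returns as \<sigma> \<delta> M on the right. This is at most (1 - \<rho>) / 2 times M and
  leaves the contraction factor (1 + \<rho>) / 2, so no bound on the sample variance is needed in
  advance.\<close>

lemma T0_error:
  assumes ij: "i \<in> V" "j \<in> V" shows "\<bar>T0 i j - R0 i j\<bar> \<le> err1 * \<delta>"
proof -
  define K where "K = \<sigma>\<^sup>2 / (1 - \<rho>)"
  let ?e = "\<delta> * (\<sigma> * K + 2 * \<sigma> + 5 * \<sigma>\<^sup>2 + 2)"
  have K: "0 \<le> K" unfolding K_def using rho by simp
  have "\<bar>(\<lambda>k. T0 (fst k) (snd k) - R0 (fst k) (snd k)) (i, j)\<bar> \<le> ?e / (1 - (1 + \<rho>) / 2)"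
  proof (rule contraction_bound[of "V \<times> V"])
    fix M k assume M: "0 \<le> M" "\<And>k. k \<in> V \<times> V \<Longrightarrow> \<bar>T0 (fst k) (snd k) - R0 (fst k) (snd k)\<bar> \<le> M" and k: "k \<in> V \<times> V"
    obtain i j where ij: "k = (i, j)" "i \<in> V" "j \<in> V" using k by auto
    have D: "\<bar>T0 l n - R0 l n\<bar> \<le> M" if "l \<in> V" "n \<in> V" for l n using M(2)[of "(l, n)"] that by simp
    have C: "\<bar>CC l n\<bar> \<le> \<delta> / 2 * (K + M) + \<delta>" if "l \<in> V" "n \<in> V" for l n
    proof -
      have "\<bar>CC l n\<bar> \<le> \<delta> / 2 * T0 l l + \<delta>" using cross_cov[OF that] unfolding CC_def T0_def .
      moreover have "T0 l l \<le> K + M" using D[OF that(1,1)] R0_bound'[OF that(1,1), folded K_def] by linarith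
      then have "\<delta> / 2 * T0 l l \<le> \<delta> / 2 * (K + M)" using delta by (intro mult_left_mono) auto
      ultimately show ?thesis by linarith
    qed
    let ?c = "\<delta> / 2 * (K + M) + \<delta>"
    have AC: "\<bar>\<sigma> * (\<Sum>l\<in>V. a i l * CC l n)\<bar> \<le> \<sigma> * ?c" if "i \<in> V" "n \<in> V" for i n
    proof -
      have c0: "0 \<le> ?c" using delta K M by simp
      have "\<bar>\<Sum>l\<in>V. a i l * CC l n\<bar> \<le> \<rho> * ?c" by (rule abs_row_le[OF that(1)]) (rule C, auto simp: that)
      also have "\<dots> \<le> 1 * ?c" using rho c0 by (intro mult_right_mono) auto
      finally show ?thesis using sigma by (simp add: abs_mult)
    qed
    have X: "\<bar>\<sigma>\<^sup>2 * XX i j - c * of_bool (i = j)\<bar> \<le> \<sigma>\<^sup>2 * (5 * \<delta>)"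
      using noise_cov[OF ij(2,3)] unfolding sigma(2) right_diff_distrib[symmetric] abs_mult XX_def
      by (intro mult_mono) auto
    have B: "\<bar>(y (Suc m) i * y (Suc m) j - y 1 i * y 1 j) / real m\<bar> \<le> 2 * \<delta>"
      using boundary_product[OF ij(2,3)] unfolding diff_divide_distrib by linarith
    have A: "\<bar>(\<Sum>l\<in>V. \<Sum>n\<in>V. a i l * T0 l n * a n j) - (\<Sum>l\<in>V. \<Sum>n\<in>V. a i l * R0 l n * a n j)\<bar> \<le> \<rho>\<^sup>2 * M"
    proof -
      have "(\<Sum>l\<in>V. \<Sum>n\<in>V. a i l * T0 l n * a n j) - (\<Sum>l\<in>V. \<Sum>n\<in>V. a i l * R0 l n * a n j)
          = (\<Sum>l\<in>V. \<Sum>n\<in>V. a i l * (T0 l n - R0 l n) * a n j)"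
        by (simp add: sum_subtractf[symmetric] algebra_simps)
      then show ?thesis using two_sided_le[OF ij(2,3), of "\<lambda>l n. T0 l n - R0 l n" M] D M by simp
    qed
    have "\<bar>T0 i j - R0 i j\<bar> \<le> \<rho>\<^sup>2 * M + \<sigma> * ?c + \<sigma> * ?c + \<sigma>\<^sup>2 * (5 * \<delta>) + 2 * \<delta>"
      using cov_recursion[OF ij(2,3)] R0_two_sided[OF ij(2,3)] A AC[OF ij(2,3)] AC[OF ij(3,2)] X B by linarith
    also have "\<dots> = \<rho>\<^sup>2 * M + (\<sigma> * \<delta>) * M + ?e" by (simp add: algebra_simps)
    also have "\<dots> \<le> \<rho> * M + ((1 - \<rho>) / 2) * M + ?e"
    proof -
      have "\<rho>\<^sup>2 * M \<le> \<rho> * M" using rho M(1) by (intro mult_right_mono) (auto simp: power2_eq_square mult_left_le)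
      moreover have "(\<sigma> * \<delta>) * M \<le> ((1 - \<rho>) / 2) * M" by (rule mult_right_mono[OF delta(3) M(1)])
      ultimately show ?thesis by (intro add_right_mono add_mono)
    qed
    also have "\<dots> = (1 + \<rho>) / 2 * M + ?e" by (simp add: field_simps)
    finally show "\<bar>T0 (fst k) (snd k) - R0 (fst k) (snd k)\<bar> \<le> (1 + \<rho>) / 2 * M + ?e" using ij by simp
  qed (use finV rho delta K sigma ij in auto)
  also have "1 - (1 + \<rho>) / 2 = (1 - \<rho>) / 2" by (simp add: field_simps)
  also have "?e / ((1 - \<rho>) / 2) = err1 * \<delta>"
  proof -
    have "\<sigma> * K = \<sigma> ^ 3 / (1 - \<rho>)" by (simp add: power2_eq_square power3_eq_cube K_def)
    moreover have "z / ((1 - \<rho>) / 2) = 2 / (1 - \<rho>) * z" for z by simp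
    ultimately show ?thesis unfolding err1_def by (simp only: mult_ac)
  qed
  finally show ?thesis by simp
qed

lemma err_bounds: "0 \<le> err1" "err1 + 1 + \<sigma>\<^sup>2 / (1 - \<rho>) \<le> err" "err1 + \<sigma> * (\<sigma>\<^sup>2 / (1 - \<rho>) + err1 + 1) \<le> err"
proof -
  show e1: "0 \<le> err1" unfolding err1_def using sigma rho by (intro mult_nonneg_nonneg add_nonneg_nonneg) auto
  have q: "0 \<le> \<sigma>\<^sup>2 / (1 - \<rho>)" using rho by simp
  have "err = (err1 + 1 + \<sigma>\<^sup>2 / (1 - \<rho>)) + \<sigma> * (err1 + 1 + \<sigma>\<^sup>2 / (1 - \<rho>))" unfolding err_def by (simp only: distrib_right mult_1)
  moreover have "0 \<le> \<sigma> * (err1 + 1 + \<sigma>\<^sup>2 / (1 - \<rho>))" using sigma e1 q by (intro mult_nonneg_nonneg) linarith+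
  ultimately show "err1 + 1 + \<sigma>\<^sup>2 / (1 - \<rho>) \<le> err" "err1 + \<sigma> * (\<sigma>\<^sup>2 / (1 - \<rho>) + err1 + 1) \<le> err"
    using q by (simp_all add: ac_simps)
qed

lemma corr1_error:
  assumes ij: "i \<in> V" "j \<in> V" shows "\<bar>corr1 y (Suc m) i j - R1 i j\<bar> \<le> err * \<delta>"
proof -
  define Q where "Q = \<sigma>\<^sup>2 / (1 - \<rho>)"
  have Q: "0 \<le> Q" unfolding Q_def using rho by simp
  note eb = err_bounds[folded Q_def] and R0b = R0_bound'[folded Q_def]
  have "\<bar>CC j i\<bar> \<le> \<delta> / 2 * T0 j j + \<delta>" using cross_cov[OF ij(2,1)] unfolding CC_def T0_def .
  moreover have "T0 j j \<le> Q + err1"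
  proof -
    have "err1 * \<delta> \<le> err1 * 1" using eb(1) delta by (intro mult_left_mono) auto
    then show ?thesis using T0_error[OF ij(2,2)] R0b[OF ij(2,2)] by linarith
  qed
  then have "\<delta> / 2 * T0 j j \<le> \<delta> / 2 * (Q + err1)" using delta by (intro mult_left_mono) auto
  moreover have "\<delta> / 2 * (Q + err1) \<le> \<delta> * (Q + err1)"
    using delta eb(1) Q by (intro mult_right_mono) auto
  ultimately have "\<bar>CC j i\<bar> \<le> \<delta> * (Q + err1 + 1)" by (simp add: algebra_simps)
  then have "\<bar>\<sigma> * CC j i\<bar> \<le> \<sigma> * (\<delta> * (Q + err1 + 1))" using sigma by (simp add: abs_mult)
  moreover have "\<bar>(\<Sum>l\<in>V. a i l * T0 l j) - R1 i j\<bar> \<le> \<rho> * (err1 * \<delta>)"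
  proof -
    have "(\<Sum>l\<in>V. a i l * T0 l j) - R1 i j = (\<Sum>l\<in>V. a i l * (T0 l j - R0 l j))"
      unfolding R1_left[OF ij] by (simp add: right_diff_distrib sum_subtractf)
    then show ?thesis using abs_row_le[OF ij(1), of "\<lambda>l. T0 l j - R0 l j"] T0_error ij(2) by simp
  qed
  moreover have "\<rho> * (err1 * \<delta>) \<le> 1 * (err1 * \<delta>)" using rho eb(1) delta by (intro mult_right_mono) auto
  \<comment> \<open>\<open>corr1\<close> divides by n - 1, which is m for n = Suc m, so no boundary
    term arises.\<close>
  moreover have "corr1 y (Suc m) i j = (\<Sum>l\<in>V. a i l * T0 l j) + \<sigma> * CC j i"
    using lag_recursion[OF ij] by (simp add: corr1_def)
  ultimately have "\<bar>corr1 y (Suc m) i j - R1 i j\<bar> \<le> err1 * \<delta> + \<sigma> * (\<delta> * (Q + err1 + 1))" by linarith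
  also have "\<dots> = (err1 + \<sigma> * (Q + err1 + 1)) * \<delta>" by (simp add: algebra_simps)
  also have "\<dots> \<le> err * \<delta>" using eb(3) delta by (intro mult_right_mono) auto
  finally show ?thesis .
qed

text \<open>\<open>corr0\<close> averages m + 1 products and \<open>T0\<close> only m. The last
  product and a share 1 / (m + 1) of the limit remain, both of order \<delta>.\<close>

lemma corr0_error:
  assumes ij: "i \<in> V" "j \<in> V" shows "\<bar>corr0 y (Suc m) i j - R0 i j\<bar> \<le> err * \<delta>"
proof -
  let ?n = "real (Suc m)" and ?b = "y (Suc m) i * y (Suc m) j / real m"
  have n: "0 < ?n" "1 / ?n \<le> \<delta>"
  proof -
    have "1 / ?n \<le> 1 / real m" using m_pos by (intro divide_left_mono) auto
    also have "\<dots> \<le> \<delta>" using delta(4) m_pos by (simp add: divide_le_eq)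
    finally show "1 / ?n \<le> \<delta>" .
  qed simp
  have "corr0 y (Suc m) i j = (real m * T0 i j + real m * ?b) / ?n"
    using m_pos by (simp add: corr0_def T0_def)
  also have "\<dots> = real m / ?n * (T0 i j + ?b)" by (simp only: distrib_left[symmetric] times_divide_eq_left)
  finally have eq0: "corr0 y (Suc m) i j = real m / ?n * (T0 i j + ?b)" .
  have "corr0 y (Suc m) i j - R0 i j = real m / ?n * (T0 i j - R0 i j + ?b) - 1 / ?n * R0 i j"
  proof -
    have 1: "real m / ?n = 1 - 1 / ?n" by (simp add: field_simps)
    have "(1 - r) * (t + b) - R = (1 - r) * (t - R + b) - r * R" for r t b R :: real
      by (simp add: algebra_simps)
    then show ?thesis
      unfolding eq0 1 by blast
  qed
  moreover have "\<bar>real m / ?n * (T0 i j - R0 i j + ?b)\<bar> \<le> 1 * (err1 * \<delta> + \<delta>)"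
    unfolding abs_mult
  proof (rule mult_mono)
    show "\<bar>T0 i j - R0 i j + ?b\<bar> \<le> err1 * \<delta> + \<delta>"
      using T0_error[OF ij] boundary_product(2)[OF ij] by linarith
  qed auto
  moreover have "\<bar>1 / ?n * R0 i j\<bar> \<le> \<delta> * (\<sigma>\<^sup>2 / (1 - \<rho>))"
    unfolding abs_mult using n R0_bound'[OF ij] delta by (intro mult_mono) auto
  ultimately have "\<bar>corr0 y (Suc m) i j - R0 i j\<bar> \<le> 1 * (err1 * \<delta> + \<delta>) + \<delta> * (\<sigma>\<^sup>2 / (1 - \<rho>))"
    by (rule abs_eq_diff_le)
  also have "\<dots> = (err1 + 1 + \<sigma>\<^sup>2 / (1 - \<rho>)) * \<delta>" by (simp add: algebra_simps)
  also have "\<dots> \<le> err * \<delta>" using err_bounds(2) delta by (intro mult_right_mono) auto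
  finally show ?thesis .
qed

end

subsection \<open>Recovery from perturbed covariances\<close>

text \<open>The offset e is arbitrary because clustering only sees differences of entries; only a
  lower bound b on the slope is recorded.\<close>

definition scaled_separation :: "real \<Rightarrow> nat set \<Rightarrow> graph \<Rightarrow> rmatrix \<Rightarrow> real \<Rightarrow> real \<Rightarrow> bool" where
  "scaled_separation d S g M b \<epsilon> \<longleftrightarrow> (\<exists>b' e. b \<le> b' \<and> (\<forall>i\<in>S. \<forall>j\<in>S. i \<noteq> j \<longrightarrow>
     \<bar>d * M i j - (b' * of_bool (g i j) + e)\<bar> \<le> \<epsilon>))"

lemma scaled_separation_perturb:
  assumes "scaled_separation d S g M b \<epsilon>" and "\<And>i j. i \<in> S \<Longrightarrow> j \<in> S \<Longrightarrow> \<bar>d * L i j - d * M i j\<bar> \<le> \<epsilon>'"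
  shows "scaled_separation d S g L b (\<epsilon> + \<epsilon>')"
proof -
  obtain b' e where b': "b \<le> b'" and M: "\<And>i j. i \<in> S \<Longrightarrow> j \<in> S \<Longrightarrow> i \<noteq> j \<Longrightarrow>
      \<bar>d * M i j - (b' * of_bool (g i j) + e)\<bar> \<le> \<epsilon>"
    using assms(1) unfolding scaled_separation_def by blast
  have "\<bar>d * L i j - (b' * of_bool (g i j) + e)\<bar> \<le> \<epsilon> + \<epsilon>'" if "i \<in> S" "j \<in> S" "i \<noteq> j" for i j
    using abs_diff_chain[OF assms(2)[OF that(1,2)] M[OF that] add.commute] .
  then show ?thesis unfolding scaled_separation_def using b' by blast
qed

lemma clu_scaled_separation:
  assumes fin: "finite S" and d: "0 < d" and sep: "scaled_separation d S g M b \<epsilon>" "6 * \<epsilon> < b"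
    and mixed: "\<not> all_connected S g" "\<not> all_disconnected S g"
  shows "clu S M = {\<lambda>i j. i \<in> S \<and> j \<in> S \<and> i \<noteq> j \<and> g i j}"
proof -
  obtain b' e where b': "b \<le> b'" and M: "\<And>i j. i \<in> S \<Longrightarrow> j \<in> S \<Longrightarrow> i \<noteq> j \<Longrightarrow>
      \<bar>d * M i j - (b' * of_bool (g i j) + e)\<bar> \<le> \<epsilon>"
    using sep(1) unfolding scaled_separation_def by blast
  show ?thesis
  proof (rule clu_two_levels[OF fin _ _ mixed, where c = "e / d" and b = "b' / d" and \<delta> = "\<epsilon> / d"])
    fix i j assume ij: "i \<in> S" "j \<in> S" "i \<noteq> j"
    have "M i j - (e / d + b' / d * of_bool (g i j)) = (d * M i j - (b' * of_bool (g i j) + e)) / d"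
      using d by (simp add: field_simps)
    also have "\<bar>\<dots>\<bar> \<le> \<epsilon> / d" unfolding abs_divide using M[OF ij] d by (simp add: divide_right_mono)
    finally show "\<bar>M i j - (e / d + b' / d * of_bool (g i j))\<bar> \<le> \<epsilon> / d" .
  next
    have "6 * \<epsilon> / d < b' / d" using sep(2) b' d by (intro divide_strict_right_mono) auto
    then show "6 * (\<epsilon> / d) < b' / d" by simp
  qed
qed

lemma norm_max_on_le:
  assumes "finite S" "j \<in> S" shows "\<bar>v j\<bar> \<le> norm_max_on S v"
  unfolding norm_max_on_def using assms by (intro Max_ge) auto

lemma norm_max_on_bound:
  assumes "finite S" "S \<noteq> {}" "\<And>j. j \<in> S \<Longrightarrow> \<bar>v j\<bar> \<le> b" shows "norm_max_on S v \<le> b"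
  unfolding norm_max_on_def using assms by (subst Max_le_iff) auto

lemma abs_sum_norm1_le:
  fixes f v :: "'b \<Rightarrow> real"
  assumes "\<And>l. l \<in> S \<Longrightarrow> \<bar>f l\<bar> \<le> b" "(\<Sum>l\<in>S. \<bar>v l\<bar>) \<le> 1" "0 \<le> b"
  shows "\<bar>\<Sum>l\<in>S. v l * f l\<bar> \<le> b"
  using order_trans[OF abs_sum_mult_le[OF assms(1)] mult_right_mono[OF assms(2,3)]] by simp

context resolvent_pair
begin

lemma granger_coeff_R1:
  assumes SV: "S \<subseteq> V" and U: "block_solution S U" and ij: "i \<in> S" "j \<in> S"
  shows "(\<Sum>l\<in>S. granger_coeff S U i l * R0 l j) = R1 i j"
proof -
  have "i \<in> V" "j \<in> V" using ij SV by auto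
  then show ?thesis by (rule trans[OF granger_coeff_eq[OF SV U stationary_cov_R0 ij] R1_left[symmetric]])
qed

lemma granger_row_residual:
  assumes SV: "S \<subseteq> V" and U: "block_solution S U"
    and r0: "\<And>i j. i \<in> S \<Longrightarrow> j \<in> S \<Longrightarrow> \<bar>r0 i j - R0 i j\<bar> \<le> e"
    and r1: "\<And>i j. i \<in> S \<Longrightarrow> j \<in> S \<Longrightarrow> \<bar>r1 i j - R1 i j\<bar> \<le> e"
    and e: "0 \<le> e" and ij: "i \<in> S" "j \<in> S"
  shows "\<bar>(\<Sum>l\<in>S. granger_coeff S U i l * r0 l j) - r1 i j\<bar> \<le> 2 * e"
proof -
  let ?X = "granger_coeff S U i"
  have "(\<Sum>l\<in>S. ?X l * R0 l j) = R1 i j"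
    by (rule granger_coeff_R1[OF SV U ij])
  moreover have "(\<Sum>l\<in>S. ?X l * r0 l j) - (\<Sum>l\<in>S. ?X l * R0 l j) = (\<Sum>l\<in>S. ?X l * (r0 l j - R0 l j))"
    by (simp add: sum_subtractf right_diff_distrib)
  moreover have "\<bar>\<Sum>l\<in>S. ?X l * (r0 l j - R0 l j)\<bar> \<le> e"
    by (rule abs_sum_norm1_le[OF r0 granger_coeff_row[OF SV U ij(1)] e]) (use ij in auto)
  ultimately show ?thesis using r1[OF ij] by linarith
qed

text \<open>The true coefficient row is feasible and has residual at most 2 e, hence so has the
  minimizer. Passing to the exact covariances costs another 2 e, since the minimizer also has 1-norm
  at most 1, and \<open>cov_lower_bound\<close> turns 4 e into 8 e / c without a factor |S|.\<close>

lemma regra_error: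
  assumes SV: "S \<subseteq> V" and U: "block_solution S U"
    and r0: "\<And>i j. i \<in> S \<Longrightarrow> j \<in> S \<Longrightarrow> \<bar>r0 i j - R0 i j\<bar> \<le> e"
    and r1: "\<And>i j. i \<in> S \<Longrightarrow> j \<in> S \<Longrightarrow> \<bar>r1 i j - R1 i j\<bar> \<le> e"
    and e: "0 \<le> e" and A: "regra_matrix S r0 r1 A" and ij: "i \<in> S" "j \<in> S"
  shows "\<bar>A i j - granger_coeff S U i j\<bar> \<le> 8 * e / c"
proof -
  let ?X = "granger_coeff S U i"
  have fin: "finite S" using SV finV finite_subset by blast
  have n1: "(\<Sum>l\<in>S. \<bar>A i l\<bar>) \<le> 1" and opt: "\<And>v. norm1_on S v \<le> 1 \<Longrightarrow> regra_residual S r0 r1 i (A i) \<le> regra_residual S r0 r1 i v"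
    using A ij(1) unfolding regra_matrix_def norm1_on_def by blast+
  have "regra_residual S r0 r1 i ?X \<le> 2 * e"
    unfolding regra_residual_def
    by (rule norm_max_on_bound[OF fin]) (use ij granger_row_residual[OF SV U r0 r1 e ij(1)] in auto)
  moreover have "norm1_on S ?X \<le> 1" unfolding norm1_on_def by (rule granger_coeff_row[OF SV U ij(1)])
  ultimately have res: "regra_residual S r0 r1 i (A i) \<le> 2 * e" using opt by (meson order_trans)
  have "\<bar>\<Sum>l\<in>S. (A i l - ?X l) * R0 l k\<bar> \<le> 4 * e" if k: "k \<in> S" for k
  proof -
    have "\<bar>(\<Sum>l\<in>S. A i l * r0 l k) - r1 i k\<bar> \<le> 2 * e"
      using norm_max_on_le[OF fin k, of "\<lambda>j. (\<Sum>l\<in>S. A i l * r0 l j) - r1 i j"] res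
      unfolding regra_residual_def by linarith
    moreover have "\<bar>\<Sum>l\<in>S. A i l * (r0 l k - R0 l k)\<bar> \<le> e"
      by (rule abs_sum_norm1_le[OF r0 n1 e]) (use k in auto)
    moreover have "(\<Sum>l\<in>S. A i l * (r0 l k - R0 l k)) = (\<Sum>l\<in>S. A i l * r0 l k) - (\<Sum>l\<in>S. A i l * R0 l k)"
      by (simp add: sum_subtractf right_diff_distrib)
    moreover have "(\<Sum>l\<in>S. ?X l * R0 l k) = R1 i k"
      by (rule granger_coeff_R1[OF SV U ij(1) k])
    moreover have "(\<Sum>l\<in>S. (A i l - ?X l) * R0 l k) = (\<Sum>l\<in>S. A i l * R0 l k) - (\<Sum>l\<in>S. ?X l * R0 l k)"
      by (simp add: sum_subtractf left_diff_distrib)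
    ultimately show ?thesis using r1[OF ij(1) k] by linarith
  qed
  from cov_lower_bound[OF SV stationary_cov_R0 c this ij(2)]
  show ?thesis by simp
qed

text \<open>The rows of the perturbation have mass up to |S| e, which is where the dense regime
  enters. Against the bound 2 / c on the exact inverse this gives a perturbation series of ratio 1 /
  2.\<close>

lemma sample_cov_invertible:
  assumes SV: "S \<subseteq> V" and r0: "\<And>i j. i \<in> S \<Longrightarrow> j \<in> S \<Longrightarrow> \<bar>r0 i j - R0 i j\<bar> \<le> e"
    and sym0: "\<And>i j. r0 i j = r0 j i" and e: "0 \<le> e" "real (card S) * e \<le> c / 4"
  shows "\<exists>b. mat_inverse_on S r0 b"
proof -
  have fin: "finite S" using SV finV finite_subset by blast
  have "\<forall>i. \<exists>v. \<forall>j\<in>S. (\<Sum>m\<in>S. v m * R0 m j) = of_bool (i = j)"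
    by (rule allI, rule cov_solvable[OF SV stationary_cov_R0 c])
  from choice[OF this] obtain Q where Q: "\<And>i j. j \<in> S \<Longrightarrow> (\<Sum>m\<in>S. Q i m * R0 m j) = of_bool (i = j)"
    by blast
  \<comment> \<open>Column sums of the exact inverse follow by duality: the combination of its rows
    with the signs of column l is mapped by R0 to a vector with entries at most 1.\<close>
  have Qcol: "(\<Sum>j\<in>S. \<bar>Q j l\<bar>) \<le> 2 / c" if l: "l \<in> S" for l
  proof -
    let ?v = "\<lambda>m. \<Sum>j\<in>S. sgn (Q j l) * Q j m"
    have "\<bar>\<Sum>m\<in>S. ?v m * R0 m k\<bar> \<le> 1" if k: "k \<in> S" for k
    proof -
      have "(\<Sum>m\<in>S. ?v m * R0 m k) = (\<Sum>j\<in>S. sgn (Q j l) * (\<Sum>m\<in>S. Q j m * R0 m k))"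
        unfolding sum_distrib_left sum_distrib_right by (subst sum.swap) (simp add: mult.assoc)
      also have "\<dots> = (\<Sum>j\<in>S. sgn (Q j l) * of_bool (j = k))" by (intro sum.cong refl) (simp only: Q k)
      also have "\<dots> = sgn (Q k l)" by (rule sum_of_bool_mult(2)[OF fin k])
      finally show ?thesis by (simp add: abs_sgn_eq)
    qed
    from cov_lower_bound[OF SV stationary_cov_R0 c this l]
    have "?v l \<le> 2 * 1 / c" by (rule order_trans[OF abs_ge_self])
    moreover have "?v l = (\<Sum>j\<in>S. \<bar>Q j l\<bar>)"
      by (intro sum.cong refl) (metis abs_sgn mult.commute)
    ultimately show ?thesis by (simp only: mult_1_right)
  qed
  have solvable: "\<exists>v. \<forall>j\<in>S. (\<Sum>l\<in>S. v l * r0 l j) = z j" for z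
  proof -
    \<comment> \<open>With E = r0 - R0 the equation v r0 = z reads v = (z - v E) Q; the matrix of
      this fixed point equation for v has row sums at most 1 / 2.\<close>
    let ?B = "\<lambda>l m. - (\<Sum>j\<in>S. (r0 m j - R0 m j) * Q j l)"
    have rows: "(\<Sum>m\<in>S. \<bar>?B l m\<bar>) \<le> 1 / 2" if l: "l \<in> S" for l
    proof -
      have "\<bar>?B l m\<bar> \<le> e * (2 / c)" if m: "m \<in> S" for m
      proof -
        have "\<bar>\<Sum>j\<in>S. Q j l * (r0 m j - R0 m j)\<bar> \<le> (\<Sum>j\<in>S. \<bar>Q j l\<bar>) * e"
          by (rule abs_sum_mult_le) (rule r0[OF m])
        also have "\<dots> \<le> 2 / c * e" by (intro mult_right_mono Qcol l e)
        finally show ?thesis by (simp add: mult.commute)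
      qed
      then have "(\<Sum>m\<in>S. \<bar>?B l m\<bar>) \<le> (\<Sum>m\<in>S. e * (2 / c))" by (intro sum_mono)
      also have "\<dots> = (real (card S) * e) * (2 / c)" by simp
      also have "\<dots> \<le> c / 4 * (2 / c)" using e c by (intro mult_right_mono) auto
      also have "\<dots> = 1 / 2" using c by simp
      finally show ?thesis .
    qed
    have "\<exists>f. \<forall>l\<in>S. f l = (\<Sum>j\<in>S. z j * Q j l) + (\<Sum>m\<in>S. ?B l m * f m)"
      by (rule linear_system_solvable[OF fin _ rows]) simp_all
    then obtain v where v: "\<And>l. l \<in> S \<Longrightarrow> v l = (\<Sum>j\<in>S. z j * Q j l) + (\<Sum>m\<in>S. ?B l m * v m)"
      by blast
    have v': "v l = (\<Sum>j\<in>S. (z j - (\<Sum>m\<in>S. v m * (r0 m j - R0 m j))) * Q j l)" if l: "l \<in> S" for l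
    proof -
      have "(\<Sum>m\<in>S. ?B l m * v m) = - (\<Sum>m\<in>S. \<Sum>j\<in>S. v m * (r0 m j - R0 m j) * Q j l)"
        by (simp add: sum_negf sum_distrib_right sum_distrib_left mult_ac)
      also have "\<dots> = - (\<Sum>j\<in>S. (\<Sum>m\<in>S. v m * (r0 m j - R0 m j)) * Q j l)"
        by (subst sum.swap) (simp add: sum_distrib_right)
      finally have "v l = (\<Sum>j\<in>S. z j * Q j l) - (\<Sum>j\<in>S. (\<Sum>m\<in>S. v m * (r0 m j - R0 m j)) * Q j l)"
        using v[OF l] by linarith
      then show ?thesis by (simp only: left_diff_distrib sum_subtractf)
    qed
    have "(\<Sum>l\<in>S. v l * r0 l k) = z k" if k: "k \<in> S" for k
    proof -
      let ?w = "\<lambda>j. z j - (\<Sum>m\<in>S. v m * (r0 m j - R0 m j))"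
      have "(\<Sum>l\<in>S. v l * R0 l k) = (\<Sum>l\<in>S. (\<Sum>j\<in>S. ?w j * Q j l) * R0 l k)"
        by (intro sum.cong refl arg_cong2[where f = times] v')
      also have "\<dots> = (\<Sum>j\<in>S. ?w j * (\<Sum>l\<in>S. Q j l * R0 l k))"
        unfolding sum_distrib_left sum_distrib_right by (subst sum.swap) (simp add: mult.assoc)
      also have "\<dots> = (\<Sum>j\<in>S. ?w j * of_bool (j = k))" by (intro sum.cong refl) (simp only: Q k)
      also have "\<dots> = ?w k" by (rule sum_of_bool_mult(2)[OF fin k])
      finally have "(\<Sum>l\<in>S. v l * R0 l k) = ?w k" .
      moreover have "(\<Sum>m\<in>S. v m * (r0 m k - R0 m k)) = (\<Sum>m\<in>S. v m * r0 m k) - (\<Sum>m\<in>S. v m * R0 m k)"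
        by (simp add: right_diff_distrib sum_subtractf)
      ultimately show ?thesis by linarith
    qed
    then show ?thesis by blast
  qed
  have "\<forall>i. \<exists>v. \<forall>j\<in>S. (\<Sum>l\<in>S. v l * r0 l j) = of_bool (i = j)" by (rule allI, rule solvable)
  from choice[OF this] obtain b where b: "\<And>i j. j \<in> S \<Longrightarrow> (\<Sum>l\<in>S. b i l * r0 l j) = of_bool (i = j)"
    by blast
  have bt: "(\<Sum>l\<in>S. r0 i l * b j l) = of_bool (j = i)" if "i \<in> S" for i j
    using b[OF that, of j] sym0 by (simp add: mult.commute)
  \<comment> \<open>b is a left inverse of a symmetric matrix, so its transpose is a right inverse
    and the two coincide on S.\<close>
  have bsym: "b i j = b j i" if ij: "i \<in> S" "j \<in> S" for i j
  proof -
    have "b i j = (\<Sum>l\<in>S. b i l * of_bool (l = j))" by (rule sum_of_bool_mult(2)[OF fin ij(2), symmetric])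
    also have "\<dots> = (\<Sum>l\<in>S. b i l * (\<Sum>n\<in>S. r0 l n * b j n))"
      by (intro sum.cong refl) (simp add: bt eq_commute)
    also have "\<dots> = (\<Sum>n\<in>S. (\<Sum>l\<in>S. b i l * r0 l n) * b j n)"
      unfolding sum_distrib_left sum_distrib_right by (subst sum.swap) (simp add: mult.assoc)
    also have "\<dots> = (\<Sum>n\<in>S. of_bool (i = n) * b j n)" by (intro sum.cong refl) (simp only: b)
    also have "\<dots> = b j i" by (rule sum_of_bool_mult(1)[OF fin ij(1)])
    finally show ?thesis .
  qed
  have "mat_mult_on S r0 b i j = of_bool (i = j)" if ij: "i \<in> S" "j \<in> S" for i j
  proof -
    have "mat_mult_on S r0 b i j = (\<Sum>l\<in>S. r0 i l * b j l)"
      unfolding mat_mult_on_def using bsym ij by (intro sum.cong refl) simp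
    then show ?thesis using bt[OF ij(1)] by auto
  qed
  then have "mat_inverse_on S r0 b" unfolding mat_inverse_on_def using b by (simp add: mat_mult_on_def)
  then show ?thesis by blast
qed

text \<open>The estimated row solves its sample equation exactly but has no bound on its 1-norm. The
  perturbation therefore acts on the unknown error itself; |S| e \<le> c / 4 makes this a
  contraction with factor 1 / 2.\<close>

lemma granger_error:
  assumes SV: "S \<subseteq> V" and U: "block_solution S U"
    and r0: "\<And>i j. i \<in> S \<Longrightarrow> j \<in> S \<Longrightarrow> \<bar>r0 i j - R0 i j\<bar> \<le> e"
    and r1: "\<And>i j. i \<in> S \<Longrightarrow> j \<in> S \<Longrightarrow> \<bar>r1 i j - R1 i j\<bar> \<le> e"
    and sym0: "\<And>i j. r0 i j = r0 j i" and e: "0 \<le> e" "real (card S) * e \<le> c / 4"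
    and A: "granger_matrix S r0 r1 A" and ij: "i \<in> S" "j \<in> S"
  shows "\<bar>A i j - granger_coeff S U i j\<bar> \<le> 8 * e / c"
proof -
  let ?v = "\<lambda>l. A i l - granger_coeff S U i l"
  have fin: "finite S" using SV finV finite_subset by blast
  obtain b where b: "mat_inverse_on S r0 b" using sample_cov_invertible[OF SV r0 sym0 e] by blast
  then have A': "\<And>l. l \<in> S \<Longrightarrow> A i l = (\<Sum>k\<in>S. r1 i k * b k l)"
    using A ij(1) unfolding granger_matrix_def mat_mult_on_def by blast
  have eq: "(\<Sum>l\<in>S. A i l * r0 l k) = r1 i k" if k: "k \<in> S" for k
  proof -
    have "(\<Sum>l\<in>S. A i l * r0 l k) = (\<Sum>l\<in>S. (\<Sum>n\<in>S. r1 i n * b n l) * r0 l k)"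
      by (intro sum.cong refl arg_cong2[where f = times] A')
    also have "\<dots> = (\<Sum>n\<in>S. r1 i n * (\<Sum>l\<in>S. b n l * r0 l k))"
      unfolding sum_distrib_left sum_distrib_right by (subst sum.swap) (simp add: mult.assoc)
    also have "\<dots> = (\<Sum>n\<in>S. r1 i n * of_bool (n = k))"
      using b k unfolding mat_inverse_on_def mat_mult_on_def by (intro sum.cong refl arg_cong2[where f = times]) blast
    also have "\<dots> = r1 i k" by (rule sum_of_bool_mult(2)[OF fin k])
    finally show ?thesis .
  qed
  have "\<bar>?v j\<bar> \<le> (4 * e / c) / (1 - 1 / 2)"
  proof (rule contraction_bound[of S "1 / 2" _ ?v])
    fix m k assume m: "0 \<le> m" "\<And>l. l \<in> S \<Longrightarrow> \<bar>?v l\<bar> \<le> m" and k: "k \<in> S"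
    have "\<bar>\<Sum>l\<in>S. ?v l * R0 l n\<bar> \<le> 2 * e + c / 4 * m" if n: "n \<in> S" for n
    proof -
      have "(\<Sum>l\<in>S. ?v l * r0 l n) = r1 i n - (\<Sum>l\<in>S. granger_coeff S U i l * r0 l n)"
        using eq[OF n] by (simp add: left_diff_distrib sum_subtractf)
      then have 1: "\<bar>\<Sum>l\<in>S. ?v l * r0 l n\<bar> \<le> 2 * e"
        using granger_row_residual[OF SV U r0 r1 e(1) ij(1) n] by linarith
      have "\<bar>\<Sum>l\<in>S. (r0 l n - R0 l n) * ?v l\<bar> \<le> (\<Sum>l\<in>S. \<bar>r0 l n - R0 l n\<bar>) * m"
        by (rule abs_sum_mult_le[OF m(2)])
      also have "\<dots> \<le> (\<Sum>l\<in>S. e) * m" using m n by (intro mult_right_mono sum_mono r0) auto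
      also have "\<dots> \<le> c / 4 * m" using m e by (intro mult_right_mono) auto
      finally have 2: "\<bar>\<Sum>l\<in>S. (r0 l n - R0 l n) * ?v l\<bar> \<le> c / 4 * m" .
      have "(\<Sum>l\<in>S. ?v l * R0 l n) = (\<Sum>l\<in>S. ?v l * r0 l n) - (\<Sum>l\<in>S. (r0 l n - R0 l n) * ?v l)"
        unfolding sum_subtractf[symmetric] by (intro sum.cong refl) (simp add: algebra_simps)
      then show ?thesis using 1 2 by linarith
    qed
    from cov_lower_bound[OF SV stationary_cov_R0 c this k]
    have "\<bar>?v k\<bar> \<le> 2 * (2 * e + c / 4 * m) / c" .
    also have "\<dots> = 1 / 2 * m + 4 * e / c" using c by (simp add: field_simps)
    finally show "\<bar>?v k\<bar> \<le> 1 / 2 * m + 4 * e / c" .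
  qed (use fin e c ij in auto)
  then show ?thesis by simp
qed

end

subsection \<open>Measurability of the clustering event\<close>

lemma list_mean_measurable:
  fixes f :: "'a \<Rightarrow> 'b \<Rightarrow> real"
  assumes "\<And>z. z \<in> set e \<Longrightarrow> (\<lambda>\<omega>. f \<omega> z) \<in> borel_measurable M"
  shows "(\<lambda>\<omega>. mean (map (f \<omega>) e)) \<in> borel_measurable M"
proof -
  have "(\<lambda>\<omega>. sum_list (map (f \<omega>) e)) \<in> borel_measurable M"
    using assms by (induction e) auto
  then show ?thesis unfolding mean_def by simp
qed

lemma sorted_pred:
  fixes f :: "'a \<Rightarrow> 'b \<Rightarrow> real"
  assumes "\<And>z. z \<in> set e \<Longrightarrow> (\<lambda>\<omega>. f \<omega> z) \<in> borel_measurable M"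
  shows "Measurable.pred M (\<lambda>\<omega>. sorted (map (f \<omega>) e))"
  using assms
proof (induction e)
  case (Cons z e)
  have [measurable]: "Measurable.pred M (\<lambda>\<omega>. sorted (map (f \<omega>) e))" by (rule Cons.IH) (use Cons.prems in auto)
  have "Measurable.pred M (\<lambda>\<omega>. f \<omega> z \<le> f \<omega> u)" if "u \<in> set e" for u
  proof -
    have [measurable]: "(\<lambda>\<omega>. f \<omega> z) \<in> borel_measurable M" "(\<lambda>\<omega>. f \<omega> u) \<in> borel_measurable M"
      using Cons.prems that by auto
    show ?thesis by measurable
  qed
  then have [measurable]: "Measurable.pred M (\<lambda>\<omega>. \<forall>u\<in>set e. f \<omega> z \<le> f \<omega> u)"
    by (intro pred_intros_finite) auto
  have "Measurable.pred M (\<lambda>\<omega>. (\<forall>u\<in>set e. f \<omega> z \<le> f \<omega> u) \<and> sorted (map (f \<omega>) e))" by measurable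
  then show ?case by simp
qed simp

lemma separation_pred:
  fixes u v a b :: "'a \<Rightarrow> real"
  assumes [measurable]: "u \<in> borel_measurable M" "v \<in> borel_measurable M" "a \<in> borel_measurable M" "b \<in> borel_measurable M"
  shows "Measurable.pred M (\<lambda>\<omega>. P \<and> Q \<and> u \<omega> \<le> (a \<omega> + b \<omega>) / 2 \<and> (a \<omega> + b \<omega>) / 2 \<le> v \<omega>)"
  by measurable

lemma maximizer_pred:
  fixes h :: "nat \<Rightarrow> 'a \<Rightarrow> real"
  assumes [measurable]: "\<And>k. h k \<in> borel_measurable M" "\<And>k. Measurable.pred M (P k)"
  shows "Measurable.pred M (\<lambda>\<omega>. P k \<omega> \<and> (\<forall>k'. P k' \<omega> \<longrightarrow> h k' \<omega> \<le> h k \<omega>))"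
  by measurable

lemma selected_split_pred:
  fixes f :: "'a \<Rightarrow> 'b \<Rightarrow> real"
  assumes f: "\<And>z. z \<in> set e \<Longrightarrow> (\<lambda>\<omega>. f \<omega> z) \<in> borel_measurable M"
  shows "Measurable.pred M (\<lambda>\<omega>. selected_split (map (f \<omega>) e) k)"
proof -
  have mt: "(\<lambda>\<omega>. mean (take k (map (f \<omega>) e))) \<in> borel_measurable M" for k
    unfolding take_map by (rule list_mean_measurable) (rule f, meson in_set_takeD)
  have md: "(\<lambda>\<omega>. mean (drop k (map (f \<omega>) e))) \<in> borel_measurable M" for k
    unfolding drop_map by (rule list_mean_measurable) (rule f, meson in_set_dropD)
  have nth: "(\<lambda>\<omega>. map (f \<omega>) e ! k) \<in> borel_measurable M" if "k < length e" for k
    unfolding nth_map[OF that] by (rule f) (rule nth_mem[OF that])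
  have adm: "Measurable.pred M (\<lambda>\<omega>. admissible_split (map (f \<omega>) e) k)" for k
  proof (cases "k < length e")
    case True
    then have "k - 1 < length e" by simp
    then show ?thesis
      unfolding admissible_split_def length_map
      by (rule separation_pred[OF nth nth[OF True] mt md])
  next
    case False
    then have "\<not> admissible_split (map (f \<omega>) e) k" for \<omega> unfolding admissible_split_def by simp
    then show ?thesis by simp
  qed
  have "(\<lambda>\<omega>. centroid_gap (map (f \<omega>) e) k) \<in> borel_measurable M" for k
    unfolding centroid_gap_def by (rule borel_measurable_diff[OF md mt])
  then show ?thesis unfolding selected_split_def by (rule maximizer_pred[OF _ adm])
qed

text \<open>There are countably many candidate lists e and indices k. Each pair has a fixed output,
  and being a possible run of the algorithm is a measurable condition on the entries.\<close>

lemma clu_eq_pred: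
  assumes m: "\<And>i j. i \<in> S \<Longrightarrow> j \<in> S \<Longrightarrow> (\<lambda>\<omega>. m \<omega> i j) \<in> borel_measurable M"
  shows "Measurable.pred M (\<lambda>\<omega>. clu S (m \<omega>) = {g})"
proof -
  let ?f = "\<lambda>\<omega> z. case z of (i, j) \<Rightarrow> m \<omega> i j"
  define C where "C e k \<omega> \<longleftrightarrow> (distinct e \<and> set e = off_diag S) \<and> sorted (map (?f \<omega>) e) \<and> selected_split (map (?f \<omega>) e) k" for e k \<omega>
  define out where "out e k = (\<lambda>i j. (i, j) \<in> set (drop k e))" for e :: "(nat \<times> nat) list" and k
  have C: "Measurable.pred M (C e k)" for e k
  proof (cases "distinct e \<and> set e = off_diag S")
    case True
    have f: "(\<lambda>\<omega>. ?f \<omega> z) \<in> borel_measurable M" if "z \<in> set e" for z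
      using that True m by (auto simp: off_diag_def)
    have "Measurable.pred M (\<lambda>\<omega>. sorted (map (?f \<omega>) e) \<and> selected_split (map (?f \<omega>) e) k)"
      by (intro pred_intros_logic sorted_pred selected_split_pred f)
    then show ?thesis using True unfolding C_def[abs_def] by simp
  next
    case False
    then have "C e k = (\<lambda>_. False)" unfolding C_def by auto
    then show ?thesis by simp
  qed
  have clu: "clu S (m \<omega>) = {h. \<exists>e k. C e k \<omega> \<and> h = out e k}" for \<omega>
    unfolding clu_def C_def out_def by auto
  have eq: "clu S (m \<omega>) = {g} \<longleftrightarrow> (\<exists>e k. C e k \<omega> \<and> out e k = g) \<and> (\<forall>e k. C e k \<omega> \<longrightarrow> out e k = g)" for \<omega>
  proof -
    have single: "X = {g} \<longleftrightarrow> g \<in> X \<and> (\<forall>h\<in>X. h = g)" for X by blast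
    show ?thesis unfolding clu single by auto
  qed
  have "Measurable.pred M (\<lambda>\<omega>. (\<exists>e k. C e k \<omega> \<and> out e k = g) \<and> (\<forall>e k. C e k \<omega> \<longrightarrow> out e k = g))"
  proof -
    have ex: "Measurable.pred M (\<lambda>\<omega>. C e k \<omega> \<and> out e k = g)" for e k
      by (rule pred_intros_logic(3)[OF C]) simp
    have all: "Measurable.pred M (\<lambda>\<omega>. C e k \<omega> \<longrightarrow> out e k = g)" for e k
      by (rule pred_intros_logic(4)[OF C]) simp
    show ?thesis
      by (rule pred_intros_logic(3);
        rule pred_intros_countable, rule pred_intros_countable, rule ex all)
  qed
  then show ?thesis unfolding eq .
qed

lemma if_closed: "A \<in> X \<Longrightarrow> B \<in> X \<Longrightarrow> (if P then A else B) \<in> X"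
  by simp

section \<open>Good sample paths and recovery on them\<close>

context diffusion_network
begin

definition sample_good :: "nat \<Rightarrow> real \<Rightarrow> 'a \<Rightarrow> bool" where
  "sample_good m \<delta> \<omega> \<longleftrightarrow> (\<forall>i\<in>V. \<forall>j\<in>V.
     \<bar>(\<Sum>t = 1..m. x \<omega> (Suc t) i * x \<omega> (Suc t) j) / real m - of_bool (i = j)\<bar> \<le> 5 * \<delta> \<and>
     \<bar>(\<Sum>t = 1..m. y \<omega> t i * x \<omega> (Suc t) j) / real m\<bar> \<le> \<delta> / 2 * ((\<Sum>t = 1..m. y \<omega> t i * y \<omega> t i) / real m) + \<delta>) \<and>
   (\<forall>i\<in>V. (y \<omega> 1 i)\<^sup>2 \<le> \<delta> * real m \<and> (y \<omega> (Suc m) i)\<^sup>2 \<le> \<delta> * real m)"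

text \<open>The tail bounds are used at the rates \<delta> and -\<delta> with level \<delta>^2 r;
  dividing by \<delta> r combines the two signs.\<close>

lemma abs_of_signed_sums:
  fixes A B :: real
  assumes "\<And>e. e = 1 \<or> e = -1 \<Longrightarrow> e * \<delta> * A - \<delta>\<^sup>2 / 2 * B < \<delta>\<^sup>2 * r" and "0 < \<delta>" "0 < r"
  shows "\<bar>A / r\<bar> \<le> \<delta> + \<delta> / 2 * (B / r)"
proof -
  have "e * A \<le> \<delta> * r + \<delta> / 2 * B" if "e = 1 \<or> e = -1" for e :: real
  proof -
    have "\<delta> * (e * A) < \<delta> * (\<delta> * r + \<delta> / 2 * B)" using assms(1)[OF that] by (simp add: power2_eq_square algebra_simps)
    then show ?thesis using assms(2) by simp
  qed
  from this[of 1] this[of "-1"] have "\<bar>A\<bar> \<le> \<delta> * r + \<delta> / 2 * B" by simp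
  then have "\<bar>A\<bar> / r \<le> (\<delta> * r + \<delta> / 2 * B) / r" using assms(3) by (intro divide_right_mono) auto
  then show ?thesis using assms(3) by (simp add: add_divide_distrib)
qed

text \<open>A union bound at the level \<delta>^2 m: two signs for N^2 state-noise pairs and as many
  noise-noise pairs give 4 N^2, and the two boundary times with a two-sided tail give 4 N.\<close>

lemma sample_good_prob:
  assumes N: "1 \<le> N" and m: "1 \<le> m" and \<delta>: "0 < \<delta>" "\<delta> \<le> 1 / 4"
  shows "\<exists>E\<in>events. (\<forall>\<omega>\<in>space M - E. sample_good m \<delta> \<omega>) \<and>
    prob E \<le> 4 * (real N)\<^sup>2 * exp (- (\<delta>\<^sup>2 * real m)) + 4 * real N * exp (\<sigma>\<^sup>2 * kap / 2 + 1 - sqrt (\<delta> * real m))"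
proof -
  note [measurable] = y_measurable
  have xm [measurable]: "(\<lambda>\<omega>. x \<omega> (Suc t) i) \<in> borel_measurable M" if "i \<in> V" for t i
    by (rule x_measurable) (use that in auto)
  let ?s = "\<delta>\<^sup>2 * real m"
  let ?c = "\<lambda>i j e \<omega>. \<Sum>t\<in>{1..<Suc m}. e * \<delta> * (y \<omega> t i * x \<omega> (Suc t) j) - (e * \<delta>)\<^sup>2 / 2 * (y \<omega> t i)\<^sup>2"
  let ?o = "\<lambda>i j e \<omega>. \<Sum>t\<in>{1..<Suc m}. e * \<delta> * (x \<omega> (Suc t) i * x \<omega> (Suc t) j) - (e * \<delta>)\<^sup>2 / 2 * (x \<omega> (Suc t) i)\<^sup>2"
  let ?d = "\<lambda>i e \<omega>. \<Sum>t\<in>{1..<Suc m}. e * \<delta> * ((x \<omega> (Suc t) i)\<^sup>2 - 1) - 4 * (e * \<delta>)\<^sup>2"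
  let ?I = "V \<times> V \<times> {1, -1 :: real}"
  define E1 where "E1 = (\<lambda>(i, j, e). {\<omega> \<in> space M. ?s \<le> ?c i j e \<omega>})"
  define E2 where "E2 = (\<lambda>(i, j, e). if i = j then {\<omega> \<in> space M. ?s \<le> ?d i e \<omega>} else {\<omega> \<in> space M. ?s \<le> ?o i j e \<omega>})"
  define E3 where "E3 = (\<lambda>(i, t). {\<omega> \<in> space M. sqrt (\<delta> * real m) \<le> \<bar>y \<omega> t i\<bar>})"
  have fin: "finite ?I" "card ?I = 2 * N\<^sup>2" "finite (V \<times> {1, Suc m})" "card (V \<times> {1, Suc m}) = 2 * N"
    using m by (auto simp: card_cartesian_product nodes_def power2_eq_square)
  have ev1: "E1 k \<in> events" if kI: "k \<in> ?I" for k
  proof -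
    obtain i j e where k: "k = (i, j, e)" "i \<in> V" "j \<in> V" using kI by auto
    note [measurable] = y_measurable[OF k(2)] xm[OF k(3)]
    show ?thesis unfolding k(1) E1_def prod.case by measurable
  qed
  have ev2: "E2 k \<in> events" if kI: "k \<in> ?I" for k
  proof -
    obtain i j e where k: "k = (i, j, e)" "i \<in> V" "j \<in> V" using kI by auto
    note [measurable] = xm[OF k(2)] xm[OF k(3)]
    have "{\<omega> \<in> space M. ?s \<le> ?d i e \<omega>} \<in> events" "{\<omega> \<in> space M. ?s \<le> ?o i j e \<omega>} \<in> events" by measurable
    then show ?thesis unfolding k(1) E2_def prod.case by (rule if_closed)
  qed
  have ev3: "E3 k \<in> events" if "k \<in> V \<times> {1, Suc m}" for k using that unfolding E3_def by auto
  have p1: "prob (E1 k) \<le> exp (- ?s)" if kI: "k \<in> ?I" for k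
  proof -
    obtain i j e where k: "k = (i, j, e)" "i \<in> V" "j \<in> V" using kI by auto
    show ?thesis unfolding k(1) E1_def prod.case by (rule cross_tail[OF N k(2,3)])
  qed
  have p2: "prob (E2 k) \<le> exp (- ?s)" if kI: "k \<in> ?I" for k
  proof -
    obtain i j e where k: "k = (i, j, e)" "i \<in> V" "j \<in> V" "e = 1 \<or> e = -1" using kI by auto
    have e: "\<bar>e * \<delta>\<bar> \<le> 1 / 4" using k(4) \<delta> by auto
    show ?thesis
    proof (cases "i = j")
      case True
      show ?thesis unfolding k(1) E2_def prod.case if_P[OF True] by (rule noise_square_tail[OF N k(2) e])
    next
      case False
      show ?thesis unfolding k(1) E2_def prod.case if_not_P[OF False] by (rule noise_cross_tail[OF N k(2,3) False])
    qed
  qed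
  have p3: "prob (E3 k) \<le> 2 * exp (\<sigma>\<^sup>2 * kap / 2 + 1 - sqrt (\<delta> * real m))" if kI: "k \<in> V \<times> {1, Suc m}" for k
  proof -
    obtain i t where k: "k = (i, t)" "i \<in> V" using kI by auto
    have s: "\<sigma>\<^sup>2 * kap / 2 + (sqrt (\<delta> * real m) - \<sigma>\<^sup>2 * kap / 2 - 1) + 1 = sqrt (\<delta> * real m)"
      "- (sqrt (\<delta> * real m) - \<sigma>\<^sup>2 * kap / 2 - 1) = \<sigma>\<^sup>2 * kap / 2 + 1 - sqrt (\<delta> * real m)" by linarith+
    show ?thesis unfolding k(1) E3_def prod.case
      by (rule y_tail[OF N k(2), of "sqrt (\<delta> * real m) - \<sigma>\<^sup>2 * kap / 2 - 1" t, unfolded s])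
  qed
  let ?E1 = "\<Union>k\<in>?I. E1 k" and ?E2 = "\<Union>k\<in>?I. E2 k" and ?E3 = "\<Union>k\<in>V \<times> {1, Suc m}. E3 k"
  have e1: "?E1 \<in> events" by (rule sets.finite_UN[OF fin(1) ev1])
  have e2: "?E2 \<in> events" by (rule sets.finite_UN[OF fin(1) ev2])
  have e3: "?E3 \<in> events" by (rule sets.finite_UN[OF fin(3) ev3])
  have "prob ?E1 \<le> (\<Sum>k\<in>?I. exp (- ?s))"
    by (rule order_trans[OF measure_UNION_le[OF fin(1) ev1] sum_mono[OF p1]])
  then have q1: "prob ?E1 \<le> 2 * (real N)\<^sup>2 * exp (- ?s)" using fin(2) by simp
  have "prob ?E2 \<le> (\<Sum>k\<in>?I. exp (- ?s))"
    by (rule order_trans[OF measure_UNION_le[OF fin(1) ev2] sum_mono[OF p2]])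
  then have q2: "prob ?E2 \<le> 2 * (real N)\<^sup>2 * exp (- ?s)" using fin(2) by simp
  have "prob ?E3 \<le> (\<Sum>k\<in>V \<times> {1, Suc m}. 2 * exp (\<sigma>\<^sup>2 * kap / 2 + 1 - sqrt (\<delta> * real m)))"
    by (rule order_trans[OF measure_UNION_le[OF fin(3) ev3] sum_mono[OF p3]])
  then have q3: "prob ?E3 \<le> 4 * real N * exp (\<sigma>\<^sup>2 * kap / 2 + 1 - sqrt (\<delta> * real m))" using fin(4) by simp
  show ?thesis
  proof (rule bexI[of _ "(?E1 \<union> ?E2) \<union> ?E3"], rule conjI)
    show "(?E1 \<union> ?E2) \<union> ?E3 \<in> events" using e1 e2 e3 by blast
    have "prob ((?E1 \<union> ?E2) \<union> ?E3) \<le> (prob ?E1 + prob ?E2) + prob ?E3"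
      by (rule order_trans[OF measure_Un_le[OF sets.Un[OF e1 e2] e3] add_right_mono[OF measure_Un_le[OF e1 e2]]])
    also have "\<dots> \<le> (2 * (real N)\<^sup>2 * exp (- ?s) + 2 * (real N)\<^sup>2 * exp (- ?s))
        + 4 * real N * exp (\<sigma>\<^sup>2 * kap / 2 + 1 - sqrt (\<delta> * real m))"
      by (intro add_mono q1 q2 q3)
    finally show "prob ((?E1 \<union> ?E2) \<union> ?E3)
        \<le> 4 * (real N)\<^sup>2 * exp (- ?s) + 4 * real N * exp (\<sigma>\<^sup>2 * kap / 2 + 1 - sqrt (\<delta> * real m))" by simp
    show "\<forall>\<omega>\<in>space M - ((?E1 \<union> ?E2) \<union> ?E3). sample_good m \<delta> \<omega>"
    proof
      fix \<omega> assume w: "\<omega> \<in> space M - ((?E1 \<union> ?E2) \<union> ?E3)"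
      have r: "0 < real m" using m by simp
      have n1: "\<omega> \<notin> E1 (i, j, e)" and n2: "\<omega> \<notin> E2 (i, j, e)"
        if "i \<in> V" "j \<in> V" "e = 1 \<or> e = -1" for i j e
        using w that by blast+
      have n3: "\<omega> \<notin> E3 (i, t)" if "i \<in> V" "t = 1 \<or> t = Suc m" for i t using w that by blast
      have ivl: "{1..<Suc m} = {1..m}" by auto
      have cross: "\<bar>(\<Sum>t = 1..m. y \<omega> t i * x \<omega> (Suc t) j) / real m\<bar> \<le> \<delta> + \<delta> / 2 * ((\<Sum>t = 1..m. y \<omega> t i * y \<omega> t i) / real m)"
        if ij: "i \<in> V" "j \<in> V" for i j
      proof (rule abs_of_signed_sums[OF _ \<delta>(1) r])
        fix e :: real assume e: "e = 1 \<or> e = -1"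
        have "?c i j e \<omega> < ?s"
          using n1[OF ij e] w unfolding E1_def prod.case by (simp only: mem_Collect_eq not_le Diff_iff simp_thms)
        moreover have "?c i j e \<omega> = e * \<delta> * (\<Sum>t = 1..m. y \<omega> t i * x \<omega> (Suc t) j) - \<delta>\<^sup>2 / 2 * (\<Sum>t = 1..m. y \<omega> t i * y \<omega> t i)"
          using e unfolding ivl by (auto simp: sum_subtractf sum_distrib_left power2_eq_square)
        ultimately show "e * \<delta> * (\<Sum>t = 1..m. y \<omega> t i * x \<omega> (Suc t) j) - \<delta>\<^sup>2 / 2 * (\<Sum>t = 1..m. y \<omega> t i * y \<omega> t i) < ?s"
          by simp
      qed
      have diag: "\<bar>(\<Sum>t = 1..m. x \<omega> (Suc t) i * x \<omega> (Suc t) i) / real m - 1\<bar> \<le> 5 * \<delta>" if i: "i \<in> V" for i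
      proof -
        let ?A = "(\<Sum>t = 1..m. x \<omega> (Suc t) i * x \<omega> (Suc t) i) - real m"
        have "e * ?A \<le> 5 * \<delta> * real m" if e: "e = 1 \<or> e = -1" for e :: real
        proof -
          have "?d i e \<omega> < ?s"
            using n2[OF i i e] w unfolding E2_def prod.case if_P[OF refl] by (simp only: mem_Collect_eq not_le Diff_iff simp_thms)
          moreover have "?d i e \<omega> = e * \<delta> * ?A - 4 * \<delta>\<^sup>2 * real m"
          proof -
            have "?d i e \<omega> = (\<Sum>t = 1..m. e * \<delta> * (x \<omega> (Suc t) i * x \<omega> (Suc t) i) - (e * \<delta> + 4 * \<delta>\<^sup>2))"
              unfolding ivl using e by (intro sum.cong refl) (auto simp: power2_eq_square algebra_simps)
            then show ?thesis by (simp add: sum_subtractf sum_distrib_left algebra_simps)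
          qed
          ultimately have "\<delta> * (e * ?A) < \<delta> * (5 * \<delta> * real m)" by (simp add: power2_eq_square algebra_simps)
          then show ?thesis using \<delta>(1) by simp
        qed
        from this[of 1] this[of "-1"] have "\<bar>?A\<bar> \<le> 5 * \<delta> * real m" by simp
        then have "\<bar>?A\<bar> / real m \<le> 5 * \<delta>" using r by (simp add: divide_le_eq)
        moreover have "(\<Sum>t = 1..m. x \<omega> (Suc t) i * x \<omega> (Suc t) i) / real m - 1 = ?A / real m"
          using r by (simp add: diff_divide_distrib)
        ultimately show ?thesis by (simp add: abs_divide)
      qed
      have off: "\<bar>(\<Sum>t = 1..m. x \<omega> (Suc t) i * x \<omega> (Suc t) j) / real m\<bar> \<le> 5 * \<delta>" if ij: "i \<in> V" "j \<in> V" "i \<noteq> j" for i j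
      proof -
        let ?Q = "(\<Sum>t = 1..m. x \<omega> (Suc t) i * x \<omega> (Suc t) i) / real m"
        have "\<bar>(\<Sum>t = 1..m. x \<omega> (Suc t) i * x \<omega> (Suc t) j) / real m\<bar> \<le> \<delta> + \<delta> / 2 * ?Q"
        proof (rule abs_of_signed_sums[OF _ \<delta>(1) r])
          fix e :: real assume e: "e = 1 \<or> e = -1"
          have "?o i j e \<omega> < ?s"
            using n2[OF ij(1,2) e] w unfolding E2_def prod.case if_not_P[OF ij(3)] by (simp only: mem_Collect_eq not_le Diff_iff simp_thms)
          moreover have "?o i j e \<omega> = e * \<delta> * (\<Sum>t = 1..m. x \<omega> (Suc t) i * x \<omega> (Suc t) j) - \<delta>\<^sup>2 / 2 * (\<Sum>t = 1..m. x \<omega> (Suc t) i * x \<omega> (Suc t) i)"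
            using e unfolding ivl by (auto simp: sum_subtractf sum_distrib_left power2_eq_square)
          ultimately show "e * \<delta> * (\<Sum>t = 1..m. x \<omega> (Suc t) i * x \<omega> (Suc t) j) - \<delta>\<^sup>2 / 2 * (\<Sum>t = 1..m. x \<omega> (Suc t) i * x \<omega> (Suc t) i) < ?s"
            by simp
        qed
        \<comment> \<open>The diagonal estimate with \<delta> \<le> 1 / 4 bounds the compensating
          sample variance of the noise, so off-diagonal entries cost at most 3 \<delta>.\<close>
        moreover have "?Q \<le> 4" using diag[OF ij(1)] \<delta> by linarith
        then have "\<delta> / 2 * ?Q \<le> \<delta> / 2 * 4" using \<delta> by (intro mult_left_mono) auto
        ultimately show ?thesis using \<delta> by linarith
      qed
      have bnd: "(y \<omega> t i)\<^sup>2 \<le> \<delta> * real m" if "i \<in> V" "t = 1 \<or> t = Suc m" for i t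
      proof -
        have "\<bar>y \<omega> t i\<bar> \<le> sqrt (\<delta> * real m)" using n3[OF that] w unfolding E3_def by auto
        then have "\<bar>y \<omega> t i\<bar>\<^sup>2 \<le> (sqrt (\<delta> * real m))\<^sup>2" by (intro power_mono) auto
        then show ?thesis using \<delta> by simp
      qed
      show "sample_good m \<delta> \<omega>"
        unfolding sample_good_def
      proof (intro conjI ballI)
        fix i j assume ij: "i \<in> V" "j \<in> V"
        show "\<bar>(\<Sum>t = 1..m. x \<omega> (Suc t) i * x \<omega> (Suc t) j) / real m - of_bool (i = j)\<bar> \<le> 5 * \<delta>"
          using diag[OF ij(1)] off[OF ij] by (cases "i = j") auto
        show "\<bar>(\<Sum>t = 1..m. y \<omega> t i * x \<omega> (Suc t) j) / real m\<bar> \<le> \<delta> / 2 * ((\<Sum>t = 1..m. y \<omega> t i * y \<omega> t i) / real m) + \<delta>"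
          using cross[OF ij] by (simp only: add.commute)
      qed (use bnd in auto)
    qed
  qed
qed

text \<open>The constant \<open>var_sample.err\<close>, written out so that it depends on \<rho> and
  \<sigma> alone and \<epsilon> can be chosen before N.\<close>

definition sample_err :: real where
  "sample_err = (1 + \<sigma>) * (2 / (1 - \<rho>) * (\<sigma> ^ 3 / (1 - \<rho>) + 2 * \<sigma> + 5 * \<sigma>\<^sup>2 + 2) + 1 + \<sigma>\<^sup>2 / (1 - \<rho>))"

text \<open>Edges carry at least \<kappa> / d_max > 0 and non-edges carry 0.\<close>

lemma support_graph_eq:
  assumes \<omega>: "\<omega> \<in> space M" and S: "S \<subseteq> V"
  shows "support_graph S (\<pi> (G \<omega>)) = (\<lambda>i j. i \<in> S \<and> j \<in> S \<and> i \<noteq> j \<and> G \<omega> i j)"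
proof (intro ext iffI)
  have rd: "regular_diffusion N \<rho> \<kappa> (G \<omega>) (\<pi> (G \<omega>))" by (rule diffusion[OF \<omega>])
  fix i j
  have b: "\<kappa> / real (max_degree N (G \<omega>)) * of_bool (G \<omega> i j) \<le> \<pi> (G \<omega>) i j \<and>
      \<pi> (G \<omega>) i j \<le> \<kappa> / real (min_degree N (G \<omega>)) * of_bool (G \<omega> i j)" "0 < \<kappa>"
    if "i \<in> V" "j \<in> V" "i \<noteq> j"
    using rd that unfolding regular_diffusion_def by blast+
  show "i \<in> S \<and> j \<in> S \<and> i \<noteq> j \<and> G \<omega> i j" if s: "support_graph S (\<pi> (G \<omega>)) i j"
  proof -
    have ij: "i \<in> S" "j \<in> S" "i \<noteq> j" "0 < \<pi> (G \<omega>) i j" using s unfolding support_graph_def by auto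
    moreover have "G \<omega> i j" using b[of] ij S by (cases "G \<omega> i j") auto
    ultimately show ?thesis by blast
  qed
  show "support_graph S (\<pi> (G \<omega>)) i j" if s: "i \<in> S \<and> j \<in> S \<and> i \<noteq> j \<and> G \<omega> i j"
  proof -
    have ij: "i \<in> V" "j \<in> V" "i \<noteq> j" using s S by auto
    have "degree N (G \<omega>) i \<le> max_degree N (G \<omega>)"
      unfolding max_degree_def using ij finite_V by (intro Max_ge) auto
    moreover have "1 \<le> degree N (G \<omega>) i" by (simp add: degree_def)
    ultimately have "0 < real (max_degree N (G \<omega>))" by simp
    then have "0 < \<kappa> / real (max_degree N (G \<omega>))" using b(2)[OF ij] by simp
    then show ?thesis using b(1)[OF ij] s unfolding support_graph_def by auto
  qed
qed

text \<open>The separation is shared equally by the error of the two-level form, governed by \<eta>,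
  and the sampling error, governed by \<epsilon>. The constant 14400 is 6 * 300 * 8 and covers both
  the Granger and the covariance forms; 96 is 2 * 6 * 8 with the 8 from the two Granger
  errors.\<close>

lemma recovery:
  assumes \<omega>: "\<omega> \<in> space M" and S: "S \<subseteq> V" and N: "1 \<le> N" and p0: "0 < p"
    and \<eta>: "0 < \<eta>" "\<eta> \<le> (1 - \<rho>)\<^sup>2 / 2" "1 \<le> \<eta> / 2 * (real N * p)" "14400 * kap ^ 5 * \<eta> < \<kappa>"
    and con: "concentrated N S p (\<eta> / 2) (G \<omega>)"
    and \<epsilon>: "0 < \<epsilon>" "96 * sample_err * \<epsilon> < \<sigma>\<^sup>2 * \<kappa>"
    and \<delta>: "\<delta> = \<epsilon> / (real N * p)" "\<delta> \<le> 1" "\<sigma> * \<delta> \<le> (1 - \<rho>) / 2" "1 \<le> \<delta> * real m" and m: "1 \<le> m"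
    and good: "sample_good m \<delta> \<omega>"
    and mixed: "\<not> all_connected S (G \<omega>)" "\<not> all_disconnected S (G \<omega>)"
    and A: "regra_matrix S (corr0 (y \<omega>) (Suc m)) (corr1 (y \<omega>) (Suc m)) A \<or>
      A = corr1 (y \<omega>) (Suc m) \<or> A = (\<lambda>i j. corr1 (y \<omega>) (Suc m) i j - corr0 (y \<omega>) (Suc m) i j) \<or>
      granger_matrix S (corr0 (y \<omega>) (Suc m)) (corr1 (y \<omega>) (Suc m)) A \<and> real (card S) * (sample_err * \<delta>) \<le> \<sigma>\<^sup>2 / 4"
  shows "clu S A = {support_graph S (\<pi> (G \<omega>))}"
proof -
  let ?a = "\<pi> (G \<omega>)" and ?d = "real N * p" and ?r0 = "corr0 (y \<omega>) (Suc m)" and ?r1 = "corr1 (y \<omega>) (Suc m)"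
  have d0: "0 < ?d" using N p0 by simp
  have finS: "finite S" using S finite_V finite_subset by blast
  interpret rn: regular_network V ?a \<rho> S "G \<omega>" \<kappa> p ?d \<eta>
    by (rule concentrated_regular_network[OF diffusion[OF \<omega>] con S p0 p_range(2) N \<eta>(1-3)])
  obtain F1 where F1: "resolvent V ?a 1 F1" using rn.resolvent_exists[of 1] by auto
  obtain F2 where F2: "resolvent V ?a (-1) F2" using rn.resolvent_exists[of "-1"] by auto
  have c0: "0 < \<sigma>\<^sup>2" using sigma_pos by simp
  interpret rp: resolvent_pair V ?a \<rho> "\<sigma>\<^sup>2" F1 F2 by unfold_locales (use c0 F1 F2 in auto)
  have cancel: "D * (u / D) = u" if "0 < D" for D u :: real using that by simp
  have d\<delta>: "?d * \<delta> = \<epsilon>" "0 < \<delta>"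
    unfolding \<delta>(1) by (rule cancel[OF d0], rule divide_pos_pos[OF \<epsilon>(1) d0])
  interpret vs: var_sample V ?a \<rho> "\<sigma>\<^sup>2" F1 F2 \<sigma> \<delta> "x \<omega>" "y \<omega>" m
  proof
    show "y \<omega> (Suc t) i = (\<Sum>l\<in>V. ?a i l * y \<omega> t l) + \<sigma> * x \<omega> (Suc t) i" if "1 \<le> t" "i \<in> V" for t i
      using dynamics[OF \<omega>, of "Suc t" i] that by (simp add: var_step_def)
  qed (use good sigma_pos m \<delta> d\<delta> in \<open>auto simp: sample_good_def\<close>)
  have err: "vs.err = sample_err" unfolding vs.err_def vs.err1_def sample_err_def ..
  let ?e = "sample_err * \<delta>"
  have e0: "0 \<le> ?e"
    unfolding sample_err_def using sigma_pos rho_range d\<delta> by (intro mult_nonneg_nonneg add_nonneg_nonneg) auto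
  have r0: "\<bar>?r0 i j - rp.R0 i j\<bar> \<le> ?e" and r1: "\<bar>?r1 i j - rp.R1 i j\<bar> \<le> ?e" if "i \<in> S" "j \<in> S" for i j
    using vs.corr0_error[of i j] vs.corr1_error[of i j] that S unfolding err by auto
  have scale: "\<bar>?d * u - ?d * v\<bar> \<le> z * \<epsilon>" if "\<bar>u - v\<bar> \<le> z * \<delta>" for u v z
  proof -
    have "?d * \<bar>u - v\<bar> \<le> ?d * (z * \<delta>)" using that d0 by (intro mult_left_mono) auto
    moreover have "?d * (z * \<delta>) = z * \<epsilon>" unfolding d\<delta>(1)[symmetric] by (simp only: mult_ac)
    moreover have "\<bar>?d * u - ?d * v\<bar> = ?d * \<bar>u - v\<bar>" unfolding right_diff_distrib[symmetric] abs_mult[of ?d] abs_of_pos[OF d0] ..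
    ultimately show ?thesis by (simp only:)
  qed
  have kge: "1 \<le> kap" by (rule rn.k_ge)
  have k3: "kap ^ 3 \<le> kap ^ 5" by (rule power_increasing[OF _ kge]) simp
  have \<eta>k: "6 * (300 * kap ^ 3 * \<eta>) < \<kappa> / 2" "6 * (44 * \<sigma>\<^sup>2 * kap ^ 5 * \<eta>) < \<sigma>\<^sup>2 * \<kappa> / 8"
  proof -
    have "kap ^ 3 * \<eta> \<le> kap ^ 5 * \<eta>" using k3 \<eta> by (intro mult_right_mono) auto
    then show "6 * (300 * kap ^ 3 * \<eta>) < \<kappa> / 2" using \<eta>(4) rn.kappa by simp
    have "6 * (44 * kap ^ 5 * \<eta>) < \<kappa> / 8" using \<eta>(4) rn.kappa by simp
    then have "\<sigma>\<^sup>2 * (6 * (44 * kap ^ 5 * \<eta>)) < \<sigma>\<^sup>2 * (\<kappa> / 8)" using c0 by (intro mult_strict_left_mono)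
    then show "6 * (44 * \<sigma>\<^sup>2 * kap ^ 5 * \<eta>) < \<sigma>\<^sup>2 * \<kappa> / 8" by (simp add: mult_ac)
  qed
  have "\<exists>b t. scaled_separation ?d S (G \<omega>) A b t \<and> 6 * t < b"
  proof -
    have RP: "resolvent_pair V ?a \<rho> (\<sigma>\<^sup>2) F1 F2" ..
    note lev = rn.covariance_two_levels[OF RP]
    have lag: "scaled_separation ?d S (G \<omega>) rp.R1 (\<sigma>\<^sup>2 * \<kappa> / 4) (44 * \<sigma>\<^sup>2 * kap ^ 5 * \<eta>)"
      unfolding scaled_separation_def using lev(1) S by (meson subsetD)
    have res: "scaled_separation ?d S (G \<omega>) (\<lambda>i j. rp.R1 i j - rp.R0 i j) (\<sigma>\<^sup>2 * \<kappa> / 4) (44 * \<sigma>\<^sup>2 * kap ^ 5 * \<eta>)"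
      unfolding scaled_separation_def using lev(2) S by (meson subsetD)
    obtain U where U: "rn.block_solution S U" using rn.block_solution_exists[OF S] by blast
    have gra: "scaled_separation ?d S (G \<omega>) (rn.granger_coeff S U) \<kappa> (300 * kap ^ 3 * \<eta>)"
      unfolding scaled_separation_def using rn.granger_two_levels[OF U] by blast
    have coeff: ?thesis if c: "\<And>i j. i \<in> S \<Longrightarrow> j \<in> S \<Longrightarrow> \<bar>A i j - rn.granger_coeff S U i j\<bar> \<le> 8 * ?e / \<sigma>\<^sup>2"
    proof -
      have "\<bar>?d * A i j - ?d * rn.granger_coeff S U i j\<bar> \<le> (8 * sample_err / \<sigma>\<^sup>2) * \<epsilon>" if "i \<in> S" "j \<in> S" for i j
        using c[OF that] by (intro scale) simp
      then have "scaled_separation ?d S (G \<omega>) A \<kappa> (300 * kap ^ 3 * \<eta> + (8 * sample_err / \<sigma>\<^sup>2) * \<epsilon>)"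
        by (rule scaled_separation_perturb[OF gra])
      moreover have "6 * ((8 * sample_err / \<sigma>\<^sup>2) * \<epsilon>) < \<kappa> / 2"
        using \<epsilon>(2) c0 by (simp add: field_simps)
      then have "6 * (300 * kap ^ 3 * \<eta> + (8 * sample_err / \<sigma>\<^sup>2) * \<epsilon>) < \<kappa>"
        using \<eta>k(1) unfolding distrib_left by linarith
      ultimately show ?thesis by blast
    qed
    from A show ?thesis
    proof (elim disjE conjE)
      assume "regra_matrix S ?r0 ?r1 A"
      then show ?thesis by (intro coeff rp.regra_error[OF S U r0 r1 e0])
    next
      assume A: "A = ?r1"
      have "\<bar>?d * A i j - ?d * rp.R1 i j\<bar> \<le> sample_err * \<epsilon>" if "i \<in> S" "j \<in> S" for i j
        unfolding A by (rule scale[OF r1[OF that]])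
      then have "scaled_separation ?d S (G \<omega>) A (\<sigma>\<^sup>2 * \<kappa> / 4) (44 * \<sigma>\<^sup>2 * kap ^ 5 * \<eta> + sample_err * \<epsilon>)"
        by (rule scaled_separation_perturb[OF lag])
      moreover have "6 * (44 * \<sigma>\<^sup>2 * kap ^ 5 * \<eta> + sample_err * \<epsilon>) < \<sigma>\<^sup>2 * \<kappa> / 4"
        using \<eta>k(2) \<epsilon>(2) mult_pos_pos[OF c0 rn.kappa(1)] unfolding distrib_left by linarith
      ultimately show ?thesis by blast
    next
      assume A: "A = (\<lambda>i j. ?r1 i j - ?r0 i j)"
      have "\<bar>?d * A i j - ?d * (rp.R1 i j - rp.R0 i j)\<bar> \<le> (2 * sample_err) * \<epsilon>" if "i \<in> S" "j \<in> S" for i j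
        unfolding A using r0[OF that] r1[OF that] by (intro scale) linarith
      then have "scaled_separation ?d S (G \<omega>) A (\<sigma>\<^sup>2 * \<kappa> / 4) (44 * \<sigma>\<^sup>2 * kap ^ 5 * \<eta> + (2 * sample_err) * \<epsilon>)"
        by (rule scaled_separation_perturb[OF res])
      moreover have "6 * (44 * \<sigma>\<^sup>2 * kap ^ 5 * \<eta> + (2 * sample_err) * \<epsilon>) < \<sigma>\<^sup>2 * \<kappa> / 4"
        using \<eta>k(2) \<epsilon>(2) mult_pos_pos[OF c0 rn.kappa(1)] unfolding distrib_left by linarith
      ultimately show ?thesis by blast
    next
      assume g: "granger_matrix S ?r0 ?r1 A" "real (card S) * ?e \<le> \<sigma>\<^sup>2 / 4"
      have "?r0 i j = ?r0 j i" for i j by (simp add: corr0_def mult.commute)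
      from rp.granger_error[OF S U r0 r1 this e0 g(2,1)] show ?thesis by (intro coeff)
    qed
  qed
  then show ?thesis
    unfolding support_graph_eq[OF \<omega> S] using clu_scaled_separation[OF finS d0 _ _ mixed] by blast
qed

end

section \<open>Probability of recovery for one network size\<close>

context diffusion_network
begin

text \<open>The target graph is random; splitting over the finitely many values of G reduces to
  fixed targets.\<close>

lemma clu_event:
  assumes m: "\<And>i j. i \<in> S \<Longrightarrow> j \<in> S \<Longrightarrow> (\<lambda>\<omega>. A \<omega> i j) \<in> borel_measurable M"
  shows "{\<omega> \<in> space M. clu S (A \<omega>) = {h (G \<omega>)}} \<in> events"
proof -
  have "{\<omega> \<in> space M. clu S (A \<omega>) = {h (G \<omega>)}}
      = (\<Union>g\<in>graphs N. {\<omega> \<in> space M. G \<omega> = g} \<inter> {\<omega> \<in> space M. clu S (A \<omega>) = {h g}})"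
    using graph_space by auto
  also have "\<dots> \<in> events"
  proof (rule sets.finite_UN[OF finite_graphs sets.Int])
    fix g
    show "{\<omega> \<in> space M. G \<omega> = g} \<in> events" by (rule graph_event)
    have "Measurable.pred M (\<lambda>\<omega>. clu S (A \<omega>) = {h g})" by (rule clu_eq_pred[OF m])
    then show "{\<omega> \<in> space M. clu S (A \<omega>) = {h g}} \<in> events" by (rule predE)
  qed
  finally show ?thesis .
qed

text \<open>The conditions on w only ask it to be large: 192 \<le> w \<eta>^2 makes the graph
  exponent at least 3 ln N, and the others keep \<delta> and the degree tolerance in range. In the
  result, 8 / N comes from the graph, 4 / N from the sample products, and the exponential term from
  the boundary states.\<close>

lemma recovery_prob:
  assumes N: "3 \<le> N" and S: "S \<subseteq> V" and d: "real N * p = w * ln (real N)"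
    and \<eta>: "0 < \<eta>" "\<eta> \<le> (1 - \<rho>)\<^sup>2 / 2" "14400 * kap ^ 5 * \<eta> < \<kappa>"
    and \<epsilon>: "0 < \<epsilon>" "96 * sample_err * \<epsilon> < \<sigma>\<^sup>2 * \<kappa>"
    and w: "8 \<le> w * \<eta>" "192 \<le> w * \<eta>\<^sup>2" "4 * \<epsilon> \<le> w" "\<sigma> * \<epsilon> * 2 \<le> w * (1 - \<rho>)"
    and lnS: "ln (real N) \<le> 2 * ln (real (card S))"
    and n: "12 / \<epsilon>\<^sup>2 * (real N * p)\<^sup>2 * ln (real (card S)) \<le> real (Suc m)"
    and meas: "\<And>i j. i \<in> S \<Longrightarrow> j \<in> S \<Longrightarrow> (\<lambda>\<omega>. A \<omega> i j) \<in> borel_measurable M"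
    and A: "\<And>\<omega>. \<omega> \<in> space M \<Longrightarrow> regra_matrix S (corr0 (y \<omega>) (Suc m)) (corr1 (y \<omega>) (Suc m)) (A \<omega>) \<or>
      A \<omega> = corr1 (y \<omega>) (Suc m) \<or> A \<omega> = (\<lambda>i j. corr1 (y \<omega>) (Suc m) i j - corr0 (y \<omega>) (Suc m) i j) \<or>
      granger_matrix S (corr0 (y \<omega>) (Suc m)) (corr1 (y \<omega>) (Suc m)) (A \<omega>) \<and>
        real (card S) * (sample_err * (\<epsilon> / (real N * p))) \<le> \<sigma>\<^sup>2 / 4"
  shows "1 - ((12 + 4 * exp (\<sigma>\<^sup>2 * kap / 2 + 1)) / real N
      + prob {\<omega> \<in> space M. all_connected S (G \<omega>) \<or> all_disconnected S (G \<omega>)})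
    \<le> prob {\<omega> \<in> space M. clu S (A \<omega>) = {support_graph S (\<pi> (G \<omega>))}}"
proof -
  define L where "L = ln (real N)"
  define D where "D = real N * p"
  define \<delta> where "\<delta> = \<epsilon> / D"
  have N1: "1 \<le> N" and N0: "0 < real N" using N by auto
  have L: "1 \<le> L"
  proof -
    have "exp 1 \<le> real N" using exp_le N by linarith
    then show ?thesis unfolding L_def using N0 by (simp add: ln_ge_iff)
  qed
  have expL: "exp L = real N" unfolding L_def using N0 by simp
  have w0: "0 < w" using w(3) \<epsilon>(1) by linarith
  have D: "D = w * L" unfolding D_def L_def by (rule d)
  have Dw: "w \<le> D" using mult_left_mono[OF L, of w] w0 D by simp
  have D0: "0 < D" using Dw w0 by linarith
  have p0: "0 < p" using D0 N0 unfolding D_def by (simp add: zero_less_mult_iff)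
  have \<delta>0: "0 < \<delta>" unfolding \<delta>_def using \<epsilon>(1) D0 by simp
  have \<delta>4: "\<delta> \<le> 1 / 4" unfolding \<delta>_def using w(3) Dw D0 by (simp add: divide_le_eq)
  have \<delta>\<sigma>: "\<sigma> * \<delta> \<le> (1 - \<rho>) / 2"
  proof -
    have "w * (1 - \<rho>) \<le> D * (1 - \<rho>)" using Dw rho_range by (intro mult_right_mono) auto
    then have "\<sigma> * \<epsilon> * 2 \<le> D * (1 - \<rho>)" using w(4) by linarith
    then show ?thesis unfolding \<delta>_def using D0 by (simp add: field_simps)
  qed
  \<comment> \<open>The sample size gives m + 1 \<ge> 6 Z, where half of the 12 is lost in passing
    from ln |S| to ln N. With Z \<ge> 1 this yields m \<ge> 3 Z, and \<delta>^2 Z = ln N. The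
    exponent 3 ln N then beats the N^2 pairs.\<close>
  have \<delta>2m: "3 * L \<le> \<delta>\<^sup>2 * real m"
  proof -
    define Z where "Z = D\<^sup>2 * L / \<epsilon>\<^sup>2"
    have "\<epsilon> \<le> D" using w(3) Dw \<epsilon>(1) by linarith
    then have "\<epsilon>\<^sup>2 * 1 \<le> D\<^sup>2 * L" using \<epsilon>(1) L by (intro mult_mono power_mono) auto
    then have Z: "1 \<le> Z" unfolding Z_def using \<epsilon>(1) by (simp add: le_divide_eq)
    have "6 * Z = 12 / \<epsilon>\<^sup>2 * D\<^sup>2 * (L / 2)" unfolding Z_def by simp
    also have "\<dots> \<le> 12 / \<epsilon>\<^sup>2 * D\<^sup>2 * ln (real (card S))"
      using lnS by (intro mult_left_mono) (auto simp: L_def)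
    also have "\<dots> \<le> real m + 1" using n unfolding D_def by simp
    finally have "3 * Z \<le> real m" using Z by linarith
    then have "\<delta>\<^sup>2 * (3 * Z) \<le> \<delta>\<^sup>2 * real m" by (intro mult_left_mono) auto
    moreover have "\<delta>\<^sup>2 * (3 * Z) = 3 * L"
      unfolding \<delta>_def Z_def using D0 \<epsilon>(1) by (simp add: power_divide)
    ultimately show ?thesis by simp
  qed
  have m1: "1 \<le> m"
  proof (rule ccontr)
    assume "\<not> 1 \<le> m"
    then have "m = 0" by simp
    then show False using \<delta>2m L by simp
  qed
  \<comment> \<open>One factor of \<delta>^2 m is given back: 1 / \<delta> is at least 4 ln N, so
    sqrt (\<delta> m) is at least 2 ln N and the tail of the boundary states beats the union over N
    nodes.\<close>
  have \<delta>m: "4 * L\<^sup>2 \<le> \<delta> * real m"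
  proof -
    have "(4 * \<epsilon>) * L \<le> D" using mult_right_mono[OF w(3), of L] L D by simp
    then have L4: "4 * L \<le> 1 / \<delta>" unfolding \<delta>_def using \<epsilon>(1) D0 by (simp add: field_simps)
    have "(4 * L) * (1 * L) \<le> (1 / \<delta>) * (\<delta>\<^sup>2 * real m)"
      by (rule mult_mono) (use L4 \<delta>2m L \<delta>0 in simp_all)
    then show ?thesis using \<delta>0 by (simp add: power2_eq_square)
  qed
  have sq: "2 * L \<le> sqrt (\<delta> * real m)"
    using \<delta>m L by (intro real_le_rsqrt) (simp add: power_mult_distrib)
  have \<delta>m1: "1 \<le> \<delta> * real m"
    using \<delta>m one_le_power[OF L, of 2] by linarith
  have exps: "exp (- (3 * L)) = 1 / real N ^ 3" "exp (- (2 * L)) = 1 / real N ^ 2"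
    using exp_of_nat_mult[of 3 L] exp_of_nat_mult[of 2 L] expL by (simp_all add: exp_minus inverse_eq_divide)
  obtain E where E: "E \<in> events" "\<And>\<omega>. \<omega> \<in> space M - E \<Longrightarrow> sample_good m \<delta> \<omega>"
    and pE: "prob E \<le> 4 * (real N)\<^sup>2 * exp (- (\<delta>\<^sup>2 * real m)) + 4 * real N * exp (\<sigma>\<^sup>2 * kap / 2 + 1 - sqrt (\<delta> * real m))"
    using sample_good_prob[OF N1 m1 \<delta>0 \<delta>4] by blast
  let ?b = "exp (\<sigma>\<^sup>2 * kap / 2 + 1)"
  have "exp (- (\<delta>\<^sup>2 * real m)) \<le> 1 / real N ^ 3" unfolding exps(1)[symmetric] using \<delta>2m by simp
  then have "4 * (real N)\<^sup>2 * exp (- (\<delta>\<^sup>2 * real m)) \<le> 4 * (real N)\<^sup>2 * (1 / real N ^ 3)"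
    by (intro mult_left_mono) auto
  also have "\<dots> = 4 / real N" using N0 by (simp add: power2_eq_square power3_eq_cube)
  finally have b1: "4 * (real N)\<^sup>2 * exp (- (\<delta>\<^sup>2 * real m)) \<le> 4 / real N" .
  have "exp (\<sigma>\<^sup>2 * kap / 2 + 1 - sqrt (\<delta> * real m)) \<le> exp (\<sigma>\<^sup>2 * kap / 2 + 1 + - (2 * L))" using sq by simp
  also have "\<dots> = ?b * (1 / real N ^ 2)" unfolding exp_add[of _ "- (2 * L)"] exps(2) ..
  finally have "4 * real N * exp (\<sigma>\<^sup>2 * kap / 2 + 1 - sqrt (\<delta> * real m)) \<le> 4 * real N * (?b * (1 / real N ^ 2))"
    by (intro mult_left_mono) auto
  also have "\<dots> = 4 * ?b / real N" using N0 by (simp add: power2_eq_square)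
  finally have b2: "4 * real N * exp (\<sigma>\<^sup>2 * kap / 2 + 1 - sqrt (\<delta> * real m)) \<le> 4 * ?b / real N" .
  let ?C = "{\<omega> \<in> space M. \<not> concentrated N S p (\<eta> / 2) (G \<omega>)}"
  let ?B = "{\<omega> \<in> space M. all_connected S (G \<omega>) \<or> all_disconnected S (G \<omega>)}"
  let ?T = "{\<omega> \<in> space M. clu S (A \<omega>) = {support_graph S (\<pi> (G \<omega>))}}"
  have C: "?C \<in> events" by (rule graph_event)
  have B: "?B \<in> events" by (rule graph_event)
  have T: "?T \<in> events" by (rule clu_event[OF meas])
  have \<eta>D: "8 \<le> \<eta> * D" using w(1) mult_left_mono[OF Dw, of \<eta>] \<eta>(1) mult.commute[of w \<eta>] by linarith
  have pC: "prob ?C \<le> 8 / real N"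
  proof -
    have "\<eta> \<le> 1"
    proof -
      have "(1 - \<rho>)\<^sup>2 \<le> 1\<^sup>2" using rho_range by (intro power_mono) auto
      then show ?thesis using \<eta>(2) by simp
    qed
    then have "prob ?C \<le> 8 * (real N)\<^sup>2 * exp (- ((\<eta> / 2)\<^sup>2 / 16 * (real N * p)))"
      using \<eta>(1) \<eta>D unfolding D_def by (intro concentrated_prob) auto
    also have "\<dots> \<le> 8 * (real N)\<^sup>2 * exp (- (3 * L))"
    proof -
      have "192 * L \<le> (w * \<eta>\<^sup>2) * L" using w(2) L by (intro mult_right_mono) auto
      then have "3 * L \<le> (\<eta> / 2)\<^sup>2 / 16 * (real N * p)"
        unfolding D_def[symmetric] D by (simp add: power_divide mult_ac)
      then show ?thesis by (intro mult_left_mono) auto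
    qed
    also have "\<dots> = 8 / real N" unfolding exps(1) using N0 by (simp add: power2_eq_square power3_eq_cube)
    finally show ?thesis .
  qed
  have "space M - ((E \<union> ?C) \<union> ?B) \<subseteq> ?T"
  proof
    fix \<omega> assume w': "\<omega> \<in> space M - ((E \<union> ?C) \<union> ?B)"
    have "clu S (A \<omega>) = {support_graph S (\<pi> (G \<omega>))}"
    proof (rule recovery[OF _ S N1 p0 \<eta>(1,2) _ \<eta>(3) _ \<epsilon> _ _ \<delta>\<sigma> \<delta>m1 m1])
      show "\<omega> \<in> space M" "concentrated N S p (\<eta> / 2) (G \<omega>)" using w' by auto
      show "1 \<le> \<eta> / 2 * (real N * p)" using \<eta>D unfolding D_def by simp
      show "\<delta> = \<epsilon> / (real N * p)" unfolding \<delta>_def D_def ..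
      show "\<delta> \<le> 1" using \<delta>4 by simp
      show "sample_good m \<delta> \<omega>" using E(2) w' by blast
      show "\<not> all_connected S (G \<omega>)" "\<not> all_disconnected S (G \<omega>)" using w' by auto
      show "regra_matrix S (corr0 (y \<omega>) (Suc m)) (corr1 (y \<omega>) (Suc m)) (A \<omega>) \<or>
        A \<omega> = corr1 (y \<omega>) (Suc m) \<or> A \<omega> = (\<lambda>i j. corr1 (y \<omega>) (Suc m) i j - corr0 (y \<omega>) (Suc m) i j) \<or>
        granger_matrix S (corr0 (y \<omega>) (Suc m)) (corr1 (y \<omega>) (Suc m)) (A \<omega>) \<and> real (card S) * (sample_err * \<delta>) \<le> \<sigma>\<^sup>2 / 4"
        using A[of \<omega>] w' unfolding \<delta>_def D_def by blast
    qed
    then show "\<omega> \<in> ?T" using w' by blast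
  qed
  then have "prob (space M - ((E \<union> ?C) \<union> ?B)) \<le> prob ?T" by (rule finite_measure_mono[OF _ T])
  moreover have "prob (space M - ((E \<union> ?C) \<union> ?B)) = 1 - prob ((E \<union> ?C) \<union> ?B)"
    by (rule prob_compl) (intro sets.Un E(1) C B)
  moreover have "prob ((E \<union> ?C) \<union> ?B) \<le> (prob E + prob ?C) + prob ?B"
    by (rule order_trans[OF measure_Un_le[OF sets.Un[OF E(1) C] B] add_right_mono[OF measure_Un_le[OF E(1) C]]])
  moreover have "(12 + 4 * ?b) / real N = 4 / real N + 4 * ?b / real N + 8 / real N"
    by (simp add: add_divide_distrib)
  ultimately show ?thesis using pE b1 b2 pC by linarith
qed

lemma corr_measurable:
  assumes "i \<in> V" "j \<in> V"
  shows "(\<lambda>\<omega>. corr0 (y \<omega>) n i j) \<in> borel_measurable M" "(\<lambda>\<omega>. corr1 (y \<omega>) n i j) \<in> borel_measurable M"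
proof -
  note [measurable] = y_measurable[OF assms(1)] y_measurable[OF assms(2)]
  show "(\<lambda>\<omega>. corr0 (y \<omega>) n i j) \<in> borel_measurable M" unfolding corr0_def by measurable
  show "(\<lambda>\<omega>. corr1 (y \<omega>) n i j) \<in> borel_measurable M" unfolding corr1_def by measurable
qed

end

section \<open>Choice of constants and passage to the limit\<close>

lemma small_positive: "0 < C \<Longrightarrow> 0 \<le> B \<Longrightarrow> 0 < A \<Longrightarrow> \<exists>x>0. x \<le> A \<and> B * x < C" for A B C :: real
proof -
  assume C: "0 < C" and B: "0 \<le> B" and A: "0 < A"
  let ?x = "min A (C / (B + 1))"
  have "B * ?x \<le> B * (C / (B + 1))" using B by (intro mult_left_mono) auto
  also have "\<dots> < C" using B C by (simp add: divide_less_eq)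
  finally show ?thesis using A B C by (intro exI[of _ ?x]) auto
qed

theorem theorem3:
  fixes M :: "nat \<Rightarrow> 'a measure"
    and p w :: "nat \<Rightarrow> real"
    and G :: "nat \<Rightarrow> 'a \<Rightarrow> graph"
    and \<pi> :: "nat \<Rightarrow> graph \<Rightarrow> rmatrix"
    and \<rho> \<kappa> \<sigma> \<xi> p_lim :: real
    and x y :: "nat \<Rightarrow> 'a \<Rightarrow> nat \<Rightarrow> nat \<Rightarrow> real"
    and S :: "nat \<Rightarrow> nat set"
  assumes network: "\<And>N. diffusion_network (M N) N (p N) (G N) (\<pi> N) \<rho> \<kappa> \<sigma> (x N) (y N)"
    and observed: "\<And>N. S N \<subseteq> nodes N"
    and fraction: "(\<lambda>N. real (card (S N)) / real N) \<longlonglongrightarrow> \<xi>" "0 < \<xi>" "\<xi> < 1"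
    and nontrivial: "(\<lambda>N. measure (M N) {\<omega> \<in> space (M N).
          all_connected (S N) (G N \<omega>) \<or> all_disconnected (S N) (G N \<omega>)}) \<longlonglongrightarrow> 0"
    and regime: "\<And>N. N \<ge> 2 \<Longrightarrow> p N = w N * (ln (real N) / real N)"
      "filterlim w at_top sequentially" "p \<longlonglongrightarrow> p_lim"
  shows "\<forall>a. regra_estimator M S y a \<or> a = one_lag_estimator y \<or> a = residual_estimator y \<or>
        (p_lim > 0 \<and> granger_estimator M S y a) \<longrightarrow>
      (\<exists>C>0. \<forall>n :: nat \<Rightarrow> nat.
        (\<forall>\<^sub>F N in sequentially.
           real (n N) \<ge> C * (real N * p N)\<^sup>2 * ln (real (card (S N)))) \<longrightarrow>
        (\<lambda>N. measure (M N) {\<omega> \<in> space (M N).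
            clu (S N) (a N (n N) \<omega>) = {support_graph (S N) (\<pi> N (G N \<omega>))}}) \<longlonglongrightarrow> 1)"
proof (intro allI impI)
  fix a :: "nat \<Rightarrow> nat \<Rightarrow> 'a \<Rightarrow> rmatrix"
  assume est: "regra_estimator M S y a \<or> a = one_lag_estimator y \<or> a = residual_estimator y \<or>
        (p_lim > 0 \<and> granger_estimator M S y a)"
  \<comment> \<open>The instance N = 0 only serves to extract the facts on \<rho>, \<kappa> and
    \<sigma>, which are common to all sizes.\<close>
  interpret D0: diffusion_network "M 0" 0 "p 0" "G 0" "\<pi> 0" \<rho> \<kappa> \<sigma> "x 0" "y 0" by (rule network)
  note rho = D0.rho_range and sigma = D0.sigma_pos
  have kap0: "0 < \<kappa>" "\<kappa> \<le> \<rho>"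
    using D0.diffusion D0.not_empty unfolding regular_diffusion_def by blast+
  let ?k = "1 / (1 - \<rho>)"
  define K where "K = D0.sample_err"
  have K0: "0 \<le> K" unfolding K_def D0.sample_err_def using sigma rho by (intro mult_nonneg_nonneg add_nonneg_nonneg) auto
  have Keq: "diffusion_network.sample_err \<rho> \<sigma> = K" unfolding K_def ..
  \<comment> \<open>In the dense regime \<epsilon> is also made small against the limit of p, so
    that |S| times the entrywise error is at most \<sigma>^2 / 4; the minimum with 1 keeps the
    condition needed by all estimators.\<close>
  define r where "r = (if p_lim > 0 then min 1 p_lim else 1)"
  have r: "0 < r" "r \<le> 1" "0 < p_lim \<Longrightarrow> r \<le> p_lim" unfolding r_def by auto
  obtain \<eta> where \<eta>: "0 < \<eta>" "\<eta> \<le> (1 - \<rho>)\<^sup>2 / 2" "14400 * ?k ^ 5 * \<eta> < \<kappa>"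
    using small_positive[of \<kappa> "14400 * ?k ^ 5" "(1 - \<rho>)\<^sup>2 / 2"] kap0 rho by auto
  obtain \<epsilon> where \<epsilon>: "0 < \<epsilon>" "96 * K * \<epsilon> < \<sigma>\<^sup>2 * \<kappa> * r"
    using small_positive[of "\<sigma>\<^sup>2 * \<kappa> * r" "96 * K" 1] kap0 sigma r(1) K0 by auto
  have \<epsilon>r: "96 * K * \<epsilon> < \<sigma>\<^sup>2 * \<kappa>"
  proof -
    have "\<sigma>\<^sup>2 * \<kappa> * r \<le> \<sigma>\<^sup>2 * \<kappa> * 1" using r kap0 by (intro mult_left_mono) auto
    then show ?thesis using \<epsilon>(2) by simp
  qed
  show "\<exists>C>0. \<forall>n :: nat \<Rightarrow> nat.
        (\<forall>\<^sub>F N in sequentially.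
           real (n N) \<ge> C * (real N * p N)\<^sup>2 * ln (real (card (S N)))) \<longrightarrow>
        (\<lambda>N. measure (M N) {\<omega> \<in> space (M N).
            clu (S N) (a N (n N) \<omega>) = {support_graph (S N) (\<pi> N (G N \<omega>))}}) \<longlonglongrightarrow> 1"
  proof (rule exI[of _ "12 / \<epsilon>\<^sup>2"], intro conjI allI impI)
    show "0 < 12 / \<epsilon>\<^sup>2" using \<epsilon>(1) by simp
    fix n :: "nat \<Rightarrow> nat"
    assume n: "\<forall>\<^sub>F N in sequentially. real (n N) \<ge> 12 / \<epsilon>\<^sup>2 * (real N * p N)\<^sup>2 * ln (real (card (S N)))"
    let ?nt = "\<lambda>N. measure (M N) {\<omega> \<in> space (M N). all_connected (S N) (G N \<omega>) \<or> all_disconnected (S N) (G N \<omega>)}"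
    let ?P = "\<lambda>N. measure (M N) {\<omega> \<in> space (M N). clu (S N) (a N (n N) \<omega>) = {support_graph (S N) (\<pi> N (G N \<omega>))}}"
    let ?c = "12 + 4 * exp (\<sigma>\<^sup>2 * ?k / 2 + 1)"
    \<comment> \<open>The four entries are the lower bounds on w that \<open>recovery_prob\<close>
      asks for.\<close>
    define W where "W = Max {8 / \<eta>, 192 / \<eta>\<^sup>2, 4 * \<epsilon>, \<sigma> * \<epsilon> * 2 / (1 - \<rho>)}"
    have evW: "\<forall>\<^sub>F N in sequentially. W \<le> w N"
      using regime(2) unfolding filterlim_at_top by blast
    have evS: "\<forall>\<^sub>F N in sequentially. \<xi> / 2 < real (card (S N)) / real N"
      by (rule order_tendstoD(1)[OF fraction(1)]) (use fraction(2) in simp)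
    have evp: "\<forall>\<^sub>F N in sequentially. 0 < p_lim \<longrightarrow> p_lim / 2 < p N"
    proof (cases "0 < p_lim")
      case True
      then show ?thesis using order_tendstoD(1)[OF regime(3), of "p_lim / 2"] by simp
    qed simp
    have evN: "\<forall>\<^sub>F N in sequentially. max 3 (nat \<lceil>4 / \<xi>\<^sup>2\<rceil>) \<le> N" by (rule eventually_ge_at_top)
    have low: "\<forall>\<^sub>F N in sequentially. 1 - (?c / real N + ?nt N) \<le> ?P N"
      using evW evS evp evN n
    proof eventually_elim
      case (elim N)
      interpret D: diffusion_network "M N" N "p N" "G N" "\<pi> N" \<rho> \<kappa> \<sigma> "x N" "y N" by (rule network)
      have N3: "3 \<le> N" and N\<xi>: "4 / \<xi>\<^sup>2 \<le> real N"
        using elim(4) by (auto simp: nat_ceiling_le_eq)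
      have N0: "0 < real N" using N3 by simp
      have W: "8 / \<eta> \<le> w N" "192 / \<eta>\<^sup>2 \<le> w N" "4 * \<epsilon> \<le> w N" "\<sigma> * \<epsilon> * 2 / (1 - \<rho>) \<le> w N"
        using elim(1) unfolding W_def by simp_all
      have w: "8 \<le> w N * \<eta>" "192 \<le> w N * \<eta>\<^sup>2" "\<sigma> * \<epsilon> * 2 \<le> w N * (1 - \<rho>)"
        using W(1,2,4) \<eta>(1) rho by (simp_all add: divide_le_eq)
      have d: "real N * p N = w N * ln (real N)" using regime(1)[of N] N3 by simp
      let ?s = "real (card (S N))"
      have s: "\<xi> / 2 * real N \<le> ?s" using elim(2) N0 by (simp add: less_divide_eq)
      \<comment> \<open>From |S| \<ge> \<xi> N / 2 and N \<ge> 4 / \<xi>^2 follows N \<le> |S|^2,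
        hence ln N \<le> 2 ln |S|.\<close>
      have "4 \<le> real N * \<xi>\<^sup>2" using N\<xi> fraction(2) by (simp add: divide_le_eq)
      then have "real N * 4 \<le> real N * (real N * \<xi>\<^sup>2)" using N0 by (intro mult_left_mono) auto
      then have "real N \<le> (\<xi> / 2 * real N)\<^sup>2" by (simp add: power2_eq_square algebra_simps)
      also have "\<dots> \<le> ?s\<^sup>2" using s fraction(2) N0 by (intro power_mono) auto
      finally have Ns: "real N \<le> ?s\<^sup>2" .
      have s0: "0 < ?s" using s fraction(2) N0 by (smt (verit) mult_pos_pos half_gt_zero)
      have lnS: "ln (real N) \<le> 2 * ln ?s"
      proof -
        have "ln (real N) \<le> ln (?s\<^sup>2)" using Ns N0 by (intro ln_mono) auto
        then show ?thesis using s0 by (simp add: ln_realpow)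
      qed
      \<comment> \<open>The sample size must be a successor, since the sample bounds are indexed by
        the number m = n - 1 of transitions.\<close>
      have npos: "0 < n N"
      proof -
        have lnN: "0 < ln (real N)" using N3 by simp
        have "0 < w N" using W(3) \<epsilon>(1) by linarith
        then have "0 < real N * p N" unfolding d using lnN by (rule mult_pos_pos)
        then have "0 < (real N * p N)\<^sup>2" by (rule zero_less_power)
        moreover have "0 < ln ?s" using lnS lnN by linarith
        ultimately have "0 < 12 / \<epsilon>\<^sup>2 * (real N * p N)\<^sup>2 * ln ?s" using \<epsilon>(1) by (intro mult_pos_pos divide_pos_pos) auto
        then show ?thesis using elim(5) by linarith
      qed
      define m where "m = n N - 1"
      have m: "n N = Suc m" using npos unfolding m_def by simp
      have meas: "(\<lambda>\<omega>. a N (Suc m) \<omega> i j) \<in> borel_measurable (M N)" if "i \<in> S N" "j \<in> S N" for i j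
        using est
      proof (elim disjE conjE)
        have ij: "i \<in> nodes N" "j \<in> nodes N" using that observed by auto
        show ?thesis if "a = one_lag_estimator y"
          unfolding that one_lag_estimator_def by (rule D.corr_measurable[OF ij])
        show ?thesis if "a = residual_estimator y"
          unfolding that residual_estimator_def
          by (intro borel_measurable_diff D.corr_measurable[OF ij])
      qed (use that in \<open>auto simp: regra_estimator_def granger_estimator_def random_estimator_def\<close>)
      have A: "regra_matrix (S N) (corr0 (y N \<omega>) (Suc m)) (corr1 (y N \<omega>) (Suc m)) (a N (Suc m) \<omega>) \<or>
        a N (Suc m) \<omega> = corr1 (y N \<omega>) (Suc m) \<or>
        a N (Suc m) \<omega> = (\<lambda>i j. corr1 (y N \<omega>) (Suc m) i j - corr0 (y N \<omega>) (Suc m) i j) \<or>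
        granger_matrix (S N) (corr0 (y N \<omega>) (Suc m)) (corr1 (y N \<omega>) (Suc m)) (a N (Suc m) \<omega>) \<and>
        ?s * (D.sample_err * (\<epsilon> / (real N * p N))) \<le> \<sigma>\<^sup>2 / 4" if \<omega>: "\<omega> \<in> space (M N)" for \<omega>
        using est
      proof (elim disjE conjE)
        assume pl: "0 < p_lim" and g: "granger_estimator M S y a"
        have pN: "p_lim / 2 < p N" using elim(3) pl by blast
        then have pN0: "0 < p N" using pl by linarith
        have sN: "?s \<le> real N" using card_mono[OF D.finite_V observed] by (simp add: nodes_def)
        \<comment> \<open>The factor |S| \<le> N cancels the N in N p, and what remains is bounded
          because p stays above half of its limit.\<close>
        have "?s * (K * (\<epsilon> / (real N * p N))) \<le> real N * (K * (\<epsilon> / (real N * p N)))"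
          using sN K0 \<epsilon>(1) pN0 by (intro mult_right_mono) auto
        also have "\<dots> = K * \<epsilon> / p N" using N0 by simp
        also have "\<dots> \<le> K * \<epsilon> / (p_lim / 2)" using pN pl K0 \<epsilon>(1) by (intro divide_left_mono) auto
        also have "\<dots> \<le> \<sigma>\<^sup>2 / 4"
        proof -
          have "\<kappa> * r \<le> 1 * p_lim" using r(3)[OF pl] kap0 rho r(1) pl by (intro mult_mono) auto
          then have "\<sigma>\<^sup>2 * (\<kappa> * r) \<le> \<sigma>\<^sup>2 * (1 * p_lim)" by (intro mult_left_mono) auto
          then have "96 * (K * \<epsilon>) \<le> \<sigma>\<^sup>2 * p_lim" using \<epsilon>(2) by (simp add: mult.assoc)
          then have "8 * (K * \<epsilon>) \<le> \<sigma>\<^sup>2 * p_lim" using mult_nonneg_nonneg[OF K0] \<epsilon>(1) by (smt (verit))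
          then show ?thesis using pl by (simp add: field_simps)
        qed
        finally have "?s * (D.sample_err * (\<epsilon> / (real N * p N))) \<le> \<sigma>\<^sup>2 / 4" unfolding Keq .
        moreover have "granger_matrix (S N) (corr0 (y N \<omega>) (Suc m)) (corr1 (y N \<omega>) (Suc m)) (a N (Suc m) \<omega>)"
          using g \<omega> unfolding granger_estimator_def by blast
        ultimately show ?thesis by blast
      qed (use \<omega> in \<open>auto simp: regra_estimator_def one_lag_estimator_def residual_estimator_def fun_eq_iff\<close>)
      have nm: "12 / \<epsilon>\<^sup>2 * (real N * p N)\<^sup>2 * ln ?s \<le> real (Suc m)" using elim(5) unfolding m .
      show ?case unfolding m
        by (rule D.recovery_prob[OF N3 observed d \<eta> \<epsilon>(1) _ w(1,2) W(3) w(3) lnS nm meas A]) (use \<epsilon>r Keq in simp_all)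
    qed
    have up: "\<forall>\<^sub>F N in sequentially. ?P N \<le> 1"
    proof (rule always_eventually, rule allI)
      fix N
      interpret D: diffusion_network "M N" N "p N" "G N" "\<pi> N" \<rho> \<kappa> \<sigma> "x N" "y N" by (rule network)
      show "?P N \<le> 1" by (rule D.prob_le_1)
    qed
    have "(\<lambda>N. 1 - (?c / real N + ?nt N)) \<longlonglongrightarrow> 1 - (0 + 0)"
      by (intro tendsto_diff tendsto_const tendsto_add nontrivial lim_const_over_n)
    then have "(\<lambda>N. 1 - (?c / real N + ?nt N)) \<longlonglongrightarrow> 1" by simp
    then show "?P \<longlonglongrightarrow> 1" by (rule tendsto_sandwich[OF low up _ tendsto_const])
  qed
qed

end
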